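(* Let $\mathbf s,\mathbf t,\boldsymbol\varepsilon,\boldsymbol\sigma=\boldsymbol\sigma(\boldsymbol\varepsilon)\in\mathbb R^j$ be such that for every $l\in\{1,\dots,j\}$: $s_l+t_l>n_l/2$, $0<\varepsilon_l<s_l+t_l-n_l/2$ and $\sigma_l=\min\{s_l,\,t_l,\,s_l+t_l-n_l/2-\varepsilon_l\}$. Let $p,q,r\in[1,\infty]$ with $\frac1p+\frac1q=\frac1r$. Then $$\mathcal K_p^{\mathbf s}(\mathbb R^n)\cdot\mathcal K_q^{\mathbf t}(\mathbb R^n)\subset\mathcal K_r^{\boldsymbol\sigma}(\mathbb R^n).$$
   Context: Let $j\in\{1,\dots,n\}$ and $\mathbb R^n=\mathbb R^{n_1}\times\cdots\times\mathbb R^{n_j}$ with $n_1,\dots,n_j$ positive integers. For $\mathbf s=(s_1,\dots,s_j)\in\mathbb R^j$ and $\xi=(\xi_1,\dots,\xi_j)$ put $\langle\langle\xi\rangle\rangle^{\mathbf s}=\prod_{l=1}^j(1+|\xi_l|^2)^{s_l/2}$, and let $\langle\langle D\rangle\rangle^{\mathbf s}$ be the corresponding Fourier multiplier. $\mathcal H^{\mathbf s}(\mathbb R^n)=\{u\in\mathcal S'(\mathbb R^n):\langle\langle D\rangle\rangle^{\mathbf s}u\in L^2\}$, $\|u\|_{\mathcal H^{\mathbf s}}=\|\langle\langle D\rangle\rangle^{\mathbf s}u\|_{L^2}$ (with $\|u\|_{\mathcal H^{\mathbf s}}=\infty$ if $u\notin\mathcal H^{\mathbf s}$). For $1\le p\le\infty$,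 $u\in\mathcal D'(\mathbb R^n)$ belongs to $\mathcal K_p^{\mathbf s}(\mathbb R^n)$ if there is $\chi\in\mathcal C_0^\infty(\mathbb R^n)\smallsetminus0$ such that $y\mapsto\|u\,\tau_y\chi\|_{\mathcal H^{\mathbf s}}$ belongs to $L^p(\mathbb R^n)$, where $\tau_y\chi=\chi(\cdot-y)$; the space does not depend on the choice of $\chi$. Products: under the stated condition on $\mathbf s,\mathbf t,\boldsymbol\varepsilon$, the product of $u\in\mathcal H^{\mathbf s}$ and $v\in\mathcal H^{\mathbf t}$ is the continuous extension, with values in $\mathcal H^{\boldsymbol\sigma}$, of the pointwise product on $\mathcal S(\mathbb R^n)\times\mathcal S(\mathbb R^n)$. The product $uv$ of elements of $\mathcal K_p^{\mathbf s}$ and $\mathcal K_q^{\mathbf t}$ is the distribution defined locally by $uv\,\tau_y\chi^2=(u\,\tau_y\chi)(v\,\tau_y\chi)$ for $\chi\in\mathcal C_0^\infty(\mathbb R^n)$, $y\in\mathbb R^n$. *)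

theory Defs
  imports "HOL-Analysis.Analysis"
begin

section \<open>Smooth functions, test functions, Schwartz functions\<close>

definition partial_deriv :: "'n::finite \<Rightarrow> (real^'n \<Rightarrow> complex) \<Rightarrow> (real^'n \<Rightarrow> complex)" where
  "partial_deriv i f = (\<lambda>x. frechet_derivative f (at x) (axis i 1))"

text \<open>A list of coordinates \<open>[i, k, \<dots>]\<close> plays the role of the multi-index of
  \<open>\<partial>\<^sub>i \<partial>\<^sub>k \<dots>\<close>; the length of the list is the order of the derivative.\<close>

fun partial_derivs :: "'n::finite list \<Rightarrow> (real^'n \<Rightarrow> complex) \<Rightarrow> (real^'n \<Rightarrow> complex)" where
  "partial_derivs [] f = f"
| "partial_derivs (i # is) f = partial_deriv i (partial_derivs is f)"

definition smooth :: "(real^'n::finite \<Rightarrow> complex) \<Rightarrow> bool" where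
  "smooth f \<longleftrightarrow> (\<forall>is x. partial_derivs is f differentiable (at x))"

definition test_functions :: "(real^'n::finite \<Rightarrow> complex) set" where
  "test_functions = {f. smooth f \<and> compact (closure {x. f x \<noteq> 0})}"

definition schwartz_functions :: "(real^'n::finite \<Rightarrow> complex) set" where
  "schwartz_functions =
    {f. smooth f \<and> (\<forall>is k. bdd_above (range (\<lambda>x. (1 + norm x) ^ k * norm (partial_derivs is f x))))}"


section \<open>Distributions\<close>

text \<open>Distributions are functions on test functions. They are normalised to be \<open>undefined\<close>
  elsewhere (\<^const>\<open>extensional\<close>), so that \<open>=\<close> is equality of distributions; the same holds for
  tempered distributions and Schwartz functions.\<close>

type_synonym 'n functional = "(real^'n \<Rightarrow> complex) \<Rightarrow> complex"

definition linear_functional_on :: "(real^'n::finite \<Rightarrow> complex) set \<Rightarrow> 'n functional \<Rightarrow> bool" where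
  "linear_functional_on A u \<longleftrightarrow>
    (\<forall>f\<in>A. \<forall>g\<in>A. \<forall>a c. u (\<lambda>x. a * f x + c * g x) = a * u f + c * u g)"

definition distributions :: "'n::finite functional set" where
  "distributions = {u \<in> extensional test_functions. linear_functional_on test_functions u \<and>
    (\<forall>K. compact K \<longrightarrow> (\<exists>C N. \<forall>f\<in>test_functions. {x. f x \<noteq> 0} \<subseteq> K \<longrightarrow>
      norm (u f) \<le> C * (\<Sum>is | length is \<le> N. SUP x. norm (partial_derivs is f x))))}"

definition tempered_distributions :: "'n::finite functional set" where
  "tempered_distributions = {u \<in> extensional schwartz_functions.
    linear_functional_on schwartz_functions u \<and>
    (\<exists>C N. \<forall>f\<in>schwartz_functions. norm (u f) \<le>
      C * (\<Sum>is | length is \<le> N. SUP x. (1 + norm x) ^ N * norm (partial_derivs is f x)))}"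

definition tempered_of_fun :: "(real^'n::finite \<Rightarrow> complex) \<Rightarrow> 'n functional" where
  "tempered_of_fun f = (\<lambda>\<phi>\<in>schwartz_functions. LINT x|lborel. f x * \<phi> x)"

definition tempered_diff :: "'n::finite functional \<Rightarrow> 'n functional \<Rightarrow> 'n functional" where
  "tempered_diff u v = (\<lambda>\<phi>\<in>schwartz_functions. u \<phi> - v \<phi>)"

text \<open>For a test function \<open>g\<close> and a distribution \<open>u\<close>, the compactly supported distribution \<open>u g\<close>,
  viewed as a tempered distribution: \<open>g \<phi>\<close> is a test function for every Schwartz function \<open>\<phi>\<close>.\<close>

definition cutoff :: "(real^'n::finite \<Rightarrow> complex) \<Rightarrow> 'n functional \<Rightarrow> 'n functional" where
  "cutoff g u = (\<lambda>\<phi>\<in>schwartz_functions. u (\<lambda>x. g x * \<phi> x))"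

definition translate :: "real^'n::finite \<Rightarrow> (real^'n \<Rightarrow> complex) \<Rightarrow> (real^'n \<Rightarrow> complex)" where
  "translate y g = (\<lambda>x. g (x - y))"


section \<open>Fourier transform and Fourier multipliers\<close>

definition fourier :: "(real^'n::finite \<Rightarrow> complex) \<Rightarrow> (real^'n \<Rightarrow> complex)" where
  "fourier f = (\<lambda>\<xi>. LINT x|lborel. cis (- (x \<bullet> \<xi>)) * f x)"

definition inv_fourier :: "(real^'n::finite \<Rightarrow> complex) \<Rightarrow> (real^'n \<Rightarrow> complex)" where
  "inv_fourier f = (\<lambda>x. (LINT \<xi>|lborel. cis (x \<bullet> \<xi>) * f \<xi>) / complex_of_real ((2 * pi) ^ CARD('n)))"

definition tempered_fourier :: "'n::finite functional \<Rightarrow> 'n functional" where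
  "tempered_fourier u = (\<lambda>\<phi>\<in>schwartz_functions. u (fourier \<phi>))"

definition tempered_inv_fourier :: "'n::finite functional \<Rightarrow> 'n functional" where
  "tempered_inv_fourier u = (\<lambda>\<phi>\<in>schwartz_functions. u (inv_fourier \<phi>))"

text \<open>Meaningful for smooth \<open>m\<close> all of whose derivatives have polynomial growth.\<close>

definition tempered_mult :: "(real^'n::finite \<Rightarrow> complex) \<Rightarrow> 'n functional \<Rightarrow> 'n functional" where
  "tempered_mult m u = (\<lambda>\<phi>\<in>schwartz_functions. u (\<lambda>x. m x * \<phi> x))"

definition fourier_multiplier :: "(real^'n::finite \<Rightarrow> complex) \<Rightarrow> 'n functional \<Rightarrow> 'n functional" where
  "fourier_multiplier m u = tempered_inv_fourier (tempered_mult m (tempered_fourier u))"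


section \<open>The spaces \<open>\<H>\<^sup>s\<close>\<close>

text \<open>A splitting of \<open>\<real>\<^sup>n\<close> into \<open>j\<close> factors is given by a map \<open>b\<close> (for block) from the \<open>n\<close> coordinates
  (the type \<open>'n\<close>) onto the \<open>j\<close> factors (the type \<open>'j\<close>): the component \<open>\<xi>\<^sub>l\<close> of \<open>\<xi>\<close> consists of the
  coordinates \<open>i\<close> with \<open>b i = l\<close>.\<close>

definition block_dim :: "('n::finite \<Rightarrow> 'j::finite) \<Rightarrow> 'j \<Rightarrow> nat" where
  "block_dim b l = card {i. b i = l}"

definition block_norm :: "('n::finite \<Rightarrow> 'j::finite) \<Rightarrow> 'j \<Rightarrow> real^'n \<Rightarrow> real" where
  "block_norm b l \<xi> = L2_set (\<lambda>i. \<xi> $ i) {i. b i = l}"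

definition bracket :: "('n::finite \<Rightarrow> 'j::finite) \<Rightarrow> real^'j \<Rightarrow> real^'n \<Rightarrow> real" where
  "bracket b s \<xi> = (\<Prod>l\<in>UNIV. (1 + (block_norm b l \<xi>)\<^sup>2) powr (s $ l / 2))"

definition bracket_D :: "('n::finite \<Rightarrow> 'j::finite) \<Rightarrow> real^'j \<Rightarrow> 'n functional \<Rightarrow> 'n functional" where
  "bracket_D b s = fourier_multiplier (\<lambda>\<xi>. complex_of_real (bracket b s \<xi>))"

definition L2_functions :: "(real^'n::finite \<Rightarrow> complex) set" where
  "L2_functions = {f \<in> borel_measurable lborel. integrable lborel (\<lambda>x. (norm (f x))\<^sup>2)}"

definition L2_norm :: "(real^'n::finite \<Rightarrow> complex) \<Rightarrow> real" where
  "L2_norm f = sqrt (LINT x|lborel. (norm (f x))\<^sup>2)"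

definition H_space :: "('n::finite \<Rightarrow> 'j::finite) \<Rightarrow> real^'j \<Rightarrow> 'n functional set" where
  "H_space b s =
    {u \<in> tempered_distributions. \<exists>f\<in>L2_functions. bracket_D b s u = tempered_of_fun f}"

text \<open>The function \<open>f\<close> below is unique up to a null set, so the choice made by \<open>SOME\<close> is immaterial.\<close>

definition H_norm :: "('n::finite \<Rightarrow> 'j::finite) \<Rightarrow> real^'j \<Rightarrow> 'n functional \<Rightarrow> ennreal" where
  "H_norm b s u =
    (if u \<in> H_space b s
     then ennreal (L2_norm (SOME f. f \<in> L2_functions \<and> bracket_D b s u = tempered_of_fun f))
     else \<infinity>)"


section \<open>The spaces \<open>\<K>\<^sub>p\<^sup>s\<close>\<close>

definition in_Lp :: "ennreal \<Rightarrow> (real^'n::finite \<Rightarrow> ennreal) \<Rightarrow> bool" where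
  "in_Lp p g \<longleftrightarrow> g \<in> borel_measurable lebesgue \<and>
    (if p = \<infinity> then \<exists>C::real. AE y in lebesgue. g y \<le> ennreal C
     else (AE y in lebesgue. g y < \<infinity>) \<and>
          (\<integral>\<^sup>+ y. ennreal (enn2real (g y) powr enn2real p) \<partial>lebesgue) < \<infinity>)"

definition K_space :: "('n::finite \<Rightarrow> 'j::finite) \<Rightarrow> ennreal \<Rightarrow> real^'j \<Rightarrow> 'n functional set" where
  "K_space b p s =
    {u \<in> distributions. \<exists>g\<in>test_functions. g \<noteq> (\<lambda>x. 0) \<and>
      in_Lp p (\<lambda>y. H_norm b s (cutoff (translate y g) u))}"


section \<open>Products\<close>

text \<open>\<open>P\<close> is the continuous extension to \<open>\<H>\<^sup>s \<times> \<H>\<^sup>t\<close>, with values in \<open>\<H>\<^sup>\<sigma>\<close>, of the pointwise product of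
  Schwartz functions. The values of \<open>P\<close> on \<open>\<H>\<^sup>s \<times> \<H>\<^sup>t\<close> are determined by this, Schwartz functions being
  dense in \<open>\<H>\<^sup>s\<close> and \<open>\<H>\<^sup>t\<close>.\<close>

definition is_H_product ::
  "('n::finite \<Rightarrow> 'j::finite) \<Rightarrow> real^'j \<Rightarrow> real^'j \<Rightarrow> real^'j \<Rightarrow>
   ('n functional \<Rightarrow> 'n functional \<Rightarrow> 'n functional) \<Rightarrow> bool" where
  "is_H_product b s t \<sigma> P \<longleftrightarrow>
    (\<forall>u\<in>H_space b s. \<forall>v\<in>H_space b t. P u v \<in> H_space b \<sigma>) \<and>
    (\<forall>f\<in>schwartz_functions. \<forall>g\<in>schwartz_functions.
      P (tempered_of_fun f) (tempered_of_fun g) = tempered_of_fun (\<lambda>x. f x * g x)) \<and>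
    (\<forall>u\<in>H_space b s. \<forall>v\<in>H_space b t. \<forall>e>0::real. \<exists>d>0::real.
      \<forall>u'\<in>H_space b s. \<forall>v'\<in>H_space b t.
        H_norm b s (tempered_diff u' u) < ennreal d \<and> H_norm b t (tempered_diff v' v) < ennreal d \<longrightarrow>
        H_norm b \<sigma> (tempered_diff (P u' v') (P u v)) < ennreal e)"

definition is_product ::
  "('n::finite \<Rightarrow> 'j::finite) \<Rightarrow> real^'j \<Rightarrow> real^'j \<Rightarrow> real^'j \<Rightarrow>
   'n functional \<Rightarrow> 'n functional \<Rightarrow> 'n functional \<Rightarrow> bool" where
  "is_product b s t \<sigma> u v w \<longleftrightarrow> w \<in> distributions \<and>
    (\<exists>P. is_H_product b s t \<sigma> P \<and>
      (\<forall>g\<in>test_functions. \<forall>y.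
        cutoff (translate y g) u \<in> H_space b s \<and>
        cutoff (translate y g) v \<in> H_space b t \<and>
        cutoff (translate y (\<lambda>x. (g x)\<^sup>2)) w =
          P (cutoff (translate y g) u) (cutoff (translate y g) v)))"

definition dist_product ::
  "('n::finite \<Rightarrow> 'j::finite) \<Rightarrow> real^'j \<Rightarrow> real^'j \<Rightarrow> real^'j \<Rightarrow>
   'n functional \<Rightarrow> 'n functional \<Rightarrow> 'n functional" where
  "dist_product b s t \<sigma> u v = (THE w. is_product b s t \<sigma> u v w)"

end

theory Submission
  imports Defs "HOL-Probability.Characteristic_Functions"
begin

text \<open>Under the Fourier transform \<open>\<H>\<^sup>s\<close> is the space of functions \<open>F\<close> with \<open>\<langle>\<langle>\<xi>\<rangle>\<rangle>\<^sup>s F\<close> in \<open>L\<^sup>2\<close>, and the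
  product becomes a convolution. Its boundedness \<open>\<H>\<^sup>s \<times> \<H>\<^sup>t \<rightarrow> \<H>\<^sup>\<sigma>\<close> is an estimate for the kernel
  \<open>\<langle>\<langle>\<xi>\<rangle>\<rangle>\<^sup>\<sigma> / (\<langle>\<langle>\<xi> - \<eta>\<rangle>\<rangle>\<^sup>s \<langle>\<langle>\<eta>\<rangle>\<rangle>\<^sup>t)\<close>. As the two largest of \<open>\<xi>\<^sub>l\<close>, \<open>\<eta>\<^sub>l\<close>, \<open>\<xi>\<^sub>l - \<eta>\<^sub>l\<close> are comparable,
  the kernel is at most a product over \<open>l\<close> of sums of negative powers of order \<open>s\<^sub>l + t\<^sub>l - \<sigma>\<^sub>l > n\<^sub>l / 2\<close>
  of these three vectors. Each such power is in turn bounded by a product of functions of single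
  coordinates that are square integrable on the line, so the estimate follows from the Cauchy-Schwarz
  inequality one coordinate at a time.

  Multiplication by a Schwartz function is the special case where one factor lies in \<open>\<H>\<^sup>N\<close> with \<open>N\<close>
  large. With the density of Schwartz functions this shows that the product is unique, commutes
  with multiplication by Schwartz functions and hence is local. For \<open>u \<in> \<K>\<^sub>p\<^sup>s\<close> every cutoff of \<open>u\<close> is in
  \<open>\<H>\<^sup>s\<close>: the support of one test function is covered by finitely many translates, chosen outside a null set, of
  the set where another one is nonzero, and the constants do not change under translation.
  Applying the product estimate to cutoffs bounds the local norms of \<open>u v\<close> by the product of
  those of \<open>u\<close> and \<open>v\<close>, and the \<open>L\<^sup>p\<close> part is Hoelder's inequality.\<close>

section \<open>Classes of smooth functions\<close>

text \<open>The role of \<epsilon> is to make the order \<open>s $ l + t $ l - \<sigma> $ l\<close>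
  strictly larger than half the block dimension, which is the threshold of square integrability.
  Splitting a power of a block norm evenly among its coordinates keeps this threshold, so no
  integration over balls or spheres occurs and the convolution estimate can run by induction over
  single coordinates.

  The product is characterised by continuity and by its values on Schwartz functions, so nothing
  about supports is known a priori. This is the reason for comparing (u, v) \<mapsto> P(\<theta>u,
  \<theta>'v) with (u, v) \<mapsto> \<theta>\<theta>'P(u, v): locality is read off from the equality
  of these two continuous maps.

  Membership in \<open>K_space\<close> speaks of one window and of almost all translates, and it
  demands Lebesgue measurability of the local norm. The obstacle disappears once the local norm is
  known to be a finite continuous function of y: measurability is automatic and an essential
  supremum is a supremum.\<close>

lemma partial_deriv_eqI: "(f has_derivative D) (at x) \<Longrightarrow> partial_deriv i f x = D (axis i 1)"
  unfolding partial_deriv_def by (metis frechet_derivative_at)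

lemma has_derivative_partial_deriv:
  "f differentiable (at x) \<Longrightarrow> (f has_derivative frechet_derivative f (at x)) (at x)"
  by (simp add: frechet_derivative_works)

lemma partial_deriv_bounded_linear:
  assumes "bounded_linear L" "\<And>x. f differentiable (at x)"
  shows "(\<lambda>x. L (f x)) differentiable (at x)" "partial_deriv i (\<lambda>x. L (f x)) = (\<lambda>x. L (partial_deriv i f x))"
proof -
  have *: "((\<lambda>x. L (f x)) has_derivative (\<lambda>h. L (frechet_derivative f (at x) h))) (at x)" for x
    using assms by (auto intro!: bounded_linear.has_derivative[OF assms(1)] has_derivative_partial_deriv)
  then show "(\<lambda>x. L (f x)) differentiable (at x)"
    by (auto simp: differentiable_def)
  show "partial_deriv i (\<lambda>x. L (f x)) = (\<lambda>x. L (partial_deriv i f x))"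
    using partial_deriv_eqI[OF *] by (auto simp: partial_deriv_def)
qed

lemma partial_deriv_add:
  assumes "\<And>x. f differentiable (at x)" "\<And>x. g differentiable (at x)"
  shows "(\<lambda>x. f x + g x) differentiable (at x)"
    "partial_deriv i (\<lambda>x. f x + g x) = (\<lambda>x. partial_deriv i f x + partial_deriv i g x)"
proof -
  have *: "((\<lambda>x. f x + g x) has_derivative
     (\<lambda>h. frechet_derivative f (at x) h + frechet_derivative g (at x) h)) (at x)" for x
    using assms by (auto intro!: has_derivative_add has_derivative_partial_deriv)
  then show "(\<lambda>x. f x + g x) differentiable (at x)"
    by (auto simp: differentiable_def)
  show "partial_deriv i (\<lambda>x. f x + g x) = (\<lambda>x. partial_deriv i f x + partial_deriv i g x)"
    using partial_deriv_eqI[OF *] by (auto simp: partial_deriv_def)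
qed

lemma partial_deriv_mult:
  assumes "\<And>x. f differentiable (at x)" "\<And>x. g differentiable (at x)"
  shows "(\<lambda>x. f x * g x) differentiable (at x)"
    "partial_deriv i (\<lambda>x. f x * g x) = (\<lambda>x. partial_deriv i f x * g x + f x * partial_deriv i g x)"
proof -
  have *: "((\<lambda>x. f x * g x) has_derivative
     (\<lambda>h. f x * frechet_derivative g (at x) h + frechet_derivative f (at x) h * g x)) (at x)" for x
    using assms by (auto intro!: has_derivative_mult has_derivative_partial_deriv)
  then show "(\<lambda>x. f x * g x) differentiable (at x)"
    by (auto simp: differentiable_def)
  show "partial_deriv i (\<lambda>x. f x * g x) = (\<lambda>x. partial_deriv i f x * g x + f x * partial_deriv i g x)"
    using partial_deriv_eqI[OF *] by (auto simp: partial_deriv_def)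
qed

lemma partial_deriv_const:
  "(\<lambda>x. c) differentiable (at x)" "partial_deriv i (\<lambda>x. c) = (\<lambda>x. 0)"
  using partial_deriv_eqI[OF has_derivative_const] by auto

lemma partial_deriv_coord:
  fixes i :: "'n::finite"
  shows "(\<lambda>x::real^'n. complex_of_real (x $ k)) differentiable (at x)"
    "partial_deriv i (\<lambda>x::real^'n. complex_of_real (x $ k)) = (\<lambda>x. if i = k then 1 else 0)"
proof -
  have *: "((\<lambda>x::real^'n. complex_of_real (x $ k)) has_derivative (\<lambda>h. complex_of_real (h $ k))) (at x)" for x
    by (rule bounded_linear_imp_has_derivative)
      (rule bounded_linear_compose[OF bounded_linear_of_real bounded_linear_vec_nth])
  then show "(\<lambda>x::real^'n. complex_of_real (x $ k)) differentiable (at x)"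
    by (auto simp: differentiable_def)
  show "partial_deriv i (\<lambda>x::real^'n. complex_of_real (x $ k)) = (\<lambda>x. if i = k then 1 else 0)"
    by (rule ext, subst partial_deriv_eqI[OF *]) (auto simp: axis_def)
qed

text \<open>The chain rule for a real function of one variable. All functions here are complex
  valued, so the real argument is extracted by \<open>Re\<close> and the result is embedded again;
  this lets \<open>flat\<close> act on smooth functions.\<close>

lemma partial_deriv_real_comp:
  fixes f :: "real^'n::finite \<Rightarrow> complex"
  assumes f: "\<And>x. f differentiable (at x)" and h: "\<And>t. t \<in> f ` UNIV \<Longrightarrow> (h has_real_derivative h' (Re t)) (at (Re t))"
  shows "(\<lambda>x. complex_of_real (h (Re (f x)))) differentiable (at x)"
    "partial_deriv i (\<lambda>x. complex_of_real (h (Re (f x)))) =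
      (\<lambda>x. complex_of_real (h' (Re (f x))) * complex_of_real (Re (partial_deriv i f x)))"
proof -
  have *: "((\<lambda>x. complex_of_real (h (Re (f x)))) has_derivative
     (\<lambda>k. complex_of_real (h' (Re (f x)) * Re (frechet_derivative f (at x) k)))) (at x)" for x
  proof -
    have "((\<lambda>x. Re (f x)) has_derivative (\<lambda>k. Re (frechet_derivative f (at x) k))) (at x)"
      using f by (intro bounded_linear.has_derivative[OF bounded_linear_Re] has_derivative_partial_deriv)
    from has_derivative_compose[OF this, of h "\<lambda>k. h' (Re (f x)) * k"] h[of "f x"]
    have "((\<lambda>x. h (Re (f x))) has_derivative (\<lambda>k. h' (Re (f x)) * Re (frechet_derivative f (at x) k))) (at x)"
      by (simp add: has_field_derivative_def)
    then show ?thesis by (rule bounded_linear.has_derivative[OF bounded_linear_of_real])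
  qed
  then show "(\<lambda>x. complex_of_real (h (Re (f x)))) differentiable (at x)"
    by (auto simp: differentiable_def)
  show "partial_deriv i (\<lambda>x. complex_of_real (h (Re (f x)))) =
      (\<lambda>x. complex_of_real (h' (Re (f x))) * complex_of_real (Re (partial_deriv i f x)))"
    by (rule ext, subst partial_deriv_eqI[OF *]) (auto simp: partial_deriv_def)
qed

section \<open>Sets of functions that are invariant under differentiation\<close>

lemma partial_derivs_append: "partial_derivs (is @ js) f = partial_derivs is (partial_derivs js f)"
  by (induction "is") auto

text \<open>One frame for the three classes in use: the trivial bound gives the smooth functions,
  \<open>rapid\<close> the Schwartz functions and \<open>poly_bounded\<close> the slowly increasing
  ones. Closure properties are thus proved once for all of them.\<close>

definition smooth_class :: "((real^'n::finite \<Rightarrow> complex) \<Rightarrow> bool) \<Rightarrow> (real^'n \<Rightarrow> complex) set" where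
  "smooth_class B = {f. smooth f \<and> (\<forall>is. B (partial_derivs is f))}"

lemma smooth_iff_smooth_class: "smooth f \<longleftrightarrow> f \<in> smooth_class (\<lambda>f. True)"
  by (auto simp: smooth_class_def)

text \<open>Replaces all formulas for higher derivatives: it is enough to exhibit a set that
  contains f, is closed under \<open>partial_deriv\<close>, and whose members are differentiable and
  satisfy the bound. The smoothness proofs below consist in guessing such a set.\<close>

lemma smooth_classI:
  assumes "f \<in> A"
    and diff: "\<And>f x. f \<in> A \<Longrightarrow> f differentiable (at x)"
    and part: "\<And>f i. f \<in> A \<Longrightarrow> partial_deriv i f \<in> A"
    and B: "\<And>f. f \<in> A \<Longrightarrow> B f"
  shows "f \<in> smooth_class B"
proof -
  have "partial_derivs is f \<in> A" for "is"
    by (induction "is") (auto simp: assms)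
  then show ?thesis by (auto simp: smooth_class_def smooth_def B diff)
qed

lemma smooth_class_differentiable: "f \<in> smooth_class B \<Longrightarrow> f differentiable (at x)"
  unfolding smooth_class_def smooth_def using partial_derivs.simps(1) by (metis (mono_tags, lifting) mem_Collect_eq)

lemma smooth_class_partial_derivs:
  assumes "f \<in> smooth_class B" shows "partial_derivs is f \<in> smooth_class B"
  using assms unfolding smooth_class_def smooth_def by (auto simp: partial_derivs_append[symmetric])

lemma smooth_class_partial_deriv:
  assumes "f \<in> smooth_class B" shows "partial_deriv i f \<in> smooth_class B"
  using smooth_class_partial_derivs[OF assms, of "[i]"] by simp

lemma smooth_class_base: "f \<in> smooth_class B \<Longrightarrow> B f"
  unfolding smooth_class_def using partial_derivs.simps(1) by (metis (mono_tags, lifting) mem_Collect_eq)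

lemma smooth_class_mono: "f \<in> smooth_class B \<Longrightarrow> (\<And>f. B f \<Longrightarrow> B' f) \<Longrightarrow> f \<in> smooth_class B'"
  by (auto simp: smooth_class_def)

text \<open>By the Leibniz rule the derivative of a product is a sum of products, so a set of
  products is invariant only after closing it under addition.\<close>

inductive_set sum_closure :: "(real^'n::finite \<Rightarrow> complex) set \<Rightarrow> (real^'n \<Rightarrow> complex) set" for S where
  base: "f \<in> S \<Longrightarrow> f \<in> sum_closure S"
| add: "f \<in> sum_closure S \<Longrightarrow> g \<in> sum_closure S \<Longrightarrow> (\<lambda>x. f x + g x) \<in> sum_closure S"

lemma sum_closure_smooth_class:
  assumes f: "f \<in> sum_closure S"
    and diff: "\<And>f x. f \<in> S \<Longrightarrow> f differentiable (at x)"
    and part: "\<And>f i. f \<in> S \<Longrightarrow> partial_deriv i f \<in> sum_closure S"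
    and B: "\<And>f. f \<in> S \<Longrightarrow> B f" and B_add: "\<And>f g. B f \<Longrightarrow> B g \<Longrightarrow> B (\<lambda>x. f x + g x)"
  shows "f \<in> smooth_class B"
proof (rule smooth_classI[OF f])
  have *: "(\<forall>x. f differentiable (at x)) \<and> B f \<and> (\<forall>i. partial_deriv i f \<in> sum_closure S)"
    if "f \<in> sum_closure S" for f
    using that
  proof induction
    case (base f) then show ?case using diff part B by auto
  next
    case (add f g) then show ?case by (auto simp: partial_deriv_add B_add sum_closure.add)
  qed
  fix f i x assume "f \<in> sum_closure S"
  with * show "f differentiable (at x)" "partial_deriv i f \<in> sum_closure S" "B f" by auto
qed

lemma smooth_class_add:
  assumes "f \<in> smooth_class B" "g \<in> smooth_class B"
    and "\<And>f g. B f \<Longrightarrow> B g \<Longrightarrow> B (\<lambda>x. f x + g x)"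
  shows "(\<lambda>x. f x + g x) \<in> smooth_class B"
proof (rule sum_closure_smooth_class[where S="smooth_class B"])
  show "(\<lambda>x. f x + g x) \<in> sum_closure (smooth_class B)"
    by (intro sum_closure.intros assms)
next
  fix h x i assume h: "h \<in> smooth_class B"
  show "h differentiable (at x)" by (rule smooth_class_differentiable[OF h])
  show "B h" by (rule smooth_class_base[OF h])
  show "partial_deriv i h \<in> sum_closure (smooth_class B)"
    by (rule sum_closure.base, rule smooth_class_partial_deriv[OF h])
qed (rule assms(3))

text \<open>The two factors may obey different bounds, as for a slowly increasing function times a
  Schwartz function. The invariant set consists of the sums of products of members of the two
  classes.\<close>

lemma smooth_class_mult:
  assumes f: "f \<in> smooth_class B1" and g: "g \<in> smooth_class B2"
    and mult: "\<And>f g. B1 f \<Longrightarrow> B2 g \<Longrightarrow> B (\<lambda>x. f x * g x)"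
    and add: "\<And>f g. B f \<Longrightarrow> B g \<Longrightarrow> B (\<lambda>x. f x + g x)"
  shows "(\<lambda>x. f x * g x) \<in> smooth_class B"
proof (rule sum_closure_smooth_class[where S="{(\<lambda>x. f x * g x) | f g. f \<in> smooth_class B1 \<and> g \<in> smooth_class B2}", OF sum_closure.base])
  show "(\<lambda>x. f x * g x) \<in> {(\<lambda>x. f x * g x) | f g. f \<in> smooth_class B1 \<and> g \<in> smooth_class B2}"
    using f g by auto
next
  fix h x i assume "h \<in> {(\<lambda>x. f x * g x) | f g. f \<in> smooth_class B1 \<and> g \<in> smooth_class B2}"
  then obtain f g where fg: "f \<in> smooth_class B1" "g \<in> smooth_class B2" and h: "h = (\<lambda>x. f x * g x)" by auto
  show "h differentiable (at x)" unfolding h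
    by (rule partial_deriv_mult; rule smooth_class_differentiable; fact)
  show "B h" unfolding h by (rule mult; rule smooth_class_base; fact)
  have "partial_deriv i h = (\<lambda>x. partial_deriv i f x * g x + f x * partial_deriv i g x)" unfolding h
    by (rule partial_deriv_mult; rule smooth_class_differentiable; fact)
  also have "\<dots> \<in> sum_closure {(\<lambda>x. f x * g x) | f g. f \<in> smooth_class B1 \<and> g \<in> smooth_class B2}"
  proof (rule sum_closure.add; rule sum_closure.base, rule CollectI)
    show "\<exists>f' g'. (\<lambda>x. partial_deriv i f x * g x) = (\<lambda>x. f' x * g' x) \<and> f' \<in> smooth_class B1 \<and> g' \<in> smooth_class B2"
      by (rule exI[of _ "partial_deriv i f"], rule exI[of _ g]) (simp add: fg smooth_class_partial_deriv)
    show "\<exists>f' g'. (\<lambda>x. f x * partial_deriv i g x) = (\<lambda>x. f' x * g' x) \<and> f' \<in> smooth_class B1 \<and> g' \<in> smooth_class B2"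
      by (rule exI[of _ f], rule exI[of _ "partial_deriv i g"]) (simp add: fg smooth_class_partial_deriv)
  qed
  finally show "partial_deriv i h \<in> sum_closure {(\<lambda>x. f x * g x) | f g. f \<in> smooth_class B1 \<and> g \<in> smooth_class B2}" .
qed (use add in auto)

lemma smooth_class_bounded_linear:
  assumes L: "bounded_linear L" and f: "f \<in> smooth_class B" and B: "\<And>f. B f \<Longrightarrow> B' (\<lambda>x. L (f x))"
  shows "(\<lambda>x. L (f x)) \<in> smooth_class B'"
proof (rule smooth_classI[where A="{\<lambda>x. L (f x) | f. f \<in> smooth_class B}"])
  show "(\<lambda>x. L (f x)) \<in> {\<lambda>x. L (f x) | f. f \<in> smooth_class B}" using f by auto
next
  fix h x i assume "h \<in> {\<lambda>x. L (f x) | f. f \<in> smooth_class B}"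
  then obtain f where f: "f \<in> smooth_class B" and h: "h = (\<lambda>x. L (f x))" by auto
  show "h differentiable (at x)" unfolding h
    by (rule partial_deriv_bounded_linear[OF L smooth_class_differentiable[OF f]])
  have "partial_deriv i h = (\<lambda>x. L (partial_deriv i f x))" unfolding h
    by (rule partial_deriv_bounded_linear[OF L smooth_class_differentiable[OF f]])
  then show "partial_deriv i h \<in> {\<lambda>x. L (f x) | f. f \<in> smooth_class B}"
    using smooth_class_partial_deriv[OF f, of i] by auto
  show "B' h" unfolding h by (rule B, rule smooth_class_base, rule f)
qed

text \<open>Each differentiation produces a factor c, so the invariant set has to contain scalar
  multiples; this explains the scalar a in the hypothesis on the bounds.\<close>

lemma smooth_class_affine:
  fixes f :: "real^'n::finite \<Rightarrow> complex" and c :: real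
  assumes f: "f \<in> smooth_class B" and B: "\<And>f a. B f \<Longrightarrow> B' (\<lambda>x. a * f (y + c *\<^sub>R x))"
  shows "(\<lambda>x. f (y + c *\<^sub>R x)) \<in> smooth_class B'"
proof (rule smooth_classI[where A="{\<lambda>x. a * f (y + c *\<^sub>R x) | f a. f \<in> smooth_class B}"])
  show "(\<lambda>x. f (y + c *\<^sub>R x)) \<in> {\<lambda>x. a * f (y + c *\<^sub>R x) | f a. f \<in> smooth_class B}"
    using f by (auto intro!: exI[of _ f] exI[of _ 1])
next
  fix h x i assume "h \<in> {\<lambda>x. a * f (y + c *\<^sub>R x) | f a. f \<in> smooth_class B}"
  then obtain f a where f: "f \<in> smooth_class B" and h: "h = (\<lambda>x. a * f (y + c *\<^sub>R x))" by auto
  have *: "(h has_derivative (\<lambda>k. a * frechet_derivative f (at (y + c *\<^sub>R x)) (c *\<^sub>R k))) (at x)" for x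
    unfolding h
    by (rule bounded_linear.has_derivative[OF bounded_linear_mult_right])
      (rule has_derivative_compose[where f="\<lambda>x. y + c *\<^sub>R x",
         OF _ has_derivative_partial_deriv[OF smooth_class_differentiable[OF f]]],
       auto intro!: derivative_eq_intros)
  then show "h differentiable (at x)" by (auto simp: differentiable_def)
  have "partial_deriv i h = (\<lambda>x. (a * complex_of_real c) * partial_deriv i f (y + c *\<^sub>R x))"
  proof
    fix x
    have "frechet_derivative f (at (y + c *\<^sub>R x)) (c *\<^sub>R axis i 1) = c *\<^sub>R frechet_derivative f (at (y + c *\<^sub>R x)) (axis i 1)"
      using linear_frechet_derivative[OF smooth_class_differentiable[OF f]] by (rule linear_scale)
    then show "partial_deriv i h x = (a * complex_of_real c) * partial_deriv i f (y + c *\<^sub>R x)"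
      by (subst partial_deriv_eqI[OF *]) (simp add: partial_deriv_def scaleR_conv_of_real)
  qed
  then show "partial_deriv i h \<in> {\<lambda>x. a * f (y + c *\<^sub>R x) | f a. f \<in> smooth_class B}"
    using smooth_class_partial_deriv[OF f, of i] by auto
  show "B' h" unfolding h by (rule B, rule smooth_class_base, rule f)
qed

text \<open>The algebra with constants generated by S. If the derivatives of the generators lie in
  the algebra, so do those of all its members; this handles functions whose derivatives are
  polynomials in functions of the same family.\<close>

inductive_set alg_closure :: "(real^'n::finite \<Rightarrow> complex) set \<Rightarrow> (real^'n \<Rightarrow> complex) set" for S where
  base: "f \<in> S \<Longrightarrow> f \<in> alg_closure S"
| const: "(\<lambda>x. c) \<in> alg_closure S"
| add: "f \<in> alg_closure S \<Longrightarrow> g \<in> alg_closure S \<Longrightarrow> (\<lambda>x. f x + g x) \<in> alg_closure S"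
| mult: "f \<in> alg_closure S \<Longrightarrow> g \<in> alg_closure S \<Longrightarrow> (\<lambda>x. f x * g x) \<in> alg_closure S"

lemma alg_closure_smooth_class:
  assumes f: "f \<in> alg_closure S"
    and diff: "\<And>f x. f \<in> S \<Longrightarrow> f differentiable (at x)"
    and part: "\<And>f i. f \<in> S \<Longrightarrow> partial_deriv i f \<in> alg_closure S"
    and B: "\<And>f. f \<in> S \<Longrightarrow> B f" and B_const: "\<And>c. B (\<lambda>x. c)"
    and B_add: "\<And>f g. B f \<Longrightarrow> B g \<Longrightarrow> B (\<lambda>x. f x + g x)"
    and B_mult: "\<And>f g. B f \<Longrightarrow> B g \<Longrightarrow> B (\<lambda>x. f x * g x)"
  shows "f \<in> smooth_class B"
proof (rule smooth_classI[OF f])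
  have *: "(\<forall>x. f differentiable (at x)) \<and> B f \<and> (\<forall>i. partial_deriv i f \<in> alg_closure S)"
    if "f \<in> alg_closure S" for f
    using that
  proof induction
    case (base f) then show ?case using diff part B by auto
  next
    case (const c) then show ?case by (auto simp: partial_deriv_const B_const alg_closure.const)
  next
    case (add f g) then show ?case by (auto simp: partial_deriv_add B_add alg_closure.add)
  next
    case (mult f g) then show ?case
      by (auto simp: partial_deriv_mult B_mult intro!: alg_closure.add alg_closure.mult)
  qed
  fix f i x assume "f \<in> alg_closure S"
  with * show "f differentiable (at x)" "partial_deriv i f \<in> alg_closure S" "B f" by auto
qed

section \<open>Stability properties of smooth functions\<close>

lemma smooth_const: "smooth (\<lambda>x. c)"
  unfolding smooth_iff_smooth_class
  by (rule smooth_classI[where A="range (\<lambda>c x. c)"]) (auto simp: partial_deriv_const)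

lemma smooth_add: "smooth f \<Longrightarrow> smooth g \<Longrightarrow> smooth (\<lambda>x. f x + g x)"
  unfolding smooth_iff_smooth_class by (rule smooth_class_add) auto

lemma smooth_mult: "smooth f \<Longrightarrow> smooth g \<Longrightarrow> smooth (\<lambda>x. f x * g x)"
  unfolding smooth_iff_smooth_class by (rule smooth_class_mult) auto

lemma smooth_bounded_linear: "bounded_linear L \<Longrightarrow> smooth f \<Longrightarrow> smooth (\<lambda>x. L (f x))"
  unfolding smooth_iff_smooth_class by (rule smooth_class_bounded_linear) auto

lemma smooth_sum: "(\<And>i. i \<in> I \<Longrightarrow> smooth (f i)) \<Longrightarrow> smooth (\<lambda>x. \<Sum>i\<in>I. f i x)"
  by (induction I rule: infinite_finite_induct) (auto intro: smooth_add smooth_const)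

lemma smooth_diff: "smooth f \<Longrightarrow> smooth g \<Longrightarrow> smooth (\<lambda>x. f x - g x)"
  using smooth_add[of f "\<lambda>x. -1 * g x"] smooth_mult[OF smooth_const, of g "-1"] by simp

lemma smooth_translate: "smooth f \<Longrightarrow> smooth (translate y f)"
  using smooth_class_affine[of f "\<lambda>f. True" "\<lambda>f. True" "-y" 1]
  unfolding smooth_iff_smooth_class translate_def by (simp add: algebra_simps)

lemma smooth_differentiable: "smooth f \<Longrightarrow> f differentiable (at x)"
  unfolding smooth_iff_smooth_class by (rule smooth_class_differentiable)

lemma smooth_partial_deriv: "smooth f \<Longrightarrow> smooth (partial_deriv i f)"
  unfolding smooth_iff_smooth_class by (rule smooth_class_partial_deriv)

lemma smooth_continuous: "smooth f \<Longrightarrow> continuous_on A f"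
  by (meson continuous_at_imp_continuous_on differentiable_imp_continuous_within smooth_differentiable)

lemma smooth_coord: "smooth (\<lambda>x. complex_of_real (x $ k))"
  unfolding smooth_iff_smooth_class
  by (rule alg_closure_smooth_class[where S="{\<lambda>x. complex_of_real (x $ k)}"])
    (auto simp: partial_deriv_coord intro: alg_closure.intros)

text \<open>By the quotient rule the functions h / g^k with smooth h and arbitrary k are invariant
  under differentiation.\<close>

lemma smooth_inverse:
  assumes g: "smooth g" and nz: "\<And>x. g x \<noteq> 0"
  shows "smooth (\<lambda>x. 1 / g x)"
  unfolding smooth_iff_smooth_class
proof (rule smooth_classI[where A="{\<lambda>x. h x / g x ^ k | h k. smooth h}"])
  show "(\<lambda>x. 1 / g x) \<in> {\<lambda>x. h x / g x ^ k | h k. smooth h}"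
    by (auto intro!: exI[of _ "\<lambda>x. 1"] exI[of _ "1::nat"] smooth_const)
next
  fix f x i assume "f \<in> {\<lambda>x. h x / g x ^ k | h k. smooth h}"
  then obtain h k where h: "smooth h" and f: "f = (\<lambda>x. h x / g x ^ k)" by auto
  let ?D = "\<lambda>x v. (frechet_derivative h (at x) v * g x - of_nat k * h x * frechet_derivative g (at x) v) / g x ^ (k + 1)"
  have *: "(f has_derivative ?D x) (at x)" for x
  proof -
    have "(f has_derivative (\<lambda>v. (frechet_derivative h (at x) v * g x ^ k
       - h x * (of_nat k * frechet_derivative g (at x) v * g x ^ (k - 1))) / (g x ^ k * g x ^ k))) (at x)"
      unfolding f
      by (rule has_derivative_divide' has_derivative_power has_derivative_partial_deriv smooth_differentiable h g)+
         (simp add: nz)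
    moreover have "(\<lambda>v. (frechet_derivative h (at x) v * g x ^ k
       - h x * (of_nat k * frechet_derivative g (at x) v * g x ^ (k - 1))) / (g x ^ k * g x ^ k)) = ?D x"
    \<comment> \<open>The exponent \<open>k - 1\<close> is a truncated subtraction. For k = 0 the
      term in question carries the factor \<open>of_nat k\<close> = 0.\<close>
    proof (cases k)
      case (Suc m) then show ?thesis using nz[of x] by (auto simp: fun_eq_iff field_simps)
    qed (use nz[of x] in \<open>auto simp: fun_eq_iff field_simps\<close>)
    ultimately show ?thesis by simp
  qed
  then show "f differentiable (at x)" by (auto simp: differentiable_def)
  have "partial_deriv i f = (\<lambda>x. (partial_deriv i h x * g x - of_nat k * h x * partial_deriv i g x) / g x ^ (k + 1))"
    by (rule ext, subst partial_deriv_eqI[OF *]) (simp add: partial_deriv_def)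
  moreover have "smooth (\<lambda>x. partial_deriv i h x * g x - of_nat k * h x * partial_deriv i g x)"
    by (intro smooth_diff smooth_mult smooth_const h g smooth_partial_deriv)
  ultimately show "partial_deriv i f \<in> {\<lambda>x. h x / g x ^ k | h k. smooth h}"
    by (intro CollectI exI[of _ "\<lambda>x. partial_deriv i h x * g x - of_nat k * h x * partial_deriv i g x"]
        exI[of _ "k + 1"]) simp
qed auto

section \<open>Schwartz functions and functions of polynomial growth\<close>

definition rapid :: "(real^'n::finite \<Rightarrow> complex) \<Rightarrow> bool" where
  "rapid f \<longleftrightarrow> (\<forall>k. bdd_above (range (\<lambda>x. (1 + norm x) ^ k * norm (f x))))"

definition poly_bounded :: "(real^'n::finite \<Rightarrow> complex) \<Rightarrow> bool" where
  "poly_bounded f \<longleftrightarrow> (\<exists>C k. \<forall>x. norm (f x) \<le> C * (1 + norm x) ^ k)"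

abbreviation slowly_increasing :: "(real^'n::finite \<Rightarrow> complex) set" where
  "slowly_increasing \<equiv> smooth_class poly_bounded"

lemma schwartz_functions_eq: "schwartz_functions = smooth_class rapid"
  by (auto simp: schwartz_functions_def smooth_class_def rapid_def)

lemma rapidI: "(\<And>k. \<exists>C. \<forall>x. (1 + norm x) ^ k * norm (f x) \<le> C) \<Longrightarrow> rapid f"
  unfolding rapid_def bdd_above_def by auto

lemma rapidD: "rapid f \<Longrightarrow> \<exists>C\<ge>0. \<forall>x. (1 + norm x) ^ k * norm (f x) \<le> C"
proof -
  assume "rapid f"
  then obtain C where C: "\<And>x. (1 + norm x) ^ k * norm (f x) \<le> C"
    unfolding rapid_def bdd_above_def by fastforce
  then have "0 \<le> C" using order_trans[OF _ C[of 0]] by simp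
  with C show ?thesis by blast
qed

lemma rapid_bound:
  assumes "rapid f" obtains C where "C \<ge> 0" "\<And>x. norm (f x) \<le> C / (1 + norm x) ^ k"
proof -
  obtain C where C: "C \<ge> 0" "\<And>x. (1 + norm x) ^ k * norm (f x) \<le> C" using rapidD[OF assms] by metis
  have "norm (f x) \<le> C / (1 + norm x) ^ k" for x
  proof -
    have "0 < (1 + norm x) ^ k" by (simp add: add_pos_nonneg)
    then show ?thesis using C(2)[of x] by (simp add: pos_le_divide_eq mult.commute)
  qed
  with C(1) that show ?thesis by blast
qed

lemma rapid_add: "rapid f \<Longrightarrow> rapid g \<Longrightarrow> rapid (\<lambda>x. f x + g x)"
proof (rule rapidI)
  fix k assume "rapid f" "rapid g"
  then obtain C D where C: "\<And>x. (1 + norm x) ^ k * norm (f x) \<le> C" and D: "\<And>x. (1 + norm x) ^ k * norm (g x) \<le> D"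
    using rapidD by meson
  have "(1 + norm x) ^ k * norm (f x + g x) \<le> C + D" for x
  proof -
    have "(1 + norm x) ^ k * norm (f x + g x) \<le> (1 + norm x) ^ k * (norm (f x) + norm (g x))"
      by (intro mult_left_mono norm_triangle_ineq) auto
    also have "\<dots> \<le> C + D" using C[of x] D[of x] by (simp add: distrib_left)
    finally show ?thesis .
  qed
  then show "\<exists>C. \<forall>x. (1 + norm x) ^ k * norm (f x + g x) \<le> C" by blast
qed

lemma poly_bounded_common:
  fixes x :: "'a::real_normed_vector" and f :: "'a \<Rightarrow> complex" and g :: "'a \<Rightarrow> complex"
  assumes "norm (f x) \<le> C * (1 + norm x) ^ k" "norm (g x) \<le> D * (1 + norm x) ^ l"
  shows "norm (f x) \<le> \<bar>C\<bar> * (1 + norm x) ^ (k + l)" "norm (g x) \<le> \<bar>D\<bar> * (1 + norm x) ^ (k + l)"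
proof -
  have "C * (1 + norm x) ^ k \<le> \<bar>C\<bar> * (1 + norm x) ^ (k + l)"
    by (intro mult_mono power_increasing) auto
  moreover have "D * (1 + norm x) ^ l \<le> \<bar>D\<bar> * (1 + norm x) ^ (k + l)"
    by (intro mult_mono power_increasing) auto
  ultimately show "norm (f x) \<le> \<bar>C\<bar> * (1 + norm x) ^ (k + l)" "norm (g x) \<le> \<bar>D\<bar> * (1 + norm x) ^ (k + l)"
    using assms by auto
qed

lemma poly_bounded_add: "poly_bounded f \<Longrightarrow> poly_bounded g \<Longrightarrow> poly_bounded (\<lambda>x. f x + g x)"
proof -
  assume "poly_bounded f" "poly_bounded g"
  then obtain C D k l where C: "\<And>x. norm (f x) \<le> C * (1 + norm x) ^ k" and D: "\<And>x. norm (g x) \<le> D * (1 + norm x) ^ l"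
    unfolding poly_bounded_def by blast
  have "norm (f x + g x) \<le> (\<bar>C\<bar> + \<bar>D\<bar>) * (1 + norm x) ^ (k + l)" for x
    using norm_triangle_ineq[of "f x" "g x"] poly_bounded_common[where f=f and g=g, OF C[of x] D[of x]] by (simp add: algebra_simps)
  then show ?thesis unfolding poly_bounded_def by blast
qed

lemma poly_bounded_mult: "poly_bounded f \<Longrightarrow> poly_bounded g \<Longrightarrow> poly_bounded (\<lambda>x. f x * g x)"
proof -
  assume "poly_bounded f" "poly_bounded g"
  then obtain C D k l where C: "\<And>x. norm (f x) \<le> C * (1 + norm x) ^ k" and D: "\<And>x. norm (g x) \<le> D * (1 + norm x) ^ l"
    unfolding poly_bounded_def by blast
  have "norm (f x * g x) \<le> (C * D) * (1 + norm x) ^ (k + l)" for x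
    using mult_mono[OF C[of x] D[of x]] order_trans[OF norm_ge_zero C[of x]]
    by (simp add: norm_mult power_add algebra_simps)
  then show ?thesis unfolding poly_bounded_def by blast
qed

lemma poly_bounded_const: "poly_bounded (\<lambda>x. c)"
  unfolding poly_bounded_def by (rule exI[of _ "norm c"], rule exI[of _ 0]) simp

lemma rapid_mult: "poly_bounded f \<Longrightarrow> rapid g \<Longrightarrow> rapid (\<lambda>x. f x * g x)"
proof (rule rapidI)
  fix k assume "poly_bounded f" "rapid g"
  \<comment> \<open>Decay of order k + l of g absorbs the growth of degree l of f and leaves decay
    of order k.\<close>
  then obtain C l D where C: "\<And>x. norm (f x) \<le> C * (1 + norm x) ^ l" and D: "\<And>x. (1 + norm x) ^ (k + l) * norm (g x) \<le> D"
    unfolding poly_bounded_def using rapidD by meson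
  have "(1 + norm x) ^ k * norm (f x * g x) \<le> \<bar>C\<bar> * D" for x
  proof -
    have "(1 + norm x) ^ k * norm (f x * g x) \<le> (1 + norm x) ^ k * ((\<bar>C\<bar> * (1 + norm x) ^ l) * norm (g x))"
      unfolding norm_mult
      by (intro mult_left_mono mult_right_mono order_trans[OF C]) (auto intro!: mult_right_mono)
    also have "\<dots> = \<bar>C\<bar> * ((1 + norm x) ^ (k + l) * norm (g x))" by (simp add: power_add)
    also have "\<dots> \<le> \<bar>C\<bar> * D" by (intro mult_left_mono D) auto
    finally show ?thesis .
  qed
  then show "\<exists>C. \<forall>x. (1 + norm x) ^ k * norm (f x * g x) \<le> C" by blast
qed

lemma rapid_imp_poly_bounded: "rapid f \<Longrightarrow> poly_bounded f"
  unfolding poly_bounded_def using rapidD[of f 0] by (metis mult.commute mult_1 power_0)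

lemma schwartz_add: "f \<in> schwartz_functions \<Longrightarrow> g \<in> schwartz_functions \<Longrightarrow> (\<lambda>x. f x + g x) \<in> schwartz_functions"
  unfolding schwartz_functions_eq by (rule smooth_class_add) (auto intro: rapid_add)

lemma schwartz_slow_mult: "f \<in> slowly_increasing \<Longrightarrow> g \<in> schwartz_functions \<Longrightarrow> (\<lambda>x. f x * g x) \<in> schwartz_functions"
  unfolding schwartz_functions_eq by (erule smooth_class_mult) (assumption | rule rapid_add rapid_mult)+

lemma slow_mult: "f \<in> slowly_increasing \<Longrightarrow> g \<in> slowly_increasing \<Longrightarrow> (\<lambda>x. f x * g x) \<in> slowly_increasing"
  by (erule smooth_class_mult) (assumption | rule poly_bounded_add poly_bounded_mult)+

lemma schwartz_imp_slow: "f \<in> schwartz_functions \<Longrightarrow> f \<in> slowly_increasing"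
  unfolding schwartz_functions_eq by (erule smooth_class_mono) (rule rapid_imp_poly_bounded)

lemma slow_const: "(\<lambda>x. c) \<in> slowly_increasing"
  by (rule alg_closure_smooth_class[where S="{}", OF alg_closure.const])
    (auto intro: poly_bounded_add poly_bounded_mult poly_bounded_const)

lemma slow_prod: "(\<And>l. l \<in> L \<Longrightarrow> f l \<in> slowly_increasing) \<Longrightarrow> (\<lambda>x. \<Prod>l\<in>L. f l x) \<in> slowly_increasing"
  by (induction L rule: infinite_finite_induct) (auto intro: slow_mult slow_const)

lemma schwartz_cmult: "f \<in> schwartz_functions \<Longrightarrow> (\<lambda>x. c * f x) \<in> schwartz_functions"
  by (rule schwartz_slow_mult[OF slow_const])

lemma schwartz_mult: "f \<in> schwartz_functions \<Longrightarrow> g \<in> schwartz_functions \<Longrightarrow> (\<lambda>x. f x * g x) \<in> schwartz_functions"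
  by (rule schwartz_slow_mult[OF schwartz_imp_slow])

lemma schwartz_uminus: "f \<in> schwartz_functions \<Longrightarrow> (\<lambda>x. - f x) \<in> schwartz_functions"
  using schwartz_cmult[of f "-1"] by simp

lemma schwartz_diff: "f \<in> schwartz_functions \<Longrightarrow> g \<in> schwartz_functions \<Longrightarrow> (\<lambda>x. f x - g x) \<in> schwartz_functions"
  using schwartz_add[OF _ schwartz_uminus] by auto

lemma schwartz_cnj: "f \<in> schwartz_functions \<Longrightarrow> (\<lambda>x. cnj (f x)) \<in> schwartz_functions"
  unfolding schwartz_functions_eq
  by (rule smooth_class_bounded_linear[OF bounded_linear_cnj]) (unfold rapid_def complex_mod_cnj)

lemma schwartz_partial_deriv: "f \<in> schwartz_functions \<Longrightarrow> partial_deriv i f \<in> schwartz_functions"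
  unfolding schwartz_functions_eq by (rule smooth_class_partial_deriv)

lemma schwartz_rapid: "f \<in> schwartz_functions \<Longrightarrow> rapid f"
  unfolding schwartz_functions_eq by (rule smooth_class_base)

lemma schwartz_smooth: "f \<in> schwartz_functions \<Longrightarrow> smooth f"
  unfolding schwartz_functions_def by auto

lemma schwartz_uminus_arg: "f \<in> schwartz_functions \<Longrightarrow> (\<lambda>x. f (- x)) \<in> schwartz_functions"
  using smooth_class_affine[of f rapid rapid 0 "-1"] unfolding schwartz_functions_eq
proof (simp, elim meta_mp)
  fix f :: "real^'n \<Rightarrow> complex" and a assume "rapid f"
  then have "rapid (\<lambda>x. f (-x))"
    unfolding rapid_def by (metis (mono_tags, lifting) bdd_above_def norm_minus_cancel rangeE rangeI)
  then show "rapid (\<lambda>x. a * f (-x))" by (rule rapid_mult[OF poly_bounded_const])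
qed

lemma poly_bounded_coord: "poly_bounded (\<lambda>x. complex_of_real (x $ k))"
  unfolding poly_bounded_def
proof (intro exI allI)
  fix x :: "real^'a"
  show "norm (complex_of_real (x $ k)) \<le> 1 * (1 + norm x) ^ 1"
    using component_le_norm_cart[of x k] by simp
qed

lemma slow_coord: "(\<lambda>x. complex_of_real (x $ k)) \<in> slowly_increasing"
  by (rule alg_closure_smooth_class[where S="{\<lambda>x. complex_of_real (x $ k)}"])
    (auto simp: partial_deriv_coord poly_bounded_coord intro: alg_closure.intros poly_bounded_add poly_bounded_mult poly_bounded_const)

lemma block_norm_sq: "(block_norm b l \<xi>)\<^sup>2 = (\<Sum>i | b i = l. (\<xi> $ i)\<^sup>2)"
  unfolding block_norm_def L2_set_def by (simp add: sum_nonneg)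

lemma block_norm_le: "block_norm b l \<xi> \<le> norm \<xi>"
  unfolding block_norm_def L2_set_def norm_vec_def by (auto intro!: real_sqrt_le_mono sum_mono2)

lemma block_norm_nonneg: "0 \<le> block_norm b l \<xi>"
  unfolding block_norm_def by (rule L2_set_nonneg)

text \<open>The base is at least 1, so the exponent may be raised to an integer above \<bar>a\<bar>,
  whatever the sign of a; and the base is at most (1 + |\<xi>|)^2, whence the factor 2 in the
  exponent.\<close>

lemma block_power_bound:
  "\<bar>(1 + (block_norm b l \<xi>)\<^sup>2) powr a\<bar> \<le> (1 + norm \<xi>) ^ (2 * nat \<lceil>\<bar>a\<bar>\<rceil>)"
proof -
  let ?w = "1 + (block_norm b l \<xi>)\<^sup>2"
  have w1: "1 \<le> ?w" by simp
  have w2: "?w \<le> (1 + norm \<xi>)\<^sup>2"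
    using power_mono[OF block_norm_le block_norm_nonneg, of b l \<xi> 2] by (simp add: power2_sum add_increasing2)
  have "?w powr a \<le> ?w powr (real (nat \<lceil>\<bar>a\<bar>\<rceil>))"
    by (rule powr_mono) (use w1 in linarith)+
  also have "\<dots> = ?w ^ nat \<lceil>\<bar>a\<bar>\<rceil>" by (rule powr_realpow) (use w1 in linarith)
  also have "\<dots> \<le> ((1 + norm \<xi>)\<^sup>2) ^ nat \<lceil>\<bar>a\<bar>\<rceil>" by (rule power_mono[OF w2]) simp
  finally show ?thesis by (simp add: power_mult)
qed

text \<open>With w = 1 + |\<xi>_l|^2 the derivative of w^a is a multiple of w^(a-1) times a
  coordinate. Hence the powers of w with all real exponents, together with the coordinates, generate
  an invariant algebra.\<close>

lemma slow_block_power: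
  fixes b :: "'n::finite \<Rightarrow> 'j::finite"
  shows "(\<lambda>\<xi>. complex_of_real ((1 + (block_norm b l \<xi>)\<^sup>2) powr a)) \<in> slowly_increasing"
proof -
  let ?S = "range (\<lambda>a \<xi>. complex_of_real ((1 + (block_norm b l \<xi>)\<^sup>2) powr a)) \<union> range (\<lambda>k \<xi>. complex_of_real (\<xi> $ k))"
  have *: "((\<lambda>\<xi>. complex_of_real ((1 + (block_norm b l \<xi>)\<^sup>2) powr a)) has_derivative
     (\<lambda>h. complex_of_real (a * (1 + (block_norm b l \<xi>)\<^sup>2) powr (a - 1) * (\<Sum>i | b i = l. 2 * \<xi> $ i * h $ i)))) (at \<xi>)" for a and \<xi> :: "real^'n"
  proof -
    have "((\<lambda>\<xi>. 1 + (\<Sum>i | b i = l. (\<xi> $ i)\<^sup>2)) has_derivative (\<lambda>h. (\<Sum>i | b i = l. 2 * \<xi> $ i * h $ i))) (at \<xi>)"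
      by (auto intro!: derivative_eq_intros bounded_linear_imp_has_derivative bounded_linear_vec_nth simp: mult_ac)
    then have 1: "((\<lambda>\<xi>. 1 + (block_norm b l \<xi>)\<^sup>2) has_derivative (\<lambda>h. (\<Sum>i | b i = l. 2 * \<xi> $ i * h $ i))) (at \<xi>)"
      by (simp add: block_norm_sq)
    have 2: "((\<lambda>t. t powr a) has_derivative (\<lambda>k. a * (1 + (block_norm b l \<xi>)\<^sup>2) powr (a - 1) * k)) (at (1 + (block_norm b l \<xi>)\<^sup>2))"
      using has_real_derivative_powr[of "1 + (block_norm b l \<xi>)\<^sup>2" a]
      by (simp add: has_field_derivative_def add_pos_nonneg)
    show ?thesis
      by (rule bounded_linear.has_derivative[OF bounded_linear_of_real has_derivative_compose[OF 1 2]])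
  qed
  show ?thesis
  proof (rule alg_closure_smooth_class[where S="?S"])
    show "(\<lambda>\<xi>. complex_of_real ((1 + (block_norm b l \<xi>)\<^sup>2) powr a)) \<in> alg_closure ?S"
      by (rule alg_closure.base) auto
    fix f i x assume "f \<in> ?S"
    then consider a where "f = (\<lambda>\<xi>. complex_of_real ((1 + (block_norm b l \<xi>)\<^sup>2) powr a))"
      | k where "f = (\<lambda>\<xi>. complex_of_real (\<xi> $ k))" by auto
    then have "f differentiable (at x) \<and> partial_deriv i f \<in> alg_closure ?S \<and> poly_bounded f"
    proof cases
      case 1
      have "partial_deriv i f = (\<lambda>\<xi>. (complex_of_real a * complex_of_real ((1 + (block_norm b l \<xi>)\<^sup>2) powr (a - 1)))
          * (complex_of_real (if b i = l then 2 else 0) * complex_of_real (\<xi> $ i)))"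
        unfolding 1
      proof (rule ext, subst partial_deriv_eqI[OF *])
        fix \<xi> :: "real^'n"
        have "(\<Sum>j | b j = l. 2 * \<xi> $ j * axis i 1 $ j) = (if b i = l then 2 else 0) * \<xi> $ i"
          by (simp add: axis_def if_distrib cong: if_cong)
        then show "complex_of_real (a * (1 + (block_norm b l \<xi>)\<^sup>2) powr (a - 1) * (\<Sum>j | b j = l. 2 * \<xi> $ j * axis i 1 $ j)) =
           (complex_of_real a * complex_of_real ((1 + (block_norm b l \<xi>)\<^sup>2) powr (a - 1)))
          * (complex_of_real (if b i = l then 2 else 0) * complex_of_real (\<xi> $ i))"
          by (simp only: of_real_mult)
      qed
      also have "\<dots> \<in> alg_closure ?S"
        by (intro alg_closure.mult alg_closure.const alg_closure.base) auto
      finally have "partial_deriv i f \<in> alg_closure ?S" .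
      moreover have "poly_bounded f" unfolding poly_bounded_def 1
        using block_power_bound[of b l _ a]
        by (intro exI[of _ 1] exI[of _ "2 * nat \<lceil>\<bar>a\<bar>\<rceil>"]) (simp only: norm_of_real mult_1 simp_thms)
      ultimately show ?thesis using *[of a x] unfolding 1 by (auto simp: differentiable_def)
    next
      case 2 then show ?thesis
        by (auto simp: partial_deriv_coord poly_bounded_coord intro: alg_closure.const)
    qed
    then show "f differentiable (at x)" "partial_deriv i f \<in> alg_closure ?S" "poly_bounded f" by auto
  qed (auto intro: poly_bounded_add poly_bounded_mult poly_bounded_const)
qed

lemma slow_bracket: "(\<lambda>\<xi>. complex_of_real (bracket b s \<xi>)) \<in> slowly_increasing"
  unfolding bracket_def of_real_prod by (intro slow_prod slow_block_power)

section \<open>Test functions\<close>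

lemma test_functionsI:
  assumes "smooth f" "compact K" "\<And>x. f x \<noteq> 0 \<Longrightarrow> x \<in> K"
  shows "f \<in> test_functions"
proof -
  have "closure {x. f x \<noteq> 0} \<subseteq> K"
    by (rule closure_minimal) (use assms compact_imp_closed in auto)
  then have "compact (closure {x. f x \<noteq> 0})"
    using assms(2) compact_closure bounded_subset compact_imp_bounded closure_subset by (metis subset_trans)
  with assms(1) show ?thesis by (simp add: test_functions_def)
qed

lemma test_functionsE:
  assumes "f \<in> test_functions"
  obtains K where "smooth f" "compact K" "\<And>x. f x \<noteq> 0 \<Longrightarrow> x \<in> K"
  using assms closure_subset[of "{x. f x \<noteq> 0}"] unfolding test_functions_def by blast

lemma test_smooth: "f \<in> test_functions \<Longrightarrow> smooth f"
  by (simp add: test_functions_def)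

lemma test_mult: "f \<in> test_functions \<Longrightarrow> smooth g \<Longrightarrow> (\<lambda>x. f x * g x) \<in> test_functions"
  by (erule test_functionsE, rule test_functionsI) (auto intro: smooth_mult)

lemma test_mult2: "f \<in> test_functions \<Longrightarrow> smooth g \<Longrightarrow> (\<lambda>x. g x * f x) \<in> test_functions"
  using test_mult[of f g] by (simp add: mult.commute)

lemma test_zero: "(\<lambda>x. 0) \<in> test_functions"
  by (rule test_functionsI[where K="{}"]) (auto intro: smooth_const)

lemma test_add:
  assumes "f \<in> test_functions" "g \<in> test_functions" shows "(\<lambda>x. f x + g x) \<in> test_functions"
proof -
  obtain K where K: "smooth f" "compact K" "\<And>x. f x \<noteq> 0 \<Longrightarrow> x \<in> K" using test_functionsE[OF assms(1)] by blast
  obtain L where L: "smooth g" "compact L" "\<And>x. g x \<noteq> 0 \<Longrightarrow> x \<in> L" using test_functionsE[OF assms(2)] by blast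
  show ?thesis
  proof (rule test_functionsI[where K="K \<union> L"])
    fix x assume "f x + g x \<noteq> 0"
    then have "f x \<noteq> 0 \<or> g x \<noteq> 0" by auto
    then show "x \<in> K \<union> L" using K L by blast
  qed (use K L smooth_add in auto)
qed

lemma test_cmult: "f \<in> test_functions \<Longrightarrow> (\<lambda>x. c * f x) \<in> test_functions"
  by (rule test_mult2[OF _ smooth_const])

lemma test_translate:
  assumes "f \<in> test_functions" shows "translate y f \<in> test_functions"
proof -
  obtain K where K: "smooth f" "compact K" "\<And>x. f x \<noteq> 0 \<Longrightarrow> x \<in> K" using test_functionsE[OF assms] by blast
  show ?thesis
  proof (rule test_functionsI[where K="(+) y ` K"])
    show "compact ((+) y ` K)" by (rule compact_translation) fact
    fix x assume "translate y f x \<noteq> 0"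
    then have "x - y \<in> K" using K by (auto simp: translate_def)
    then show "x \<in> (+) y ` K" by (auto intro!: image_eqI[of _ _ "x - y"])
  qed (use K smooth_translate in auto)
qed

text \<open>The complement of K is open, so f and inductively each derivative is zero in a whole
  neighbourhood of x, not just at x.\<close>

lemma partial_derivs_outside:
  assumes "closed K" "\<And>x. f x \<noteq> 0 \<Longrightarrow> x \<in> K" "x \<notin> K"
  shows "partial_derivs is f x = 0"
  using assms(3)
proof (induction "is" arbitrary: x)
  case (Cons i "is")
  have "(partial_derivs is f has_derivative (\<lambda>h. 0)) (at x)"
    by (rule has_derivative_transform_within_open[OF has_derivative_const[where c=0], where s="-K"])
      (use assms(1) Cons in auto)
  from partial_deriv_eqI[OF this] show ?case by simp
qed (use assms in auto)

lemma test_imp_schwartz: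
  assumes "f \<in> test_functions" shows "f \<in> schwartz_functions"
proof -
  obtain K where K: "smooth f" "compact K" "\<And>x. f x \<noteq> 0 \<Longrightarrow> x \<in> K" using test_functionsE[OF assms] by blast
  have "rapid (partial_derivs is f)" for "is"
  proof (rule rapidI)
    fix k
    let ?g = "\<lambda>x. (1 + norm x) ^ k * norm (partial_derivs is f x)"
    have "smooth (partial_derivs is f)" using K(1) unfolding smooth_iff_smooth_class by (rule smooth_class_partial_derivs)
    then have "continuous_on K ?g"
      by (intro continuous_intros) (auto intro: smooth_continuous)
    then have "bounded (?g ` K)" using K(2) compact_continuous_image compact_imp_bounded by blast
    then obtain C where C0: "\<forall>y\<in>?g ` K. norm y \<le> C" unfolding bounded_iff by blast
    have C: "?g x \<le> C" if "x \<in> K" for x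
      using bspec[OF C0 imageI[OF that]] unfolding real_norm_def by linarith
    have "?g x \<le> max C 0" for x
      using C[of x] partial_derivs_outside[of K f x "is", OF compact_imp_closed[OF K(2)] K(3)] by (cases "x \<in> K") auto
    then show "\<exists>C. \<forall>x. ?g x \<le> C" by blast
  qed
  with K(1) show ?thesis unfolding schwartz_functions_eq smooth_class_def by auto
qed

text \<open>The powers of \<open>1 / t\<close> make the family \<open>flat k\<close> closed under differentiation up to linear combinations.\<close>

definition flat :: "nat \<Rightarrow> real \<Rightarrow> real" where
  "flat k t = (if t > 0 then exp (- 1 / t) / t ^ k else 0)"

lemma flat_nonneg: "0 \<le> flat k t"
  by (simp add: flat_def)

lemma flat_pos: "flat k t > 0 \<longleftrightarrow> t > 0"
  by (simp add: flat_def)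

text \<open>A single term of the exponential series at 1/t gives exp(-1/t) \<le> (k+2)! t^(k+2). The
  square is what makes the difference quotient at 0 tend to 0.\<close>

lemma flat_le_square: "flat k t \<le> fact (k + 2) * t\<^sup>2"
proof (cases "t > 0")
  case True
  have "(1/t) ^ (k + 2) / fact (k + 2) \<le> exp (1 / t)"
    using sum_le_suminf[OF sums_summable[OF exp_converges[of "1/t"]], of "{k + 2}"] sums_unique[OF exp_converges[of "1/t"]] True
    by (simp add: field_simps)
  then have "1 \<le> fact (k + 2) * t ^ (k + 2) * exp (1 / t)"
    using True by (simp add: divide_le_eq power_one_over field_simps del: fact_Suc power_Suc add_2_eq_Suc')
  then have "exp (- (1 / t)) \<le> fact (k + 2) * t ^ (k + 2)"
    by (simp add: exp_minus divide_simps mult.commute del: fact_Suc power_Suc add_2_eq_Suc')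
  then show ?thesis using True
    by (simp add: flat_def divide_le_eq power_add mult_ac del: fact_Suc add_2_eq_Suc')
qed (auto simp: flat_def)

lemma has_real_derivative_flat:
  "(flat k has_real_derivative (- real k * flat (k + 1) t + flat (k + 2) t)) (at t)"
proof -
  consider "t > 0" | "t < 0" | "t = 0" by linarith
  then show ?thesis
  proof cases
    case 1
    have "((\<lambda>t. exp (- 1 / t) / t ^ k) has_real_derivative (- real k * flat (k + 1) t + flat (k + 2) t)) (at t)"
      using 1
      by (auto intro!: derivative_eq_intros simp: flat_def field_simps power_add power2_eq_square)
        (cases k; auto simp: field_simps)
    then show ?thesis
      by (rule has_field_derivative_transform_within_open[of _ _ _ "{0<..}"]) (use 1 in \<open>auto simp: flat_def\<close>)
  next
    case 2
    have "((\<lambda>t. 0) has_real_derivative (- real k * flat (k + 1) t + flat (k + 2) t)) (at t)"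
      using 2 by (auto simp: flat_def)
    then show ?thesis
      by (rule has_field_derivative_transform_within_open[of _ _ _ "{..<0}"]) (use 2 in \<open>auto simp: flat_def\<close>)
  next
    case 3
    \<comment> \<open>At the origin \<open>flat k 0\<close> = 0, so the quotient is at most (k+2)!
      |h|. The claimed derivative is also 0 there, since every member of the family vanishes at
      0.\<close>
    have "((\<lambda>h. (flat k h - flat k 0) / h) \<longlongrightarrow> 0) (at 0)"
    proof (rule Lim_null_comparison)
      show "\<forall>\<^sub>F h in at 0. norm ((flat k h - flat k 0) / h) \<le> fact (k + 2) * \<bar>h\<bar>"
      proof (rule eventually_at_filter[THEN iffD2], rule always_eventually, intro allI impI)
        fix h :: real assume "h \<noteq> 0"
        then show "norm ((flat k h - flat k 0) / h) \<le> fact (k + 2) * \<bar>h\<bar>"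
          using flat_le_square[of k h] flat_nonneg[of k h]
          by (simp add: flat_def[of _ 0] divide_le_eq abs_mult[symmetric] power2_eq_square mult.assoc)
      qed
      show "((\<lambda>h. fact (k + 2) * \<bar>h\<bar>) \<longlongrightarrow> (0::real)) (at 0)"
        by (auto intro!: tendsto_eq_intros)
    qed
    then show ?thesis using 3 by (simp add: has_field_derivative_iff flat_def[of _ 0])
  qed
qed

lemma smooth_flat:
  assumes f: "smooth f" shows "smooth (\<lambda>x. complex_of_real (flat k (Re (f x))))"
proof -
  let ?S = "Collect smooth \<union> range (\<lambda>k x. complex_of_real (flat k (Re (f x))))"
  have "(\<lambda>x. complex_of_real (flat k (Re (f x)))) \<in> smooth_class (\<lambda>f. True)"
  proof (rule alg_closure_smooth_class[where S="?S"])
    show "(\<lambda>x. complex_of_real (flat k (Re (f x)))) \<in> alg_closure ?S"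
      by (rule alg_closure.base) auto
    fix g i x assume "g \<in> ?S"
    then consider "smooth g" | k where "g = (\<lambda>x. complex_of_real (flat k (Re (f x))))" by auto
    then have "g differentiable (at x) \<and> partial_deriv i g \<in> alg_closure ?S"
    proof cases
      case 1 then show ?thesis by (auto intro: smooth_differentiable alg_closure.base smooth_partial_deriv)
    next
      case 2
      note d = partial_deriv_real_comp[where h="flat k" and h'="\<lambda>t. - real k * flat (k + 1) t + flat (k + 2) t",
         OF smooth_differentiable[OF f] has_real_derivative_flat]
      have "partial_deriv i g = (\<lambda>x. (complex_of_real (- real k) * complex_of_real (flat (k + 1) (Re (f x))) +
         complex_of_real (flat (k + 2) (Re (f x)))) * complex_of_real (Re (partial_deriv i f x)))"
        unfolding 2 d(2) by (simp only: of_real_mult of_real_add)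
      also have "\<dots> \<in> alg_closure ?S"
      proof (intro alg_closure.mult alg_closure.add alg_closure.const)
        show "(\<lambda>x. complex_of_real (Re (partial_deriv i f x))) \<in> alg_closure ?S"
          by (rule alg_closure.base, rule UnI1, rule CollectI,
             rule smooth_bounded_linear[OF bounded_linear_compose[OF bounded_linear_of_real bounded_linear_Re]])
            (rule smooth_partial_deriv[OF f])
      qed (rule alg_closure.base, blast)+
      finally show ?thesis using d(1) unfolding 2 by simp
    qed
    then show "g differentiable (at x)" "partial_deriv i g \<in> alg_closure ?S" by auto
  qed auto
  then show ?thesis unfolding smooth_iff_smooth_class .
qed

text \<open>The function is positive exactly in the open ball of radius r about c (for r > 0);
  composed with \<open>flat 0\<close> it yields the elementary bump.\<close>

lemma smooth_paraboloid:
  fixes c :: "real^'n::finite"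
  shows "smooth (\<lambda>x. complex_of_real (r\<^sup>2 - (norm (x - c))\<^sup>2))"
proof -
  have "smooth (\<lambda>x. complex_of_real (r\<^sup>2) - (\<Sum>i\<in>UNIV. (complex_of_real (x $ i) - complex_of_real (c $ i)) *
     (complex_of_real (x $ i) - complex_of_real (c $ i))))"
    by (intro smooth_diff smooth_sum smooth_mult smooth_const smooth_coord)
  also have "(\<lambda>x. complex_of_real (r\<^sup>2) - (\<Sum>i\<in>UNIV. (complex_of_real (x $ i) - complex_of_real (c $ i)) *
     (complex_of_real (x $ i) - complex_of_real (c $ i)))) = (\<lambda>x. complex_of_real (r\<^sup>2 - (norm (x - c))\<^sup>2))"
    by (simp add: norm_vec_def L2_set_def sum_nonneg power2_eq_square)
  finally show ?thesis .
qed

text \<open>Finitely many elementary bumps \<open>q c\<close>, positive exactly on balls that cover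
  K and whose closures lie in U, are added up to S. By compactness S has a positive minimum d on K,
  and a smooth transition between the levels 0 and d of S turns it into a function that equals 1 on
  K.\<close>

lemma exists_bump:
  fixes K U :: "(real^'n::finite) set"
  assumes K: "compact K" and U: "open U" and KU: "K \<subseteq> U"
  obtains p :: "real^'n \<Rightarrow> real" where "(\<lambda>x. complex_of_real (p x)) \<in> test_functions"
    "\<And>x. 0 \<le> p x" "\<And>x. p x \<le> 1" "\<And>x. x \<in> K \<Longrightarrow> p x = 1" "\<And>x. p x \<noteq> 0 \<Longrightarrow> x \<in> U"
proof (cases "K = {}")
  case True
  then show ?thesis using that[of "\<lambda>x. 0"] test_zero by auto
next
  case False
  obtain r where r: "\<And>c. c \<in> K \<Longrightarrow> 0 < r c \<and> cball c (r c) \<subseteq> U"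
    using KU U open_contains_cball by (metis subsetD)
  obtain C where C: "C \<subseteq> K" "finite C" "K \<subseteq> (\<Union>c\<in>C. ball c (r c))"
    by (rule compactE_image[OF K, of K "\<lambda>c. ball c (r c)"]) (use r in force)+
  define q where "q = (\<lambda>c x. flat 0 ((r c)\<^sup>2 - (norm (x - c))\<^sup>2))"
  define S where "S = (\<lambda>x. \<Sum>c\<in>C. q c x)"
  have q0: "q c x \<ge> 0" for c x by (simp add: q_def flat_nonneg)
  have q_pos: "q c x > 0 \<longleftrightarrow> x \<in> ball c (r c)" if "c \<in> C" for c x
  proof -
    have "0 < r c" using that C r by auto
    then show ?thesis
      by (auto simp: q_def flat_pos dist_norm norm_minus_commute abs_square_less_1 power2_less_imp_less
          intro: power_strict_mono)
  qed
  have S0: "S x \<ge> 0" for x by (simp add: S_def sum_nonneg q0)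
  have S_pos: "S x > 0 \<longleftrightarrow> (\<exists>c\<in>C. x \<in> ball c (r c))" for x
  proof -
    have "S x > 0 \<longleftrightarrow> S x \<noteq> 0" using S0[of x] by linarith
    also have "\<dots> \<longleftrightarrow> (\<exists>c\<in>C. q c x \<noteq> 0)" unfolding S_def using C(2) q0 by (subst sum_nonneg_eq_0_iff) auto
    also have "\<dots> \<longleftrightarrow> (\<exists>c\<in>C. q c x > 0)" by (metis q0 less_le)
    finally show ?thesis using q_pos by auto
  qed
  have sS: "smooth (\<lambda>x. complex_of_real (S x))"
    unfolding S_def of_real_sum q_def
    by (rule smooth_sum) (use smooth_flat[OF smooth_paraboloid] in simp)
  have contS: "continuous_on K S"
    using smooth_continuous[OF sS, of K] continuous_on_Re by fastforce
  obtain x0 where x0: "x0 \<in> K" "\<And>x. x \<in> K \<Longrightarrow> S x0 \<le> S x"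
    using continuous_attains_inf[OF K False contS] by blast
  define d where "d = S x0"
  have d: "d > 0" unfolding d_def S_pos using x0(1) C(3) by blast
  \<comment> \<open>As a function of S this is 0 where S = 0 and 1 where S \<ge> d. The denominator
    never vanishes because S and d - S cannot both be at most 0.\<close>
  define p where "p = (\<lambda>x. flat 0 (S x) / (flat 0 (S x) + flat 0 (d - S x)))"
  have den: "flat 0 (S x) + flat 0 (d - S x) > 0" for x
  proof (cases "S x > 0")
    case True then show ?thesis using flat_pos[of 0 "S x"] flat_nonneg[of 0 "d - S x"] by linarith
  next
    case False then show ?thesis using d flat_pos[of 0 "d - S x"] flat_nonneg[of 0 "S x"] by linarith
  qed
  have p_pos: "p x \<noteq> 0 \<Longrightarrow> \<exists>c\<in>C. x \<in> ball c (r c)" for x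
    using S_pos[of x] flat_pos[of 0 "S x"] flat_nonneg[of 0 "S x"] unfolding p_def by force
  have sp: "smooth (\<lambda>x. complex_of_real (p x))"
  proof -
    have 1: "smooth (\<lambda>x. complex_of_real (flat 0 (S x)))" using smooth_flat[OF sS] by simp
    have 2: "smooth (\<lambda>x. complex_of_real (flat 0 (d - S x)))"
      using smooth_flat[OF smooth_diff[OF smooth_const[of "complex_of_real d"] sS]] by simp
    have "smooth (\<lambda>x. complex_of_real (flat 0 (S x)) * (1 / (complex_of_real (flat 0 (S x)) + complex_of_real (flat 0 (d - S x)))))"
      using den by (intro smooth_mult[OF 1 smooth_inverse] smooth_add 1 2) (metis of_real_0 of_real_add of_real_eq_iff less_irrefl)
    then show ?thesis by (simp add: p_def)
  qed
  have "(\<lambda>x. complex_of_real (p x)) \<in> test_functions"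
  proof (rule test_functionsI[OF sp, of "\<Union>c\<in>C. cball c (r c)"])
    show "compact (\<Union>c\<in>C. cball c (r c))" using C by (intro compact_UN) auto
    show "x \<in> (\<Union>c\<in>C. cball c (r c))" if "complex_of_real (p x) \<noteq> 0" for x
      using p_pos[of x] that by (auto intro: less_imp_le)
  qed
  moreover have "0 \<le> p x" "p x \<le> 1" for x
    using den[of x] flat_nonneg[of 0 "S x"] flat_nonneg[of 0 "d - S x"] unfolding p_def
    by (auto simp: divide_le_eq_1)
  moreover have "p x = 1" if "x \<in> K" for x
  proof -
    have "flat 0 (d - S x) = 0" using x0(2)[OF that] by (simp add: flat_def d_def)
    then show ?thesis using den[of x] by (simp add: p_def)
  qed
  moreover have "x \<in> U" if "p x \<noteq> 0" for x
  proof -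
    obtain c where "c \<in> C" "x \<in> ball c (r c)" using p_pos[of x] \<open>p x \<noteq> 0\<close> by blast
    then show ?thesis using r[of c] C(1) by (meson ball_subset_cball subsetD)
  qed
  ultimately show ?thesis using that by blast
qed

text \<open>The multipliers are g cnj(h_i) / d, where d is the sum of the |h_i|^2. This sum may
  vanish away from the support of g, so 1 - p is added, with a bump p that is 1 on the support of g:
  then d is positive everywhere, and where g is nonzero the correction is 0. The support of p lies
  where some h_i is nonzero, which covers the points with p = 1.\<close>

lemma test_partition:
  assumes g: "g \<in> test_functions" and I: "finite I" and h: "\<And>i. i \<in> I \<Longrightarrow> smooth (h i)"
    and cover: "\<And>x. x \<in> closure {x. g x \<noteq> 0} \<Longrightarrow> \<exists>i\<in>I. h i x \<noteq> 0"
  obtains \<theta> where "\<And>i. i \<in> I \<Longrightarrow> \<theta> i \<in> test_functions" "\<And>x. g x = (\<Sum>i\<in>I. \<theta> i x * h i x)"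
proof -
  define U where "U = (\<Union>i\<in>I. h i -` (- {0}))"
  have 1: "open U" unfolding U_def
    by (intro open_UN ballI open_vimage smooth_continuous[OF h]) auto
  have 2: "closure {x. g x \<noteq> 0} \<subseteq> U" using cover by (auto simp: U_def)
  have 3: "compact (closure {x. g x \<noteq> 0})" using g by (simp add: test_functions_def)
  obtain p :: "real^'a \<Rightarrow> real" where p: "(\<lambda>x. complex_of_real (p x)) \<in> test_functions"
    "\<And>x. 0 \<le> p x" "\<And>x. p x \<le> 1" "\<And>x. x \<in> closure {x. g x \<noteq> 0} \<Longrightarrow> p x = 1" "\<And>x. p x \<noteq> 0 \<Longrightarrow> x \<in> U"
    by (rule exists_bump[OF 3 1 2], blast)
  define d where "d = (\<lambda>x. (\<Sum>i\<in>I. (cmod (h i x))\<^sup>2) + (1 - p x))"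
  have dpos: "d x > 0" for x
  proof (cases "p x = 1")
    case True
    then obtain i where "i \<in> I" "h i x \<noteq> 0" using p(5)[of x] by (auto simp: U_def)
    then have "(\<Sum>i\<in>I. (cmod (h i x))\<^sup>2) > 0" using I by (intro sum_pos2[of I i]) auto
    with True show ?thesis by (simp add: d_def)
  next
    case False
    then have "1 - p x > 0" using p(3)[of x] by simp
    then show ?thesis unfolding d_def by (intro add_nonneg_pos sum_nonneg) auto
  qed
  have "smooth (\<lambda>x. (\<Sum>i\<in>I. h i x * cnj (h i x)) + (1 - complex_of_real (p x)))"
    by (intro smooth_add smooth_sum smooth_mult smooth_diff smooth_const
        smooth_bounded_linear[OF bounded_linear_cnj] h test_smooth p)
  then have sd: "smooth (\<lambda>x. complex_of_real (d x))"
    by (simp add: d_def complex_norm_square del: of_real_power)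
  define \<theta> where "\<theta> = (\<lambda>i x. g x * (cnj (h i x) * (1 / complex_of_real (d x))))"
  have "\<theta> i \<in> test_functions" if "i \<in> I" for i unfolding \<theta>_def
    by (intro test_mult[OF g] smooth_mult smooth_inverse sd
        smooth_bounded_linear[OF bounded_linear_cnj] h that) (metis dpos less_irrefl of_real_eq_0_iff)
  moreover have "g x = (\<Sum>i\<in>I. \<theta> i x * h i x)" for x
  proof (cases "g x = 0")
    case False
    then have "x \<in> closure {x. g x \<noteq> 0}" using closure_subset[of "{x. g x \<noteq> 0}"] by auto
    then have "d x = (\<Sum>i\<in>I. (cmod (h i x))\<^sup>2)" using p(4) by (simp add: d_def)
    then have "(\<Sum>i\<in>I. cnj (h i x) * h i x) = complex_of_real (d x)"
      by (simp add: mult.commute complex_norm_square del: of_real_power)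
    moreover have "(\<Sum>i\<in>I. \<theta> i x * h i x) = g x * (1 / complex_of_real (d x)) * (\<Sum>i\<in>I. cnj (h i x) * h i x)"
      unfolding sum_distrib_left by (rule sum.cong) (auto simp: \<theta>_def)
    ultimately show ?thesis using dpos[of x] by simp
  qed (simp add: \<theta>_def)
  ultimately show ?thesis using that by blast
qed

section \<open>Lebesgue measure as a product measure\<close>

lemma product_sigma_finite_lborel: "product_sigma_finite (\<lambda>_. lborel :: real measure)"
  by standard

interpretation lborel_PiM: product_sigma_finite "\<lambda>_. lborel :: real measure"
  by (rule product_sigma_finite_lborel)

lemma measurable_vec_lambda:
  "(\<lambda>f. vec_lambda f :: real^'n::finite) \<in> measurable (Pi\<^sub>M UNIV (\<lambda>_. lborel)) borel"
proof (subst borel_measurable_euclidean_space, intro ballI)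
  fix b :: "real^'n" assume "b \<in> Basis"
  then obtain i where "b = axis i 1" by (auto simp: Basis_vec_def)
  then show "(\<lambda>f. vec_lambda f \<bullet> b) \<in> borel_measurable (Pi\<^sub>M UNIV (\<lambda>_. lborel))"
    by (simp add: inner_axis)
qed

lemma borel_measurable_vec_nth [measurable (raw)]:
  "f \<in> borel_measurable M \<Longrightarrow> (\<lambda>x. (f x :: real^'n::finite) $ i) \<in> borel_measurable M"
  by (rule measurable_compose[of f M borel]) (auto intro!: borel_measurable_continuous_onI continuous_intros)

lemma prod_Basis_vec: "(\<Prod>b\<in>(Basis::(real^'n::finite) set). f b) = (\<Prod>i\<in>UNIV. f (axis i 1))"
proof -
  have "inj (\<lambda>i::'n. axis i (1::real))" by (auto simp: inj_on_def axis_eq_axis)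
  moreover have "(Basis::(real^'n) set) = range (\<lambda>i. axis i 1)" by (auto simp: Basis_vec_def)
  ultimately show ?thesis by (metis prod.reindex_cong)
qed

text \<open>The two measures agree on boxes. This gives access to the product measure theorems,
  whose functions live on an index set, for integration one coordinate at a time.\<close>

lemma lborel_eq_distr_PiM:
  "(lborel :: (real^'n::finite) measure) = distr (Pi\<^sub>M UNIV (\<lambda>_. lborel)) borel vec_lambda"
proof (rule lborel_eqI)
  fix l u :: "real^'n" assume le: "\<And>b. b \<in> Basis \<Longrightarrow> l \<bullet> b \<le> u \<bullet> b"
  have le': "l $ i \<le> u $ i" for i using le[of "axis i 1"] by (simp add: inner_axis axis_in_Basis_iff)
  have "vec_lambda -` box l u \<inter> space (Pi\<^sub>M UNIV (\<lambda>_::'n. lborel)) = (\<Pi>\<^sub>E i\<in>UNIV. {l $ i <..< u $ i})"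
    by (auto simp: mem_box_cart space_PiM PiE_def extensional_def Pi_def)
  then have "emeasure (distr (Pi\<^sub>M UNIV (\<lambda>_. lborel)) borel vec_lambda) (box l u) =
     emeasure (Pi\<^sub>M UNIV (\<lambda>_. lborel)) (\<Pi>\<^sub>E i\<in>UNIV. {l $ i <..< u $ i})"
    by (subst emeasure_distr[OF measurable_vec_lambda]) auto
  also have "\<dots> = (\<Prod>i\<in>UNIV. emeasure lborel {l $ i <..< u $ i})"
    by (rule lborel_PiM.emeasure_PiM) auto
  also have "\<dots> = ennreal (\<Prod>b\<in>Basis. (u - l) \<bullet> b)"
    using le' by (simp add: prod_Basis_vec inner_axis inner_diff_left prod_ennreal)
  finally show "emeasure (distr (Pi\<^sub>M UNIV (\<lambda>_. lborel)) borel vec_lambda) (box l u) = ennreal (\<Prod>b\<in>Basis. (u - l) \<bullet> b)" .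
qed simp

lemma nn_integral_lborel_PiM:
  fixes f :: "real^'n::finite \<Rightarrow> ennreal"
  assumes "f \<in> borel_measurable borel"
  shows "(\<integral>\<^sup>+x. f x \<partial>lborel) = (\<integral>\<^sup>+x. f (vec_lambda x) \<partial>Pi\<^sub>M UNIV (\<lambda>_. lborel))"
  by (subst lborel_eq_distr_PiM) (rule nn_integral_distr[OF measurable_vec_lambda], simp add: assms)

lemma nn_integral_lborel_vec_prod:
  fixes f :: "'n::finite \<Rightarrow> real \<Rightarrow> ennreal"
  assumes [measurable]: "\<And>i. f i \<in> borel_measurable borel"
  shows "(\<integral>\<^sup>+x. (\<Prod>i\<in>UNIV. f i (x $ i)) \<partial>(lborel :: (real^'n) measure)) = (\<Prod>i\<in>UNIV. \<integral>\<^sup>+t. f i t \<partial>lborel)"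
  by (subst nn_integral_lborel_PiM) (auto intro!: lborel_PiM.product_nn_integral_prod)

lemma integral_lborel_vec_prod:
  fixes f :: "'n::finite \<Rightarrow> real \<Rightarrow> complex"
  assumes f: "\<And>i. integrable lborel (f i)"
  shows "integrable (lborel :: (real^'n) measure) (\<lambda>x. \<Prod>i\<in>UNIV. f i (x $ i))"
    "(LINT x|(lborel :: (real^'n) measure). (\<Prod>i\<in>UNIV. f i (x $ i))) = (\<Prod>i\<in>UNIV. LINT t|lborel. f i t)"
proof -
  have [measurable]: "f i \<in> borel_measurable borel" for i using borel_measurable_integrable[OF f] by simp
  have m: "(\<lambda>x::real^'n. \<Prod>i\<in>UNIV. f i (x $ i)) \<in> borel_measurable borel" by measurable
  show "integrable (lborel :: (real^'n) measure) (\<lambda>x. \<Prod>i\<in>UNIV. f i (x $ i))"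
    using lborel_PiM.product_integrable_prod[OF finite f]
    by (subst lborel_eq_distr_PiM, subst integrable_distr_eq[OF measurable_vec_lambda m]) simp
  show "(LINT x|(lborel :: (real^'n) measure). (\<Prod>i\<in>UNIV. f i (x $ i))) = (\<Prod>i\<in>UNIV. LINT t|lborel. f i t)"
    using lborel_PiM.product_integral_prod[OF finite f]
    by (subst lborel_eq_distr_PiM, subst integral_distr[OF measurable_vec_lambda m]) simp
qed

section \<open>Integrability of powers\<close>

lemma nn_integral_weight_finite:
  assumes c: "c > 1/2"
  shows "(\<integral>\<^sup>+t. ennreal ((1 + t\<^sup>2) powr (- c)) \<partial>lborel) < \<infinity>"
proof -
  let ?w = "\<lambda>t::real. (1 + t\<^sup>2) powr (- c)"
  \<comment> \<open>A primitive of \<open>2 powr c * (1 + t) powr (- (2 * c))\<close>, which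
    dominates the weight on the half line because (1 + t)^2 \<le> 2 (1 + t^2). It tends to 0 at
    infinity precisely since c > 1/2.\<close>
  let ?F = "\<lambda>t::real. 2 powr c * ((1 + t) powr (1 - 2 * c) / (1 - 2 * c))"
  have half: "(\<integral>\<^sup>+t. ennreal (?w t) * indicator {0..} t \<partial>lborel) < \<infinity>"
  proof -
    have "(\<integral>\<^sup>+t. ennreal (?w t) * indicator {0..} t \<partial>lborel)
        \<le> (\<integral>\<^sup>+t. ennreal (2 powr c * (1 + t) powr (- (2 * c))) * indicator {0..} t \<partial>lborel)"
    proof (rule nn_integral_mono)
      fix t :: real
      show "ennreal (?w t) * indicator {0..} t \<le> ennreal (2 powr c * (1 + t) powr (- (2 * c))) * indicator {0..} t"
      proof (cases "t \<ge> 0")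
        case True
        have "(1 + t)\<^sup>2 \<le> 2 * (1 + t\<^sup>2)" using sum_squares_bound[of 1 t] by (simp add: power2_sum)
        then have "((1 + t)\<^sup>2 / 2) powr c \<le> (1 + t\<^sup>2) powr c"
          using c by (intro powr_mono2) auto
        moreover have "((1 + t)\<^sup>2) powr c = (1 + t) powr (2 * c)"
          using True powr_powr[of "1 + t" 2 c] by simp
        moreover have "(1 + t) powr (2 * c) > 0" "(1 + t\<^sup>2) powr c > 0" using True
          by (auto simp: add_nonneg_eq_0_iff)
        ultimately have "?w t \<le> 2 powr c * (1 + t) powr (- (2 * c))"
          by (simp add: powr_minus powr_divide divide_simps mult_ac)
        then show ?thesis using True by (simp add: ennreal_leI)
      qed auto
    qed
    also have "\<dots> = ennreal (0 - ?F 0)"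
    proof (rule nn_integral_FTC_atLeast)
      show "DERIV ?F t :> 2 powr c * (1 + t) powr (- (2 * c))" if "0 \<le> t" for t
      proof -
        have "((\<lambda>t. (1 + t) powr (1 - 2 * c)) has_real_derivative (1 - 2 * c) * (1 + t) powr (- (2 * c))) (at t)"
          using that by (auto intro!: derivative_eq_intros)
        from DERIV_cmult[OF DERIV_cdivide[OF this, of "1 - 2 * c"], of "2 powr c"] c show ?thesis by simp
      qed
      have "((\<lambda>t. (1 + t) powr (1 - 2 * c)) \<longlongrightarrow> 0) at_top"
        by (rule tendsto_neg_powr) (use c in \<open>auto intro: filterlim_tendsto_add_at_top filterlim_ident\<close>)
      from tendsto_mult[OF tendsto_const[of "2 powr c"] tendsto_divide[OF this tendsto_const[of "1 - 2 * c"]]] c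
      show "(?F \<longlongrightarrow> 0) at_top" by simp
    qed auto
    finally show ?thesis by (rule le_less_trans) simp
  qed
  have "(\<integral>\<^sup>+t. ennreal (?w t) \<partial>lborel) \<le> (\<integral>\<^sup>+t. ennreal (?w t) * indicator {0..} t + ennreal (?w t) * indicator {..0} t \<partial>lborel)"
    by (intro nn_integral_mono) (auto simp: indicator_def)
  also have "\<dots> = (\<integral>\<^sup>+t. ennreal (?w t) * indicator {0..} t \<partial>lborel) + (\<integral>\<^sup>+t. ennreal (?w t) * indicator {..0} t \<partial>lborel)"
    by (rule nn_integral_add) auto
  also have "(\<integral>\<^sup>+t. ennreal (?w t) * indicator {..0} t \<partial>lborel) = (\<integral>\<^sup>+t. ennreal (?w t) * indicator {0..} t \<partial>lborel)"
    by (subst nn_integral_real_affine[where c="-1" and t=0]) (auto simp: indicator_def cong: if_cong)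
  also have "(\<integral>\<^sup>+t. ennreal (?w t) * indicator {0..} t \<partial>lborel) + (\<integral>\<^sup>+t. ennreal (?w t) * indicator {0..} t \<partial>lborel) < \<infinity>"
    using half by (simp add: less_top)
  finally show ?thesis .
qed

text \<open>Each coordinate satisfies 1 + x_i^2 \<le> (1 + |x|)^2, so one factor (1 + |x|)^2 per
  coordinate dominates a product of integrable functions of single coordinates. This is the origin
  of the exponent \<open>2 * CARD('n)\<close>.\<close>

lemma integrable_inverse_power:
  assumes "k \<ge> 2 * CARD('n::finite)"
  shows "integrable (lborel :: (real^'n) measure) (\<lambda>x. 1 / (1 + norm x) ^ k)"
proof (rule integrableI_bounded)
  have "(\<integral>\<^sup>+x. ennreal (norm (1 / (1 + norm x) ^ k)) \<partial>(lborel :: (real^'n) measure)) \<le>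
    (\<integral>\<^sup>+x. (\<Prod>i\<in>UNIV. ennreal ((1 + (x $ i)\<^sup>2) powr (- 1))) \<partial>(lborel :: (real^'n) measure))"
  proof (rule nn_integral_mono)
    fix x :: "real^'n"
    have "(\<Prod>i\<in>(UNIV::'n set). 1 + (x $ i)\<^sup>2) \<le> (\<Prod>i\<in>(UNIV::'n set). (1 + norm x)\<^sup>2)"
    proof (rule prod_mono)
      fix i :: 'n
      have "(x $ i)\<^sup>2 \<le> (norm x)\<^sup>2" using component_le_norm_cart[of x i] by (simp add: abs_le_square_iff[symmetric])
      then show "0 \<le> 1 + (x $ i)\<^sup>2 \<and> 1 + (x $ i)\<^sup>2 \<le> (1 + norm x)\<^sup>2"
        by (simp add: power2_sum add_increasing2)
    qed
    also have "\<dots> = (1 + norm x) ^ (2 * CARD('n))" by (simp add: power_mult)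
    also have "\<dots> \<le> (1 + norm x) ^ k" by (rule power_increasing) (use assms in auto)
    finally have "1 / (1 + norm x) ^ k \<le> 1 / (\<Prod>i\<in>(UNIV::'n set). 1 + (x $ i)\<^sup>2)"
      by (intro divide_left_mono mult_pos_pos prod_pos) (auto simp: add_pos_nonneg)
    also have "\<dots> = (\<Prod>i\<in>(UNIV::'n set). (1 + (x $ i)\<^sup>2) powr (- 1))"
      by (simp add: powr_minus prod_inversef[symmetric] divide_inverse add_pos_nonneg powr_one o_def)
    finally have "1 / (1 + norm x) ^ k \<le> (\<Prod>i\<in>(UNIV::'n set). (1 + (x $ i)\<^sup>2) powr (- 1))" .
    from ennreal_leI[OF this] show "ennreal (norm (1 / (1 + norm x) ^ k)) \<le> (\<Prod>i\<in>UNIV. ennreal ((1 + (x $ i)\<^sup>2) powr (- 1)))"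
      by (subst prod_ennreal) auto
  qed
  also have "\<dots> = (\<Prod>i\<in>(UNIV::'n set). \<integral>\<^sup>+t. ennreal ((1 + t\<^sup>2) powr (- 1)) \<partial>lborel)"
    by (rule nn_integral_lborel_vec_prod) simp
  also have "\<dots> < \<infinity>"
    using nn_integral_weight_finite[of 1] by (simp add: less_top[symmetric] ennreal_prod_eq_top power_eq_top_ennreal)
  finally show "(\<integral>\<^sup>+x. ennreal (norm (1 / (1 + norm x) ^ k)) \<partial>(lborel :: (real^'n) measure)) < \<infinity>" .
qed simp

lemma schwartz_measurable: "f \<in> schwartz_functions \<Longrightarrow> f \<in> borel_measurable borel"
  by (intro borel_measurable_continuous_onI smooth_continuous schwartz_smooth)

lemma schwartz_integrable_norm_power:
  assumes f: "f \<in> schwartz_functions" and m: "m \<in> borel_measurable borel"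
    and le: "\<And>x. norm (m x) \<le> C * (1 + norm x) ^ k"
  shows "integrable lborel (\<lambda>x. m x * f x :: complex)"
proof -
  obtain D where D: "D \<ge> 0" "\<And>x. norm (f x) \<le> D / (1 + norm x) ^ (k + 2 * CARD('a))"
    using rapid_bound[OF schwartz_rapid[OF f]] by metis
  show ?thesis
  proof (rule Bochner_Integration.integrable_bound)
    show "integrable lborel (\<lambda>x::real^'a. (C * D) * (1 / (1 + norm x) ^ (2 * CARD('a))))"
      by (intro integrable_mult_right integrable_inverse_power) simp
    show "(\<lambda>x. m x * f x) \<in> borel_measurable lborel"
      using m schwartz_measurable[OF f] by simp
    show "AE x in lborel. norm (m x * f x) \<le> norm ((C * D) * (1 / (1 + norm x) ^ (2 * CARD('a))))"
    proof (rule AE_I2)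
      fix x :: "real^'a"
      have p: "(1 + norm x) ^ k > 0" by (simp add: add_pos_nonneg)
      have "norm (m x * f x) \<le> (C * (1 + norm x) ^ k) * (D / (1 + norm x) ^ (k + 2 * CARD('a)))"
        unfolding norm_mult by (intro mult_mono le D order_trans[OF norm_ge_zero le]) auto
      also have "\<dots> = (C * D) * (1 / (1 + norm x) ^ (2 * CARD('a)))"
        using p by (simp add: power_add)
      finally show "norm (m x * f x) \<le> norm ((C * D) * (1 / (1 + norm x) ^ (2 * CARD('a))))"
        by (rule order_trans) (simp only: real_norm_def abs_ge_self)
    qed
  qed
qed

lemma schwartz_integrable: "f \<in> schwartz_functions \<Longrightarrow> integrable lborel f"
  using schwartz_integrable_norm_power[of f "\<lambda>x. 1" 1 0] by simp

lemma integrable_bounded_mult: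
  fixes f g :: "'a \<Rightarrow> complex"
  assumes "integrable M f" "g \<in> borel_measurable M" "\<And>x. norm (g x) \<le> C"
  shows "integrable M (\<lambda>x. g x * f x)"
proof (rule Bochner_Integration.integrable_bound[OF integrable_mult_right[OF integrable_norm[OF assms(1)], of C]])
  show "AE x in M. norm (g x * f x) \<le> norm (C * norm (f x))"
  proof (rule AE_I2)
    fix x
    have "norm (g x * f x) \<le> C * norm (f x)" unfolding norm_mult by (intro mult_right_mono assms(3)) auto
    also have "\<dots> \<le> norm (C * norm (f x))" by (simp only: real_norm_def abs_ge_self)
    finally show "norm (g x * f x) \<le> norm (C * norm (f x))" .
  qed
qed (use assms in auto)

section \<open>Affine changes of variables\<close>

lemma nn_integral_lborel_affine:
  fixes f :: "'a::euclidean_space \<Rightarrow> ennreal"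
  assumes [measurable]: "f \<in> borel_measurable borel" and c: "c \<noteq> 0"
  shows "(\<integral>\<^sup>+x. f x \<partial>lborel) = ennreal (\<bar>c\<bar> ^ DIM('a)) * (\<integral>\<^sup>+x. f (t + c *\<^sub>R x) \<partial>lborel)"
  by (subst lborel_affine[OF c, of t]) (simp add: nn_integral_density nn_integral_distr nn_integral_cmult)

lemma lborel_integral_affine:
  fixes f :: "'a::euclidean_space \<Rightarrow> complex"
  assumes [measurable]: "f \<in> borel_measurable borel" and c: "c \<noteq> 0"
  shows "(LINT x|lborel. f x) = complex_of_real (\<bar>c\<bar> ^ DIM('a)) * (LINT x|lborel. f (t + c *\<^sub>R x))"
  by (subst lborel_affine[OF c, of t]) (simp add: integral_density integral_distr scaleR_conv_of_real)

lemma lborel_integral_translate: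
  fixes f :: "'a::euclidean_space \<Rightarrow> complex"
  assumes "f \<in> borel_measurable borel"
  shows "(LINT x|lborel. f (t + x)) = (LINT x|lborel. f x)"
  using lborel_integral_affine[OF assms, of 1 t] by simp

lemma lborel_integral_uminus:
  fixes f :: "'a::euclidean_space \<Rightarrow> complex"
  assumes "f \<in> borel_measurable borel"
  shows "(LINT x|lborel. f (- x)) = (LINT x|lborel. f x)"
  using lborel_integral_affine[OF assms, of "-1" 0] by simp

lemma lborel_integrable_affine:
  fixes f :: "'a::euclidean_space \<Rightarrow> complex"
  assumes f: "integrable lborel f" and c: "c \<noteq> 0"
  shows "integrable lborel (\<lambda>x. f (t + c *\<^sub>R x))"
proof (rule integrableI_bounded)
  have [measurable]: "f \<in> borel_measurable borel" using f by (auto dest: borel_measurable_integrable)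
  show "(\<lambda>x. f (t + c *\<^sub>R x)) \<in> borel_measurable lborel" by simp
  have "ennreal (\<bar>c\<bar> ^ DIM('a)) * (\<integral>\<^sup>+x. ennreal (norm (f (t + c *\<^sub>R x))) \<partial>lborel) < \<infinity>"
    using f c by (subst nn_integral_lborel_affine[symmetric]) (auto simp: integrable_iff_bounded)
  then show "(\<integral>\<^sup>+x. ennreal (norm (f (t + c *\<^sub>R x))) \<partial>lborel) < \<infinity>"
    using c by (auto simp: ennreal_mult_less_top)
qed

section \<open>The Fourier transform of Schwartz functions\<close>

text \<open>The function exp(-|x|^2 / 2), written as a product so that its Fourier transform factors
  into one-dimensional transforms.\<close>

definition gauss :: "real^'n::finite \<Rightarrow> real" where
  "gauss x = (\<Prod>i\<in>UNIV. exp (- (x $ i)\<^sup>2 / 2))"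

text \<open>Up to the factor sqrt(2 pi) the integral is the characteristic function of the standard
  normal distribution at -a.\<close>

lemma gauss_1:
  "integrable lborel (\<lambda>t. cis (- (a * t)) * complex_of_real (exp (- t\<^sup>2 / 2)))"
  "(LINT t|lborel. cis (- (a * t)) * complex_of_real (exp (- t\<^sup>2 / 2))) = complex_of_real (sqrt (2 * pi) * exp (- a\<^sup>2 / 2))"
proof -
  have eq: "cis (- (a * t)) * complex_of_real (exp (- t\<^sup>2 / 2)) = complex_of_real (sqrt (2 * pi)) * (std_normal_density t *\<^sub>R cis (- (a * t)))" for t
    by (simp add: normal_density_def scaleR_conv_of_real)
  have i: "integrable lborel (\<lambda>t. std_normal_density t *\<^sub>R cis (- (a * t)))"
    by (rule Bochner_Integration.integrable_bound[OF integrable_std_normal_moment_abs[of 0]])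
       (auto simp: cis_conv_exp intro!: borel_measurable_continuous_onI continuous_intros)
  then show "integrable lborel (\<lambda>t. cis (- (a * t)) * complex_of_real (exp (- t\<^sup>2 / 2)))"
    unfolding eq by (rule integrable_mult_right)
  have "(LINT t|lborel. std_normal_density t *\<^sub>R cis (- (a * t))) = char std_normal_distribution (- a)"
    unfolding char_def by (subst integral_density) (auto simp: cis_conv_exp normal_density_nonneg intro!: borel_measurable_continuous_onI continuous_intros)
  then show "(LINT t|lborel. cis (- (a * t)) * complex_of_real (exp (- t\<^sup>2 / 2))) = complex_of_real (sqrt (2 * pi) * exp (- a\<^sup>2 / 2))"
    unfolding eq integral_mult_right_zero by (simp add: char_std_normal_distribution)
qed

lemma cis_inner: "cis (- (z \<bullet> x)) = (\<Prod>i\<in>UNIV. cis (- (z $ i * x $ i)))"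
  by (simp add: inner_vec_def cis_conv_exp sum_negf[symmetric] sum_distrib_left exp_sum[symmetric] of_real_sum del: of_real_mult)

lemma gauss_fourier:
  fixes z :: "real^'n::finite"
  shows "integrable lborel (\<lambda>x. cis (- (z \<bullet> x)) * complex_of_real (gauss x))"
    "(LINT x|lborel. cis (- (z \<bullet> x)) * complex_of_real (gauss x)) = complex_of_real (sqrt (2 * pi) ^ CARD('n) * gauss z)"
proof -
  have eq: "cis (- (z \<bullet> x)) * complex_of_real (gauss x) = (\<Prod>i\<in>UNIV. cis (- (z $ i * x $ i)) * complex_of_real (exp (- (x $ i)\<^sup>2 / 2)))" for x
    by (simp add: cis_inner gauss_def prod.distrib)
  show "integrable lborel (\<lambda>x. cis (- (z \<bullet> x)) * complex_of_real (gauss x))"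
    unfolding eq by (rule integral_lborel_vec_prod) (rule gauss_1)
  show "(LINT x|lborel. cis (- (z \<bullet> x)) * complex_of_real (gauss x)) = complex_of_real (sqrt (2 * pi) ^ CARD('n) * gauss z)"
    unfolding eq by (subst integral_lborel_vec_prod(2)[OF gauss_1(1)])
      (simp only: gauss_1(2), simp add: gauss_def prod.distrib)
qed

lemma borel_measurable_cis [measurable (raw)]:
  "f \<in> borel_measurable M \<Longrightarrow> (\<lambda>x. cis (f x)) \<in> borel_measurable M"
  by (rule measurable_compose[of f M borel]) (auto simp: cis_conv_exp intro!: borel_measurable_continuous_onI continuous_intros)

text \<open>Supplies the integrability that Fubini's theorem asks for in the inversion theorem, the
  multiplication formula and the formula for the transform of a product.\<close>

lemma integrable_pair_bound:
  fixes h :: "'a::euclidean_space \<times> 'b::euclidean_space \<Rightarrow> complex"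
  assumes f: "integrable lborel (f :: 'a \<Rightarrow> complex)" and g: "integrable lborel (g :: 'b \<Rightarrow> complex)"
    and h: "h \<in> borel_measurable (lborel \<Otimes>\<^sub>M lborel)"
    and le: "\<And>x y. norm (h (x, y)) \<le> norm (f x) * norm (g y)"
  shows "integrable (lborel \<Otimes>\<^sub>M lborel) h"
proof (rule integrableI_bounded[OF h])
  have [measurable]: "f \<in> borel_measurable borel" "g \<in> borel_measurable borel" "h \<in> borel_measurable (lborel \<Otimes>\<^sub>M lborel)"
    using f g h by (auto dest: borel_measurable_integrable)
  have "(\<integral>\<^sup>+z. ennreal (norm (h z)) \<partial>(lborel \<Otimes>\<^sub>M lborel)) = (\<integral>\<^sup>+x. \<integral>\<^sup>+y. ennreal (norm (h (x, y))) \<partial>lborel \<partial>lborel)"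
    by (rule lborel.nn_integral_fst[symmetric]) measurable
  also have "\<dots> \<le> (\<integral>\<^sup>+x. \<integral>\<^sup>+y. ennreal (norm (f x)) * ennreal (norm (g y)) \<partial>lborel \<partial>lborel)"
    by (intro nn_integral_mono) (simp add: ennreal_mult[symmetric] le ennreal_leI)
  also have "\<dots> = (\<integral>\<^sup>+x. ennreal (norm (f x)) \<partial>lborel) * (\<integral>\<^sup>+y. ennreal (norm (g y)) \<partial>lborel)"
    by (simp add: nn_integral_cmult nn_integral_multc)
  also have "\<dots> < \<infinity>"
    using f g by (auto simp: integrable_iff_bounded ennreal_mult_less_top)
  finally show "(\<integral>\<^sup>+z. ennreal (norm (h z)) \<partial>(lborel \<Otimes>\<^sub>M lborel)) < \<infinity>" .
qed

lemma schwartz_integrable_coord: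
  "f \<in> schwartz_functions \<Longrightarrow> (\<lambda>x. (- \<i> * complex_of_real (x $ i)) * f x) \<in> schwartz_functions"
  by (rule schwartz_slow_mult[OF slow_mult[OF slow_const slow_coord]])

lemma integrable_cis_mult:
  "integrable lborel f \<Longrightarrow> g \<in> borel_measurable borel \<Longrightarrow> integrable lborel (\<lambda>x. cis (g x) * f x)"
  by (rule integrable_bounded_mult[where C=1]) auto

lemma fourier_linear:
  assumes "f \<in> schwartz_functions" "g \<in> schwartz_functions"
  shows "fourier (\<lambda>x. a * f x + c * g x) = (\<lambda>\<xi>. a * fourier f \<xi> + c * fourier g \<xi>)"
proof
  fix \<xi>
  have "fourier (\<lambda>x. a * f x + c * g x) \<xi> = (LINT x|lborel. a * (cis (- (x \<bullet> \<xi>)) * f x) + c * (cis (- (x \<bullet> \<xi>)) * g x))"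
    by (simp add: fourier_def algebra_simps)
  also have "\<dots> = a * fourier f \<xi> + c * fourier g \<xi>"
    using assms by (subst Bochner_Integration.integral_add)
      (auto simp: fourier_def intro!: integrable_mult_right integrable_cis_mult intro: schwartz_integrable)
  finally show "fourier (\<lambda>x. a * f x + c * g x) \<xi> = a * fourier f \<xi> + c * fourier g \<xi>" .
qed

section \<open>Differentiation and decay of the Fourier transform\<close>

lemma cis_remainder: "norm (cis t - 1 - \<i> * complex_of_real t) \<le> t\<^sup>2"
proof -
  have "norm (iexp t - (\<Sum>k\<le>1. (\<i> * complex_of_real t) ^ k / fact k)) \<le> \<bar>t\<bar> ^ Suc 1 / fact (Suc 1)"
    by (rule iexp_approx1)
  then have "norm (cis t - 1 - \<i> * complex_of_real t) \<le> t\<^sup>2 / 2"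
    by (simp add: cis_conv_exp algebra_simps power2_eq_square)
  then show ?thesis by (rule order_trans) simp
qed

text \<open>Differentiation under the integral with an explicit error: the remainder of
  \<open>cis\<close> is quadratic in x \<bullet> h, so the error is at most |h|^2 times the second
  absolute moment B of f, which is finite for a Schwartz function.\<close>

lemma fourier_has_derivative:
  fixes f :: "real^'n::finite \<Rightarrow> complex"
  assumes f: "f \<in> schwartz_functions"
  shows "(fourier f has_derivative
    (\<lambda>h. \<Sum>i\<in>UNIV. complex_of_real (h $ i) * fourier (\<lambda>x. (- \<i> * complex_of_real (x $ i)) * f x) \<xi>)) (at \<xi>)"
    (is "(_ has_derivative ?D) _")
proof -
  define B where "B = (LINT x|lborel. (norm x)\<^sup>2 * norm (f x))"
  have iB: "integrable lborel (\<lambda>x. (norm x)\<^sup>2 * norm (f x))"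
  proof -
    have "integrable lborel (\<lambda>x. complex_of_real ((norm x)\<^sup>2) * f x)"
      by (rule schwartz_integrable_norm_power[OF f, of _ 1 2])
        (auto intro!: power_mono borel_measurable_continuous_onI continuous_intros simp: norm_power)
    from integrable_norm[OF this] show ?thesis by (simp add: norm_mult norm_power)
  qed
  have bound: "norm (fourier f (\<xi> + h) - fourier f \<xi> - ?D h) \<le> (norm h)\<^sup>2 * B" for h
  proof -
    have "fourier f (\<xi> + h) - fourier f \<xi> - ?D h =
      (LINT x|lborel. (cis (- (x \<bullet> (\<xi> + h))) * f x - cis (- (x \<bullet> \<xi>)) * f x -
        (\<Sum>i\<in>UNIV. complex_of_real (h $ i) * (cis (- (x \<bullet> \<xi>)) * ((- \<i> * complex_of_real (x $ i)) * f x)))))"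
      unfolding fourier_def
      using f schwartz_integrable_coord[OF f]
      by (subst Bochner_Integration.integral_diff Bochner_Integration.integral_sum integral_mult_right_zero |
          intro Bochner_Integration.integrable_diff Bochner_Integration.integrable_sum integrable_mult_right
            integrable_cis_mult schwartz_integrable | simp)+
    also have "norm \<dots> \<le> (LINT x|lborel. (norm h)\<^sup>2 * ((norm x)\<^sup>2 * norm (f x)))"
    proof (rule Bochner_Integration.integral_norm_bound_integral)
      show "integrable lborel (\<lambda>x. cis (- (x \<bullet> (\<xi> + h))) * f x - cis (- (x \<bullet> \<xi>)) * f x -
        (\<Sum>i\<in>UNIV. complex_of_real (h $ i) * (cis (- (x \<bullet> \<xi>)) * ((- \<i> * complex_of_real (x $ i)) * f x))))"
        by (intro Bochner_Integration.integrable_diff Bochner_Integration.integrable_sum integrable_mult_right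
            integrable_cis_mult schwartz_integrable schwartz_integrable_coord f) auto
      show "integrable lborel (\<lambda>x. (norm h)\<^sup>2 * ((norm x)\<^sup>2 * norm (f x)))"
        by (rule integrable_mult_right[OF iB])
      fix x :: "real^'n"
      have "(\<Sum>i\<in>UNIV. complex_of_real (h $ i) * (cis (- (x \<bullet> \<xi>)) * ((- \<i> * complex_of_real (x $ i)) * f x)))
        = cis (- (x \<bullet> \<xi>)) * (\<i> * complex_of_real (- (x \<bullet> h))) * f x"
        by (simp add: inner_vec_def sum_distrib_left sum_distrib_right mult_ac sum_negf)
      then have eq: "cis (- (x \<bullet> (\<xi> + h))) * f x - cis (- (x \<bullet> \<xi>)) * f x -
        (\<Sum>i\<in>UNIV. complex_of_real (h $ i) * (cis (- (x \<bullet> \<xi>)) * ((- \<i> * complex_of_real (x $ i)) * f x)))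
        = cis (- (x \<bullet> \<xi>)) * (cis (- (x \<bullet> h)) - 1 - \<i> * complex_of_real (- (x \<bullet> h))) * f x"
        using cis_mult[of "- (x \<bullet> \<xi>)" "- (x \<bullet> h)"] by (simp add: inner_add_right algebra_simps)
      have "norm \<dots> \<le> (- (x \<bullet> h))\<^sup>2 * norm (f x)"
        unfolding norm_mult norm_cis mult_1 by (intro mult_right_mono cis_remainder) simp
      also have "\<dots> \<le> (norm x * norm h)\<^sup>2 * norm (f x)"
        by (intro mult_right_mono) (simp_all add: Cauchy_Schwarz_ineq2 abs_le_square_iff[symmetric])
      finally show "norm (cis (- (x \<bullet> (\<xi> + h))) * f x - cis (- (x \<bullet> \<xi>)) * f x -
        (\<Sum>i\<in>UNIV. complex_of_real (h $ i) * (cis (- (x \<bullet> \<xi>)) * ((- \<i> * complex_of_real (x $ i)) * f x))))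
        \<le> (norm h)\<^sup>2 * ((norm x)\<^sup>2 * norm (f x))"
        unfolding eq by (simp add: power_mult_distrib mult_ac)
    qed
    finally show ?thesis by (simp add: B_def)
  qed
  show ?thesis
    unfolding has_derivative_at
  proof
    show "bounded_linear ?D"
      by (intro bounded_linear_sum bounded_linear_mult_const bounded_linear_compose[OF bounded_linear_of_real bounded_linear_vec_nth])
    show "(\<lambda>h. norm (fourier f (\<xi> + h) - fourier f \<xi> - ?D h) / norm h) \<midarrow>0\<rightarrow> 0"
    proof (rule Lim_null_comparison)
      show "\<forall>\<^sub>F h in at 0. norm (norm (fourier f (\<xi> + h) - fourier f \<xi> - ?D h) / norm h) \<le> norm h * B"
      proof (rule eventually_at_filter[THEN iffD2], rule always_eventually, intro allI impI)
        fix h :: "real^'n" assume "h \<noteq> 0"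
        then show "norm (norm (fourier f (\<xi> + h) - fourier f \<xi> - ?D h) / norm h) \<le> norm h * B"
          using bound[of h] by (simp add: divide_le_eq power2_eq_square mult_ac)
      qed
      show "((\<lambda>h. norm h * B) \<longlongrightarrow> 0) (at 0)"
        by (rule tendsto_eq_intros refl tendsto_norm_zero tendsto_ident_at)+ simp
    qed
  qed
qed

lemma partial_deriv_fourier:
  assumes f: "f \<in> schwartz_functions"
  shows "partial_deriv i (fourier f) = fourier (\<lambda>x. (- \<i> * complex_of_real (x $ i)) * f x)"
proof
  fix \<xi>
  show "partial_deriv i (fourier f) \<xi> = fourier (\<lambda>x. (- \<i> * complex_of_real (x $ i)) * f x) \<xi>"
    by (subst partial_deriv_eqI[OF fourier_has_derivative[OF f]])
      (simp add: axis_def if_distrib[of complex_of_real] if_distrib[of "\<lambda>z. z * _"] cong: if_cong)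
qed

text \<open>Provides the integrable majorant of difference quotients. The mean value theorem leads
  to the derivative at an intermediate point at distance at most 1 from x, where 1 + |x| changes at
  most by a factor 2; this costs the factor 2^k.\<close>

lemma schwartz_axis_differences:
  fixes f :: "real^'n::finite \<Rightarrow> complex"
  assumes f: "f \<in> schwartz_functions"
  obtains C where "\<And>x t. 0 < t \<Longrightarrow> t \<le> 1 \<Longrightarrow> norm (f (x + t *\<^sub>R axis i 1) - f x) \<le> t * (C * (1 / (1 + norm x) ^ k))"
proof -
  obtain D where D: "D \<ge> 0" "\<And>x. norm (partial_deriv i f x) \<le> D / (1 + norm x) ^ k"
    using rapid_bound[OF schwartz_rapid[OF schwartz_partial_deriv[OF f]]] by metis
  have "norm (f (x + t *\<^sub>R axis i 1) - f x) \<le> t * ((D * 2 ^ k) * (1 / (1 + norm x) ^ k))" if t: "0 < t" "t \<le> 1" for x t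
  proof -
    have der: "((\<lambda>s. f (x + s *\<^sub>R axis i 1)) has_derivative (\<lambda>r. frechet_derivative f (at (x + s *\<^sub>R axis i 1)) (r *\<^sub>R axis i 1))) (at s)" for s
      by (rule has_derivative_compose[where f="\<lambda>s. x + s *\<^sub>R axis i 1",
         OF _ has_derivative_partial_deriv[OF smooth_differentiable[OF schwartz_smooth[OF f]]]])
       (auto intro!: derivative_eq_intros)
    have "\<exists>s\<in>{0<..<t}. norm (f (x + t *\<^sub>R axis i 1) - f (x + 0 *\<^sub>R axis i 1)) \<le> norm (frechet_derivative f (at (x + s *\<^sub>R axis i 1)) ((t - 0) *\<^sub>R axis i 1))"
    proof (rule mvt_general[OF t(1)])
      show "continuous_on {0..t} (\<lambda>s. f (x + s *\<^sub>R axis i 1))"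
        using der by (meson continuous_at_imp_continuous_on has_derivative_continuous)
    qed (rule der)
    then obtain s where s: "0 < s" "s < t" and
      le: "norm (f (x + t *\<^sub>R axis i 1) - f x) \<le> norm (frechet_derivative f (at (x + s *\<^sub>R axis i 1)) (t *\<^sub>R axis i 1))"
      by auto
    have "frechet_derivative f (at (x + s *\<^sub>R axis i 1)) (t *\<^sub>R axis i 1) = t *\<^sub>R partial_deriv i f (x + s *\<^sub>R axis i 1)"
      unfolding partial_deriv_def
      using linear_frechet_derivative[OF smooth_differentiable[OF schwartz_smooth[OF f]]] by (rule linear_scale)
    with le t have "norm (f (x + t *\<^sub>R axis i 1) - f x) \<le> t * norm (partial_deriv i f (x + s *\<^sub>R axis i 1))" by simp
    also have "\<dots> \<le> t * ((D * 2 ^ k) * (1 / (1 + norm x) ^ k))"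
    proof (rule mult_left_mono)
      have p: "0 < 1 + norm (x + s *\<^sub>R axis i 1)" "0 < 1 + norm x" by (auto simp: add_pos_nonneg)
      have "norm x \<le> norm (x + s *\<^sub>R axis i 1) + norm (s *\<^sub>R axis i (1::real))"
        using norm_triangle_ineq4[of "x + s *\<^sub>R axis i 1" "s *\<^sub>R axis i 1"] by simp
      then have "1 + norm x \<le> 2 * (1 + norm (x + s *\<^sub>R axis i 1))"
        using s t norm_ge_zero[of "x + s *\<^sub>R axis i 1"] by (simp add: norm_axis_1 del: norm_ge_zero)
      then have "(1 + norm x) ^ k \<le> 2 ^ k * (1 + norm (x + s *\<^sub>R axis i 1)) ^ k"
        unfolding power_mult_distrib[symmetric] by (rule power_mono) simp
      then have "1 / (1 + norm (x + s *\<^sub>R axis i 1)) ^ k \<le> 2 ^ k / (1 + norm x) ^ k"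
        using p by (simp add: divide_simps mult.commute)
      from mult_left_mono[OF this D(1)]
      show "norm (partial_deriv i f (x + s *\<^sub>R axis i 1)) \<le> (D * 2 ^ k) * (1 / (1 + norm x) ^ k)"
        using D(2)[of "x + s *\<^sub>R axis i 1"] by simp
    qed (use t in simp)
    finally show ?thesis .
  qed
  then show ?thesis using that by blast
qed

lemma has_vector_derivative_tendsto_quotient:
  fixes f :: "real \<Rightarrow> 'a::real_normed_vector"
  assumes "(f has_vector_derivative D) (at 0)"
  shows "((\<lambda>h. (f h - f 0) /\<^sub>R h) \<longlongrightarrow> D) (at 0)"
proof -
  have "(\<lambda>h. norm (f (0 + h) - f 0 - h *\<^sub>R D) / norm h) \<midarrow>0\<rightarrow> 0"
    using assms unfolding has_vector_derivative_def has_derivative_at by blast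
  moreover have "\<forall>\<^sub>F h in at 0. norm (f (0 + h) - f 0 - h *\<^sub>R D) / norm h = norm ((f h - f 0) /\<^sub>R h - D)"
  proof (rule eventually_at_filter[THEN iffD2], rule always_eventually, intro allI impI)
    fix h :: real assume h: "h \<noteq> 0"
    then have "(f h - f 0) /\<^sub>R h - D = (f (0 + h) - f 0 - h *\<^sub>R D) /\<^sub>R h" by (simp add: scaleR_diff_right)
    then show "norm (f (0 + h) - f 0 - h *\<^sub>R D) / norm h = norm ((f h - f 0) /\<^sub>R h - D)"
      by (simp add: divide_inverse_commute)
  qed
  ultimately have "(\<lambda>h. norm ((f h - f 0) /\<^sub>R h - D)) \<midarrow>0\<rightarrow> 0"
    by (rule Lim_transform_eventually)
  then show ?thesis by (rule LIM_zero_cancel[OF tendsto_norm_zero_cancel])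
qed

text \<open>Proved without integration by parts. The integrals of the difference quotients with step
  1/(m+1) converge to the left side by dominated convergence; by translation invariance they equal
  (cis(t \<xi>_i) - 1)/t times \<open>fourier f \<xi>\<close>, whose limit is the right
  side.\<close>

lemma fourier_partial_deriv:
  fixes f :: "real^'n::finite \<Rightarrow> complex"
  assumes f: "f \<in> schwartz_functions"
  shows "fourier (partial_deriv i f) \<xi> = \<i> * complex_of_real (\<xi> $ i) * fourier f \<xi>"
proof -
  let ?t = "\<lambda>m. 1 / real (Suc m)"
  let ?s = "\<lambda>m x. complex_of_real (1 / ?t m) * (cis (- (x \<bullet> \<xi>)) * (f (x + ?t m *\<^sub>R axis i 1) - f x))"
  have t0: "?t \<longlonglongrightarrow> 0"
    using LIMSEQ_inverse_real_of_nat by (simp add: inverse_eq_divide)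
  then have t_at: "filterlim ?t (at 0) sequentially" by (intro filterlim_atI always_eventually) auto
  have [measurable]: "f \<in> borel_measurable borel" "partial_deriv i f \<in> borel_measurable borel"
    using schwartz_measurable f schwartz_partial_deriv by auto
  obtain C where C: "\<And>x t. 0 < t \<Longrightarrow> t \<le> 1 \<Longrightarrow> norm (f (x + t *\<^sub>R axis i 1) - f x) \<le> t * (C * (1 / (1 + norm x) ^ (2 * CARD('n))))"
    using schwartz_axis_differences[OF f] by blast
  have "(\<lambda>m. LINT x|lborel. ?s m x) \<longlonglongrightarrow> fourier (partial_deriv i f) \<xi>"
    unfolding fourier_def
  proof (rule integral_dominated_convergence)
    show "integrable lborel (\<lambda>x::real^'n. C * (1 / (1 + norm x) ^ (2 * CARD('n))))"
      by (intro integrable_mult_right integrable_inverse_power) simp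
    show "AE x in lborel. norm (?s m x) \<le> C * (1 / (1 + norm x) ^ (2 * CARD('n)))" for m
    proof (rule AE_I2)
      fix x
      have "norm (?s m x) = (1 / ?t m) * norm (f (x + ?t m *\<^sub>R axis i 1) - f x)"
        unfolding norm_mult norm_of_real norm_cis by simp
      also have "\<dots> \<le> (1 / ?t m) * (?t m * (C * (1 / (1 + norm x) ^ (2 * CARD('n)))))"
        by (intro mult_left_mono C) auto
      finally show "norm (?s m x) \<le> C * (1 / (1 + norm x) ^ (2 * CARD('n)))" by simp
    qed
    show "AE x in lborel. (\<lambda>m. ?s m x) \<longlonglongrightarrow> cis (- (x \<bullet> \<xi>)) * partial_deriv i f x"
    proof (rule AE_I2)
      fix x
      have "((\<lambda>s. f (x + s *\<^sub>R axis i 1)) has_vector_derivative partial_deriv i f x) (at 0)"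
      proof -
        have 1: "((\<lambda>s::real. x + s *\<^sub>R axis i 1) has_derivative (\<lambda>r. r *\<^sub>R axis i 1)) (at 0)"
          by (auto intro!: derivative_eq_intros)
        have 2: "(f has_derivative frechet_derivative f (at x)) (at (x + 0 *\<^sub>R axis i 1))"
          using has_derivative_partial_deriv[OF smooth_differentiable[OF schwartz_smooth[OF f]]] by simp
        have "frechet_derivative f (at x) (r *\<^sub>R axis i 1) = r *\<^sub>R partial_deriv i f x" for r
          unfolding partial_deriv_def
          using linear_frechet_derivative[OF smooth_differentiable[OF schwartz_smooth[OF f]]] by (rule linear_scale)
        then show ?thesis using has_derivative_compose[OF 1 2] by (simp add: has_vector_derivative_def)
      qed
      then have "((\<lambda>h. (f (x + h *\<^sub>R axis i 1) - f x) /\<^sub>R h) \<longlongrightarrow> partial_deriv i f x) (at 0)"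
        by (auto dest: has_vector_derivative_tendsto_quotient)
      from tendsto_mult[OF tendsto_const[of "cis (- (x \<bullet> \<xi>))"] filterlim_compose[OF this t_at]]
      show "(\<lambda>m. ?s m x) \<longlonglongrightarrow> cis (- (x \<bullet> \<xi>)) * partial_deriv i f x"
        by (simp add: scaleR_conv_of_real mult_ac)
    qed
  qed simp_all
  moreover have "(\<lambda>m. LINT x|lborel. ?s m x) \<longlonglongrightarrow> \<i> * complex_of_real (\<xi> $ i) * fourier f \<xi>"
  proof -
    have eq: "(LINT x|lborel. ?s m x) = (cis (?t m * \<xi> $ i) - 1) /\<^sub>R ?t m * fourier f \<xi>" for m
    proof -
      let ?g = "\<lambda>x. cis (- (x \<bullet> \<xi>)) * f x"
      have gi: "integrable lborel ?g" using f by (intro integrable_cis_mult schwartz_integrable) auto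
      have "cis (- (x \<bullet> \<xi>)) * f (x + ?t m *\<^sub>R axis i 1) = cis (?t m * \<xi> $ i) * ?g (?t m *\<^sub>R axis i 1 + x)" for x
        by (simp add: cis_mult mult.assoc[symmetric] inner_add_left inner_axis' add.commute)
      then have "?s m x = complex_of_real (1 / ?t m) * (cis (?t m * \<xi> $ i) * ?g (?t m *\<^sub>R axis i 1 + x) - ?g x)" for x
        by (simp only: right_diff_distrib)
      then have "(LINT x|lborel. ?s m x) = (LINT x|lborel. complex_of_real (1 / ?t m) * (cis (?t m * \<xi> $ i) * ?g (?t m *\<^sub>R axis i 1 + x) - ?g x))"
        by (rule Bochner_Integration.integral_cong[OF refl])
      also have "\<dots> = complex_of_real (1 / ?t m) * ((LINT x|lborel. cis (?t m * \<xi> $ i) * ?g (?t m *\<^sub>R axis i 1 + x)) - (LINT x|lborel. ?g x))"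
        using lborel_integrable_affine[OF gi, of 1 "?t m *\<^sub>R axis i 1"] gi
        by (subst integral_mult_right_zero, subst Bochner_Integration.integral_diff) (auto intro: integrable_mult_right)
      also have "(LINT x|lborel. cis (?t m * \<xi> $ i) * ?g (?t m *\<^sub>R axis i 1 + x)) = cis (?t m * \<xi> $ i) * (LINT x|lborel. ?g x)"
        by (subst integral_mult_right_zero, subst lborel_integral_translate) auto
      finally show ?thesis by (simp add: fourier_def scaleR_conv_of_real algebra_simps)
    qed
    have "((\<lambda>s. cis (s * \<xi> $ i)) has_vector_derivative \<i> * complex_of_real (\<xi> $ i)) (at 0)"
    proof -
      have "((\<lambda>z. exp (\<i> * (z * complex_of_real (\<xi> $ i)))) has_field_derivative \<i> * complex_of_real (\<xi> $ i)) (at (complex_of_real 0))"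
        by (auto intro!: derivative_eq_intros)
      from has_vector_derivative_real_field[OF this] show ?thesis by (simp add: cis_conv_exp)
    qed
    then have "((\<lambda>h. (cis (h * \<xi> $ i) - 1) /\<^sub>R h) \<longlongrightarrow> \<i> * complex_of_real (\<xi> $ i)) (at 0)"
      by (auto dest: has_vector_derivative_tendsto_quotient)
    from tendsto_mult[OF filterlim_compose[OF this t_at] tendsto_const[of "fourier f \<xi>"]]
    show ?thesis unfolding eq .
  qed
  ultimately show ?thesis by (rule LIMSEQ_unique)
qed

lemma fourier_partial_derivs_replicate:
  assumes f: "f \<in> schwartz_functions"
  shows "fourier (partial_derivs (replicate k i) f) \<xi> = (\<i> * complex_of_real (\<xi> $ i)) ^ k * fourier f \<xi>"
proof (induction k)
  case (Suc k)
  have "partial_derivs (replicate k i) f \<in> schwartz_functions"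
    using f unfolding schwartz_functions_eq by (rule smooth_class_partial_derivs)
  then show ?case using Suc by (simp add: fourier_partial_deriv mult_ac)
qed simp

text \<open>Only pure powers of single coordinates appear on the right, so that the decay estimate
  below involves only the pure derivatives \<open>replicate k i\<close>. The proof compares |x| with
  the largest coordinate.\<close>

lemma norm_power_le_sum:
  fixes x :: "real^'n::finite"
  shows "(1 + norm x) ^ k \<le> (2 * real CARD('n)) ^ k * (1 + (\<Sum>i\<in>UNIV. \<bar>x $ i\<bar> ^ k))"
proof -
  obtain j where j: "\<And>i. \<bar>x $ i\<bar> \<le> \<bar>x $ j\<bar>"
  proof -
    have "Max (range (\<lambda>i. \<bar>x $ i\<bar>)) \<in> range (\<lambda>i. \<bar>x $ i\<bar>)" by (rule Max_in) auto
    then obtain j where j: "Max (range (\<lambda>i. \<bar>x $ i\<bar>)) = \<bar>x $ j\<bar>" unfolding image_iff by blast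
    have "\<bar>x $ i\<bar> \<le> \<bar>x $ j\<bar>" for i unfolding j[symmetric] by (rule Max_ge) auto
    then show ?thesis by (rule that)
  qed
  let ?m = "max 1 \<bar>x $ j\<bar>"
  have n1: "real CARD('n) \<ge> 1" by (simp add: Suc_leI)
  have "norm x \<le> (\<Sum>i\<in>UNIV. \<bar>x $ i\<bar>)" by (rule norm_le_l1_cart)
  also have "\<dots> \<le> (\<Sum>i\<in>(UNIV::'n set). ?m)" by (intro sum_mono) (use j in \<open>auto simp: max.coboundedI2\<close>)
  also have "\<dots> = real CARD('n) * ?m" by simp
  finally have "norm x \<le> real CARD('n) * ?m" .
  moreover have "1 \<le> real CARD('n) * ?m" using mult_mono[of 1 "real CARD('n)" 1 ?m] n1 by simp
  ultimately have "1 + norm x \<le> (2 * real CARD('n)) * ?m" by simp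
  then have "(1 + norm x) ^ k \<le> ((2 * real CARD('n)) * ?m) ^ k" by (intro power_mono) auto
  also have "\<dots> = (2 * real CARD('n)) ^ k * ?m ^ k" by (rule power_mult_distrib)
  also have "\<dots> \<le> (2 * real CARD('n)) ^ k * (1 + (\<Sum>i\<in>UNIV. \<bar>x $ i\<bar> ^ k))"
  proof (rule mult_left_mono)
    have "\<bar>x $ j\<bar> ^ k \<le> (\<Sum>i\<in>UNIV. \<bar>x $ i\<bar> ^ k)" by (rule member_le_sum) auto
    moreover have "0 \<le> (\<Sum>i\<in>UNIV. \<bar>x $ i\<bar> ^ k)" by (intro sum_nonneg) auto
    ultimately show "?m ^ k \<le> 1 + (\<Sum>i\<in>UNIV. \<bar>x $ i\<bar> ^ k)" by (auto simp: max_def)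
  qed simp
  finally show ?thesis .
qed

lemma fourier_le_L1: "norm (fourier f \<xi>) \<le> (LINT x|lborel. norm (f x))"
proof -
  have "norm (fourier f \<xi>) \<le> (LINT x|lborel. norm (cis (- (x \<bullet> \<xi>)) * f x))"
    unfolding fourier_def by (rule integral_norm_bound)
  then show ?thesis by (simp add: norm_mult)
qed

text \<open>The right side is kept explicit because the continuity of tempered distributions on the
  Fourier side requires a bound by seminorms of f, not merely some constant depending on f.\<close>

lemma fourier_decay:
  fixes f :: "real^'n::finite \<Rightarrow> complex"
  assumes f: "f \<in> schwartz_functions"
  shows "(1 + norm \<xi>) ^ k * norm (fourier f \<xi>) \<le> (2 * real CARD('n)) ^ k *
    ((LINT x|lborel. norm (f x)) + (\<Sum>i\<in>UNIV. LINT x|lborel. norm (partial_derivs (replicate k i) f x)))"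
proof -
  have "(1 + norm \<xi>) ^ k * norm (fourier f \<xi>) \<le>
    (2 * real CARD('n)) ^ k * (1 + (\<Sum>i\<in>UNIV. \<bar>\<xi> $ i\<bar> ^ k)) * norm (fourier f \<xi>)"
    by (intro mult_right_mono norm_power_le_sum) simp
  also have "\<dots> = (2 * real CARD('n)) ^ k * (norm (fourier f \<xi>) + (\<Sum>i\<in>UNIV. \<bar>\<xi> $ i\<bar> ^ k * norm (fourier f \<xi>)))"
    by (simp add: distrib_left distrib_right sum_distrib_right mult.assoc)
  also have "\<dots> \<le> (2 * real CARD('n)) ^ k *
    ((LINT x|lborel. norm (f x)) + (\<Sum>i\<in>UNIV. LINT x|lborel. norm (partial_derivs (replicate k i) f x)))"
  proof (intro mult_left_mono add_mono sum_mono fourier_le_L1)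
    fix i :: 'n
    have "\<bar>\<xi> $ i\<bar> ^ k * norm (fourier f \<xi>) = norm (fourier (partial_derivs (replicate k i) f) \<xi>)"
      by (simp add: fourier_partial_derivs_replicate[OF f] norm_mult norm_power)
    also have "\<dots> \<le> (LINT x|lborel. norm (partial_derivs (replicate k i) f x))" by (rule fourier_le_L1)
    finally show "\<bar>\<xi> $ i\<bar> ^ k * norm (fourier f \<xi>) \<le> (LINT x|lborel. norm (partial_derivs (replicate k i) f x))" .
  qed simp
  finally show ?thesis .
qed

text \<open>The set of all transforms of Schwartz functions is invariant, since differentiating a
  transform amounts to multiplying the original function by a coordinate.\<close>

lemma fourier_schwartz:
  assumes f: "f \<in> schwartz_functions" shows "fourier f \<in> schwartz_functions"
  unfolding schwartz_functions_eq
proof (rule smooth_classI[where A="fourier ` schwartz_functions"])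
  fix g i x assume "g \<in> fourier ` (schwartz_functions :: (real^'a \<Rightarrow> complex) set)"
  then obtain f where f: "f \<in> schwartz_functions" and g: "g = fourier f" by auto
  show "g differentiable (at x)" unfolding g using fourier_has_derivative[OF f] by (auto simp: differentiable_def)
  show "partial_deriv i g \<in> fourier ` schwartz_functions" unfolding g partial_deriv_fourier[OF f]
    by (rule imageI[OF schwartz_integrable_coord[OF f]])
  show "rapid g" unfolding g by (rule rapidI) (use fourier_decay[OF f] in blast)
qed (use f in auto)

section \<open>The inverse transform and inversion\<close>

lemma inv_fourier_eq:
  "inv_fourier f x = fourier f (- x) / complex_of_real ((2 * pi) ^ CARD('n))" for x :: "real^'n::finite"
  by (simp add: inv_fourier_def fourier_def inner_commute)

lemma inv_fourier_schwartz:
  fixes f :: "real^'n::finite \<Rightarrow> complex"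
  assumes f: "f \<in> schwartz_functions" shows "inv_fourier f \<in> schwartz_functions"
  using schwartz_cmult[OF schwartz_uminus_arg[OF fourier_schwartz[OF f]], of "1 / complex_of_real ((2 * pi) ^ CARD('n))"]
  by (simp add: inv_fourier_eq[abs_def])

lemma inv_fourier_linear:
  assumes "f \<in> schwartz_functions" "g \<in> schwartz_functions"
  shows "inv_fourier (\<lambda>x. a * f x + c * g x) = (\<lambda>\<xi>. a * inv_fourier f \<xi> + c * inv_fourier g \<xi>)"
  using assms by (simp add: inv_fourier_eq[abs_def] fourier_linear add_divide_distrib)

lemma inv_fourier_diff:
  assumes "f \<in> schwartz_functions" "g \<in> schwartz_functions"
  shows "inv_fourier (\<lambda>x. f x - g x) = (\<lambda>\<xi>. inv_fourier f \<xi> - inv_fourier g \<xi>)"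
  using inv_fourier_linear[OF assms, of 1 "-1"] by simp

lemma fourier_diff:
  assumes "f \<in> schwartz_functions" "g \<in> schwartz_functions"
  shows "fourier (\<lambda>x. f x - g x) = (\<lambda>\<xi>. fourier f \<xi> - fourier g \<xi>)"
  using fourier_linear[OF assms, of 1 "-1"] by simp

lemma fourier_translate:
  assumes "f \<in> borel_measurable borel"
  shows "fourier (translate y f) \<xi> = cis (- (y \<bullet> \<xi>)) * fourier f \<xi>"
proof -
  have [measurable]: "f \<in> borel_measurable borel" by fact
  have "fourier (translate y f) \<xi> = (LINT x|lborel. cis (- ((y + x) \<bullet> \<xi>)) * translate y f (y + x))"
    unfolding fourier_def translate_def by (rule lborel_integral_translate[symmetric]) simp
  also have "\<dots> = (LINT x|lborel. cis (- (y \<bullet> \<xi>)) * (cis (- (x \<bullet> \<xi>)) * f x))"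
    by (simp add: translate_def inner_add_left cis_mult mult.assoc[symmetric])
  finally show ?thesis by (simp add: fourier_def)
qed

text \<open>The integral of the transform written out as a double integral does not converge
  absolutely, so the factor \<open>gauss (?e m *\<^sub>R \<xi>)\<close> is inserted. Fubini then
  moves the transform onto the Gaussian, and m \<rightarrow> \<infinity> is taken on both sides: one
  limit is the integral sought, the other is f(x) times the integral of the transformed
  Gaussian.\<close>

lemma integral_fourier_inversion:
  fixes f :: "real^'n::finite \<Rightarrow> complex"
  assumes f: "f \<in> schwartz_functions"
  shows "(LINT \<xi>|lborel. cis (x \<bullet> \<xi>) * fourier f \<xi>) = complex_of_real ((2 * pi) ^ CARD('n)) * f x"
proof -
  let ?e = "\<lambda>m. 1 / real (Suc m)"
  define c where "c = complex_of_real (sqrt (2 * pi) ^ CARD('n))"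
  have t0: "?e \<longlonglongrightarrow> 0"
    using LIMSEQ_inverse_real_of_nat by (simp add: inverse_eq_divide)
  have cont_gauss: "continuous_on UNIV (gauss :: real^'n \<Rightarrow> real)"
    unfolding gauss_def by (intro continuous_intros) auto
  then have [measurable]: "(gauss :: real^'n \<Rightarrow> real) \<in> borel_measurable borel"
    by (rule borel_measurable_continuous_onI)
  have [measurable]: "f \<in> borel_measurable borel" "fourier f \<in> borel_measurable borel"
    using schwartz_measurable f fourier_schwartz by auto
  have gauss_le: "\<bar>gauss z\<bar> \<le> 1" for z :: "real^'n"
    unfolding gauss_def abs_prod by (rule prod_le_1) auto
  have gauss0: "gauss (0 :: real^'n) = 1" by (simp add: gauss_def)
  have gint: "integrable lborel (\<lambda>z::real^'n. complex_of_real (gauss z))"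
    using gauss_fourier(1)[of 0] by simp
  have lim: "(\<lambda>m. z0 + ?e m *\<^sub>R z) \<longlonglongrightarrow> z0" for z0 z :: "real^'n"
    using tendsto_add[OF tendsto_const tendsto_scaleR[OF t0 tendsto_const]] by simp
  let ?A = "\<lambda>m. LINT \<xi>|lborel. cis (x \<bullet> \<xi>) * complex_of_real (gauss (?e m *\<^sub>R \<xi>)) * fourier f \<xi>"
  have 1: "?A \<longlonglongrightarrow> (LINT \<xi>|lborel. cis (x \<bullet> \<xi>) * fourier f \<xi>)"
  proof (rule integral_dominated_convergence)
    show "integrable lborel (\<lambda>\<xi>. norm (fourier f \<xi>))"
      by (intro integrable_norm schwartz_integrable fourier_schwartz f)
    show "AE \<xi> in lborel. norm (cis (x \<bullet> \<xi>) * complex_of_real (gauss (?e m *\<^sub>R \<xi>)) * fourier f \<xi>) \<le> norm (fourier f \<xi>)" for m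
      using gauss_le by (intro AE_I2) (auto simp: norm_mult intro!: mult_left_le_one_le)
    show "AE \<xi> in lborel. (\<lambda>m. cis (x \<bullet> \<xi>) * complex_of_real (gauss (?e m *\<^sub>R \<xi>)) * fourier f \<xi>) \<longlonglongrightarrow> cis (x \<bullet> \<xi>) * fourier f \<xi>"
    proof (rule AE_I2)
      fix \<xi> :: "real^'n"
      have "(\<lambda>m. gauss (?e m *\<^sub>R \<xi>)) \<longlonglongrightarrow> gauss (0 :: real^'n)"
        using lim[of 0 \<xi>] cont_gauss by (auto intro!: continuous_on_tendsto_compose[of UNIV gauss])
      from tendsto_mult[OF tendsto_mult[OF tendsto_const tendsto_of_real[OF this]] tendsto_const]
      show "(\<lambda>m. cis (x \<bullet> \<xi>) * complex_of_real (gauss (?e m *\<^sub>R \<xi>)) * fourier f \<xi>) \<longlonglongrightarrow> cis (x \<bullet> \<xi>) * fourier f \<xi>"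
        by (simp add: gauss0)
    qed
  qed simp_all
  \<comment> \<open>Two substitutions: y = x + e z in the integral defining the transform, and e
    \<xi> \<mapsto> \<xi> in the outer integral. The Jacobian \<open>?q\<close> of the first is
    absorbed by the second.\<close>
  have A_eq: "?A m = (LINT z|lborel. f (x + ?e m *\<^sub>R z) * (c * complex_of_real (gauss z)))" for m
  proof -
    let ?q = "complex_of_real (\<bar>?e m\<bar> ^ CARD('n))"
    let ?h = "\<lambda>\<xi> z. cis (- (z \<bullet> \<xi>)) * complex_of_real (gauss \<xi>) * f (x + ?e m *\<^sub>R z)"
    have e: "?e m \<noteq> 0" by simp
    have "cis (x \<bullet> \<xi>) * complex_of_real (gauss (?e m *\<^sub>R \<xi>)) * fourier f \<xi> =
       ?q * (LINT z|lborel. ?h (0 + ?e m *\<^sub>R \<xi>) z)" for \<xi>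
    proof -
      have "fourier f \<xi> = ?q * (LINT z|lborel. cis (- ((x + ?e m *\<^sub>R z) \<bullet> \<xi>)) * f (x + ?e m *\<^sub>R z))"
        unfolding fourier_def by (subst lborel_integral_affine[OF _ e, of _ x]) simp_all
      also have "(LINT z|lborel. cis (- ((x + ?e m *\<^sub>R z) \<bullet> \<xi>)) * f (x + ?e m *\<^sub>R z))
         = (LINT z|lborel. cis (- (x \<bullet> \<xi>)) * (cis (- (z \<bullet> (?e m *\<^sub>R \<xi>))) * f (x + ?e m *\<^sub>R z)))"
        by (simp add: inner_add_left cis_mult mult.assoc[symmetric])
      also have "\<dots> = cis (- (x \<bullet> \<xi>)) * (LINT z|lborel. (cis (- (z \<bullet> (?e m *\<^sub>R \<xi>))) * f (x + ?e m *\<^sub>R z)))"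
        by (rule integral_mult_right_zero)
      finally have "cis (x \<bullet> \<xi>) * complex_of_real (gauss (?e m *\<^sub>R \<xi>)) * fourier f \<xi> =
         (cis (x \<bullet> \<xi>) * cis (- (x \<bullet> \<xi>))) * (?q * (complex_of_real (gauss (?e m *\<^sub>R \<xi>)) *
           (LINT z|lborel. (cis (- (z \<bullet> (?e m *\<^sub>R \<xi>))) * f (x + ?e m *\<^sub>R z)))))"
        by (simp only: mult_ac)
      also have "\<dots> = ?q * (LINT z|lborel. ?h (0 + ?e m *\<^sub>R \<xi>) z)"
        by (subst integral_mult_right_zero[symmetric]) (simp add: cis_mult mult_ac)
      finally show ?thesis .
    qed
    then have "?A m = ?q * (LINT \<xi>|lborel. (LINT z|lborel. ?h (0 + ?e m *\<^sub>R \<xi>) z))"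
      by (simp only: integral_mult_right_zero)
    also have "\<dots> = (LINT \<xi>|lborel. (LINT z|lborel. ?h \<xi> z))"
      by (subst (2) lborel_integral_affine[OF _ e, of _ 0]) auto
    also have "\<dots> = (LINT z|lborel. (LINT \<xi>|lborel. ?h \<xi> z))"
    proof (rule lborel_pair.Fubini_integral[symmetric])
      show "integrable (lborel \<Otimes>\<^sub>M lborel) (\<lambda>(\<xi>, z). ?h \<xi> z)"
        by (rule integrable_pair_bound[OF gint lborel_integrable_affine[OF schwartz_integrable[OF f] e, of x]])
          (auto simp: norm_mult)
    qed
    also have "\<dots> = (LINT z|lborel. f (x + ?e m *\<^sub>R z) * (c * complex_of_real (gauss z)))"
      by (simp add: gauss_fourier(2) c_def mult.commute[of _ "f _"] mult.left_commute[of _ "f _"])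
    finally show ?thesis .
  qed
  obtain C where C: "\<And>z. norm (f z) \<le> C"
    using rapid_bound[OF schwartz_rapid[OF f], of 0] by (metis div_by_1 power_0)
  have 2: "?A \<longlonglongrightarrow> (LINT z|lborel. f x * (c * complex_of_real (gauss (z::real^'n))))"
    unfolding A_eq
  proof (rule integral_dominated_convergence)
    show "integrable lborel (\<lambda>z::real^'n. C * norm (c * complex_of_real (gauss z)))"
      by (intro integrable_mult_right integrable_norm gint)
    show "AE z in lborel. norm (f (x + ?e m *\<^sub>R z) * (c * complex_of_real (gauss z))) \<le> C * norm (c * complex_of_real (gauss z))" for m
      using C by (intro AE_I2) (auto simp: norm_mult intro!: mult_right_mono)
    show "AE z in lborel. (\<lambda>m. f (x + ?e m *\<^sub>R z) * (c * complex_of_real (gauss z))) \<longlonglongrightarrow> f x * (c * complex_of_real (gauss z))"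
      by (intro AE_I2 tendsto_mult tendsto_const continuous_on_tendsto_compose[OF smooth_continuous[OF schwartz_smooth[OF f], of UNIV] lim]) auto
  qed simp_all
  have "(LINT z|lborel. f x * (c * complex_of_real (gauss (z::real^'n)))) = f x * (c * c)"
    using gauss_fourier(2)[of "0::real^'n"] by (simp add: gauss0 c_def)
  also have "c * c = complex_of_real ((2 * pi) ^ CARD('n))"
    unfolding c_def of_real_mult[symmetric] power_mult_distrib[symmetric] by simp
  finally show ?thesis using LIMSEQ_unique[OF 1 2] by (simp add: mult_ac c_def)
qed

lemma inv_fourier_fourier:
  assumes f: "f \<in> schwartz_functions" shows "inv_fourier (fourier f) = f"
  by (rule ext) (simp add: inv_fourier_def integral_fourier_inversion[OF f] inner_commute)

lemma fourier_inv_fourier: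
  fixes f :: "real^'n::finite \<Rightarrow> complex"
  assumes f: "f \<in> schwartz_functions" shows "fourier (inv_fourier f) = f"
proof
  fix x
  have "fourier (inv_fourier f) x = (LINT \<xi>|lborel. cis (- ((- \<xi>) \<bullet> x)) * inv_fourier f (- \<xi>))"
    unfolding fourier_def
    by (rule lborel_integral_uminus[symmetric]) (use schwartz_measurable[OF inv_fourier_schwartz[OF f]] in simp)
  also have "\<dots> = (LINT \<xi>|lborel. cis (x \<bullet> \<xi>) * fourier f \<xi>) / complex_of_real ((2 * pi) ^ CARD('n))"
    by (simp add: inv_fourier_eq inner_commute)
  finally show "fourier (inv_fourier f) x = f x" by (simp add: integral_fourier_inversion[OF f])
qed

lemma fourier_multiplication:
  fixes f g :: "real^'n::finite \<Rightarrow> complex"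
  assumes f: "f \<in> schwartz_functions" and g: "g \<in> schwartz_functions"
  shows "(LINT x|lborel. fourier f x * g x) = (LINT x|lborel. f x * fourier g x)"
proof -
  have [measurable]: "f \<in> borel_measurable borel" "g \<in> borel_measurable borel"
    using schwartz_measurable f g by auto
  have "(LINT x|lborel. fourier f x * g x) = (LINT x|lborel. LINT y|lborel. cis (- (y \<bullet> x)) * f y * g x)"
    by (simp add: fourier_def)
  also have "\<dots> = (LINT y|lborel. LINT x|lborel. cis (- (y \<bullet> x)) * f y * g x)"
    by (rule lborel_pair.Fubini_integral[symmetric], rule integrable_pair_bound[OF schwartz_integrable[OF g] schwartz_integrable[OF f]])
      (auto simp: norm_mult)
  also have "\<dots> = (LINT y|lborel. f y * fourier g y)"
    by (simp add: fourier_def inner_commute mult_ac flip: integral_mult_right_zero)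
  finally show ?thesis .
qed

lemma inv_fourier_multiplication:
  fixes f g :: "real^'n::finite \<Rightarrow> complex"
  assumes f: "f \<in> schwartz_functions" and g: "g \<in> schwartz_functions"
  shows "(LINT x|lborel. inv_fourier f x * g x) = (LINT x|lborel. f x * inv_fourier g x)"
  using fourier_multiplication[OF inv_fourier_schwartz[OF f] inv_fourier_schwartz[OF g]]
  by (simp add: fourier_inv_fourier f g)

lemma cnj_inv_fourier:
  fixes f :: "real^'n::finite \<Rightarrow> complex"
  shows "cnj (inv_fourier f x) = fourier (\<lambda>y. cnj (f y)) x / complex_of_real ((2 * pi) ^ CARD('n))"
proof -
  have "cnj (LINT y|lborel. cis (x \<bullet> y) * f y) = (LINT y|lborel. cis (- (y \<bullet> x)) * cnj (f y))"
  proof -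
    have "cis (- (y \<bullet> x)) * cnj (f y) = cnj (cis (x \<bullet> y) * f y)" for y
      by (simp add: cis_cnj inner_commute)
    then show ?thesis using Bochner_Integration.integral_cnj[of lborel "\<lambda>y. cis (x \<bullet> y) * f y"] by (simp only:)
  qed
  then show ?thesis unfolding inv_fourier_def fourier_def by simp
qed

text \<open>Inversion for f followed by Fubini. Since f is expressed through
  \<open>fourier f\<close> but g is transformed back, the result is a correlation with \<xi> +
  \<eta> rather than a convolution; reflecting one variable later turns it into one.\<close>

lemma inv_fourier_mult:
  fixes f g :: "real^'n::finite \<Rightarrow> complex"
  assumes f: "f \<in> schwartz_functions" and g: "g \<in> schwartz_functions"
  shows "inv_fourier (\<lambda>x. f x * g x) \<xi> =
    (LINT \<eta>|lborel. fourier f \<eta> * inv_fourier g (\<xi> + \<eta>)) / complex_of_real ((2 * pi) ^ CARD('n))"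
proof -
  let ?c = "complex_of_real ((2 * pi) ^ CARD('n))"
  have [measurable]: "fourier f \<in> borel_measurable borel" "g \<in> borel_measurable borel"
    using schwartz_measurable fourier_schwartz f g by auto
  have f_eq: "f x = (LINT \<eta>|lborel. cis (x \<bullet> \<eta>) * fourier f \<eta>) / ?c" for x
    using inv_fourier_fourier[OF f] by (metis inv_fourier_def)
  have "(LINT x|lborel. cis (\<xi> \<bullet> x) * (f x * g x)) = (LINT x|lborel. LINT \<eta>|lborel. cis (\<xi> \<bullet> x) * (cis (x \<bullet> \<eta>) * fourier f \<eta> / ?c) * g x)"
    by (subst f_eq) (simp, simp only: mult.assoc)
  also have "\<dots> = (LINT \<eta>|lborel. LINT x|lborel. cis (\<xi> \<bullet> x) * (cis (x \<bullet> \<eta>) * fourier f \<eta> / ?c) * g x)"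
    by (rule lborel_pair.Fubini_integral[symmetric],
        rule integrable_pair_bound[OF schwartz_integrable[OF g] integrable_divide_zero[OF schwartz_integrable[OF fourier_schwartz[OF f]], of ?c]])
      (auto simp: norm_mult norm_divide mult.commute)
  also have "\<dots> = (LINT \<eta>|lborel. fourier f \<eta> * inv_fourier g (\<xi> + \<eta>))"
  proof (rule Bochner_Integration.integral_cong[OF refl])
    fix \<eta>
    have "cis (\<xi> \<bullet> x) * (cis (x \<bullet> \<eta>) * fourier f \<eta> / ?c) * g x = (fourier f \<eta> / ?c) * (cis ((\<xi> + \<eta>) \<bullet> x) * g x)" for x
    proof -
      have "cis ((\<xi> + \<eta>) \<bullet> x) = cis (\<xi> \<bullet> x) * cis (x \<bullet> \<eta>)"
        unfolding cis_mult inner_add_left by (simp add: inner_commute)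
      then show ?thesis by (simp add: mult_ac)
    qed
    then have "(LINT x|lborel. cis (\<xi> \<bullet> x) * (cis (x \<bullet> \<eta>) * fourier f \<eta> / ?c) * g x) =
        (LINT x|lborel. (fourier f \<eta> / ?c) * (cis ((\<xi> + \<eta>) \<bullet> x) * g x))"
      by (rule Bochner_Integration.integral_cong[OF refl])
    then show "(LINT x|lborel. cis (\<xi> \<bullet> x) * (cis (x \<bullet> \<eta>) * fourier f \<eta> / ?c) * g x) = fourier f \<eta> * inv_fourier g (\<xi> + \<eta>)"
      by (simp add: inv_fourier_def)
  qed
  finally show ?thesis by (simp add: inv_fourier_def)
qed

section \<open>Square integrable functions and Plancherel's theorem\<close>

lemma L2_measurable: "f \<in> L2_functions \<Longrightarrow> f \<in> borel_measurable borel"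
  by (simp add: L2_functions_def)

lemma L2_integrable: "f \<in> L2_functions \<Longrightarrow> integrable lborel (\<lambda>x. (norm (f x))\<^sup>2)"
  by (simp add: L2_functions_def)

lemma L2_norm_nonneg: "0 \<le> L2_norm f"
  unfolding L2_norm_def by (intro real_sqrt_ge_zero Bochner_Integration.integral_nonneg) simp

lemma L2_norm_sq: "(L2_norm f)\<^sup>2 = (LINT x|lborel. (norm (f x))\<^sup>2)"
  unfolding L2_norm_def by (intro real_sqrt_pow2 Bochner_Integration.integral_nonneg) simp

lemma L2_nn_integral: "f \<in> L2_functions \<Longrightarrow> (\<integral>\<^sup>+x. ennreal ((norm (f x))\<^sup>2) \<partial>lborel) = ennreal ((L2_norm f)\<^sup>2)"
  unfolding L2_norm_sq by (rule nn_integral_eq_integral[OF L2_integrable]) auto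

lemma L2_nn_bound:
  assumes f: "f \<in> borel_measurable borel" and le: "(\<integral>\<^sup>+x. ennreal ((norm (f x))\<^sup>2) \<partial>lborel) \<le> ennreal (c\<^sup>2)" and c: "c \<ge> 0"
  shows "f \<in> L2_functions" "L2_norm f \<le> c"
proof -
  have "integrable lborel (\<lambda>x. (norm (f x))\<^sup>2)"
    by (rule integrableI_bounded) (use f le in \<open>auto intro: le_less_trans\<close>)
  then show f2: "f \<in> L2_functions" using f by (simp add: L2_functions_def)
  have "(L2_norm f)\<^sup>2 \<le> c\<^sup>2" using le unfolding L2_nn_integral[OF f2] by simp
  then show "L2_norm f \<le> c" using c by (simp add: abs_le_square_iff[symmetric] L2_norm_nonneg)
qed

lemma L2_cmult:
  assumes "f \<in> L2_functions"
  shows "(\<lambda>x. c * f x) \<in> L2_functions" "L2_norm (\<lambda>x. c * f x) = norm c * L2_norm f"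
  using assms by (auto simp: L2_functions_def L2_norm_def norm_mult power_mult_distrib real_sqrt_mult)

lemma L2_add:
  assumes f: "f \<in> L2_functions" and g: "g \<in> L2_functions"
  shows "(\<lambda>x. f x + g x) \<in> L2_functions"
proof -
  have "integrable lborel (\<lambda>x. (norm (f x + g x))\<^sup>2)"
  proof (rule Bochner_Integration.integrable_bound)
    show "integrable lborel (\<lambda>x. 2 * (norm (f x))\<^sup>2 + 2 * (norm (g x))\<^sup>2)"
      by (intro Bochner_Integration.integrable_add integrable_mult_right L2_integrable f g)
    show "AE x in lborel. norm ((norm (f x + g x))\<^sup>2) \<le> norm (2 * (norm (f x))\<^sup>2 + 2 * (norm (g x))\<^sup>2)"
    proof (rule AE_I2)
      fix x
      have "(norm (f x + g x))\<^sup>2 \<le> (norm (f x) + norm (g x))\<^sup>2" by (intro power_mono norm_triangle_ineq) simp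
      also have "\<dots> \<le> 2 * (norm (f x))\<^sup>2 + 2 * (norm (g x))\<^sup>2"
        using sum_squares_bound[of "norm (f x)" "norm (g x)"] by (simp add: power2_sum)
      finally show "norm ((norm (f x + g x))\<^sup>2) \<le> norm (2 * (norm (f x))\<^sup>2 + 2 * (norm (g x))\<^sup>2)" by simp
    qed
  qed (use L2_measurable[OF f] L2_measurable[OF g] in measurable)
  then show ?thesis using L2_measurable[OF f] L2_measurable[OF g] by (simp add: L2_functions_def)
qed

lemma L2_uminus: "f \<in> L2_functions \<Longrightarrow> (\<lambda>x. - f x) \<in> L2_functions"
  using L2_cmult(1)[of f "-1"] by simp

lemma L2_diff: "f \<in> L2_functions \<Longrightarrow> g \<in> L2_functions \<Longrightarrow> (\<lambda>x. f x - g x) \<in> L2_functions"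
  using L2_add[OF _ L2_uminus] by auto

lemma L2_norm_minus_commute: "L2_norm (\<lambda>x. f x - g x) = L2_norm (\<lambda>x. g x - f x)"
  by (simp add: L2_norm_def norm_minus_commute)

lemma ennreal_le_of_square_le:
  assumes "a\<^sup>2 \<le> ennreal (c\<^sup>2)" "0 \<le> c" shows "a \<le> ennreal c"
proof (cases a)
  case (real r)
  then have "r\<^sup>2 \<le> c\<^sup>2" using assms by (simp add: ennreal_power)
  then show ?thesis using real assms(2) by (simp add: abs_le_square_iff[symmetric])
qed (use assms in \<open>auto simp: top_unique\<close>)

lemma borel_measurable_cnj [measurable (raw)]:
  "f \<in> borel_measurable M \<Longrightarrow> (\<lambda>x. cnj (f x)) \<in> borel_measurable M"
  by (rule measurable_compose[of f M borel]) (auto intro!: borel_measurable_continuous_onI continuous_intros)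

text \<open>Derived from the inequality for nonnegative integrals, which needs no integrability in
  advance and therefore also yields that f g is integrable.\<close>

lemma L2_Cauchy_Schwarz:
  assumes f: "f \<in> L2_functions" and g: "g \<in> L2_functions"
  shows "integrable lborel (\<lambda>x. f x * g x)" "(LINT x|lborel. norm (f x * g x)) \<le> L2_norm f * L2_norm g"
    "norm (LINT x|lborel. f x * g x) \<le> L2_norm f * L2_norm g"
proof -
  note [measurable] = L2_measurable[OF f] L2_measurable[OF g]
  have "(\<integral>\<^sup>+x. ennreal (norm (f x * g x)) \<partial>lborel)\<^sup>2 = (\<integral>\<^sup>+x. ennreal (norm (f x)) * ennreal (norm (g x)) \<partial>lborel)\<^sup>2"
    by (simp add: norm_mult ennreal_mult)
  also have "\<dots> \<le> (\<integral>\<^sup>+x. (ennreal (norm (f x)))\<^sup>2 \<partial>lborel) * (\<integral>\<^sup>+x. (ennreal (norm (g x)))\<^sup>2 \<partial>lborel)"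
    by (rule Cauchy_Schwarz_nn_integral) auto
  also have "\<dots> = ennreal ((L2_norm f * L2_norm g)\<^sup>2)"
    using f g by (simp add: ennreal_power L2_nn_integral power_mult_distrib ennreal_mult)
  also have "\<dots> = (ennreal (L2_norm f * L2_norm g))\<^sup>2"
    by (simp add: ennreal_power L2_norm_nonneg)
  finally have le: "(\<integral>\<^sup>+x. ennreal (norm (f x * g x)) \<partial>lborel) \<le> ennreal (L2_norm f * L2_norm g)"
    unfolding ennreal_power[OF mult_nonneg_nonneg[OF L2_norm_nonneg L2_norm_nonneg]]
    by (rule ennreal_le_of_square_le) (simp add: L2_norm_nonneg)
  show i: "integrable lborel (\<lambda>x. f x * g x)"
    by (rule integrableI_bounded) (use le in \<open>auto intro: le_less_trans\<close>)
  have "ennreal (LINT x|lborel. norm (f x * g x)) \<le> ennreal (L2_norm f * L2_norm g)"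
    using le by (subst nn_integral_eq_integral[symmetric]) (auto intro: integrable_norm i)
  then show 1: "(LINT x|lborel. norm (f x * g x)) \<le> L2_norm f * L2_norm g"
    by (subst (asm) ennreal_le_iff) (auto simp: L2_norm_nonneg)
  then show "norm (LINT x|lborel. f x * g x) \<le> L2_norm f * L2_norm g"
    by (rule order_trans[OF integral_norm_bound])
qed

lemma L2_triangle:
  assumes f: "f \<in> L2_functions" and g: "g \<in> L2_functions"
  shows "L2_norm (\<lambda>x. f x + g x) \<le> L2_norm f + L2_norm g"
proof -
  have "(L2_norm (\<lambda>x. f x + g x))\<^sup>2 \<le> (LINT x|lborel. (norm (f x))\<^sup>2 + 2 * norm (f x * g x) + (norm (g x))\<^sup>2)"
    unfolding L2_norm_sq
  proof (rule integral_mono)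
    show "integrable lborel (\<lambda>x. (norm (f x + g x))\<^sup>2)" by (rule L2_integrable[OF L2_add[OF f g]])
    show "integrable lborel (\<lambda>x. (norm (f x))\<^sup>2 + 2 * norm (f x * g x) + (norm (g x))\<^sup>2)"
      by (intro Bochner_Integration.integrable_add integrable_mult_right L2_integrable f g integrable_norm L2_Cauchy_Schwarz)
    fix x
    have "(norm (f x + g x))\<^sup>2 \<le> (norm (f x) + norm (g x))\<^sup>2" by (intro power_mono norm_triangle_ineq) simp
    then show "(norm (f x + g x))\<^sup>2 \<le> (norm (f x))\<^sup>2 + 2 * norm (f x * g x) + (norm (g x))\<^sup>2"
      by (simp add: power2_sum norm_mult)
  qed
  also have "\<dots> = (L2_norm f)\<^sup>2 + 2 * (LINT x|lborel. norm (f x * g x)) + (L2_norm g)\<^sup>2"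
    unfolding L2_norm_sq
    by (subst Bochner_Integration.integral_add Bochner_Integration.integral_mult_right |
      intro Bochner_Integration.integrable_add integrable_mult_right L2_integrable f g integrable_norm L2_Cauchy_Schwarz | simp)+
  also have "\<dots> \<le> (L2_norm f + L2_norm g)\<^sup>2"
    using L2_Cauchy_Schwarz(2)[OF f g] by (simp add: power2_sum)
  finally show ?thesis
    by (rule power2_le_imp_le) (simp add: L2_norm_nonneg)
qed

lemma L2_triangle_diff:
  assumes "f \<in> L2_functions" "g \<in> L2_functions" "h \<in> L2_functions"
  shows "L2_norm (\<lambda>x. f x - h x) \<le> L2_norm (\<lambda>x. f x - g x) + L2_norm (\<lambda>x. g x - h x)"
  using L2_triangle[OF L2_diff[OF assms(1,2)] L2_diff[OF assms(2,3)]] by simp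

lemma L2_norm_diff_bound:
  assumes "f \<in> L2_functions" "g \<in> L2_functions"
  shows "\<bar>L2_norm f - L2_norm g\<bar> \<le> L2_norm (\<lambda>x. f x - g x)"
proof -
  have "L2_norm f \<le> L2_norm (\<lambda>x. f x - g x) + L2_norm g"
    using L2_triangle[OF L2_diff[OF assms] assms(2)] by simp
  moreover have "L2_norm g \<le> L2_norm (\<lambda>x. g x - f x) + L2_norm f"
    using L2_triangle[OF L2_diff[OF assms(2,1)] assms(1)] by simp
  ultimately show ?thesis using L2_norm_minus_commute[of f g] by linarith
qed

lemma L2_norm_zero_AE:
  assumes "f \<in> L2_functions" "L2_norm f = 0" shows "AE x in lborel. f x = 0"
proof -
  have "(LINT x|lborel. (norm (f x))\<^sup>2) = 0" using assms(2) L2_norm_sq[of f] by simp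
  then have "AE x in lborel. (norm (f x))\<^sup>2 = 0"
    by (subst (asm) integral_nonneg_eq_0_iff_AE) (use assms L2_integrable in auto)
  then show ?thesis by simp
qed

section \<open>Density of the test functions in L2\<close>

lemma schwartz_L2:
  assumes f: "f \<in> schwartz_functions" shows "f \<in> L2_functions"
proof -
  have "integrable lborel (\<lambda>x. f x * cnj (f x))"
    by (intro schwartz_integrable schwartz_mult schwartz_cnj f)
  from integrable_norm[OF this] show ?thesis
    using schwartz_measurable[OF f] by (simp add: L2_functions_def norm_mult power2_eq_square)
qed

lemma test_L2: "f \<in> test_functions \<Longrightarrow> f \<in> L2_functions"
  by (intro schwartz_L2 test_imp_schwartz)

text \<open>The closure of the test functions in L2. It is a linear space containing the indicators
  of bounded Borel sets, hence all simple functions cut off to a ball.\<close>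

definition L2_approx :: "(real^'n::finite \<Rightarrow> complex) set" where
  "L2_approx = {f \<in> L2_functions. \<forall>e>0. \<exists>g\<in>test_functions. L2_norm (\<lambda>x. f x - g x) < e}"

lemma L2_approx_add:
  assumes f: "f \<in> L2_approx" and g: "g \<in> L2_approx" shows "(\<lambda>x. f x + g x) \<in> L2_approx"
proof -
  have f2: "f \<in> L2_functions" and g2: "g \<in> L2_functions" using f g by (auto simp: L2_approx_def)
  have "\<exists>h\<in>test_functions. L2_norm (\<lambda>x. f x + g x - h x) < e" if e: "e > 0" for e
  proof -
    have "e/2 > 0" using e by simp
    then obtain p q where p: "p \<in> test_functions" "L2_norm (\<lambda>x. f x - p x) < e/2"
      and q: "q \<in> test_functions" "L2_norm (\<lambda>x. g x - q x) < e/2"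
      using f g unfolding L2_approx_def by blast
    have "L2_norm (\<lambda>x. (f x - p x) + (g x - q x)) \<le> L2_norm (\<lambda>x. f x - p x) + L2_norm (\<lambda>x. g x - q x)"
      by (intro L2_triangle L2_diff f2 g2 test_L2 p q)
    then have "L2_norm (\<lambda>x. f x + g x - (p x + q x)) < e" using p q by (simp add: algebra_simps)
    then show ?thesis by (rule bexI[OF _ test_add[OF p(1) q(1)]])
  qed
  then show ?thesis using L2_add[OF f2 g2] by (auto simp: L2_approx_def)
qed

lemma L2_approx_cmult:
  assumes f: "f \<in> L2_approx" shows "(\<lambda>x. c * f x) \<in> L2_approx"
proof -
  have f2: "f \<in> L2_functions" using f by (auto simp: L2_approx_def)
  have "\<exists>h\<in>test_functions. L2_norm (\<lambda>x. c * f x - h x) < e" if e: "e > 0" for e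
  proof -
    have "e / (norm c + 1) > 0" using e by (simp add: add_nonneg_pos)
    then obtain p where p: "p \<in> test_functions" "L2_norm (\<lambda>x. f x - p x) < e / (norm c + 1)"
      using f unfolding L2_approx_def by blast
    have "L2_norm (\<lambda>x. c * (f x - p x)) = norm c * L2_norm (\<lambda>x. f x - p x)"
      by (intro L2_cmult L2_diff f2 test_L2 p)
    also have "\<dots> \<le> norm c * (e / (norm c + 1))" using p by (intro mult_left_mono) auto
    also have "\<dots> < e"
    proof -
      have "0 < norm c + 1" by (simp add: add_nonneg_pos)
      then show ?thesis using e by (simp add: pos_divide_less_eq algebra_simps)
    qed
    finally have "L2_norm (\<lambda>x. c * f x - c * p x) < e" by (simp add: right_diff_distrib)
    then show ?thesis by (rule bexI[OF _ test_cmult[OF p(1)]])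
  qed
  then show ?thesis using L2_cmult[OF f2] by (auto simp: L2_approx_def)
qed

lemma L2_approx_zero: "(\<lambda>x. 0) \<in> L2_approx"
  unfolding L2_approx_def using test_L2[OF test_zero] by (auto intro!: bexI[OF _ test_zero] simp: L2_norm_def)

lemma L2_approx_sum: "(\<And>i. i \<in> I \<Longrightarrow> f i \<in> L2_approx) \<Longrightarrow> (\<lambda>x. \<Sum>i\<in>I. f i x) \<in> L2_approx"
  by (induction I rule: infinite_finite_induct) (auto intro: L2_approx_add L2_approx_zero)

text \<open>By regularity A lies between a compact T and an open U of almost the same measure. A
  bump that is 1 on T and supported in U differs from the indicator only on U - T, and there by at
  most 1.\<close>

lemma L2_approx_indicator:
  fixes A :: "(real^'n::finite) set"
  assumes A: "A \<in> sets borel" and bA: "bounded A"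
  shows "(\<lambda>x. indicator A x) \<in> L2_approx"
proof -
  have fin: "emeasure lborel A < \<infinity>" using emeasure_bounded_finite[OF bA] .
  have L2: "(\<lambda>x. indicator A x) \<in> L2_functions"
  proof -
    have "integrable lborel (\<lambda>x. indicator A x :: real)" using A fin by simp
    moreover have "(norm (indicator A x :: complex))\<^sup>2 = indicator A x" for x by (simp add: indicator_def)
    ultimately show ?thesis using A by (simp add: L2_functions_def)
  qed
  have "\<exists>h\<in>test_functions. L2_norm (\<lambda>x. indicator A x - h x) < e" if e: "e > 0" for e
  proof -
    \<comment> \<open>Two remainders of measure below e^2/4 bound the squared norm by e^2/2, so the
      norm is at most e / sqrt 2 < e.\<close>
    let ?d = "e\<^sup>2 / 4"
    have d: "?d > 0" using e by simp
    have A': "A \<in> sets lebesgue" using A by simp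
    obtain T where T: "closed T" "T \<subseteq> A" "emeasure lebesgue (A - T) < ennreal ?d"
      using sets_lebesgue_inner_closed[OF A' d] by metis
    obtain U where U: "open U" "A \<subseteq> U" "emeasure lebesgue (U - A) < ennreal ?d"
      using sets_lebesgue_outer_open[OF A' d] by metis
    have "compact T" using T bA by (metis bounded_subset compact_eq_bounded_closed)
    moreover have "T \<subseteq> U" using T U by auto
    ultimately obtain p :: "real^'n \<Rightarrow> real" where p: "(\<lambda>x. complex_of_real (p x)) \<in> test_functions"
      "\<And>x. 0 \<le> p x" "\<And>x. p x \<le> 1" "\<And>x. x \<in> T \<Longrightarrow> p x = 1" "\<And>x. p x \<noteq> 0 \<Longrightarrow> x \<in> U"
      using exists_bump[OF _ U(1)] by blast
    have TU: "T \<in> sets borel" "U \<in> sets borel" using T U by auto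
    have "(\<integral>\<^sup>+x. ennreal ((norm (indicator A x - complex_of_real (p x)))\<^sup>2) \<partial>lborel) \<le> (\<integral>\<^sup>+x. indicator (A - T) x + indicator (U - A) x \<partial>lborel)"
    proof (rule nn_integral_mono)
      fix x
      have "(norm (indicator A x - complex_of_real (p x)))\<^sup>2 \<le> indicator (A - T) x + indicator (U - A) x"
      proof (cases "x \<in> T")
        case True then show ?thesis using p(4) T(2) by (auto simp: indicator_def)
      next
        case F: False
        show ?thesis
        proof (cases "x \<in> A")
          case True
          have "1 - complex_of_real (p x) = complex_of_real (1 - p x)" by simp
          then have "norm (1 - complex_of_real (p x)) = \<bar>1 - p x\<bar>" by (simp only: norm_of_real)
          then have "norm (1 - complex_of_real (p x)) \<le> 1" using p(2,3)[of x] by simp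
          then show ?thesis using True F by (simp add: power_le_one)
        next
          case False
          then show ?thesis using p(2,3,5)[of x] by (cases "p x = 0") (auto simp: power_le_one)
        qed
      qed
      then have "ennreal ((norm (indicator A x - complex_of_real (p x)))\<^sup>2) \<le> ennreal (indicator (A - T) x + indicator (U - A) x)"
        by (rule ennreal_leI)
      also have "\<dots> = indicator (A - T) x + indicator (U - A) x" by (simp add: ennreal_indicator)
      finally show "ennreal ((norm (indicator A x - complex_of_real (p x)))\<^sup>2) \<le> indicator (A - T) x + indicator (U - A) x" .
    qed
    also have "\<dots> = emeasure lborel (A - T) + emeasure lborel (U - A)"
      using A TU by (subst nn_integral_add) auto
    also have "\<dots> \<le> ennreal ?d + ennreal ?d"
      using T U A TU by (intro add_mono) auto
    also have "\<dots> = ennreal (e\<^sup>2 / 2)" using e by (simp flip: ennreal_plus)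
    also have "\<dots> = ennreal ((e / sqrt 2)\<^sup>2)" by (simp add: power_divide)
    finally have "L2_norm (\<lambda>x. indicator A x - complex_of_real (p x)) \<le> e / sqrt 2"
      using e A schwartz_measurable[OF test_imp_schwartz[OF p(1)]] by (intro L2_nn_bound) auto
    also have "\<dots> < e" using e by (simp add: divide_less_eq)
    finally show ?thesis by (rule bexI[OF _ p(1)])
  qed
  with L2 show ?thesis by (auto simp: L2_approx_def)
qed

lemma test_dense_L2:
  assumes f: "f \<in> L2_functions" and e: "e > 0"
  obtains g where "g \<in> test_functions" "L2_norm (\<lambda>x. f x - g x) < e"
proof -
  note [measurable] = L2_measurable[OF f]
  obtain s where s: "\<And>i. simple_function lborel (s i)" "\<And>x. (\<lambda>i. s i x) \<longlonglongrightarrow> f x" "\<And>i x. norm (s i x) \<le> 2 * norm (f x)"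
    using borel_measurable_implies_sequence_metric[of f lborel 0] by auto
  have [measurable]: "s i \<in> borel_measurable borel" for i using borel_measurable_simple_function[OF s(1)] by simp
  \<comment> \<open>The simple functions may have unbounded support; the indicator of a ball makes
    every level set bounded and does not affect the pointwise limit.\<close>
  define t where "t = (\<lambda>i x. indicator (cball 0 (real i)) x * s i x)"
  have [measurable]: "t i \<in> borel_measurable borel" for i
    unfolding t_def by (intro borel_measurable_times borel_measurable_indicator) auto
  have t_approx: "t i \<in> L2_approx" for i
  proof -
    have fin: "finite (range (s i))" using simple_functionD(1)[OF s(1)] by simp
    have "t i = (\<lambda>x. \<Sum>y\<in>range (s i). y * indicator (cball 0 (real i) \<inter> s i -` {y}) x)"
    proof
      fix x
      have "(\<Sum>y\<in>range (s i). y * indicator (cball 0 (real i) \<inter> s i -` {y}) x) =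
         (\<Sum>y\<in>range (s i). if s i x = y then y * indicator (cball 0 (real i)) x else 0)"
        by (rule sum.cong) (auto simp: indicator_def)
      also have "\<dots> = s i x * indicator (cball 0 (real i)) x" using fin by simp
      finally show "t i x = (\<Sum>y\<in>range (s i). y * indicator (cball 0 (real i) \<inter> s i -` {y}) x)"
        by (simp add: t_def mult.commute)
    qed
    also have "\<dots> \<in> L2_approx"
    proof (intro L2_approx_sum L2_approx_cmult L2_approx_indicator)
      fix y
      have "s i -` {y} \<inter> space borel \<in> sets borel" by measurable
      then show "cball 0 (real i) \<inter> s i -` {y} \<in> sets borel" by simp
      show "bounded (cball 0 (real i) \<inter> s i -` {y})" by (simp add: bounded_Int)
    qed
    finally show ?thesis .
  qed
  have t_bound: "norm (t i x) \<le> 2 * norm (f x)" for i x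
    using s(3)[of i x] by (auto simp: t_def indicator_def)
  have t_lim: "(\<lambda>i. t i x) \<longlonglongrightarrow> f x" for x
  proof -
    obtain N where N: "norm x \<le> real N" using real_arch_simple by blast
    have "\<forall>\<^sub>F i in sequentially. s i x = t i x"
      using eventually_ge_at_top[of N] by eventually_elim (use N in \<open>auto simp: t_def indicator_def\<close>)
    from Lim_transform_eventually[OF s(2) this] show ?thesis .
  qed
  have "(\<lambda>i. LINT x|lborel. (norm (f x - t i x))\<^sup>2) \<longlonglongrightarrow> (LINT x|(lborel :: (real^'a) measure). 0)"
  proof (rule integral_dominated_convergence)
    \<comment> \<open>The majorant is (1 + 2)^2 |f|^2, because the approximations are bounded by 2
      |f|.\<close>
    show "integrable lborel (\<lambda>x. 9 * (norm (f x))\<^sup>2)" by (intro integrable_mult_right L2_integrable f)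
    show "AE x in lborel. norm ((norm (f x - t i x))\<^sup>2) \<le> 9 * (norm (f x))\<^sup>2" for i
    proof (rule AE_I2)
      fix x
      have "norm (f x - t i x) \<le> norm (f x) + norm (t i x)" by (rule norm_triangle_ineq4)
      then have "norm (f x - t i x) \<le> 3 * norm (f x)" using t_bound[of i x] by simp
      from power_mono[OF this, of 2] show "norm ((norm (f x - t i x))\<^sup>2) \<le> 9 * (norm (f x))\<^sup>2"
        by (simp add: power_mult_distrib)
    qed
    show "AE x in lborel. (\<lambda>i. (norm (f x - t i x))\<^sup>2) \<longlonglongrightarrow> 0"
    proof (rule AE_I2)
      fix x
      from tendsto_power[OF tendsto_norm[OF tendsto_diff[OF tendsto_const t_lim]], of "f x" x 2]
      show "(\<lambda>i. (norm (f x - t i x))\<^sup>2) \<longlonglongrightarrow> 0" by simp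
    qed
  qed simp_all
  from tendsto_real_sqrt[OF this] have "(\<lambda>i. L2_norm (\<lambda>x. f x - t i x)) \<longlonglongrightarrow> 0"
    by (simp add: L2_norm_def)
  then have "\<forall>\<^sub>F i in sequentially. L2_norm (\<lambda>x. f x - t i x) < e / 2"
    by (rule order_tendstoD) (use e in simp)
  then obtain i where i: "L2_norm (\<lambda>x. f x - t i x) < e / 2" by (auto simp: eventually_sequentially)
  have ti: "t i \<in> L2_functions" using t_approx by (auto simp: L2_approx_def)
  obtain g where g: "g \<in> test_functions" "L2_norm (\<lambda>x. t i x - g x) < e / 2"
    using t_approx[of i] e unfolding L2_approx_def by (auto dest!: spec[of _ "e/2"])
  have "L2_norm (\<lambda>x. f x - g x) \<le> L2_norm (\<lambda>x. f x - t i x) + L2_norm (\<lambda>x. t i x - g x)"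
    by (intro L2_triangle_diff f ti test_L2 g)
  then show ?thesis using that[OF g(1)] i g(2) by simp
qed

text \<open>Pairing f with a test function close to its conjugate gives |f|^2 \<le> |f| e for the L2
  norm and every e > 0. Taking e to be half the norm forces the norm to vanish.\<close>

lemma L2_orthogonal_zero:
  assumes f: "f \<in> L2_functions" and orth: "\<And>\<phi>. \<phi> \<in> schwartz_functions \<Longrightarrow> (LINT x|lborel. f x * \<phi> x) = 0"
  shows "AE x in lborel. f x = 0"
proof -
  have cf: "(\<lambda>x. cnj (f x)) \<in> L2_functions" using f by (auto simp: L2_functions_def intro: borel_measurable_cnj)
  have "(L2_norm f)\<^sup>2 \<le> L2_norm f * e" if e: "e > 0" for e
  proof -
    obtain g where g: "g \<in> test_functions" "L2_norm (\<lambda>x. cnj (f x) - g x) < e"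
      using test_dense_L2[OF cf e] by blast
    have "complex_of_real ((L2_norm f)\<^sup>2) = (LINT x|lborel. f x * cnj (f x))"
      unfolding L2_norm_sq complex_norm_square[symmetric] by (rule integral_complex_of_real[symmetric])
    also have "\<dots> = (LINT x|lborel. f x * (cnj (f x) - g x)) + (LINT x|lborel. f x * g x)"
      by (subst Bochner_Integration.integral_add[symmetric])
        (auto simp: algebra_simps intro!: L2_Cauchy_Schwarz f L2_diff cf test_L2[OF g(1)])
    also have "(LINT x|lborel. f x * g x) = 0" by (rule orth[OF test_imp_schwartz[OF g(1)]])
    finally have "(L2_norm f)\<^sup>2 = norm (LINT x|lborel. f x * (cnj (f x) - g x))"
      by (metis add.right_neutral norm_of_real abs_of_nonneg zero_le_power2)
    also have "\<dots> \<le> L2_norm f * L2_norm (\<lambda>x. cnj (f x) - g x)"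
      by (intro L2_Cauchy_Schwarz f L2_diff cf test_L2[OF g(1)])
    also have "\<dots> \<le> L2_norm f * e" using g(2) by (intro mult_left_mono) (auto simp: L2_norm_nonneg)
    finally show ?thesis .
  qed
  from this[of "L2_norm f / 2"] have "L2_norm f = 0"
    using L2_norm_nonneg[of f] by (cases "L2_norm f = 0") (auto simp: power2_eq_square)
  then show ?thesis by (rule L2_norm_zero_AE[OF f])
qed

text \<open>With d_k the successive differences, the integral of the sum of 2^k |d_k|^2 is at most
  the sum of M^2 / 2^k. Almost everywhere the sum is therefore finite, and 2 |d_k| \<le> 2^k |d_k|^2
  + 2^-k makes the series of the d_k absolutely convergent. Only integrals of squares are used, no
  triangle inequality for infinite sums. Fatou's lemma transfers the bounds to the limit.\<close>

lemma Riesz_Fischer: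
  assumes f: "\<And>k. f k \<in> L2_functions" and M: "M \<ge> 0"
    and d: "\<And>k. L2_norm (\<lambda>x. f (Suc k) x - f k x) \<le> M * (1/2) ^ k"
  obtains F where "F \<in> L2_functions" "\<And>k. L2_norm (\<lambda>x. F x - f k x) \<le> 2 * M * (1/2) ^ k"
proof -
  note [measurable] = L2_measurable[OF f]
  let ?d = "\<lambda>k x. f (Suc k) x - f k x"
  have "(\<integral>\<^sup>+x. (\<Sum>k. ennreal (2 ^ k * (norm (?d k x))\<^sup>2)) \<partial>lborel) = (\<Sum>k. \<integral>\<^sup>+x. ennreal (2 ^ k * (norm (?d k x))\<^sup>2) \<partial>lborel)"
    by (rule nn_integral_suminf) measurable
  also have "\<dots> \<le> (\<Sum>k. ennreal (M\<^sup>2 * (1/2) ^ k))"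
  proof (rule suminf_le)
    fix k
    have "(\<integral>\<^sup>+x. ennreal (2 ^ k * (norm (?d k x))\<^sup>2) \<partial>lborel) = ennreal (2 ^ k) * ennreal ((L2_norm (?d k))\<^sup>2)"
      by (simp add: ennreal_mult nn_integral_cmult L2_nn_integral L2_diff f)
    also have "\<dots> \<le> ennreal (2 ^ k) * ennreal ((M * (1/2) ^ k)\<^sup>2)"
      by (intro mult_left_mono ennreal_leI power_mono d L2_norm_nonneg) auto
    also have "\<dots> = ennreal (M\<^sup>2 * (1/2) ^ k)"
      by (simp add: ennreal_mult[symmetric] power_mult_distrib power2_eq_square power_one_over field_simps)
    finally show "(\<integral>\<^sup>+x. ennreal (2 ^ k * (norm (?d k x))\<^sup>2) \<partial>lborel) \<le> ennreal (M\<^sup>2 * (1/2) ^ k)" .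
  qed auto
  also have "\<dots> < \<infinity>"
  proof -
    have "summable (\<lambda>k. M\<^sup>2 * (1/2::real) ^ k)" by (intro summable_mult summable_geometric) simp
    then show ?thesis by (subst suminf_ennreal2) auto
  qed
  finally have "AE x in lborel. (\<Sum>k. ennreal (2 ^ k * (norm (?d k x))\<^sup>2)) \<noteq> \<infinity>"
    by (intro nn_integral_noteq_infinite) auto
  then have conv: "AE x in lborel. convergent (\<lambda>k. f k x)"
  proof eventually_elim
    fix x assume fin: "(\<Sum>k. ennreal (2 ^ k * (norm (?d k x))\<^sup>2)) \<noteq> \<infinity>"
    have s1: "summable (\<lambda>k. 2 ^ k * (norm (?d k x))\<^sup>2)"
      by (rule summable_suminf_not_top) (use fin in auto)
    have s2: "summable (\<lambda>k. (1/2::real) ^ k)" by (rule summable_geometric) simp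
    have "summable (\<lambda>k. norm (?d k x))"
    proof (rule summable_comparison_test'[OF summable_add[OF s1 s2]])
      fix k
      have "2 * (sqrt (2 ^ k) * norm (?d k x)) * sqrt ((1/2) ^ k) \<le> (sqrt (2 ^ k) * norm (?d k x))\<^sup>2 + (sqrt ((1/2) ^ k))\<^sup>2"
        by (rule sum_squares_bound)
      moreover have "sqrt (2 ^ k) * sqrt ((1/2) ^ k) = 1"
        by (simp add: real_sqrt_mult[symmetric] power_mult_distrib[symmetric])
      moreover have "2 * (sqrt (2 ^ k) * norm (?d k x)) * sqrt ((1/2) ^ k) = 2 * norm (?d k x) * (sqrt (2 ^ k) * sqrt ((1/2) ^ k))"
        by (simp only: mult_ac)
      ultimately have "2 * norm (?d k x) \<le> (sqrt (2 ^ k) * norm (?d k x))\<^sup>2 + (sqrt ((1/2) ^ k))\<^sup>2"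
        by (simp only: mult_1_right)
      then have "2 * norm (?d k x) \<le> 2 ^ k * (norm (?d k x))\<^sup>2 + (1/2) ^ k"
        by (simp add: power_mult_distrib)
      then show "norm (norm (?d k x)) \<le> 2 ^ k * (norm (?d k x))\<^sup>2 + (1/2) ^ k"
        using norm_ge_zero[of "?d k x"] by (simp del: norm_ge_zero)
    qed
    then have "summable (\<lambda>k. ?d k x)" by (rule summable_norm_cancel)
    then have "convergent (\<lambda>n. \<Sum>k<n. ?d k x)" by (simp add: summable_iff_convergent)
    then have "convergent (\<lambda>n. f n x - f 0 x)" using sum_lessThan_telescope[of "\<lambda>n. f n x"] by simp
    then show "convergent (\<lambda>n. f n x)"
      using convergent_add[OF _ convergent_const[of "f 0 x"], of "\<lambda>n. f n x - f 0 x"] by simp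
  qed
  define F where "F = (\<lambda>x. lim (\<lambda>k. f k x))"
  have [measurable]: "F \<in> borel_measurable borel" unfolding F_def by measurable
  \<comment> \<open>The subtracted term makes the induction on m close: adding the next difference
    uses up exactly M / 2^(k+m).\<close>
  have tail: "L2_norm (\<lambda>x. f (k + m) x - f k x) \<le> 2 * M * (1/2) ^ k - 2 * M * (1/2) ^ (k + m)" for k m
  proof (induction m)
    case (Suc m)
    have "L2_norm (\<lambda>x. f (k + Suc m) x - f k x) \<le> L2_norm (?d (k + m)) + L2_norm (\<lambda>x. f (k + m) x - f k x)"
      using L2_triangle_diff[OF f f f, of "Suc (k + m)" k "k + m"] by simp
    also have "\<dots> \<le> M * (1/2) ^ (k + m) + (2 * M * (1/2) ^ k - 2 * M * (1/2) ^ (k + m))"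
      by (intro add_mono d Suc)
    finally show ?case by simp
  qed (simp add: L2_norm_def)
  have F_bound: "(\<integral>\<^sup>+x. ennreal ((norm (F x - f k x))\<^sup>2) \<partial>lborel) \<le> ennreal ((2 * M * (1/2) ^ k)\<^sup>2)" for k
  proof -
    have "(\<integral>\<^sup>+x. ennreal ((norm (F x - f k x))\<^sup>2) \<partial>lborel) = (\<integral>\<^sup>+x. liminf (\<lambda>m. ennreal ((norm (f (k + m) x - f k x))\<^sup>2)) \<partial>lborel)"
    proof (rule nn_integral_cong_AE)
      show "AE x in lborel. ennreal ((norm (F x - f k x))\<^sup>2) = liminf (\<lambda>m. ennreal ((norm (f (k + m) x - f k x))\<^sup>2))"
        using conv
      proof eventually_elim
        fix x assume "convergent (\<lambda>n. f n x)"
        then have "(\<lambda>n. f n x) \<longlonglongrightarrow> F x" unfolding F_def by (simp add: convergent_LIMSEQ_iff)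
        then have "(\<lambda>n. f (n + k) x) \<longlonglongrightarrow> F x" by (rule LIMSEQ_ignore_initial_segment)
        then have "(\<lambda>m. f (k + m) x) \<longlonglongrightarrow> F x" by (simp add: add.commute)
        then have "(\<lambda>m. ennreal ((norm (f (k + m) x - f k x))\<^sup>2)) \<longlonglongrightarrow> ennreal ((norm (F x - f k x))\<^sup>2)"
          by (intro tendsto_ennrealI tendsto_power tendsto_norm tendsto_diff tendsto_const)
        then show "ennreal ((norm (F x - f k x))\<^sup>2) = liminf (\<lambda>m. ennreal ((norm (f (k + m) x - f k x))\<^sup>2))"
          by (rule lim_imp_Liminf[OF trivial_limit_sequentially, symmetric])
      qed
    qed
    also have "\<dots> \<le> liminf (\<lambda>m. \<integral>\<^sup>+x. ennreal ((norm (f (k + m) x - f k x))\<^sup>2) \<partial>lborel)"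
      by (rule nn_integral_liminf) measurable
    also have "\<dots> \<le> limsup (\<lambda>m. \<integral>\<^sup>+x. ennreal ((norm (f (k + m) x - f k x))\<^sup>2) \<partial>lborel)"
      by (rule Liminf_le_Limsup) simp
    also have "\<dots> \<le> ennreal ((2 * M * (1/2) ^ k)\<^sup>2)"
    proof (rule Limsup_bounded, rule always_eventually, rule allI)
      fix m
      have "L2_norm (\<lambda>x. f (k + m) x - f k x) \<le> 2 * M * (1/2) ^ k"
        by (rule order_trans[OF tail]) (use M in simp)
      then show "(\<integral>\<^sup>+x. ennreal ((norm (f (k + m) x - f k x))\<^sup>2) \<partial>lborel) \<le> ennreal ((2 * M * (1/2) ^ k)\<^sup>2)"
        by (subst L2_nn_integral[OF L2_diff[OF f f]]) (intro ennreal_leI power_mono L2_norm_nonneg)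
    qed
    finally show ?thesis .
  qed
  have Fk: "(\<lambda>x. F x - f k x) \<in> L2_functions" "L2_norm (\<lambda>x. F x - f k x) \<le> 2 * M * (1/2) ^ k" for k
    using L2_nn_bound[OF _ F_bound[of k]] M by auto
  have "F \<in> L2_functions" using L2_add[OF Fk(1)[of 0] f[of 0]] by simp
  then show ?thesis using Fk(2) that by blast
qed

text \<open>Extends an operator that multiplies norms by c from Schwartz functions to L2. The limit
  is not named as a value of an operator; it is identified by its pairing with Schwartz functions,
  to which the duality relation passes in the limit. Applied to the transform and to its inverse,
  this is Plancherel's theorem.\<close>

lemma L2_extension:
  assumes A: "\<And>f. f \<in> schwartz_functions \<Longrightarrow> A f \<in> schwartz_functions"
    and A_diff: "\<And>f g. f \<in> schwartz_functions \<Longrightarrow> g \<in> schwartz_functions \<Longrightarrow> A (\<lambda>x. f x - g x) = (\<lambda>x. A f x - A g x)"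
    and B: "\<And>f. f \<in> schwartz_functions \<Longrightarrow> B f \<in> schwartz_functions"
    and iso: "\<And>f. f \<in> schwartz_functions \<Longrightarrow> L2_norm (A f) = c * L2_norm f"
    and dual: "\<And>f g. f \<in> schwartz_functions \<Longrightarrow> g \<in> schwartz_functions \<Longrightarrow> (LINT x|lborel. A f x * g x) = (LINT x|lborel. f x * B g x)"
    and c: "c \<ge> 0" and L: "L \<in> L2_functions"
  obtains F where "F \<in> L2_functions" "L2_norm F = c * L2_norm L"
    "\<And>\<phi>. \<phi> \<in> schwartz_functions \<Longrightarrow> (LINT x|lborel. F x * \<phi> x) = (LINT x|lborel. L x * B \<phi> x)"
proof -
  have "\<forall>k. \<exists>g\<in>test_functions. L2_norm (\<lambda>x. L x - g x) < (1/2) ^ k"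
    using test_dense_L2[OF L] by (metis zero_less_divide_1_iff zero_less_numeral zero_less_power)
  then obtain g where g: "\<And>k. g k \<in> test_functions" "\<And>k. L2_norm (\<lambda>x. L x - g k x) < (1/2) ^ k" by metis
  have gS: "g k \<in> schwartz_functions" for k by (rule test_imp_schwartz[OF g(1)])
  note g2 = schwartz_L2[OF gS] and A2 = schwartz_L2[OF A[OF gS]]
  \<comment> \<open>The factor 2 arises from comparing both neighbouring approximations with
    L.\<close>
  have "L2_norm (\<lambda>x. A (g (Suc k)) x - A (g k) x) \<le> (2 * c) * (1/2) ^ k" for k
  proof -
    have "L2_norm (\<lambda>x. A (g (Suc k)) x - A (g k) x) = c * L2_norm (\<lambda>x. g (Suc k) x - g k x)"
      unfolding A_diff[OF gS gS, symmetric] by (rule iso[OF schwartz_diff[OF gS gS]])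
    also have "L2_norm (\<lambda>x. g (Suc k) x - g k x) \<le> L2_norm (\<lambda>x. g (Suc k) x - L x) + L2_norm (\<lambda>x. L x - g k x)"
      by (rule L2_triangle_diff[OF g2 L g2])
    also have "\<dots> \<le> (1/2) ^ k + (1/2) ^ k"
      using g(2)[of "Suc k"] g(2)[of k] unfolding L2_norm_minus_commute[of _ L]
      by (simp del: power_Suc) (simp add: field_simps)
    finally show ?thesis using c by (simp add: mult_left_mono)
  qed
  from Riesz_Fischer[of "\<lambda>k. A (g k)" "2 * c", OF A2 _ this] c
  obtain F where F: "F \<in> L2_functions" "\<And>k. L2_norm (\<lambda>x. F x - A (g k) x) \<le> 2 * (2 * c) * (1/2) ^ k" by auto
  have half: "(\<lambda>k. C * (1/2) ^ k) \<longlonglongrightarrow> 0" for C :: real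
    using tendsto_mult[OF tendsto_const[of C] LIMSEQ_power_zero[of "1/2::real"]] by simp
  have gL: "(\<lambda>k. L2_norm (\<lambda>x. L x - g k x)) \<longlonglongrightarrow> 0"
    by (rule tendsto_sandwich[OF _ _ tendsto_const half[of 1]])
      (use g(2) in \<open>auto intro!: always_eventually less_imp_le simp: L2_norm_nonneg\<close>)
  have AF: "(\<lambda>k. L2_norm (\<lambda>x. F x - A (g k) x)) \<longlonglongrightarrow> 0"
    by (rule tendsto_sandwich[OF _ _ tendsto_const half[of "2 * (2 * c)"]])
      (rule always_eventually, rule allI, rule L2_norm_nonneg F(2))+
  have norm_conv: "(\<lambda>k. L2_norm (h k)) \<longlonglongrightarrow> L2_norm H" if "(\<lambda>k. L2_norm (\<lambda>x. H x - h k x)) \<longlonglongrightarrow> 0"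
    "H \<in> L2_functions" "\<And>k. h k \<in> L2_functions" for h H
  proof -
    have "(\<lambda>k. L2_norm (h k) - L2_norm H) \<longlonglongrightarrow> 0"
      by (rule Lim_null_comparison[OF _ that(1)])
        (use L2_norm_diff_bound[OF that(2,3)] in \<open>auto intro!: always_eventually simp: abs_minus_commute\<close>)
    then show ?thesis by (rule LIM_zero_cancel)
  qed
  have int_conv: "(\<lambda>k. LINT x|lborel. h k x * \<psi> x) \<longlonglongrightarrow> (LINT x|lborel. H x * \<psi> x)" if "(\<lambda>k. L2_norm (\<lambda>x. H x - h k x)) \<longlonglongrightarrow> 0"
    "H \<in> L2_functions" "\<And>k. h k \<in> L2_functions" "\<psi> \<in> L2_functions" for h H \<psi>
  proof -
    have "(\<lambda>k. (LINT x|lborel. h k x * \<psi> x) - (LINT x|lborel. H x * \<psi> x)) \<longlonglongrightarrow> 0"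
    proof (rule Lim_null_comparison)
      show "\<forall>\<^sub>F k in sequentially. norm ((LINT x|lborel. h k x * \<psi> x) - (LINT x|lborel. H x * \<psi> x)) \<le> L2_norm (\<lambda>x. H x - h k x) * L2_norm \<psi>"
      proof (rule always_eventually, rule allI)
        fix k
        have "(LINT x|lborel. h k x * \<psi> x) - (LINT x|lborel. H x * \<psi> x) = (LINT x|lborel. (h k x - H x) * \<psi> x)"
          by (subst Bochner_Integration.integral_diff[symmetric]) (auto intro: L2_Cauchy_Schwarz that simp: left_diff_distrib)
        also have "norm \<dots> \<le> L2_norm (\<lambda>x. h k x - H x) * L2_norm \<psi>"
          by (intro L2_Cauchy_Schwarz L2_diff that)
        finally show "norm ((LINT x|lborel. h k x * \<psi> x) - (LINT x|lborel. H x * \<psi> x)) \<le> L2_norm (\<lambda>x. H x - h k x) * L2_norm \<psi>"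
          by (simp add: L2_norm_minus_commute[of H])
      qed
      show "(\<lambda>k. L2_norm (\<lambda>x. H x - h k x) * L2_norm \<psi>) \<longlonglongrightarrow> 0"
        using tendsto_mult[OF that(1) tendsto_const[of "L2_norm \<psi>"]] by simp
    qed
    then show ?thesis by (rule LIM_zero_cancel)
  qed
  have "(\<lambda>k. c * L2_norm (g k)) \<longlonglongrightarrow> L2_norm F"
    using norm_conv[OF AF F(1) A2] by (simp add: iso[OF gS])
  moreover have "(\<lambda>k. c * L2_norm (g k)) \<longlonglongrightarrow> c * L2_norm L"
    by (intro tendsto_mult tendsto_const norm_conv gL L g2)
  ultimately have "L2_norm F = c * L2_norm L" by (rule LIMSEQ_unique)
  moreover have "(LINT x|lborel. F x * \<phi> x) = (LINT x|lborel. L x * B \<phi> x)" if \<phi>: "\<phi> \<in> schwartz_functions" for \<phi>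
  proof (rule LIMSEQ_unique)
    show "(\<lambda>k. LINT x|lborel. A (g k) x * \<phi> x) \<longlonglongrightarrow> (LINT x|lborel. F x * \<phi> x)"
      by (intro int_conv AF F A2 schwartz_L2 \<phi>)
    show "(\<lambda>k. LINT x|lborel. A (g k) x * \<phi> x) \<longlonglongrightarrow> (LINT x|lborel. L x * B \<phi> x)"
      unfolding dual[OF gS \<phi>] by (intro int_conv gL L g2 schwartz_L2 B \<phi>)
  qed
  ultimately show ?thesis using F(1) that by blast
qed

text \<open>The conjugate of an inverse transform is a transform up to the factor (2 pi)^n, so the
  multiplication formula moves it onto the other factor, where the two transforms cancel.\<close>

lemma L2_norm_inv_fourier:
  fixes f :: "real^'n::finite \<Rightarrow> complex"
  assumes f: "f \<in> schwartz_functions"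
  shows "L2_norm (inv_fourier f) = (1 / sqrt ((2 * pi) ^ CARD('n))) * L2_norm f"
proof -
  let ?c = "(2 * pi) ^ CARD('n)"
  note S = inv_fourier_schwartz[OF f]
  have "complex_of_real ((L2_norm (inv_fourier f))\<^sup>2) = (LINT x|lborel. inv_fourier f x * cnj (inv_fourier f x))"
    unfolding L2_norm_sq complex_norm_square[symmetric] by (rule integral_complex_of_real[symmetric])
  also have "\<dots> = (LINT x|lborel. inv_fourier f x * fourier (\<lambda>y. cnj (f y)) x) / complex_of_real ?c"
    by (simp add: cnj_inv_fourier)
  also have "(LINT x|lborel. inv_fourier f x * fourier (\<lambda>y. cnj (f y)) x) = (LINT x|lborel. f x * cnj (f x))"
    using fourier_multiplication[OF S schwartz_cnj[OF f]] by (simp add: fourier_inv_fourier[OF f])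
  also have "\<dots> = complex_of_real ((L2_norm f)\<^sup>2)"
    unfolding L2_norm_sq complex_norm_square[symmetric] by (rule integral_complex_of_real)
  finally have "(L2_norm (inv_fourier f))\<^sup>2 = (L2_norm f)\<^sup>2 / ?c"
    by (metis of_real_divide of_real_eq_iff)
  also have "\<dots> = ((1 / sqrt ?c) * L2_norm f)\<^sup>2" by (simp add: power_mult_distrib power_divide)
  finally show ?thesis by (rule power2_eq_imp_eq) (auto simp: L2_norm_nonneg)
qed

lemma L2_norm_fourier:
  fixes f :: "real^'n::finite \<Rightarrow> complex"
  assumes f: "f \<in> schwartz_functions"
  shows "L2_norm (fourier f) = sqrt ((2 * pi) ^ CARD('n)) * L2_norm f"
  using L2_norm_inv_fourier[OF fourier_schwartz[OF f]] by (simp add: inv_fourier_fourier[OF f])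

lemma Plancherel_inv_fourier:
  fixes L :: "real^'n::finite \<Rightarrow> complex"
  assumes "L \<in> L2_functions"
  obtains F where "F \<in> L2_functions" "L2_norm F = (1 / sqrt ((2 * pi) ^ CARD('n))) * L2_norm L"
    "\<And>\<phi>. \<phi> \<in> schwartz_functions \<Longrightarrow> (LINT x|lborel. F x * \<phi> x) = (LINT x|lborel. L x * inv_fourier \<phi> x)"
  by (rule L2_extension[of inv_fourier inv_fourier, OF inv_fourier_schwartz inv_fourier_diff inv_fourier_schwartz
        L2_norm_inv_fourier inv_fourier_multiplication _ assms]) (auto intro: that)

lemma Plancherel_fourier:
  fixes F :: "real^'n::finite \<Rightarrow> complex"
  assumes "F \<in> L2_functions"
  obtains L where "L \<in> L2_functions"
    "\<And>\<phi>. \<phi> \<in> schwartz_functions \<Longrightarrow> (LINT x|lborel. L x * \<phi> x) = (LINT x|lborel. F x * fourier \<phi> x)"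
  by (rule L2_extension[of fourier fourier, OF fourier_schwartz fourier_diff fourier_schwartz
        L2_norm_fourier fourier_multiplication _ assms]) (auto intro: that)

section \<open>A trilinear estimate\<close>

text \<open>A square root with value \<infinity> at \<infinity>, so that the estimates of this part
  can be stated for arbitrary measurable functions without finiteness assumptions.\<close>

definition esqrt :: "ennreal \<Rightarrow> ennreal" where
  "esqrt x = (if x = top then top else ennreal (sqrt (enn2real x)))"

lemma esqrt_sq [simp]: "(esqrt x)\<^sup>2 = x"
  by (cases x) (auto simp: esqrt_def ennreal_power power2_eq_square[of top])

lemma ennreal_square_le_cancel: "(a::ennreal)\<^sup>2 \<le> b\<^sup>2 \<Longrightarrow> a \<le> b"
proof (cases b)
  case (real r)
  assume "a\<^sup>2 \<le> b\<^sup>2"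
  then have "a\<^sup>2 \<le> ennreal (r\<^sup>2)" using real by (simp add: ennreal_power)
  then show ?thesis using ennreal_le_of_square_le[of a r] real by simp
qed simp

lemma esqrt_mult: "esqrt (a * b) = esqrt a * esqrt b"
  by (rule antisym; rule ennreal_square_le_cancel; simp add: power_mult_distrib)

lemma esqrt_eq_top: "esqrt a = top \<longleftrightarrow> a = top"
  by (simp add: esqrt_def)

lemma borel_measurable_esqrt [measurable]: "esqrt \<in> borel_measurable borel"
  unfolding esqrt_def[abs_def] by measurable

lemma nn_integral_convolve_left:
  fixes f k :: "real \<Rightarrow> ennreal"
  assumes [measurable]: "f \<in> borel_measurable borel" "k \<in> borel_measurable borel"
  shows "(\<integral>\<^sup>+x. \<integral>\<^sup>+y. f (x - y) * k x \<partial>lborel \<partial>lborel) = (\<integral>\<^sup>+x. f x \<partial>lborel) * (\<integral>\<^sup>+x. k x \<partial>lborel)"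
proof -
  have "(\<integral>\<^sup>+y. f (x - y) \<partial>lborel) = (\<integral>\<^sup>+y. f y \<partial>lborel)" for x
    using nn_integral_real_affine[of f "-1" x] by simp
  then show ?thesis by (simp add: nn_integral_multc nn_integral_cmult)
qed

lemma nn_integral_convolve_right:
  fixes f k :: "real \<Rightarrow> ennreal"
  assumes [measurable]: "f \<in> borel_measurable borel" "k \<in> borel_measurable borel"
  shows "(\<integral>\<^sup>+x. \<integral>\<^sup>+y. f (x - y) * k y \<partial>lborel \<partial>lborel) = (\<integral>\<^sup>+x. f x \<partial>lborel) * (\<integral>\<^sup>+x. k x \<partial>lborel)"
proof -
  have "(\<integral>\<^sup>+x. f (x - y) \<partial>lborel) = (\<integral>\<^sup>+x. f x \<partial>lborel)" for y
    using nn_integral_real_affine[of f 1 "-y"] by (simp add: add.commute[of "-y"] )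
  moreover have "(\<integral>\<^sup>+x. \<integral>\<^sup>+y. f (x - y) * k y \<partial>lborel \<partial>lborel) = (\<integral>\<^sup>+y. \<integral>\<^sup>+x. f (x - y) * k y \<partial>lborel \<partial>lborel)"
    by (rule lborel_pair.Fubini'[symmetric]) measurable
  ultimately show ?thesis by (simp add: nn_integral_multc nn_integral_cmult)
qed

lemma iterated_Cauchy_Schwarz:
  fixes X Y :: "real \<times> real \<Rightarrow> ennreal"
  assumes [measurable]: "X \<in> borel_measurable (lborel \<Otimes>\<^sub>M lborel)" "Y \<in> borel_measurable (lborel \<Otimes>\<^sub>M lborel)"
    and X: "(\<integral>\<^sup>+x. \<integral>\<^sup>+y. (X (x, y))\<^sup>2 \<partial>lborel \<partial>lborel) = a" and Y: "(\<integral>\<^sup>+x. \<integral>\<^sup>+y. (Y (x, y))\<^sup>2 \<partial>lborel \<partial>lborel) = b"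
  shows "(\<integral>\<^sup>+x. \<integral>\<^sup>+y. X (x, y) * Y (x, y) \<partial>lborel \<partial>lborel) \<le> esqrt a * esqrt b"
proof (rule ennreal_square_le_cancel)
  have "(\<integral>\<^sup>+x. \<integral>\<^sup>+y. X (x, y) * Y (x, y) \<partial>lborel \<partial>lborel) = (\<integral>\<^sup>+z. X z * Y z \<partial>(lborel \<Otimes>\<^sub>M lborel))"
    by (rule lborel.nn_integral_fst) measurable
  also have "\<dots>\<^sup>2 \<le> (\<integral>\<^sup>+z. (X z)\<^sup>2 \<partial>(lborel \<Otimes>\<^sub>M lborel)) * (\<integral>\<^sup>+z. (Y z)\<^sup>2 \<partial>(lborel \<Otimes>\<^sub>M lborel))"
    by (rule Cauchy_Schwarz_nn_integral) measurable
  also have "(\<integral>\<^sup>+z. (X z)\<^sup>2 \<partial>(lborel \<Otimes>\<^sub>M lborel)) = a" unfolding X[symmetric]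
    by (rule lborel.nn_integral_fst[symmetric]) measurable
  also have "(\<integral>\<^sup>+z. (Y z)\<^sup>2 \<partial>(lborel \<Otimes>\<^sub>M lborel)) = b" unfolding Y[symmetric]
    by (rule lborel.nn_integral_fst[symmetric]) measurable
  finally show "(\<integral>\<^sup>+x. \<integral>\<^sup>+y. X (x, y) * Y (x, y) \<partial>lborel \<partial>lborel)\<^sup>2 \<le> (esqrt a * esqrt b)\<^sup>2"
    by (simp add: power_mult_distrib)
qed

text \<open>Any two of x, y, x - y are independent variables. For each of the three summands the
  four functions are grouped into two pairs, each depending on two different ones of these
  variables, with \<alpha> paired with g or h. The square integral of each pair then factors, so
  Cauchy-Schwarz on the plane gives the product of the four norms; the constant 3 counts the
  summands.\<close>

lemma trilinear_1:
  fixes f g h \<alpha> :: "real \<Rightarrow> ennreal"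
  assumes [measurable]: "f \<in> borel_measurable borel" "g \<in> borel_measurable borel" "h \<in> borel_measurable borel"
    "\<alpha> \<in> borel_measurable borel"
  defines "N \<equiv> \<lambda>f. esqrt (\<integral>\<^sup>+x. (f x)\<^sup>2 \<partial>lborel)"
  shows "(\<integral>\<^sup>+x. \<integral>\<^sup>+y. f (x - y) * g y * h x * (\<alpha> x + \<alpha> y + \<alpha> (x - y)) \<partial>lborel \<partial>lborel) \<le> 3 * N \<alpha> * N f * N g * N h"
proof -
  let ?sq = "\<lambda>f. \<integral>\<^sup>+x. (f x :: ennreal)\<^sup>2 \<partial>(lborel :: real measure)"
  have L: "(\<integral>\<^sup>+x. \<integral>\<^sup>+y. (f (x - y) * h x)\<^sup>2 \<partial>lborel \<partial>lborel) = ?sq f * ?sq h"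
    unfolding power_mult_distrib by (rule nn_integral_convolve_left) measurable
  have R: "(\<integral>\<^sup>+x. \<integral>\<^sup>+y. (f (x - y) * g y)\<^sup>2 \<partial>lborel \<partial>lborel) = ?sq f * ?sq g" if [measurable]: "f \<in> borel_measurable borel" for f
    unfolding power_mult_distrib by (rule nn_integral_convolve_right) measurable
  have 1: "(\<integral>\<^sup>+x. \<integral>\<^sup>+y. (f (x - y) * h x) * (g y * \<alpha> x) \<partial>lborel \<partial>lborel) \<le> esqrt (?sq f * ?sq h) * esqrt (?sq g * ?sq \<alpha>)"
    using iterated_Cauchy_Schwarz[of "\<lambda>(x, y). f (x - y) * h x" "\<lambda>(x, y). g y * \<alpha> x", OF _ _ _ refl] L
    by (simp add: power_mult_distrib nn_integral_multc nn_integral_cmult)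
  have 2: "(\<integral>\<^sup>+x. \<integral>\<^sup>+y. (f (x - y) * g y) * (h x * \<alpha> y) \<partial>lborel \<partial>lborel) \<le> esqrt (?sq f * ?sq g) * esqrt (?sq h * ?sq \<alpha>)"
    using iterated_Cauchy_Schwarz[of "\<lambda>(x, y). f (x - y) * g y" "\<lambda>(x, y). h x * \<alpha> y", OF _ _ _ refl] R[of f]
    by (simp add: power_mult_distrib nn_integral_multc nn_integral_cmult)
  have 3: "(\<integral>\<^sup>+x. \<integral>\<^sup>+y. (f (x - y) * h x) * (\<alpha> (x - y) * g y) \<partial>lborel \<partial>lborel) \<le> esqrt (?sq f * ?sq h) * esqrt (?sq \<alpha> * ?sq g)"
    using iterated_Cauchy_Schwarz[of "\<lambda>(x, y). f (x - y) * h x" "\<lambda>(x, y). \<alpha> (x - y) * g y", OF _ _ _ refl] L R[of \<alpha>]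
    by simp
  have "(\<integral>\<^sup>+x. \<integral>\<^sup>+y. f (x - y) * g y * h x * (\<alpha> x + \<alpha> y + \<alpha> (x - y)) \<partial>lborel \<partial>lborel) =
    (\<integral>\<^sup>+x. \<integral>\<^sup>+y. (f (x - y) * h x) * (g y * \<alpha> x) + (f (x - y) * g y) * (h x * \<alpha> y) + (f (x - y) * h x) * (\<alpha> (x - y) * g y) \<partial>lborel \<partial>lborel)"
    by (simp add: distrib_left mult_ac)
  also have "\<dots> = (\<integral>\<^sup>+x. \<integral>\<^sup>+y. (f (x - y) * h x) * (g y * \<alpha> x) \<partial>lborel \<partial>lborel)
     + (\<integral>\<^sup>+x. \<integral>\<^sup>+y. (f (x - y) * g y) * (h x * \<alpha> y) \<partial>lborel \<partial>lborel)
     + (\<integral>\<^sup>+x. \<integral>\<^sup>+y. (f (x - y) * h x) * (\<alpha> (x - y) * g y) \<partial>lborel \<partial>lborel)"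
    by (simp add: nn_integral_add)
  also have "\<dots> \<le> esqrt (?sq f * ?sq h) * esqrt (?sq g * ?sq \<alpha>) + esqrt (?sq f * ?sq g) * esqrt (?sq h * ?sq \<alpha>) + esqrt (?sq f * ?sq h) * esqrt (?sq \<alpha> * ?sq g)"
    by (intro add_mono 1 2 3)
  also have "\<dots> = N \<alpha> * N f * N g * N h + N \<alpha> * N f * N g * N h + N \<alpha> * N f * N g * N h"
    by (simp add: N_def esqrt_mult mult_ac)
  also have "\<dots> = (1 + 1 + 1) * (N \<alpha> * N f * N g * N h)" by (simp only: distrib_right mult_1)
  also have "\<dots> = 3 * N \<alpha> * N f * N g * N h" by (simp add: mult.assoc)
  finally show ?thesis .
qed

text \<open>Induction on the number of coordinates. With all other coordinates frozen, the
  one-dimensional estimate in the new coordinate replaces f, g, h by their partial norms in that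
  coordinate, and the induction hypothesis applies to these. It has to hold for all f, g, h, which
  is why they are quantified in the conclusion.\<close>

lemma trilinear_PiM:
  fixes \<alpha> :: "'i \<Rightarrow> real \<Rightarrow> ennreal"
  assumes I: "finite I" and [measurable]: "\<And>i. \<alpha> i \<in> borel_measurable borel"
  defines "N \<equiv> \<lambda>I f. esqrt (\<integral>\<^sup>+x. (f x)\<^sup>2 \<partial>Pi\<^sub>M I (\<lambda>_. lborel :: real measure))"
  shows "\<And>f g h. f \<in> borel_measurable (Pi\<^sub>M I (\<lambda>_. lborel)) \<Longrightarrow> g \<in> borel_measurable (Pi\<^sub>M I (\<lambda>_. lborel)) \<Longrightarrow>
    h \<in> borel_measurable (Pi\<^sub>M I (\<lambda>_. lborel)) \<Longrightarrow>
    (\<integral>\<^sup>+x. \<integral>\<^sup>+y. f (\<lambda>i\<in>I. x i - y i) * g y * h x * (\<Prod>i\<in>I. \<alpha> i (x i) + \<alpha> i (y i) + \<alpha> i (x i - y i)) \<partial>Pi\<^sub>M I (\<lambda>_. lborel) \<partial>Pi\<^sub>M I (\<lambda>_. lborel))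
    \<le> (\<Prod>i\<in>I. 3 * esqrt (\<integral>\<^sup>+t. (\<alpha> i t)\<^sup>2 \<partial>lborel)) * N I f * N I g * N I h"
  using I
proof (induction I)
  case empty
  have "esqrt (a\<^sup>2) = a" for a by (rule antisym; rule ennreal_square_le_cancel; simp)
  then show ?case by (simp add: N_def lborel_PiM.nn_integral_empty restrict_def)
next
  case (insert i I)
  let ?P = "Pi\<^sub>M I (\<lambda>_. lborel :: real measure)" and ?Q = "Pi\<^sub>M (insert i I) (\<lambda>_. lborel :: real measure)"
  let ?k = "\<lambda>i x y. \<alpha> i x + \<alpha> i y + \<alpha> i (x - y)"
  note [measurable] = insert.prems
  interpret I: finite_product_sigma_finite "\<lambda>_. lborel :: real measure" I by standard fact
  interpret J: finite_product_sigma_finite "\<lambda>_. lborel :: real measure" "insert i I"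
    by standard (use insert.hyps in simp)
  interpret PL: pair_sigma_finite ?P "lborel :: real measure" by standard
  interpret LP: pair_sigma_finite "lborel :: real measure" ?P by standard
  \<comment> \<open>The norm of f in the coordinate i alone, as a function of the remaining ones.
    Its norm over those coordinates is the full norm of f, which is \<open>R_N\<close>
    below.\<close>
  define R where "R = (\<lambda>f z. esqrt (\<integral>\<^sup>+s. (f (z(i := s)))\<^sup>2 \<partial>(lborel :: real measure)) :: ennreal)"
  have upd [measurable]: "(\<lambda>(z, s). f (z(i := s))) \<in> borel_measurable (?P \<Otimes>\<^sub>M lborel)" if "f \<in> borel_measurable ?Q" for f :: "('i \<Rightarrow> real) \<Rightarrow> ennreal"
    using measurable_compose[OF measurable_add_dim that] by (simp add: case_prod_beta')
  have R_meas [measurable]: "R f \<in> borel_measurable ?P" if [measurable]: "f \<in> borel_measurable ?Q" for f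
    unfolding R_def by measurable
  have R_N: "N I (R f) = N (insert i I) f" if [measurable]: "f \<in> borel_measurable ?Q" for f
    unfolding N_def R_def using insert.hyps
    by (subst lborel_PiM.product_nn_integral_insert) simp_all
  have rest: "(\<lambda>j\<in>insert i I. (x(i := s)) j - (y(i := t)) j) = (\<lambda>j\<in>I. x j - y j)(i := s - t)" for x y :: "'i \<Rightarrow> real" and s t
    using insert.hyps by (auto simp: fun_eq_iff restrict_def)
  have prod: "(\<Prod>j\<in>insert i I. ?k j ((x(i := s)) j) ((y(i := t)) j)) = ?k i s t * (\<Prod>j\<in>I. ?k j (x j) (y j))" for x y :: "'i \<Rightarrow> real" and s t
  proof -
    have "(\<Prod>j\<in>I. ?k j ((x(i := s)) j) ((y(i := t)) j)) = (\<Prod>j\<in>I. ?k j (x j) (y j))"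
      by (rule prod.cong) (use insert.hyps in auto)
    then show ?thesis using insert.hyps by simp
  qed
  have "(\<integral>\<^sup>+x. \<integral>\<^sup>+y. f (\<lambda>i\<in>insert i I. x i - y i) * g y * h x * (\<Prod>i\<in>insert i I. ?k i (x i) (y i)) \<partial>?Q \<partial>?Q)
    = (\<integral>\<^sup>+x. \<integral>\<^sup>+s. \<integral>\<^sup>+y. \<integral>\<^sup>+t. f ((\<lambda>j\<in>I. x j - y j)(i := s - t)) * g (y(i := t)) * h (x(i := s)) * (?k i s t * (\<Prod>j\<in>I. ?k j (x j) (y j))) \<partial>lborel \<partial>?P \<partial>lborel \<partial>?P)"
  proof -
    let ?\<Phi> = "\<lambda>x y. f (\<lambda>i\<in>insert i I. x i - y i) * g y * h x * (\<Prod>i\<in>insert i I. ?k i (x i) (y i))"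
    have inner: "(\<integral>\<^sup>+y. ?\<Phi> x y \<partial>?Q) = (\<integral>\<^sup>+y. \<integral>\<^sup>+t. ?\<Phi> x (y(i := t)) \<partial>lborel \<partial>?P)" for x
      by (rule lborel_PiM.product_nn_integral_insert[OF insert.hyps]) measurable
    have "(\<integral>\<^sup>+x. \<integral>\<^sup>+y. ?\<Phi> x y \<partial>?Q \<partial>?Q) = (\<integral>\<^sup>+x. \<integral>\<^sup>+s. \<integral>\<^sup>+y. ?\<Phi> (x(i := s)) y \<partial>?Q \<partial>lborel \<partial>?P)"
      by (rule lborel_PiM.product_nn_integral_insert[OF insert.hyps]) measurable
    then show ?thesis unfolding inner rest prod .
  qed
  also have "\<dots> = (\<integral>\<^sup>+x. \<integral>\<^sup>+y. \<integral>\<^sup>+s. \<integral>\<^sup>+t. f ((\<lambda>j\<in>I. x j - y j)(i := s - t)) * g (y(i := t)) * h (x(i := s)) * (?k i s t * (\<Prod>j\<in>I. ?k j (x j) (y j))) \<partial>lborel \<partial>lborel \<partial>?P \<partial>?P)"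
    by (intro nn_integral_cong, rule PL.Fubini') measurable
  also have "\<dots> \<le> (\<integral>\<^sup>+x. \<integral>\<^sup>+y. (3 * esqrt (\<integral>\<^sup>+t. (\<alpha> i t)\<^sup>2 \<partial>lborel)) * (R f (\<lambda>j\<in>I. x j - y j) * R g y * R h x * (\<Prod>j\<in>I. ?k j (x j) (y j))) \<partial>?P \<partial>?P)"
  proof (intro nn_integral_mono)
    fix x y assume x: "x \<in> space ?P" and y: "y \<in> space ?P"
    have z: "(\<lambda>j\<in>I. x j - y j) \<in> space ?P" by (auto simp: space_PiM)
    have m: "(\<lambda>s. f (z(i := s))) \<in> borel_measurable borel" if "z \<in> space ?P" "f \<in> borel_measurable ?Q" for f :: "('i \<Rightarrow> real) \<Rightarrow> ennreal" and z
      using measurable_Pair2[OF upd[OF that(2)] that(1)] by simp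
    note [measurable] = m[OF z insert.prems(1)] m[OF y insert.prems(2)] m[OF x insert.prems(3)]
    have "(\<integral>\<^sup>+s. \<integral>\<^sup>+t. f ((\<lambda>j\<in>I. x j - y j)(i := s - t)) * g (y(i := t)) * h (x(i := s)) * (?k i s t * (\<Prod>j\<in>I. ?k j (x j) (y j))) \<partial>lborel \<partial>lborel)
      = (\<integral>\<^sup>+s. \<integral>\<^sup>+t. f ((\<lambda>j\<in>I. x j - y j)(i := s - t)) * g (y(i := t)) * h (x(i := s)) * ?k i s t \<partial>lborel \<partial>lborel) * (\<Prod>j\<in>I. ?k j (x j) (y j))"
      by (simp only: mult.assoc[symmetric]) (simp add: nn_integral_multc)
    also have "\<dots> \<le> (3 * esqrt (\<integral>\<^sup>+t. (\<alpha> i t)\<^sup>2 \<partial>lborel) * R f (\<lambda>j\<in>I. x j - y j) * R g y * R h x) * (\<Prod>j\<in>I. ?k j (x j) (y j))"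
      unfolding R_def
      by (intro mult_right_mono trilinear_1[of "\<lambda>s. f ((\<lambda>j\<in>I. x j - y j)(i := s))" "\<lambda>s. g (y(i := s))" "\<lambda>s. h (x(i := s))" "\<alpha> i"]) simp_all
    finally show "(\<integral>\<^sup>+s. \<integral>\<^sup>+t. f ((\<lambda>j\<in>I. x j - y j)(i := s - t)) * g (y(i := t)) * h (x(i := s)) * (?k i s t * (\<Prod>j\<in>I. ?k j (x j) (y j))) \<partial>lborel \<partial>lborel)
      \<le> (3 * esqrt (\<integral>\<^sup>+t. (\<alpha> i t)\<^sup>2 \<partial>lborel)) * (R f (\<lambda>j\<in>I. x j - y j) * R g y * R h x * (\<Prod>j\<in>I. ?k j (x j) (y j)))"
      by (simp only: mult.assoc)
  qed
  also have "\<dots> = (3 * esqrt (\<integral>\<^sup>+t. (\<alpha> i t)\<^sup>2 \<partial>lborel)) * (\<integral>\<^sup>+x. \<integral>\<^sup>+y. R f (\<lambda>j\<in>I. x j - y j) * R g y * R h x * (\<Prod>j\<in>I. ?k j (x j) (y j)) \<partial>?P \<partial>?P)"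
    by (simp add: nn_integral_cmult)
  also have "\<dots> \<le> (3 * esqrt (\<integral>\<^sup>+t. (\<alpha> i t)\<^sup>2 \<partial>lborel)) * ((\<Prod>i\<in>I. 3 * esqrt (\<integral>\<^sup>+t. (\<alpha> i t)\<^sup>2 \<partial>lborel)) * N I (R f) * N I (R g) * N I (R h))"
    by (intro mult_left_mono insert.IH) auto
  also have "\<dots> = (\<Prod>i\<in>insert i I. 3 * esqrt (\<integral>\<^sup>+t. (\<alpha> i t)\<^sup>2 \<partial>lborel)) * N (insert i I) f * N (insert i I) g * N (insert i I) h"
    using insert.hyps insert.prems by (simp add: R_N mult.assoc)
  finally show ?case .
qed

lemma trilinear_vec:
  fixes f g h :: "real^'n::finite \<Rightarrow> ennreal" and \<alpha> :: "'n \<Rightarrow> real \<Rightarrow> ennreal"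
  assumes [measurable]: "f \<in> borel_measurable borel" "g \<in> borel_measurable borel" "h \<in> borel_measurable borel"
    "\<And>i. \<alpha> i \<in> borel_measurable borel"
  defines "N \<equiv> \<lambda>f. esqrt (\<integral>\<^sup>+x. (f x)\<^sup>2 \<partial>(lborel :: (real^'n) measure))"
  shows "(\<integral>\<^sup>+x. \<integral>\<^sup>+y. f (x - y) * g y * h x * (\<Prod>i\<in>UNIV. \<alpha> i (x $ i) + \<alpha> i (y $ i) + \<alpha> i (x $ i - y $ i)) \<partial>lborel \<partial>lborel)
    \<le> (\<Prod>i\<in>UNIV. 3 * esqrt (\<integral>\<^sup>+t. (\<alpha> i t)\<^sup>2 \<partial>lborel)) * N f * N g * N h"
proof -
  let ?P = "Pi\<^sub>M (UNIV :: 'n set) (\<lambda>_. lborel :: real measure)"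
  let ?k = "\<lambda>i x y. \<alpha> i x + \<alpha> i y + \<alpha> i (x - y)"
  have m [measurable]: "(\<lambda>x. f (vec_lambda x)) \<in> borel_measurable ?P" if "f \<in> borel_measurable borel" for f :: "real^'n \<Rightarrow> ennreal"
    by (rule measurable_compose[OF measurable_vec_lambda that])
  have "(\<integral>\<^sup>+x. \<integral>\<^sup>+y. f (x - y) * g y * h x * (\<Prod>i\<in>UNIV. ?k i (x $ i) (y $ i)) \<partial>lborel \<partial>lborel) =
    (\<integral>\<^sup>+x. \<integral>\<^sup>+y. f (vec_lambda x - vec_lambda y) * g (vec_lambda y) * h (vec_lambda x) * (\<Prod>i\<in>UNIV. ?k i (x i) (y i)) \<partial>?P \<partial>?P)"
  proof -
    have inner: "(\<integral>\<^sup>+y. f (x - y) * g y * h x * (\<Prod>i\<in>UNIV. ?k i (x $ i) (y $ i)) \<partial>lborel) =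
      (\<integral>\<^sup>+y. f (x - vec_lambda y) * g (vec_lambda y) * h x * (\<Prod>i\<in>UNIV. ?k i (x $ i) (vec_lambda y $ i)) \<partial>?P)" for x
      by (rule nn_integral_lborel_PiM) measurable
    have "(\<integral>\<^sup>+x. \<integral>\<^sup>+y. f (x - y) * g y * h x * (\<Prod>i\<in>UNIV. ?k i (x $ i) (y $ i)) \<partial>lborel \<partial>lborel) =
      (\<integral>\<^sup>+x. \<integral>\<^sup>+y. f (vec_lambda x - y) * g y * h (vec_lambda x) * (\<Prod>i\<in>UNIV. ?k i (vec_lambda x $ i) (y $ i)) \<partial>lborel \<partial>?P)"
      by (rule nn_integral_lborel_PiM) measurable
    then show ?thesis unfolding inner by (simp only: vec_lambda_beta)
  qed
  also have "\<dots> = (\<integral>\<^sup>+x. \<integral>\<^sup>+y. f (vec_lambda (\<lambda>i\<in>UNIV. x i - y i)) * g (vec_lambda y) * h (vec_lambda x) * (\<Prod>i\<in>UNIV. ?k i (x i) (y i)) \<partial>?P \<partial>?P)"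
  proof (intro nn_integral_cong)
    fix x y :: "'n \<Rightarrow> real"
    have "vec_lambda x - vec_lambda y = vec_lambda (\<lambda>i\<in>UNIV. x i - y i)" by (simp add: vec_eq_iff)
    then show "f (vec_lambda x - vec_lambda y) * g (vec_lambda y) * h (vec_lambda x) * (\<Prod>i\<in>UNIV. ?k i (x i) (y i)) =
      f (vec_lambda (\<lambda>i\<in>UNIV. x i - y i)) * g (vec_lambda y) * h (vec_lambda x) * (\<Prod>i\<in>UNIV. ?k i (x i) (y i))"
      by simp
  qed
  also have "\<dots> \<le> (\<Prod>i\<in>UNIV. 3 * esqrt (\<integral>\<^sup>+t. (\<alpha> i t)\<^sup>2 \<partial>lborel)) * esqrt (\<integral>\<^sup>+x. (f (vec_lambda x))\<^sup>2 \<partial>?P) * esqrt (\<integral>\<^sup>+x. (g (vec_lambda x))\<^sup>2 \<partial>?P) * esqrt (\<integral>\<^sup>+x. (h (vec_lambda x))\<^sup>2 \<partial>?P)"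
    by (rule trilinear_PiM[of UNIV \<alpha> "\<lambda>x. f (vec_lambda x)" "\<lambda>x. g (vec_lambda x)" "\<lambda>x. h (vec_lambda x)"]) (simp_all add: m)
  also have "\<dots> = (\<Prod>i\<in>UNIV. 3 * esqrt (\<integral>\<^sup>+t. (\<alpha> i t)\<^sup>2 \<partial>lborel)) * N f * N g * N h"
  proof -
    have "N f = esqrt (\<integral>\<^sup>+x. (f (vec_lambda x))\<^sup>2 \<partial>?P)" if [measurable]: "f \<in> borel_measurable borel" for f :: "real^'n \<Rightarrow> ennreal"
      unfolding N_def by (rule arg_cong[where f=esqrt], rule nn_integral_lborel_PiM) measurable
    then show ?thesis by simp
  qed
  finally show ?thesis .
qed

text \<open>The estimate for the convolution follows from the trilinear one by testing against the
  truncations \<open>h\<close> of the convolution itself, for which \<open>\<integral> h\<^sup>2\<close> is known to be finite.\<close>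

lemma convolution_bound:
  fixes f g :: "real^'n::finite \<Rightarrow> ennreal" and \<alpha> :: "'n \<Rightarrow> real \<Rightarrow> ennreal"
  assumes [measurable]: "f \<in> borel_measurable borel" "g \<in> borel_measurable borel" "\<And>i. \<alpha> i \<in> borel_measurable borel"
  defines "A \<equiv> (\<Prod>i\<in>UNIV. 3 * esqrt (\<integral>\<^sup>+t. (\<alpha> i t)\<^sup>2 \<partial>lborel))"
  shows "(\<integral>\<^sup>+x. (\<integral>\<^sup>+y. f (x - y) * g y * (\<Prod>i\<in>UNIV. \<alpha> i (x $ i) + \<alpha> i (y $ i) + \<alpha> i (x $ i - y $ i)) \<partial>lborel)\<^sup>2 \<partial>lborel)
    \<le> A\<^sup>2 * (\<integral>\<^sup>+x. (f x)\<^sup>2 \<partial>lborel) * (\<integral>\<^sup>+x. (g x)\<^sup>2 \<partial>lborel)"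
proof -
  let ?k = "\<lambda>x y :: real^'n. \<Prod>i\<in>UNIV. \<alpha> i (x $ i) + \<alpha> i (y $ i) + \<alpha> i (x $ i - y $ i)"
  define Q where "Q = (\<lambda>x. \<integral>\<^sup>+y. f (x - y) * g y * ?k x y \<partial>lborel)"
  define D where "D = A * esqrt (\<integral>\<^sup>+x. (f x)\<^sup>2 \<partial>lborel) * esqrt (\<integral>\<^sup>+x. (g x)\<^sup>2 \<partial>lborel)"
  have [measurable]: "Q \<in> borel_measurable borel" unfolding Q_def by measurable
  define h where "h = (\<lambda>m x. min (Q x) (of_nat m) * indicator (cball 0 (real m)) x)"
  have [measurable]: "cball (0::real^'n) c \<in> sets borel" for c by simp
  have [measurable]: "h m \<in> borel_measurable borel" for m unfolding h_def by measurable
  have h_mono: "h m x \<le> h n x" if "m \<le> n" for m n x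
    using that unfolding h_def by (intro mult_mono min.mono of_nat_mono) (auto simp: indicator_def)
  have bound: "(\<integral>\<^sup>+x. (h m x)\<^sup>2 \<partial>lborel) \<le> D\<^sup>2" for m
  proof -
    let ?n = "\<integral>\<^sup>+x. (h m x)\<^sup>2 \<partial>lborel"
    have "?n \<le> (\<integral>\<^sup>+x. (of_nat m)\<^sup>2 * indicator (cball 0 (real m)) x \<partial>(lborel :: (real^'n) measure))"
      by (intro nn_integral_mono) (auto simp: h_def indicator_def intro!: power_mono)
    also have "\<dots> = (of_nat m)\<^sup>2 * emeasure lborel (cball (0::real^'n) (real m))"
      by (subst nn_integral_cmult) auto
    also have "\<dots> < top"
      using emeasure_bounded_finite[OF bounded_cball, of "0::real^'n" "real m"]
      by (simp add: ennreal_mult_less_top power_less_top_ennreal of_nat_less_top)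
    finally have fin: "?n < top" .
    have "?n \<le> (\<integral>\<^sup>+x. h m x * Q x \<partial>lborel)"
      by (intro nn_integral_mono) (auto simp: h_def indicator_def power2_eq_square intro!: mult_left_mono)
    also have "\<dots> = (\<integral>\<^sup>+x. \<integral>\<^sup>+y. f (x - y) * g y * h m x * ?k x y \<partial>lborel \<partial>lborel)"
      unfolding Q_def by (intro nn_integral_cong, subst nn_integral_cmult[symmetric]) (auto simp: mult_ac intro!: nn_integral_cong)
    also have "\<dots> \<le> D * esqrt ?n"
      unfolding D_def A_def by (rule trilinear_vec) measurable
    finally have le: "?n \<le> D * esqrt ?n" .
    \<comment> \<open>One factor \<open>esqrt ?n\<close> is cancelled from \<open>le\<close>. This
      is legitimate only because the truncation made it finite; the value 0 is treated
      separately.\<close>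
    have "esqrt ?n \<le> D"
    proof (cases "?n = 0")
      case True then show ?thesis by (simp add: esqrt_def)
    next
      case False
      have "esqrt ?n * esqrt ?n \<le> esqrt ?n * D" using le esqrt_sq[of ?n] by (simp add: power2_eq_square mult.commute)
      moreover have "esqrt ?n \<noteq> top" using fin by (simp add: esqrt_eq_top)
      moreover have "esqrt ?n \<noteq> 0" using False esqrt_sq[of ?n] by (metis power_zero_numeral)
      ultimately show ?thesis by (simp add: ennreal_mult_le_mult_iff)
    qed
    then show ?thesis using power_mono[of "esqrt ?n" D 2] by simp
  qed
  have "(\<integral>\<^sup>+x. (Q x)\<^sup>2 \<partial>lborel) = (\<integral>\<^sup>+x. (SUP m. (h m x)\<^sup>2) \<partial>lborel)"
  proof (intro nn_integral_cong)
    fix x :: "real^'n"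
    have inc: "incseq (\<lambda>m. h m x)"
      by (auto simp: incseq_def intro: h_mono)
    have "(\<lambda>m. h m x) \<longlonglongrightarrow> Q x"
    proof -
      obtain N where N: "norm x \<le> real N" using real_arch_simple by blast
      have "\<forall>\<^sub>F m in sequentially. min (Q x) (of_nat m) = h m x"
        using eventually_ge_at_top[of N] by eventually_elim (use N in \<open>auto simp: h_def indicator_def\<close>)
      moreover have "(\<lambda>m. min (Q x) (of_nat m)) \<longlonglongrightarrow> min (Q x) top"
        by (intro tendsto_min tendsto_const of_nat_tendsto_top_ennreal)
      ultimately show ?thesis using Lim_transform_eventually by fastforce
    qed
    then have "(\<lambda>m. (h m x)\<^sup>2) \<longlonglongrightarrow> (Q x)\<^sup>2"
      unfolding power2_eq_square by (intro tendsto_mult_ennreal) auto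
    moreover have "incseq (\<lambda>m. (h m x)\<^sup>2)"
      using inc by (auto simp: incseq_def intro!: power_mono)
    ultimately show "(Q x)\<^sup>2 = (SUP m. (h m x)\<^sup>2)"
      using LIMSEQ_SUP LIMSEQ_unique by blast
  qed
  also have "\<dots> = (SUP m. \<integral>\<^sup>+x. (h m x)\<^sup>2 \<partial>lborel)"
  proof (rule nn_integral_monotone_convergence_SUP)
    show "incseq (\<lambda>m x. (h m x)\<^sup>2)"
      by (auto simp: incseq_def le_fun_def intro!: power_mono h_mono)
  qed measurable
  also have "\<dots> \<le> D\<^sup>2" by (rule SUP_least) (rule bound)
  finally show ?thesis by (simp add: Q_def D_def power_mult_distrib)
qed

section \<open>Convolution of weighted square integrable functions\<close>

text \<open>The sign of r decides which of the two comparisons is used. The constant 4 is the one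
  that occurs later: if u \<le> 2 (v + w) and v \<le> w, then u \<le> 4 w.\<close>

lemma powr_comparable:
  fixes x y r :: real
  assumes "0 < x" "0 < y" "x \<le> 4 * y" "y \<le> 4 * x"
  shows "x powr r \<le> 4 powr \<bar>r\<bar> * y powr r"
proof (cases "r \<ge> 0")
  case True
  have "x powr r \<le> (4 * y) powr r" using assms True by (intro powr_mono2) auto
  also have "\<dots> = 4 powr r * y powr r" using assms by (simp add: powr_mult)
  finally show ?thesis using True by simp
next
  case False
  have "x powr r \<le> (y / 4) powr r" using assms False by (intro powr_mono2') auto
  also have "\<dots> = 4 powr (- r) * y powr r"
    using powr_divide[of y 4 r] powr_minus_divide[of 4 r] assms by simp
  finally show ?thesis using False by simp
qed

text \<open>In the application \<open>u\<close>, \<open>v\<close>, \<open>w\<close> are \<open>1 + |\<xi>\<^sub>l|\<^sup>2\<close>, \<open>1 + |\<eta>\<^sub>l|\<^sup>2\<close> and \<open>1 + |\<xi>\<^sub>l - \<eta>\<^sub>l|\<^sup>2\<close>. The two largest of them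
  are comparable; the cases distinguish which one is the smallest.\<close>

lemma kernel_bound_block:
  fixes u v w s t \<sigma> :: real
  assumes uvw: "1 \<le> u" "1 \<le> v" "1 \<le> w" "u \<le> 2 * (v + w)" "v \<le> 2 * (u + w)" "w \<le> 2 * (u + v)"
    and st: "\<sigma> \<le> s" "\<sigma> \<le> t" "0 \<le> s + t"
  shows "u powr \<sigma> \<le> 4 powr (\<bar>\<sigma>\<bar> + \<bar>s\<bar>) * (w powr s * v powr t * (u powr (- (s + t - \<sigma>)) + v powr (- (s + t - \<sigma>)) + w powr (- (s + t - \<sigma>))))"
proof -
  let ?a = "s + t - \<sigma>"
  have pos: "0 < u" "0 < v" "0 < w" using uvw by auto
  have C: "4 powr \<bar>\<sigma>\<bar> \<le> 4 powr (\<bar>\<sigma>\<bar> + \<bar>s\<bar>)" "4 powr \<bar>s\<bar> \<le> 4 powr (\<bar>\<sigma>\<bar> + \<bar>s\<bar>)" by auto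
  \<comment> \<open>It suffices to dominate by one of the three summands, with a constant below the
    common one.\<close>
  have fin: "u powr \<sigma> \<le> 4 powr (\<bar>\<sigma>\<bar> + \<bar>s\<bar>) * (w powr s * v powr t * (u powr (- ?a) + v powr (- ?a) + w powr (- ?a)))"
    if "u powr \<sigma> \<le> c * (w powr s * v powr t * z powr (- ?a))" "0 \<le> c" "c \<le> 4 powr (\<bar>\<sigma>\<bar> + \<bar>s\<bar>)" "z = u \<or> z = v \<or> z = w" for c z
  proof -
    have "z powr (- ?a) \<le> u powr (- ?a) + v powr (- ?a) + w powr (- ?a)" using that(4) by auto
    then have "c * (w powr s * v powr t * z powr (- ?a)) \<le> 4 powr (\<bar>\<sigma>\<bar> + \<bar>s\<bar>) * (w powr s * v powr t * (u powr (- ?a) + v powr (- ?a) + w powr (- ?a)))"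
      using that by (intro mult_mono) auto
    with that(1) show ?thesis by linarith
  qed
  consider "v \<le> u" "v \<le> w" | "w \<le> u" "w \<le> v" | "u \<le> v" "u \<le> w" by linarith
  then show ?thesis
  proof cases
    case 1
    \<comment> \<open>Here v is the smallest, so u and w are comparable. The exponent \<sigma> - s
      is at most 0, so the surplus power of w may be replaced by the same power of the smaller
      v.\<close>
    have "u powr \<sigma> \<le> 4 powr \<bar>\<sigma>\<bar> * w powr \<sigma>" by (rule powr_comparable) (use 1 uvw in auto)
    also have "w powr \<sigma> = w powr s * w powr (\<sigma> - s)" by (simp flip: powr_add)
    also have "w powr (\<sigma> - s) \<le> v powr (\<sigma> - s)" using 1 pos st by (intro powr_mono2') auto
    also have "v powr (\<sigma> - s) = v powr t * v powr (- ?a)" by (simp flip: powr_add)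
    finally show ?thesis using C pos by (intro fin[of "4 powr \<bar>\<sigma>\<bar>" v]) (auto simp: mult_ac)
  next
    case 2
    have "u powr \<sigma> \<le> 4 powr \<bar>\<sigma>\<bar> * v powr \<sigma>" by (rule powr_comparable) (use 2 uvw in auto)
    also have "v powr \<sigma> = v powr t * v powr (\<sigma> - t)" by (simp flip: powr_add)
    also have "v powr (\<sigma> - t) \<le> w powr (\<sigma> - t)" using 2 pos st by (intro powr_mono2') auto
    also have "w powr (\<sigma> - t) = w powr s * w powr (- ?a)" by (simp flip: powr_add)
    finally show ?thesis using C pos by (intro fin[of "4 powr \<bar>\<sigma>\<bar>" w]) (auto simp: mult_ac)
  next
    case 3
    \<comment> \<open>Here u is the smallest. Passing from u to v in the power s + t needs s + t
      \<ge> 0, and then s is moved from v to the comparable w.\<close>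
    have "u powr \<sigma> = u powr (s + t) * u powr (- ?a)" by (simp flip: powr_add)
    also have "u powr (s + t) \<le> v powr (s + t)" using 3 pos st by (intro powr_mono2) auto
    also have "v powr (s + t) = v powr s * v powr t" by (simp flip: powr_add)
    also have "v powr s \<le> 4 powr \<bar>s\<bar> * w powr s" by (rule powr_comparable) (use 3 uvw in auto)
    finally show ?thesis using C pos by (intro fin[of "4 powr \<bar>s\<bar>" u]) (auto simp: mult_ac)
  qed
qed

text \<open>Expanding the right side gives the three products on the left and further nonnegative
  mixed terms. The index set must be nonempty: the empty products would give 3 on the left and 1 on
  the right.\<close>

lemma prod_add3_le:
  fixes x y z :: "'i \<Rightarrow> real"
  assumes "finite I" "I \<noteq> {}" "\<And>i. 0 \<le> x i" "\<And>i. 0 \<le> y i" "\<And>i. 0 \<le> z i"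
  shows "prod x I + prod y I + prod z I \<le> (\<Prod>i\<in>I. x i + y i + z i)"
  using assms(1,2)
proof (induction I rule: finite_ne_induct)
  case (insert i I)
  have p: "0 \<le> prod x I" "0 \<le> prod y I" "0 \<le> prod z I" using assms by (auto intro: prod_nonneg)
  have "x i * prod x I + y i * prod y I + z i * prod z I \<le> (x i + y i + z i) * (prod x I + prod y I + prod z I)"
    using p assms(3-5)[of i] by (simp add: algebra_simps)
  also have "\<dots> \<le> (x i + y i + z i) * (\<Prod>i\<in>I. x i + y i + z i)"
    using assms(3-5)[of i] by (intro mult_left_mono insert.IH) auto
  finally show ?case using insert.hyps by simp
qed simp

lemma block_norm_triangle: "block_norm b l (x + y) \<le> block_norm b l x + block_norm b l y"
proof -
  have "L2_set (\<lambda>i. (x + y) $ i) {i. b i = l} = L2_set (\<lambda>i. x $ i + y $ i) {i. b i = l}"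
    by (rule L2_set_cong) auto
  then show ?thesis unfolding block_norm_def by (rule ord_eq_le_trans) (rule L2_set_triangle_ineq)
qed

lemma block_norm_uminus: "block_norm b l (- x) = block_norm b l x"
  by (simp add: block_norm_def L2_set_def)

lemma square_triangle:
  fixes a c d :: real
  assumes "0 \<le> a" "a \<le> c + d" "0 \<le> c" "0 \<le> d"
  shows "1 + a\<^sup>2 \<le> 2 * ((1 + c\<^sup>2) + (1 + d\<^sup>2))"
proof -
  have "a\<^sup>2 \<le> (c + d)\<^sup>2" using assms by (intro power_mono) auto
  also have "\<dots> \<le> 2 * c\<^sup>2 + 2 * d\<^sup>2" using sum_squares_bound[of c d] by (simp add: power2_sum)
  finally show ?thesis by simp
qed

text \<open>The power is written as n_l equal factors, one for each coordinate of the block. A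
  coordinate is at most the block norm, so a negative power of the latter is bounded by that of the
  former.\<close>

lemma block_power_le_prod:
  fixes b :: "'n::finite \<Rightarrow> 'j::finite"
  assumes "block_dim b l > 0" and a: "a \<ge> 0"
  shows "(1 + (block_norm b l \<xi>)\<^sup>2) powr (- a) \<le> (\<Prod>i | b i = l. (1 + (\<xi> $ i)\<^sup>2) powr (- (a / real (block_dim b l))))"
proof -
  let ?n = "real (block_dim b l)"
  have "(1 + (block_norm b l \<xi>)\<^sup>2) powr (- a) = ((1 + (block_norm b l \<xi>)\<^sup>2) powr (- (a / ?n))) ^ block_dim b l"
  proof -
    have "0 < (1 + (block_norm b l \<xi>)\<^sup>2) powr (- (a / ?n))" by (simp add: add_pos_nonneg add_nonneg_eq_0_iff)
    from powr_realpow[OF this, of "block_dim b l"] show ?thesis using assms by (simp add: powr_powr)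
  qed
  also have "\<dots> = (\<Prod>i | b i = l. (1 + (block_norm b l \<xi>)\<^sup>2) powr (- (a / ?n)))"
    by (simp add: block_dim_def)
  also have "\<dots> \<le> (\<Prod>i | b i = l. (1 + (\<xi> $ i)\<^sup>2) powr (- (a / ?n)))"
  proof (intro prod_mono conjI powr_mono2')
    fix i assume "i \<in> {i. b i = l}"
    then have "(\<xi> $ i)\<^sup>2 \<le> (block_norm b l \<xi>)\<^sup>2" unfolding block_norm_sq by (intro member_le_sum) auto
    then show "1 + (\<xi> $ i)\<^sup>2 \<le> 1 + (block_norm b l \<xi>)\<^sup>2" by simp
  qed (use assms in \<open>auto simp: add_pos_nonneg\<close>)
  finally show ?thesis .
qed

text \<open>The power \<open>(1 + |\<xi>\<^sub>l|\<^sup>2)\<^bsup>-a\<^sub>l/2\<^esup>\<close> is split evenly among the \<open>n\<^sub>l\<close> coordinates of the block. Each factor is square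
  integrable on the line precisely when \<open>a\<^sub>l > n\<^sub>l / 2\<close>.\<close>

definition coord_weight :: "('n::finite \<Rightarrow> 'j::finite) \<Rightarrow> real^'j \<Rightarrow> 'n \<Rightarrow> real \<Rightarrow> real" where
  "coord_weight b a i t = (1 + t\<^sup>2) powr (- (a $ b i / 2 / real (block_dim b (b i))))"

lemma bracket_pos: "0 < bracket b s \<xi>"
  unfolding bracket_def by (intro prod_pos) (simp add: add_pos_nonneg add_nonneg_eq_0_iff)

text \<open>The block estimate is applied with halved exponents, because \<open>bracket\<close>
  raises 1 + |\<xi>_l|^2 to the power s_l / 2. Surjectivity of b makes every block nonempty, as the
  splitting into coordinates requires.\<close>

lemma bracket_kernel_bound:
  fixes b :: "'n::finite \<Rightarrow> 'j::finite" and s t \<sigma> :: "real^'j"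
  assumes surj: "surj b" and st: "\<And>l. \<sigma> $ l \<le> s $ l" "\<And>l. \<sigma> $ l \<le> t $ l" "\<And>l. 0 \<le> s $ l + t $ l"
  obtains C where "0 \<le> C" "\<And>\<xi> \<eta>. bracket b \<sigma> \<xi> \<le> C * (bracket b s (\<xi> - \<eta>) * bracket b t \<eta> *
    (\<Prod>i\<in>UNIV. coord_weight b (s + t - \<sigma>) i (\<xi> $ i) + coord_weight b (s + t - \<sigma>) i (\<eta> $ i) + coord_weight b (s + t - \<sigma>) i (\<xi> $ i - \<eta> $ i)))"
proof -
  let ?a = "s + t - \<sigma>"
  let ?C = "\<Prod>l\<in>UNIV. 4 powr (\<bar>\<sigma> $ l / 2\<bar> + \<bar>s $ l / 2\<bar>)"
  let ?w = "\<lambda>l \<xi>. 1 + (block_norm b l \<xi>)\<^sup>2"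
  let ?k = "\<lambda>\<xi> \<eta> i. coord_weight b ?a i (\<xi> $ i) + coord_weight b ?a i (\<eta> $ i) + coord_weight b ?a i (\<xi> $ i - \<eta> $ i)"
  have a0: "?a $ l \<ge> 0" for l using st(1)[of l] st(2)[of l] st(3)[of l] by simp
  have dim: "block_dim b l > 0" for l
  proof -
    obtain i where "b i = l" using surj by (metis surjD)
    then show ?thesis by (auto simp: block_dim_def card_gt_0_iff)
  qed
  have main: "bracket b \<sigma> \<xi> \<le> ?C * (bracket b s (\<xi> - \<eta>) * bracket b t \<eta> * (\<Prod>i\<in>UNIV. ?k \<xi> \<eta> i))" for \<xi> \<eta> :: "real^'n"
  proof -
    have "bracket b \<sigma> \<xi> \<le> (\<Prod>l\<in>UNIV. 4 powr (\<bar>\<sigma> $ l / 2\<bar> + \<bar>s $ l / 2\<bar>) * (?w l (\<xi> - \<eta>) powr (s $ l / 2) * ?w l \<eta> powr (t $ l / 2) * (\<Prod>i | b i = l. ?k \<xi> \<eta> i)))"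
      unfolding bracket_def
    proof (intro prod_mono conjI)
      fix l
      have "?w l \<xi> powr (\<sigma> $ l / 2) \<le> 4 powr (\<bar>\<sigma> $ l / 2\<bar> + \<bar>s $ l / 2\<bar>) * (?w l (\<xi> - \<eta>) powr (s $ l / 2) * ?w l \<eta> powr (t $ l / 2) *
         (?w l \<xi> powr (- (s $ l / 2 + t $ l / 2 - \<sigma> $ l / 2)) + ?w l \<eta> powr (- (s $ l / 2 + t $ l / 2 - \<sigma> $ l / 2)) + ?w l (\<xi> - \<eta>) powr (- (s $ l / 2 + t $ l / 2 - \<sigma> $ l / 2))))"
      proof (rule kernel_bound_block)
        note tri = block_norm_triangle[of b l] and nn = block_norm_nonneg[of b l]
        show "?w l \<xi> \<le> 2 * (?w l \<eta> + ?w l (\<xi> - \<eta>))"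
          using tri[of \<eta> "\<xi> - \<eta>"] by (intro square_triangle nn) simp
        show "?w l \<eta> \<le> 2 * (?w l \<xi> + ?w l (\<xi> - \<eta>))"
          using tri[of \<xi> "- (\<xi> - \<eta>)"] block_norm_uminus[of b l "\<xi> - \<eta>"] by (intro square_triangle nn) simp
        show "?w l (\<xi> - \<eta>) \<le> 2 * (?w l \<xi> + ?w l \<eta>)"
          using tri[of \<xi> "- \<eta>"] block_norm_uminus[of b l \<eta>] by (intro square_triangle nn) simp
      qed (use st(1)[of l] st(2)[of l] st(3)[of l] in auto)
      also have "s $ l / 2 + t $ l / 2 - \<sigma> $ l / 2 = ?a $ l / 2" by (simp add: field_simps)
      also have "?w l \<xi> powr (- (?a $ l / 2)) + ?w l \<eta> powr (- (?a $ l / 2)) + ?w l (\<xi> - \<eta>) powr (- (?a $ l / 2))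
        \<le> (\<Prod>i | b i = l. ?k \<xi> \<eta> i)"
      proof -
        have *: "?w l \<zeta> powr (- (?a $ l / 2)) \<le> (\<Prod>i | b i = l. coord_weight b ?a i (\<zeta> $ i))" for \<zeta> :: "real^'n"
        proof -
          have "?w l \<zeta> powr (- (?a $ l / 2)) \<le> (\<Prod>i | b i = l. (1 + (\<zeta> $ i)\<^sup>2) powr (- (?a $ l / 2 / real (block_dim b l))))"
            using a0[of l] dim[of l] by (intro block_power_le_prod) auto
          also have "\<dots> = (\<Prod>i | b i = l. coord_weight b ?a i (\<zeta> $ i))"
            by (rule prod.cong) (auto simp: coord_weight_def)
          finally show ?thesis .
        qed
        have "?w l \<xi> powr (- (?a $ l / 2)) + ?w l \<eta> powr (- (?a $ l / 2)) + ?w l (\<xi> - \<eta>) powr (- (?a $ l / 2)) \<le>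
          (\<Prod>i | b i = l. coord_weight b ?a i (\<xi> $ i)) + (\<Prod>i | b i = l. coord_weight b ?a i (\<eta> $ i)) + (\<Prod>i | b i = l. coord_weight b ?a i ((\<xi> - \<eta>) $ i))"
          by (intro add_mono *)
        also have "\<dots> \<le> (\<Prod>i | b i = l. ?k \<xi> \<eta> i)"
          using dim[of l] unfolding block_dim_def vector_minus_component
          by (intro prod_add3_le) (auto simp: coord_weight_def card_gt_0_iff)
        finally show ?thesis .
      qed
      finally show "?w l \<xi> powr (\<sigma> $ l / 2) \<le> 4 powr (\<bar>\<sigma> $ l / 2\<bar> + \<bar>s $ l / 2\<bar>) * (?w l (\<xi> - \<eta>) powr (s $ l / 2) * ?w l \<eta> powr (t $ l / 2) * (\<Prod>i | b i = l. ?k \<xi> \<eta> i))"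
        by (simp add: mult_left_mono)
    qed simp
    also have "\<dots> = ?C * (bracket b s (\<xi> - \<eta>) * bracket b t \<eta> * (\<Prod>l\<in>UNIV. \<Prod>i | b i = l. ?k \<xi> \<eta> i))"
      unfolding bracket_def by (simp only: prod.distrib)
    \<comment> \<open>The fibres of b partition the coordinates.\<close>
    also have "(\<Prod>l\<in>UNIV. \<Prod>i | b i = l. ?k \<xi> \<eta> i) = (\<Prod>i\<in>UNIV. ?k \<xi> \<eta> i)"
      using prod.group[of "UNIV :: 'n set" "UNIV :: 'j set" b "?k \<xi> \<eta>"] by simp
    finally show ?thesis .
  qed
  have "0 \<le> ?C" by (intro prod_nonneg) simp
  with main that show ?thesis by blast
qed

section \<open>Weighted L2 spaces and their convolution\<close>

lemma bracket_measurable [measurable]: "bracket b s \<in> borel_measurable borel"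
proof -
  have "(\<lambda>\<xi>. Re (complex_of_real (bracket b s \<xi>))) \<in> borel_measurable borel"
    by (intro borel_measurable_continuous_onI continuous_intros continuous_on_Re smooth_continuous)
       (use slow_bracket[of b s] in \<open>simp add: smooth_class_def\<close>)
  then show ?thesis by simp
qed

text \<open>The Fourier image of \<open>H_space b s\<close>. The accompanying
  \<open>weighted_norm\<close> differs from the norm of that space by the Plancherel factor (2
  pi)^(-n/2).\<close>

definition weighted_L2 :: "('n::finite \<Rightarrow> 'j::finite) \<Rightarrow> real^'j \<Rightarrow> (real^'n \<Rightarrow> complex) set" where
  "weighted_L2 b s = {F. (\<lambda>\<xi>. complex_of_real (bracket b s \<xi>) * F \<xi>) \<in> L2_functions}"

definition weighted_norm :: "('n::finite \<Rightarrow> 'j::finite) \<Rightarrow> real^'j \<Rightarrow> (real^'n \<Rightarrow> complex) \<Rightarrow> real" where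
  "weighted_norm b s F = L2_norm (\<lambda>\<xi>. complex_of_real (bracket b s \<xi>) * F \<xi>)"

lemma weighted_measurable:
  assumes "F \<in> weighted_L2 b s" shows "F \<in> borel_measurable borel"
proof -
  have "(\<lambda>\<xi>. (complex_of_real (bracket b s \<xi>) * F \<xi>) / complex_of_real (bracket b s \<xi>)) \<in> borel_measurable borel"
    using L2_measurable[of "\<lambda>\<xi>. complex_of_real (bracket b s \<xi>) * F \<xi>"] assms unfolding weighted_L2_def
    by (intro borel_measurable_divide borel_measurable_of_real bracket_measurable) auto
  moreover have "(complex_of_real (bracket b s \<xi>) * F \<xi>) / complex_of_real (bracket b s \<xi>) = F \<xi>" for \<xi>
    using bracket_pos[of b s \<xi>] by simp
  ultimately show ?thesis by simp
qed

lemma weighted_norm_nonneg: "0 \<le> weighted_norm b s F"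
  by (simp add: weighted_norm_def L2_norm_nonneg)

lemma weighted_add:
  assumes "F \<in> weighted_L2 b s" "G \<in> weighted_L2 b s"
  shows "(\<lambda>\<xi>. F \<xi> + G \<xi>) \<in> weighted_L2 b s" "weighted_norm b s (\<lambda>\<xi>. F \<xi> + G \<xi>) \<le> weighted_norm b s F + weighted_norm b s G"
  using L2_add[of "\<lambda>\<xi>. complex_of_real (bracket b s \<xi>) * F \<xi>" "\<lambda>\<xi>. complex_of_real (bracket b s \<xi>) * G \<xi>"]
    L2_triangle[of "\<lambda>\<xi>. complex_of_real (bracket b s \<xi>) * F \<xi>" "\<lambda>\<xi>. complex_of_real (bracket b s \<xi>) * G \<xi>"] assms
  by (auto simp: weighted_L2_def weighted_norm_def distrib_left)

lemma weighted_cmult: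
  assumes "F \<in> weighted_L2 b s"
  shows "(\<lambda>\<xi>. c * F \<xi>) \<in> weighted_L2 b s" "weighted_norm b s (\<lambda>\<xi>. c * F \<xi>) = norm c * weighted_norm b s F"
  using L2_cmult[of "\<lambda>\<xi>. complex_of_real (bracket b s \<xi>) * F \<xi>" c] assms
  by (auto simp: weighted_L2_def weighted_norm_def mult_ac)

lemma weighted_uminus:
  assumes "F \<in> weighted_L2 b s"
  shows "(\<lambda>\<xi>. - F \<xi>) \<in> weighted_L2 b s" "weighted_norm b s (\<lambda>\<xi>. - F \<xi>) = weighted_norm b s F"
  using weighted_cmult[OF assms, of "-1"] by auto

lemma weighted_diff:
  assumes "F \<in> weighted_L2 b s" "G \<in> weighted_L2 b s"
  shows "(\<lambda>\<xi>. F \<xi> - G \<xi>) \<in> weighted_L2 b s"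
  using weighted_add(1)[OF assms(1) weighted_uminus(1)[OF assms(2)]] by simp

lemma weighted_nn_integral:
  "F \<in> weighted_L2 b s \<Longrightarrow> (\<integral>\<^sup>+\<xi>. (ennreal (bracket b s \<xi>) * ennreal (norm (F \<xi>)))\<^sup>2 \<partial>lborel) = ennreal ((weighted_norm b s F)\<^sup>2)"
  unfolding weighted_norm_def
  by (subst L2_nn_integral[symmetric])
    (auto simp: weighted_L2_def norm_mult ennreal_mult[symmetric] ennreal_power bracket_pos[THEN less_imp_le] abs_of_pos[OF bracket_pos])

definition conv :: "(real^'n::finite \<Rightarrow> complex) \<Rightarrow> (real^'n \<Rightarrow> complex) \<Rightarrow> (real^'n \<Rightarrow> complex)" where
  "conv F G = (\<lambda>\<xi>. LINT \<eta>|lborel. F (\<xi> - \<eta>) * G \<eta>)"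

text \<open>All estimates are made for this convolution of absolute values, which is defined at
  every point. In contrast \<open>conv\<close> has the default value 0 where its integrand fails to
  be integrable, so it is bilinear only where \<open>abs_conv\<close> is finite.\<close>

definition abs_conv :: "(real^'n::finite \<Rightarrow> complex) \<Rightarrow> (real^'n \<Rightarrow> complex) \<Rightarrow> (real^'n \<Rightarrow> ennreal)" where
  "abs_conv F G = (\<lambda>\<xi>. \<integral>\<^sup>+\<eta>. ennreal (norm (F (\<xi> - \<eta>))) * ennreal (norm (G \<eta>)) \<partial>lborel)"

lemma conv_measurable [measurable (raw)]:
  assumes [measurable]: "F \<in> borel_measurable borel" "G \<in> borel_measurable borel"
  shows "conv F G \<in> borel_measurable borel" "abs_conv F G \<in> borel_measurable borel"
  unfolding conv_def abs_conv_def by measurable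

lemma norm_conv_le: "ennreal (norm (conv F G \<xi>)) \<le> abs_conv F G \<xi>"
proof (cases "integrable lborel (\<lambda>\<eta>. F (\<xi> - \<eta>) * G \<eta>)")
  case True
  from integral_norm_bound_ennreal[OF this] show ?thesis
    by (simp add: conv_def abs_conv_def norm_mult ennreal_mult)
qed (simp add: conv_def not_integrable_integral_eq)

lemma abs_conv_finite_integrable:
  assumes [measurable]: "F \<in> borel_measurable borel" "G \<in> borel_measurable borel" and fin: "abs_conv F G \<xi> < \<infinity>"
  shows "integrable lborel (\<lambda>\<eta>. F (\<xi> - \<eta>) * G \<eta>)"
  using fin by (intro integrableI_bounded) (auto simp: abs_conv_def norm_mult ennreal_mult)

text \<open>The kernel bound reduces the claim to \<open>convolution_bound\<close> for f =
  \<open>bracket b s\<close> |F| and g = \<open>bracket b t\<close> |G|, whose L2 norms are the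
  weighted norms of F and G. The strict inequality for the orders makes the constant A
  finite.\<close>

lemma abs_conv_bound:
  fixes b :: "'n::finite \<Rightarrow> 'j::finite" and s t \<sigma> :: "real^'j"
  assumes surj: "surj b" and st: "\<And>l. \<sigma> $ l \<le> s $ l" "\<And>l. \<sigma> $ l \<le> t $ l" "\<And>l. 0 \<le> s $ l + t $ l"
    "\<And>l. real (block_dim b l) / 2 < s $ l + t $ l - \<sigma> $ l"
  obtains C where "0 \<le> C" "\<And>F G. F \<in> weighted_L2 b s \<Longrightarrow> G \<in> weighted_L2 b t \<Longrightarrow>
    (\<integral>\<^sup>+\<xi>. (ennreal (bracket b \<sigma> \<xi>) * abs_conv F G \<xi>)\<^sup>2 \<partial>lborel) \<le> ennreal ((C * weighted_norm b s F * weighted_norm b t G)\<^sup>2)"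
proof -
  let ?a = "s + t - \<sigma>"
  obtain C where C: "0 \<le> C" "\<And>\<xi> \<eta>. bracket b \<sigma> \<xi> \<le> C * (bracket b s (\<xi> - \<eta>) * bracket b t \<eta> *
    (\<Prod>i\<in>UNIV. coord_weight b ?a i (\<xi> $ i) + coord_weight b ?a i (\<eta> $ i) + coord_weight b ?a i (\<xi> $ i - \<eta> $ i)))"
    using bracket_kernel_bound[OF surj, of \<sigma> s t] st by blast
  define \<alpha> where "\<alpha> = (\<lambda>i t. ennreal (coord_weight b ?a i t))"
  have [measurable]: "\<alpha> i \<in> borel_measurable borel" for i unfolding \<alpha>_def coord_weight_def by measurable
  define A where "A = (\<Prod>i\<in>UNIV. 3 * esqrt (\<integral>\<^sup>+t. (\<alpha> i t)\<^sup>2 \<partial>lborel))"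
  have "(\<integral>\<^sup>+t. (\<alpha> i t)\<^sup>2 \<partial>lborel) < \<infinity>" for i
  proof -
    \<comment> \<open>Squaring the coordinate weight doubles its exponent to a_l / n_l, and a_l >
      n_l / 2 says exactly that this exceeds 1/2.\<close>
    let ?c = "?a $ b i / real (block_dim b (b i))"
    have dim: "block_dim b (b i) > 0" by (auto simp: block_dim_def card_gt_0_iff)
    have "(\<alpha> i t)\<^sup>2 = ennreal ((1 + t\<^sup>2) powr (- ?c))" for t
    proof -
      have "(coord_weight b ?a i t)\<^sup>2 = (1 + t\<^sup>2) powr (- (?a $ b i / 2 / real (block_dim b (b i))) + - (?a $ b i / 2 / real (block_dim b (b i))))"
        unfolding powr_add coord_weight_def by (rule power2_eq_square)
      also have "- (?a $ b i / 2 / real (block_dim b (b i))) + - (?a $ b i / 2 / real (block_dim b (b i))) = - ?c"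
      proof -
        have "- (x / 2 / n) + - (x / 2 / n) = - (x / n)" for x n :: real
          by (cases "n = 0") (auto simp: field_simps)
        then show ?thesis .
      qed
      finally show ?thesis by (simp add: \<alpha>_def ennreal_power coord_weight_def)
    qed
    moreover have "?c > 1/2" using st(4)[of "b i"] dim by (simp add: field_simps)
    ultimately show ?thesis using nn_integral_weight_finite[of ?c] by simp
  qed
  then have "A < top" unfolding A_def by (auto simp: less_top[symmetric] ennreal_prod_eq_top esqrt_eq_top ennreal_mult_eq_top_iff)
  then obtain A' where A': "A = ennreal A'" "0 \<le> A'" by (cases A) auto
  have "(\<integral>\<^sup>+\<xi>. (ennreal (bracket b \<sigma> \<xi>) * abs_conv F G \<xi>)\<^sup>2 \<partial>lborel) \<le> ennreal (((C * A') * weighted_norm b s F * weighted_norm b t G)\<^sup>2)"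
    if F: "F \<in> weighted_L2 b s" and G: "G \<in> weighted_L2 b t" for F G
  proof -
    note [measurable] = weighted_measurable[OF F] weighted_measurable[OF G]
    let ?k = "\<lambda>\<xi> \<eta>. \<Prod>i\<in>UNIV. \<alpha> i (\<xi> $ i) + \<alpha> i (\<eta> $ i) + \<alpha> i (\<xi> $ i - \<eta> $ i)"
    define f where "f = (\<lambda>\<xi>. ennreal (bracket b s \<xi>) * ennreal (norm (F \<xi>)))"
    define g where "g = (\<lambda>\<xi>. ennreal (bracket b t \<xi>) * ennreal (norm (G \<xi>)))"
    have [measurable]: "f \<in> borel_measurable borel" "g \<in> borel_measurable borel" unfolding f_def g_def by measurable
    have le: "ennreal (bracket b \<sigma> \<xi>) * abs_conv F G \<xi> \<le> ennreal C * (\<integral>\<^sup>+\<eta>. f (\<xi> - \<eta>) * g \<eta> * ?k \<xi> \<eta> \<partial>lborel)" for \<xi>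
    proof -
      have "ennreal (bracket b \<sigma> \<xi>) * abs_conv F G \<xi> = (\<integral>\<^sup>+\<eta>. ennreal (bracket b \<sigma> \<xi>) * (ennreal (norm (F (\<xi> - \<eta>))) * ennreal (norm (G \<eta>))) \<partial>lborel)"
        unfolding abs_conv_def by (rule nn_integral_cmult[symmetric]) measurable
      also have "\<dots> \<le> (\<integral>\<^sup>+\<eta>. ennreal C * (f (\<xi> - \<eta>) * g \<eta> * ?k \<xi> \<eta>) \<partial>lborel)"
      proof (rule nn_integral_mono)
        fix \<eta>
        have k: "?k \<xi> \<eta> = ennreal (\<Prod>i\<in>UNIV. coord_weight b ?a i (\<xi> $ i) + coord_weight b ?a i (\<eta> $ i) + coord_weight b ?a i (\<xi> $ i - \<eta> $ i))"
          unfolding \<alpha>_def by (subst prod_ennreal[symmetric]) (auto simp: coord_weight_def)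
        have "ennreal (bracket b \<sigma> \<xi>) \<le> ennreal (C * (bracket b s (\<xi> - \<eta>) * bracket b t \<eta> *
          (\<Prod>i\<in>UNIV. coord_weight b ?a i (\<xi> $ i) + coord_weight b ?a i (\<eta> $ i) + coord_weight b ?a i (\<xi> $ i - \<eta> $ i))))"
          by (rule ennreal_leI[OF C(2)])
        also have "\<dots> = ennreal C * (ennreal (bracket b s (\<xi> - \<eta>)) * ennreal (bracket b t \<eta>) * ?k \<xi> \<eta>)"
          unfolding k by (simp add: ennreal_mult ennreal_mult' ennreal_mult'' C(1) bracket_pos[THEN less_imp_le] prod_nonneg coord_weight_def)
        finally have "ennreal (bracket b \<sigma> \<xi>) * (ennreal (norm (F (\<xi> - \<eta>))) * ennreal (norm (G \<eta>))) \<le>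
          ennreal C * (ennreal (bracket b s (\<xi> - \<eta>)) * ennreal (bracket b t \<eta>) * ?k \<xi> \<eta>) * (ennreal (norm (F (\<xi> - \<eta>))) * ennreal (norm (G \<eta>)))"
          by (rule mult_right_mono) simp
        then show "ennreal (bracket b \<sigma> \<xi>) * (ennreal (norm (F (\<xi> - \<eta>))) * ennreal (norm (G \<eta>))) \<le> ennreal C * (f (\<xi> - \<eta>) * g \<eta> * ?k \<xi> \<eta>)"
          by (simp add: f_def g_def mult_ac)
      qed
      also have "\<dots> = ennreal C * (\<integral>\<^sup>+\<eta>. f (\<xi> - \<eta>) * g \<eta> * ?k \<xi> \<eta> \<partial>lborel)"
        by (rule nn_integral_cmult) measurable
      finally show ?thesis .
    qed
    have "(\<integral>\<^sup>+\<xi>. (ennreal (bracket b \<sigma> \<xi>) * abs_conv F G \<xi>)\<^sup>2 \<partial>lborel) \<le> (\<integral>\<^sup>+\<xi>. (ennreal C)\<^sup>2 * (\<integral>\<^sup>+\<eta>. f (\<xi> - \<eta>) * g \<eta> * ?k \<xi> \<eta> \<partial>lborel)\<^sup>2 \<partial>lborel)"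
      unfolding power_mult_distrib[symmetric] by (intro nn_integral_mono power_mono le) auto
    also have "\<dots> = (ennreal C)\<^sup>2 * (\<integral>\<^sup>+\<xi>. (\<integral>\<^sup>+\<eta>. f (\<xi> - \<eta>) * g \<eta> * ?k \<xi> \<eta> \<partial>lborel)\<^sup>2 \<partial>lborel)"
      by (rule nn_integral_cmult) measurable
    also have "\<dots> \<le> (ennreal C)\<^sup>2 * (A\<^sup>2 * (\<integral>\<^sup>+x. (f x)\<^sup>2 \<partial>lborel) * (\<integral>\<^sup>+x. (g x)\<^sup>2 \<partial>lborel))"
      unfolding A_def by (intro mult_left_mono convolution_bound) auto
    also have "\<dots> = ennreal (((C * A') * weighted_norm b s F * weighted_norm b t G)\<^sup>2)"
      unfolding f_def g_def weighted_nn_integral[OF F] weighted_nn_integral[OF G] A'(1)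
      using C(1) A'(2) by (simp add: ennreal_power ennreal_mult[symmetric] weighted_norm_nonneg power_mult_distrib mult_ac)
    finally show ?thesis .
  qed
  moreover have "0 \<le> C * A'" using C(1) A'(2) by simp
  ultimately show ?thesis using that by blast
qed

text \<open>Bounds for \<open>abs_conv\<close> pass to \<open>conv\<close> because
  |\<open>conv\<close>| \<le> \<open>abs_conv\<close> everywhere, also at points with the default
  value. Finiteness almost everywhere follows from the finite weighted integral, the weight being
  positive.\<close>

lemma conv_bound:
  assumes m: "F \<in> borel_measurable borel" "G \<in> borel_measurable borel" and c: "0 \<le> c"
    and le: "(\<integral>\<^sup>+\<xi>. (ennreal (bracket b \<sigma> \<xi>) * abs_conv F G \<xi>)\<^sup>2 \<partial>lborel) \<le> ennreal (c\<^sup>2)"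
  shows "conv F G \<in> weighted_L2 b \<sigma>" "weighted_norm b \<sigma> (conv F G) \<le> c" "AE \<xi> in lborel. abs_conv F G \<xi> < \<infinity>"
proof -
  note [measurable] = m
  have "(\<integral>\<^sup>+\<xi>. ennreal ((norm (complex_of_real (bracket b \<sigma> \<xi>) * conv F G \<xi>))\<^sup>2) \<partial>lborel) \<le>
    (\<integral>\<^sup>+\<xi>. (ennreal (bracket b \<sigma> \<xi>) * abs_conv F G \<xi>)\<^sup>2 \<partial>lborel)"
  proof (rule nn_integral_mono)
    fix \<xi>
    have "ennreal ((norm (complex_of_real (bracket b \<sigma> \<xi>) * conv F G \<xi>))\<^sup>2) = (ennreal (bracket b \<sigma> \<xi>) * ennreal (norm (conv F G \<xi>)))\<^sup>2"
      by (simp add: norm_mult ennreal_power[symmetric] ennreal_mult abs_of_pos[OF bracket_pos] bracket_pos[THEN less_imp_le])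
    also have "\<dots> \<le> (ennreal (bracket b \<sigma> \<xi>) * abs_conv F G \<xi>)\<^sup>2"
      by (intro power_mono mult_left_mono norm_conv_le) auto
    finally show "ennreal ((norm (complex_of_real (bracket b \<sigma> \<xi>) * conv F G \<xi>))\<^sup>2) \<le> (ennreal (bracket b \<sigma> \<xi>) * abs_conv F G \<xi>)\<^sup>2" .
  qed
  also note le
  finally have le': "(\<integral>\<^sup>+\<xi>. ennreal ((norm (complex_of_real (bracket b \<sigma> \<xi>) * conv F G \<xi>))\<^sup>2) \<partial>lborel) \<le> ennreal (c\<^sup>2)" .
  from L2_nn_bound[OF _ le' c] show "conv F G \<in> weighted_L2 b \<sigma>" "weighted_norm b \<sigma> (conv F G) \<le> c"
    by (auto simp: weighted_L2_def weighted_norm_def)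
  have "AE \<xi> in lborel. (ennreal (bracket b \<sigma> \<xi>) * abs_conv F G \<xi>)\<^sup>2 \<noteq> \<infinity>"
    by (intro nn_integral_noteq_infinite) (use le in \<open>auto simp: top_unique\<close>)
  then show "AE \<xi> in lborel. abs_conv F G \<xi> < \<infinity>"
  proof eventually_elim
    fix \<xi> assume "(ennreal (bracket b \<sigma> \<xi>) * abs_conv F G \<xi>)\<^sup>2 \<noteq> \<infinity>"
    then have "ennreal (bracket b \<sigma> \<xi>) * abs_conv F G \<xi> \<noteq> top" by (auto simp: power2_eq_square)
    then show "abs_conv F G \<xi> < \<infinity>"
      using bracket_pos[of b \<sigma> \<xi>] by (auto simp: less_top[symmetric] ennreal_mult_eq_top_iff)
  qed
qed

lemma bracket_uminus: "bracket b (- s) \<xi> = 1 / bracket b s \<xi>"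
  by (simp add: bracket_def powr_minus_divide prod_dividef)

lemma bracket_cancel: "complex_of_real (bracket b (- s) \<xi>) * complex_of_real (bracket b s \<xi>) = 1"
  using bracket_pos[of b s \<xi>] by (simp add: bracket_uminus)

lemma schwartz_bracket_mult:
  "f \<in> schwartz_functions \<Longrightarrow> (\<lambda>\<xi>. complex_of_real (bracket b s \<xi>) * f \<xi>) \<in> schwartz_functions"
  by (rule schwartz_slow_mult[OF slow_bracket])

lemma schwartz_weighted_L2: "f \<in> schwartz_functions \<Longrightarrow> f \<in> weighted_L2 b s"
  unfolding weighted_L2_def by (simp add: schwartz_L2 schwartz_bracket_mult)

text \<open>The spaces of order s and -s are dual: the two brackets multiply to 1, and
  Cauchy-Schwarz applies to the weighted functions.\<close>

lemma weighted_pairing: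
  assumes G: "G \<in> weighted_L2 b s" and \<psi>: "\<psi> \<in> weighted_L2 b (- s)"
  shows "integrable lborel (\<lambda>\<xi>. G \<xi> * \<psi> \<xi>)" "norm (LINT \<xi>|lborel. G \<xi> * \<psi> \<xi>) \<le> weighted_norm b s G * weighted_norm b (- s) \<psi>"
proof -
  have eq: "G \<xi> * \<psi> \<xi> = (complex_of_real (bracket b s \<xi>) * G \<xi>) * (complex_of_real (bracket b (- s) \<xi>) * \<psi> \<xi>)" for \<xi>
  proof -
    have "(complex_of_real (bracket b s \<xi>) * G \<xi>) * (complex_of_real (bracket b (- s) \<xi>) * \<psi> \<xi>) =
      (complex_of_real (bracket b (- s) \<xi>) * complex_of_real (bracket b s \<xi>)) * (G \<xi> * \<psi> \<xi>)" by (simp only: mult_ac)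
    then show ?thesis by (simp only: bracket_cancel mult_1)
  qed
  show "integrable lborel (\<lambda>\<xi>. G \<xi> * \<psi> \<xi>)" "norm (LINT \<xi>|lborel. G \<xi> * \<psi> \<xi>) \<le> weighted_norm b s G * weighted_norm b (- s) \<psi>"
    unfolding eq weighted_norm_def
    by (rule L2_Cauchy_Schwarz; use G \<psi> in \<open>simp add: weighted_L2_def\<close>)+
qed

text \<open>Multiplication by the bracket preserves the Schwartz functions, so the unweighted
  statement applies to \<open>bracket b s\<close> times G.\<close>

lemma weighted_orthogonal_zero:
  assumes G: "G \<in> weighted_L2 b s" and orth: "\<And>\<phi>. \<phi> \<in> schwartz_functions \<Longrightarrow> (LINT \<xi>|lborel. G \<xi> * \<phi> \<xi>) = 0"
  shows "AE \<xi> in lborel. G \<xi> = 0"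
proof -
  have "AE \<xi> in lborel. complex_of_real (bracket b s \<xi>) * G \<xi> = 0"
  proof (rule L2_orthogonal_zero)
    show "(\<lambda>\<xi>. complex_of_real (bracket b s \<xi>) * G \<xi>) \<in> L2_functions" using G by (simp add: weighted_L2_def)
    fix \<phi> :: "real^'a \<Rightarrow> complex" assume "\<phi> \<in> schwartz_functions"
    from orth[OF schwartz_bracket_mult[OF this]] show "(LINT \<xi>|lborel. complex_of_real (bracket b s \<xi>) * G \<xi> * \<phi> \<xi>) = 0"
      by (simp add: mult_ac)
  qed
  then show ?thesis using bracket_pos[of b s] by (simp add: less_imp_neq[symmetric])
qed

section \<open>The spaces \<open>\<H>\<^sup>s\<close> on the Fourier side\<close>

text \<open>\<open>of_transform G\<close> is the tempered distribution whose Fourier transform is the function \<open>G\<close>.\<close>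

definition of_transform :: "(real^'n::finite \<Rightarrow> complex) \<Rightarrow> 'n functional" where
  "of_transform G = (\<lambda>\<psi>\<in>schwartz_functions. LINT \<xi>|lborel. G \<xi> * inv_fourier \<psi> \<xi>)"

lemma of_transform_cong_AE:
  assumes "F \<in> borel_measurable borel" "G \<in> borel_measurable borel" "AE \<xi> in lborel. F \<xi> = G \<xi>"
  shows "of_transform F = of_transform G"
proof -
  have "(LINT \<xi>|lborel. F \<xi> * inv_fourier \<psi> \<xi>) = (LINT \<xi>|lborel. G \<xi> * inv_fourier \<psi> \<xi>)" if "\<psi> \<in> schwartz_functions" for \<psi>
    using assms schwartz_measurable[OF inv_fourier_schwartz[OF that]] by (intro integral_cong_AE) auto
  then show ?thesis unfolding of_transform_def by (intro restrict_ext) auto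
qed

lemma of_transform_linear:
  assumes F: "F \<in> weighted_L2 b s" and G: "G \<in> weighted_L2 b s" and \<psi>: "\<psi> \<in> schwartz_functions"
  shows "of_transform (\<lambda>\<xi>. a * F \<xi> + c * G \<xi>) \<psi> = a * of_transform F \<psi> + c * of_transform G \<psi>"
proof -
  have i: "integrable lborel (\<lambda>\<xi>. H \<xi> * inv_fourier \<psi> \<xi>)" if "H \<in> weighted_L2 b s" for H
    using that by (rule weighted_pairing) (intro schwartz_weighted_L2 inv_fourier_schwartz \<psi>)
  have "(LINT \<xi>|lborel. (a * F \<xi> + c * G \<xi>) * inv_fourier \<psi> \<xi>) = (LINT \<xi>|lborel. a * (F \<xi> * inv_fourier \<psi> \<xi>) + c * (G \<xi> * inv_fourier \<psi> \<xi>))"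
    by (simp add: algebra_simps)
  also have "\<dots> = a * (LINT \<xi>|lborel. F \<xi> * inv_fourier \<psi> \<xi>) + c * (LINT \<xi>|lborel. G \<xi> * inv_fourier \<psi> \<xi>)"
    by (subst Bochner_Integration.integral_add) (use i[OF F] i[OF G] in auto)
  finally show ?thesis using \<psi> by (simp add: of_transform_def)
qed

lemma tempered_diff_of_transform:
  assumes F: "F \<in> weighted_L2 b s" and G: "G \<in> weighted_L2 b s"
  shows "tempered_diff (of_transform F) (of_transform G) = of_transform (\<lambda>\<xi>. F \<xi> - G \<xi>)"
proof
  fix \<psi>
  show "tempered_diff (of_transform F) (of_transform G) \<psi> = of_transform (\<lambda>\<xi>. F \<xi> - G \<xi>) \<psi>"
    using of_transform_linear[OF F G, of \<psi> 1 "-1"]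
    by (cases "\<psi> \<in> schwartz_functions") (auto simp: tempered_diff_def of_transform_def)
qed

section \<open>Bounds by Schwartz seminorms\<close>

definition schwartz_seminorm :: "nat \<Rightarrow> (real^'n::finite \<Rightarrow> complex) \<Rightarrow> real" where
  "schwartz_seminorm N f = (\<Sum>is | length is \<le> N. SUP x. (1 + norm x) ^ N * norm (partial_derivs is f x))"

lemma finite_length_le: "finite {is :: 'n::finite list. length is \<le> N}"
  using finite_lists_length_le[of "UNIV :: 'n set" N] by simp

lemma partial_derivs_le_seminorm:
  fixes f :: "real^'n::finite \<Rightarrow> complex"
  assumes f: "f \<in> schwartz_functions" and "length is \<le> N"
  shows "(1 + norm x) ^ N * norm (partial_derivs is f x) \<le> schwartz_seminorm N f"
proof -
  have bdd: "bdd_above (range (\<lambda>x. (1 + norm x) ^ N * norm (partial_derivs is f x)))" for "is"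
    using f by (simp add: schwartz_functions_def)
  have le: "(1 + norm x) ^ N * norm (partial_derivs is f x) \<le> (SUP x. (1 + norm x) ^ N * norm (partial_derivs is f x))" for "is" x
    by (rule cSUP_upper[OF _ bdd]) simp
  have "(SUP x. (1 + norm x) ^ N * norm (partial_derivs is f x)) \<le> schwartz_seminorm N f"
    unfolding schwartz_seminorm_def using assms(2)
    by (intro member_le_sum finite_length_le) (auto intro: order_trans[OF _ le])
  with le show ?thesis by (rule order_trans)
qed

lemma schwartz_seminorm_nonneg: "f \<in> schwartz_functions \<Longrightarrow> 0 \<le> schwartz_seminorm N f"
  by (rule order_trans[OF _ partial_derivs_le_seminorm[of f "[]" N 0]]) auto

lemma L1_le_seminorm:
  fixes f :: "real^'n::finite \<Rightarrow> complex"
  assumes f: "f \<in> schwartz_functions" and is_N: "length is \<le> N" and N: "2 * CARD('n) \<le> N"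
  shows "(LINT x|lborel. norm (partial_derivs is f x)) \<le> (LINT x|(lborel :: (real^'n) measure). 1 / (1 + norm x) ^ (2 * CARD('n))) * schwartz_seminorm N f"
proof -
  let ?n = "2 * CARD('n)"
  have S: "partial_derivs is f \<in> schwartz_functions"
    using f unfolding schwartz_functions_eq by (rule smooth_class_partial_derivs)
  have "(LINT x|lborel. norm (partial_derivs is f x)) \<le> (LINT x|(lborel :: (real^'n) measure). schwartz_seminorm N f * (1 / (1 + norm x) ^ ?n))"
  proof (rule integral_mono)
    show "integrable lborel (\<lambda>x. norm (partial_derivs is f x))" by (intro integrable_norm schwartz_integrable S)
    show "integrable lborel (\<lambda>x::real^'n. schwartz_seminorm N f * (1 / (1 + norm x) ^ ?n))"
      by (intro integrable_mult_right integrable_inverse_power) simp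
    fix x :: "real^'n"
    have "(1 + norm x) ^ ?n * norm (partial_derivs is f x) \<le> (1 + norm x) ^ N * norm (partial_derivs is f x)"
      using N by (intro mult_right_mono power_increasing) auto
    also have "\<dots> \<le> schwartz_seminorm N f" by (rule partial_derivs_le_seminorm[OF f is_N])
    finally show "norm (partial_derivs is f x) \<le> schwartz_seminorm N f * (1 / (1 + norm x) ^ ?n)"
      by (simp add: pos_le_divide_eq add_pos_nonneg mult.commute)
  qed
  then show ?thesis unfolding integral_mult_right_zero by (simp only: mult.commute)
qed

text \<open>Continuity of the inverse transform on Schwartz functions, to the extent needed here: k
  derivatives enter through the decay, and \<open>2 * CARD('n)\<close> powers of the weight bound an
  L1 norm by a supremum.\<close>

lemma inv_fourier_seminorm_bound:
  fixes k :: nat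
  obtains C N where "0 \<le> C" "\<And>f \<xi>. f \<in> (schwartz_functions :: (real^'n::finite \<Rightarrow> complex) set) \<Longrightarrow>
    (1 + norm \<xi>) ^ k * norm (inv_fourier f \<xi>) \<le> C * schwartz_seminorm N f"
proof -
  let ?I = "LINT x|(lborel :: (real^'n) measure). 1 / (1 + norm x) ^ (2 * CARD('n))"
  let ?N = "max k (2 * CARD('n))"
  let ?c = "(2 * pi) ^ CARD('n)"
  let ?K = "(2 * real CARD('n)) ^ k * (?I + real CARD('n) * ?I)"
  have I0: "0 \<le> ?I" by (intro Bochner_Integration.integral_nonneg) simp
  have "(1 + norm \<xi>) ^ k * norm (inv_fourier f \<xi>) \<le> (?K / ?c) * schwartz_seminorm ?N f"
    if f: "f \<in> schwartz_functions" for f :: "real^'n \<Rightarrow> complex" and \<xi>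
  proof -
    have "(1 + norm (- \<xi>)) ^ k * norm (fourier f (- \<xi>)) \<le> (2 * real CARD('n)) ^ k *
      ((LINT x|lborel. norm (f x)) + (\<Sum>i\<in>UNIV. LINT x|lborel. norm (partial_derivs (replicate k i) f x)))"
      by (rule fourier_decay[OF f])
    also have "\<dots> \<le> (2 * real CARD('n)) ^ k * (?I * schwartz_seminorm ?N f + (\<Sum>i\<in>(UNIV :: 'n set). ?I * schwartz_seminorm ?N f))"
      using L1_le_seminorm[OF f, of "[]" ?N] by (intro mult_left_mono add_mono sum_mono L1_le_seminorm[OF f]) auto
    also have "\<dots> = ?K * schwartz_seminorm ?N f" by (simp add: algebra_simps)
    finally have "(1 + norm \<xi>) ^ k * norm (fourier f (- \<xi>)) \<le> ?K * schwartz_seminorm ?N f" by simp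
    then have "(1 + norm \<xi>) ^ k * norm (fourier f (- \<xi>)) / ?c \<le> ?K * schwartz_seminorm ?N f / ?c"
      by (rule divide_right_mono) simp
    then show ?thesis by (simp add: inv_fourier_eq norm_divide norm_power norm_mult)
  qed
  moreover have "0 \<le> ?K / ?c" using I0 by simp
  ultimately show ?thesis using that by blast
qed

text \<open>The exponent k is p + n, where p is the growth of the bracket and n further powers make
  the square integrable.\<close>

lemma weighted_norm_le_sup:
  fixes b :: "'n::finite \<Rightarrow> 'j::finite"
  obtains C k where "0 \<le> C" "\<And>f M. f \<in> borel_measurable borel \<Longrightarrow> (\<And>\<xi>. (1 + norm \<xi>) ^ k * norm (f \<xi>) \<le> M) \<Longrightarrow> 0 \<le> M \<Longrightarrow>
    weighted_norm b s f \<le> C * M"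
proof -
  have "poly_bounded (\<lambda>\<xi>. complex_of_real (bracket b s \<xi>))"
    using smooth_class_base[OF slow_bracket] .
  then obtain D p where D: "\<And>\<xi>. norm (complex_of_real (bracket b s \<xi>)) \<le> D * (1 + norm \<xi>) ^ p"
    unfolding poly_bounded_def by blast
  let ?n = "2 * CARD('n)"
  let ?J = "LINT x|(lborel :: (real^'n) measure). 1 / (1 + norm x) ^ ?n"
  have D0: "0 \<le> D" using order_trans[OF norm_ge_zero D[of 0]] by simp
  have J0: "0 \<le> ?J" by (intro Bochner_Integration.integral_nonneg) simp
  have "weighted_norm b s f \<le> (D * sqrt ?J) * M"
    if m: "f \<in> borel_measurable borel" and le: "\<And>\<xi>. (1 + norm \<xi>) ^ (p + CARD('n)) * norm (f \<xi>) \<le> M" and M: "0 \<le> M" for f M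
    unfolding weighted_norm_def
  proof (rule L2_nn_bound)
    note [measurable] = m
    show "(\<lambda>\<xi>. complex_of_real (bracket b s \<xi>) * f \<xi>) \<in> borel_measurable borel" by measurable
    have "(\<integral>\<^sup>+\<xi>. ennreal ((norm (complex_of_real (bracket b s \<xi>) * f \<xi>))\<^sup>2) \<partial>lborel) \<le> (\<integral>\<^sup>+\<xi>. ennreal ((D * M)\<^sup>2 * (1 / (1 + norm \<xi>) ^ ?n)) \<partial>(lborel :: (real^'n) measure))"
    proof (intro nn_integral_mono ennreal_leI)
      fix \<xi> :: "real^'n"
      have p: "0 < (1 + norm \<xi>) ^ CARD('n)" by (simp add: add_pos_nonneg)
      have "(1 + norm \<xi>) ^ CARD('n) * norm (complex_of_real (bracket b s \<xi>) * f \<xi>) \<le> (1 + norm \<xi>) ^ CARD('n) * ((D * (1 + norm \<xi>) ^ p) * norm (f \<xi>))"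
        unfolding norm_mult by (intro mult_left_mono mult_right_mono D) auto
      also have "\<dots> = D * ((1 + norm \<xi>) ^ (p + CARD('n)) * norm (f \<xi>))" by (simp add: power_add)
      also have "\<dots> \<le> D * M" by (intro mult_left_mono le D0)
      finally have "norm (complex_of_real (bracket b s \<xi>) * f \<xi>) \<le> (D * M) / (1 + norm \<xi>) ^ CARD('n)"
        using p by (simp add: pos_le_divide_eq mult.commute)
      then have "(norm (complex_of_real (bracket b s \<xi>) * f \<xi>))\<^sup>2 \<le> ((D * M) / (1 + norm \<xi>) ^ CARD('n))\<^sup>2"
        by (rule power_mono) simp
      then show "(norm (complex_of_real (bracket b s \<xi>) * f \<xi>))\<^sup>2 \<le> (D * M)\<^sup>2 * (1 / (1 + norm \<xi>) ^ ?n)"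
        by (simp add: power_divide flip: power_mult) (simp add: mult.commute)
    qed
    also have "\<dots> = ennreal ((D * M)\<^sup>2 * ?J)"
    proof -
      have "integrable lborel (\<lambda>\<xi>::real^'n. (D * M)\<^sup>2 * (1 / (1 + norm \<xi>) ^ ?n))"
        by (intro integrable_mult_right integrable_inverse_power) simp
      from nn_integral_eq_integral[OF this] show ?thesis unfolding integral_mult_right_zero by simp
    qed
    also have "(D * M)\<^sup>2 * ?J = ((D * sqrt ?J) * M)\<^sup>2" using J0 by (simp add: power_mult_distrib mult_ac)
    finally show "(\<integral>\<^sup>+\<xi>. ennreal ((norm (complex_of_real (bracket b s \<xi>) * f \<xi>))\<^sup>2) \<partial>lborel) \<le> ennreal (((D * sqrt ?J) * M)\<^sup>2)" .
    show "0 \<le> (D * sqrt ?J) * M" using D0 J0 M by simp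
  qed
  moreover have "0 \<le> D * sqrt ?J" using D0 J0 by simp
  ultimately show ?thesis using that by blast
qed

text \<open>The pairing of order s against -s reduces continuity to the weighted norm of order -s of
  \<open>inv_fourier \<psi>\<close>, which a supremum and then a seminorm of \<psi>
  controls.\<close>

lemma of_transform_tempered:
  fixes b :: "'n::finite \<Rightarrow> 'j::finite"
  assumes G: "G \<in> weighted_L2 b s"
  shows "of_transform G \<in> tempered_distributions"
proof -
  obtain C k where C: "0 \<le> C" "\<And>f M. f \<in> borel_measurable borel \<Longrightarrow> (\<And>\<xi>. (1 + norm \<xi>) ^ k * norm (f \<xi>) \<le> M) \<Longrightarrow> 0 \<le> M \<Longrightarrow>
    weighted_norm b (- s) f \<le> C * M"
    using weighted_norm_le_sup[of b "- s"] by metis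
  obtain D N where D: "0 \<le> D" "\<And>f \<xi>. f \<in> (schwartz_functions :: (real^'n \<Rightarrow> complex) set) \<Longrightarrow>
    (1 + norm \<xi>) ^ k * norm (inv_fourier f \<xi>) \<le> D * schwartz_seminorm N f"
    using inv_fourier_seminorm_bound[of k] by metis
  have "norm (of_transform G \<psi>) \<le> (weighted_norm b s G * (C * D)) * schwartz_seminorm N \<psi>" if \<psi>: "\<psi> \<in> schwartz_functions" for \<psi>
  proof -
    note S = inv_fourier_schwartz[OF \<psi>]
    have "norm (of_transform G \<psi>) \<le> weighted_norm b s G * weighted_norm b (- s) (inv_fourier \<psi>)"
      using weighted_pairing(2)[OF G schwartz_weighted_L2[OF S]] \<psi> by (simp add: of_transform_def)
    also have "\<dots> \<le> weighted_norm b s G * (C * (D * schwartz_seminorm N \<psi>))"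
      by (intro mult_left_mono C schwartz_measurable S D \<psi> mult_nonneg_nonneg schwartz_seminorm_nonneg weighted_norm_nonneg)
    finally show ?thesis by (simp add: mult_ac)
  qed
  moreover have "linear_functional_on schwartz_functions (of_transform G)"
    unfolding linear_functional_on_def
  proof (intro ballI allI)
    fix f g :: "real^'n \<Rightarrow> complex" and a c assume f: "f \<in> schwartz_functions" and g: "g \<in> schwartz_functions"
    have S: "(\<lambda>x. a * f x + c * g x) \<in> schwartz_functions" by (intro schwartz_add schwartz_cmult f g)
    have "(LINT \<xi>|lborel. G \<xi> * inv_fourier (\<lambda>x. a * f x + c * g x) \<xi>) = (LINT \<xi>|lborel. a * (G \<xi> * inv_fourier f \<xi>) + c * (G \<xi> * inv_fourier g \<xi>))"
      by (simp add: inv_fourier_linear[OF f g] algebra_simps)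
    also have "\<dots> = a * (LINT \<xi>|lborel. G \<xi> * inv_fourier f \<xi>) + c * (LINT \<xi>|lborel. G \<xi> * inv_fourier g \<xi>)"
      using weighted_pairing(1)[OF G schwartz_weighted_L2[OF inv_fourier_schwartz[OF f]]] weighted_pairing(1)[OF G schwartz_weighted_L2[OF inv_fourier_schwartz[OF g]]]
      by (subst Bochner_Integration.integral_add) auto
    finally show "of_transform G (\<lambda>x. a * f x + c * g x) = a * of_transform G f + c * of_transform G g"
      using f g S by (simp add: of_transform_def)
  qed
  moreover have "of_transform G \<in> extensional schwartz_functions" by (simp add: of_transform_def)
  ultimately show ?thesis unfolding tempered_distributions_def schwartz_seminorm_def by blast
qed

section \<open>Identification of the spaces with weighted L2 spaces\<close>

lemma bracket_D_apply:
  assumes "\<phi> \<in> schwartz_functions"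
  shows "bracket_D b s u \<phi> = u (fourier (\<lambda>\<xi>. complex_of_real (bracket b s \<xi>) * inv_fourier \<phi> \<xi>))"
  using assms inv_fourier_schwartz[OF assms] schwartz_bracket_mult[OF inv_fourier_schwartz[OF assms], of b s]
  by (simp add: bracket_D_def fourier_multiplier_def tempered_inv_fourier_def tempered_mult_def tempered_fourier_def)

lemma bracket_D_eqI:
  assumes "\<And>\<phi>. \<phi> \<in> schwartz_functions \<Longrightarrow> u (fourier (\<lambda>\<xi>. complex_of_real (bracket b s \<xi>) * inv_fourier \<phi> \<xi>)) = (LINT x|lborel. F x * \<phi> x)"
  shows "bracket_D b s u = tempered_of_fun F"
proof
  fix \<phi>
  show "bracket_D b s u \<phi> = tempered_of_fun F \<phi>"
  proof (cases "\<phi> \<in> schwartz_functions")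
    case True then show ?thesis using assms bracket_D_apply[OF True, of b s u] by (simp add: tempered_of_fun_def)
  qed (simp add: bracket_D_def fourier_multiplier_def tempered_inv_fourier_def tempered_of_fun_def)
qed

lemma of_transform_bracket_D:
  assumes G: "G \<in> weighted_L2 b s" and \<phi>: "\<phi> \<in> schwartz_functions"
  shows "of_transform G (fourier (\<lambda>\<xi>. complex_of_real (bracket b s \<xi>) * inv_fourier \<phi> \<xi>)) =
    (LINT \<xi>|lborel. (complex_of_real (bracket b s \<xi>) * G \<xi>) * inv_fourier \<phi> \<xi>)"
proof -
  note S = schwartz_bracket_mult[OF inv_fourier_schwartz[OF \<phi>], of b s]
  show ?thesis using fourier_schwartz[OF S] by (simp add: of_transform_def inv_fourier_fourier[OF S]) (simp add: mult_ac)
qed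

text \<open>Plancherel provides a function F that represents \<open>bracket_D b s\<close> of the
  distribution. The function selected in \<open>H_norm\<close> represents the same distribution, so
  it equals F almost everywhere and has the same norm.\<close>

lemma H_norm_of_transform:
  fixes b :: "'n::finite \<Rightarrow> 'j::finite"
  assumes G: "G \<in> weighted_L2 b s"
  shows "of_transform G \<in> H_space b s" "H_norm b s (of_transform G) = ennreal ((1 / sqrt ((2 * pi) ^ CARD('n))) * weighted_norm b s G)"
proof -
  have L: "(\<lambda>\<xi>. complex_of_real (bracket b s \<xi>) * G \<xi>) \<in> L2_functions" using G by (simp add: weighted_L2_def)
  obtain F where F: "F \<in> L2_functions" "L2_norm F = (1 / sqrt ((2 * pi) ^ CARD('n))) * weighted_norm b s G"
    "\<And>\<phi>. \<phi> \<in> schwartz_functions \<Longrightarrow> (LINT x|lborel. F x * \<phi> x) = (LINT \<xi>|lborel. (complex_of_real (bracket b s \<xi>) * G \<xi>) * inv_fourier \<phi> \<xi>)"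
    using Plancherel_inv_fourier[OF L, folded weighted_norm_def] by blast
  have eq: "bracket_D b s (of_transform G) = tempered_of_fun F"
    by (rule bracket_D_eqI) (simp only: of_transform_bracket_D[OF G] F(3))
  show H: "of_transform G \<in> H_space b s"
    unfolding H_space_def using of_transform_tempered[OF G] F(1) eq by blast
  let ?f = "SOME f. f \<in> L2_functions \<and> bracket_D b s (of_transform G) = tempered_of_fun f"
  have f: "?f \<in> L2_functions \<and> bracket_D b s (of_transform G) = tempered_of_fun ?f"
    by (rule someI[of _ F]) (use F(1) eq in simp)
  have "AE x in lborel. ?f x - F x = 0"
  proof (rule L2_orthogonal_zero[OF L2_diff[OF conjunct1[OF f] F(1)]])
    fix \<phi> :: "real^'n \<Rightarrow> complex" assume \<phi>: "\<phi> \<in> schwartz_functions"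
    have "tempered_of_fun ?f \<phi> = tempered_of_fun F \<phi>" using f eq by simp
    then have "(LINT x|lborel. ?f x * \<phi> x) = (LINT x|lborel. F x * \<phi> x)" using \<phi> by (simp add: tempered_of_fun_def)
    then show "(LINT x|lborel. (?f x - F x) * \<phi> x) = 0"
      unfolding left_diff_distrib
      using Bochner_Integration.integral_diff[OF L2_Cauchy_Schwarz(1)[OF conjunct1[OF f] schwartz_L2[OF \<phi>]]
          L2_Cauchy_Schwarz(1)[OF F(1) schwartz_L2[OF \<phi>]]] by simp
  qed
  then have "AE x in lborel. ?f x = F x" by simp
  then have "L2_norm ?f = L2_norm F"
    unfolding L2_norm_def using L2_measurable[OF conjunct1[OF f]] L2_measurable[OF F(1)]
    by (intro arg_cong[where f=sqrt] integral_cong_AE) auto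
  then show "H_norm b s (of_transform G) = ennreal ((1 / sqrt ((2 * pi) ^ CARD('n))) * weighted_norm b s G)"
    using H F(2) by (simp add: H_norm_def)
qed

text \<open>The representing L2 function is transformed by Plancherel and divided by the bracket.
  That u is recovered from it uses that the multiplier is invertible on Schwartz functions.\<close>

lemma H_space_of_transform:
  fixes b :: "'n::finite \<Rightarrow> 'j::finite"
  assumes u: "u \<in> H_space b s"
  obtains G where "G \<in> weighted_L2 b s" "u = of_transform G"
proof -
  obtain F where F: "F \<in> L2_functions" "bracket_D b s u = tempered_of_fun F" and ut: "u \<in> tempered_distributions"
    using u by (auto simp: H_space_def)
  obtain L where L: "L \<in> L2_functions" "\<And>\<phi>. \<phi> \<in> schwartz_functions \<Longrightarrow> (LINT x|lborel. L x * \<phi> x) = (LINT x|lborel. F x * fourier \<phi> x)"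
    using Plancherel_fourier[OF F(1)] by blast
  define G where "G = (\<lambda>\<xi>. complex_of_real (bracket b (- s) \<xi>) * L \<xi>)"
  have "complex_of_real (bracket b s \<xi>) * G \<xi> = L \<xi>" for \<xi>
  proof -
    have "complex_of_real (bracket b s \<xi>) * G \<xi> = (complex_of_real (bracket b (- s) \<xi>) * complex_of_real (bracket b s \<xi>)) * L \<xi>"
      by (simp only: G_def mult_ac)
    then show ?thesis by (simp only: bracket_cancel mult_1)
  qed
  then have G: "G \<in> weighted_L2 b s" using L(1) by (simp add: weighted_L2_def)
  have "u = of_transform G"
  proof
    fix \<psi>
    show "u \<psi> = of_transform G \<psi>"
    proof (cases "\<psi> \<in> schwartz_functions")
      case True
      \<comment> \<open>Chosen so that \<open>bracket_D b s u\<close> applied to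
        \<open>fourier ?\<chi>\<close> is u applied to \<psi>: the multiplier restores the bracket
        that was divided out.\<close>
      let ?\<chi> = "\<lambda>\<xi>. complex_of_real (bracket b (- s) \<xi>) * inv_fourier \<psi> \<xi>"
      have S: "?\<chi> \<in> schwartz_functions" by (intro schwartz_bracket_mult inv_fourier_schwartz True)
      have "(\<lambda>\<xi>. complex_of_real (bracket b s \<xi>) * ?\<chi> \<xi>) = inv_fourier \<psi>"
      proof
        fix \<xi>
        have "complex_of_real (bracket b s \<xi>) * ?\<chi> \<xi> = (complex_of_real (bracket b (- s) \<xi>) * complex_of_real (bracket b s \<xi>)) * inv_fourier \<psi> \<xi>"
          by (simp only: mult_ac)
        then show "complex_of_real (bracket b s \<xi>) * ?\<chi> \<xi> = inv_fourier \<psi> \<xi>" by (simp only: bracket_cancel mult_1)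
      qed
      then have "bracket_D b s u (fourier ?\<chi>) = u \<psi>"
        using bracket_D_apply[OF fourier_schwartz[OF S], of b s u] by (simp add: inv_fourier_fourier[OF S] fourier_inv_fourier[OF True])
      then have "u \<psi> = (LINT x|lborel. F x * fourier ?\<chi> x)"
        using fourier_schwartz[OF S] by (simp add: F(2) tempered_of_fun_def)
      also have "\<dots> = (LINT x|lborel. L x * ?\<chi> x)" by (rule L(2)[OF S, symmetric])
      also have "\<dots> = of_transform G \<psi>" using True by (simp add: of_transform_def G_def mult_ac)
      finally show ?thesis .
    next
      case False
      then show ?thesis using ut by (simp add: of_transform_def tempered_distributions_def extensional_def)
    qed
  qed
  with G that show ?thesis by blast
qed

lemma of_transform_inject:
  assumes F: "F \<in> weighted_L2 b s" and G: "G \<in> weighted_L2 b s" and eq: "of_transform F = of_transform G"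
  shows "AE \<xi> in lborel. F \<xi> = G \<xi>"
proof -
  have "AE \<xi> in lborel. F \<xi> - G \<xi> = 0"
  proof (rule weighted_orthogonal_zero[OF weighted_diff[OF F G]])
    fix \<phi> :: "real^'a \<Rightarrow> complex" assume \<phi>: "\<phi> \<in> schwartz_functions"
    have "of_transform F (fourier \<phi>) = of_transform G (fourier \<phi>)" using eq by simp
    then have "(LINT \<xi>|lborel. F \<xi> * \<phi> \<xi>) = (LINT \<xi>|lborel. G \<xi> * \<phi> \<xi>)"
      using fourier_schwartz[OF \<phi>] by (simp add: of_transform_def inv_fourier_fourier[OF \<phi>])
    then show "(LINT \<xi>|lborel. (F \<xi> - G \<xi>) * \<phi> \<xi>) = 0"
      unfolding left_diff_distrib
      using Bochner_Integration.integral_diff[OF weighted_pairing(1)[OF F schwartz_weighted_L2[OF \<phi>]]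
          weighted_pairing(1)[OF G schwartz_weighted_L2[OF \<phi>]]] by simp
  qed
  then show ?thesis by simp
qed

lemma tempered_of_fun_eq_of_transform:
  assumes f: "f \<in> schwartz_functions"
  shows "tempered_of_fun f = of_transform (fourier f)"
proof -
  have "(LINT x|lborel. f x * \<psi> x) = (LINT x|lborel. fourier f x * inv_fourier \<psi> x)" if "\<psi> \<in> schwartz_functions" for \<psi>
    using inv_fourier_multiplication[OF fourier_schwartz[OF f] that] by (simp add: inv_fourier_fourier[OF f])
  then show ?thesis unfolding tempered_of_fun_def of_transform_def by (intro restrict_ext) auto
qed

lemma schwartz_H_space: "f \<in> schwartz_functions \<Longrightarrow> tempered_of_fun f \<in> H_space b s"
  by (simp add: tempered_of_fun_eq_of_transform H_norm_of_transform schwartz_weighted_L2 fourier_schwartz)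

text \<open>A test function near \<open>bracket b s\<close> times G, divided by the bracket, is
  Schwartz and close to G in the weighted norm; its inverse transform is the function
  sought.\<close>

lemma weighted_dense:
  assumes G: "G \<in> weighted_L2 b s" and e: "0 < e"
  obtains f where "f \<in> schwartz_functions" "weighted_norm b s (\<lambda>\<xi>. fourier f \<xi> - G \<xi>) < e"
proof -
  have L: "(\<lambda>\<xi>. complex_of_real (bracket b s \<xi>) * G \<xi>) \<in> L2_functions" using G by (simp add: weighted_L2_def)
  obtain g where g: "g \<in> test_functions" "L2_norm (\<lambda>\<xi>. complex_of_real (bracket b s \<xi>) * G \<xi> - g \<xi>) < e"
    using test_dense_L2[OF L e] by blast
  define h where "h = (\<lambda>\<xi>. complex_of_real (bracket b (- s) \<xi>) * g \<xi>)"
  have h: "h \<in> schwartz_functions" unfolding h_def by (intro schwartz_bracket_mult test_imp_schwartz g)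
  have "complex_of_real (bracket b s \<xi>) * (h \<xi> - G \<xi>) = g \<xi> - complex_of_real (bracket b s \<xi>) * G \<xi>" for \<xi>
  proof -
    have "complex_of_real (bracket b s \<xi>) * h \<xi> = (complex_of_real (bracket b (- s) \<xi>) * complex_of_real (bracket b s \<xi>)) * g \<xi>"
      by (simp only: h_def mult_ac)
    then show ?thesis by (simp only: bracket_cancel mult_1 right_diff_distrib)
  qed
  then have "weighted_norm b s (\<lambda>\<xi>. fourier (inv_fourier h) \<xi> - G \<xi>) < e"
    using g(2) by (simp add: weighted_norm_def fourier_inv_fourier[OF h] L2_norm_minus_commute[of g])
  then show ?thesis using that[OF inv_fourier_schwartz[OF h]] by blast
qed

text \<open>A real-valued norm for computations. Outside \<open>H_space\<close> it takes the value
  0, by \<open>enn2real\<close>, so membership has to be carried along separately.\<close>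

definition Hn :: "('n::finite \<Rightarrow> 'j::finite) \<Rightarrow> real^'j \<Rightarrow> 'n functional \<Rightarrow> real" where
  "Hn b s u = enn2real (H_norm b s u)"

lemma Hn_nonneg: "0 \<le> Hn b s u"
  by (simp add: Hn_def)

lemma Hn_of_transform:
  fixes b :: "'n::finite \<Rightarrow> 'j::finite"
  assumes "G \<in> weighted_L2 b s"
  shows "Hn b s (of_transform G) = (1 / sqrt ((2 * pi) ^ CARD('n))) * weighted_norm b s G"
  using H_norm_of_transform[OF assms] by (simp add: Hn_def weighted_norm_nonneg)

lemma H_norm_eq_Hn: "u \<in> H_space b s \<Longrightarrow> H_norm b s u = ennreal (Hn b s u)"
  by (simp add: Hn_def H_norm_def L2_norm_nonneg)

lemma H_norm_less_iff: "u \<in> H_space b s \<Longrightarrow> H_norm b s u < ennreal d \<longleftrightarrow> Hn b s u < d"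
  by (simp add: H_norm_eq_Hn Hn_nonneg ennreal_less_iff)

lemma H_norm_finite_iff: "H_norm b s u < \<infinity> \<longleftrightarrow> u \<in> H_space b s"
  by (simp add: H_norm_def)

lemma H_tempered_diff:
  assumes "u \<in> H_space b s" "v \<in> H_space b s"
  shows "tempered_diff u v \<in> H_space b s"
proof -
  obtain F G where F: "F \<in> weighted_L2 b s" "u = of_transform F" and G: "G \<in> weighted_L2 b s" "v = of_transform G"
    using assms by (metis H_space_of_transform)
  show ?thesis unfolding F(2) G(2) tempered_diff_of_transform[OF F(1) G(1)]
    by (rule H_norm_of_transform) (rule weighted_diff[OF F(1) G(1)])
qed

lemma weighted_diff_bound:
  assumes "F \<in> weighted_L2 b s" "G \<in> weighted_L2 b s"
  shows "\<bar>weighted_norm b s F - weighted_norm b s G\<bar> \<le> weighted_norm b s (\<lambda>\<xi>. F \<xi> - G \<xi>)"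
  using L2_norm_diff_bound[of "\<lambda>\<xi>. complex_of_real (bracket b s \<xi>) * F \<xi>" "\<lambda>\<xi>. complex_of_real (bracket b s \<xi>) * G \<xi>"] assms
  by (simp add: weighted_norm_def weighted_L2_def right_diff_distrib)

lemma Hn_diff_bound:
  fixes b :: "'n::finite \<Rightarrow> 'j::finite"
  assumes "u \<in> H_space b s" "v \<in> H_space b s"
  shows "\<bar>Hn b s u - Hn b s v\<bar> \<le> Hn b s (tempered_diff u v)"
proof -
  obtain F G where F: "F \<in> weighted_L2 b s" "u = of_transform F" and G: "G \<in> weighted_L2 b s" "v = of_transform G"
    using assms by (metis H_space_of_transform)
  let ?c = "1 / sqrt ((2 * pi) ^ CARD('n))"
  have "\<bar>?c * weighted_norm b s F - ?c * weighted_norm b s G\<bar> = ?c * \<bar>weighted_norm b s F - weighted_norm b s G\<bar>"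
    unfolding right_diff_distrib[symmetric] abs_mult by simp
  also have "\<dots> \<le> ?c * weighted_norm b s (\<lambda>\<xi>. F \<xi> - G \<xi>)"
    by (intro mult_left_mono weighted_diff_bound F G) simp
  finally show ?thesis
    unfolding F(2) G(2) tempered_diff_of_transform[OF F(1) G(1)] Hn_of_transform[OF F(1)] Hn_of_transform[OF G(1)]
      Hn_of_transform[OF weighted_diff[OF F(1) G(1)]] .
qed

lemma H_sum:
  fixes b :: "'n::finite \<Rightarrow> 'j::finite" and u :: "'i \<Rightarrow> 'n functional"
  assumes "finite I" "\<And>i. i \<in> I \<Longrightarrow> u i \<in> H_space b s"
  shows "(\<lambda>\<phi>\<in>schwartz_functions. \<Sum>i\<in>I. u i \<phi>) \<in> H_space b s"
    "Hn b s (\<lambda>\<phi>\<in>schwartz_functions. \<Sum>i\<in>I. u i \<phi>) \<le> (\<Sum>i\<in>I. Hn b s (u i))"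
proof -
  have "\<exists>F. F \<in> weighted_L2 b s \<and> (\<lambda>\<phi>\<in>schwartz_functions. \<Sum>i\<in>I. u i \<phi>) = of_transform F \<and>
    (1 / sqrt ((2 * pi) ^ CARD('n))) * weighted_norm b s F \<le> (\<Sum>i\<in>I. Hn b s (u i))"
    using assms
  proof (induction I)
    case empty
    show ?case
      by (rule exI[of _ "\<lambda>\<xi>. 0"]) (auto simp: weighted_L2_def of_transform_def weighted_norm_def L2_norm_def test_L2[OF test_zero])
  next
    case (insert i I)
    then obtain F where F: "F \<in> weighted_L2 b s" "(\<lambda>\<phi>\<in>schwartz_functions. \<Sum>i\<in>I. u i \<phi>) = of_transform F"
      "(1 / sqrt ((2 * pi) ^ CARD('n))) * weighted_norm b s F \<le> (\<Sum>i\<in>I. Hn b s (u i))" by blast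
    obtain G where G: "G \<in> weighted_L2 b s" "u i = of_transform G" using insert.prems H_space_of_transform by (metis insertI1)
    have "(\<lambda>\<phi>\<in>schwartz_functions. \<Sum>i\<in>insert i I. u i \<phi>) = of_transform (\<lambda>\<xi>. G \<xi> + F \<xi>)"
    proof
      fix \<phi>
      show "(\<lambda>\<phi>\<in>schwartz_functions. \<Sum>i\<in>insert i I. u i \<phi>) \<phi> = of_transform (\<lambda>\<xi>. G \<xi> + F \<xi>) \<phi>"
      proof (cases "\<phi> \<in> schwartz_functions")
        case True
        have "(\<Sum>i\<in>I. u i \<phi>) = of_transform F \<phi>" using fun_cong[OF F(2), of \<phi>] True by simp
        then show ?thesis using insert.hyps of_transform_linear[OF G(1) F(1) True, of 1 1] True by (simp add: G(2))
      qed (simp add: of_transform_def)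
    qed
    moreover have "(1 / sqrt ((2 * pi) ^ CARD('n))) * weighted_norm b s (\<lambda>\<xi>. G \<xi> + F \<xi>) \<le>
      (1 / sqrt ((2 * pi) ^ CARD('n))) * (weighted_norm b s G + weighted_norm b s F)"
      by (intro mult_left_mono weighted_add G F) simp
    then have "(1 / sqrt ((2 * pi) ^ CARD('n))) * weighted_norm b s (\<lambda>\<xi>. G \<xi> + F \<xi>) \<le> (\<Sum>i\<in>insert i I. Hn b s (u i))"
      using insert.hyps F(3) by (simp add: G(2) Hn_of_transform[OF G(1)] distrib_left add_divide_distrib)
    ultimately show ?case using weighted_add(1)[OF G(1) F(1)] by blast
  qed
  then obtain F where F: "F \<in> weighted_L2 b s" "(\<lambda>\<phi>\<in>schwartz_functions. \<Sum>i\<in>I. u i \<phi>) = of_transform F"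
      "(1 / sqrt ((2 * pi) ^ CARD('n))) * weighted_norm b s F \<le> (\<Sum>i\<in>I. Hn b s (u i))" by blast
  show "(\<lambda>\<phi>\<in>schwartz_functions. \<Sum>i\<in>I. u i \<phi>) \<in> H_space b s"
    unfolding F(2) by (rule H_norm_of_transform[OF F(1)])
  show "Hn b s (\<lambda>\<phi>\<in>schwartz_functions. \<Sum>i\<in>I. u i \<phi>) \<le> (\<Sum>i\<in>I. Hn b s (u i))"
    unfolding F(2) Hn_of_transform[OF F(1)] by (rule F(3))
qed

lemma H_dense:
  fixes b :: "'n::finite \<Rightarrow> 'j::finite"
  assumes u: "u \<in> H_space b s" and e: "0 < e"
  obtains f where "f \<in> schwartz_functions" "H_norm b s (tempered_diff (tempered_of_fun f) u) < ennreal e"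
proof -
  let ?c = "1 / sqrt ((2 * pi) ^ CARD('n))"
  obtain G where G: "G \<in> weighted_L2 b s" "u = of_transform G" using u by (metis H_space_of_transform)
  have c: "?c > 0" by simp
  have "e / ?c > 0" by (rule divide_pos_pos[OF e c])
  then obtain f where f: "f \<in> schwartz_functions" "weighted_norm b s (\<lambda>\<xi>. fourier f \<xi> - G \<xi>) < e / ?c"
    by (rule weighted_dense[OF G(1)])
  note W = schwartz_weighted_L2[OF fourier_schwartz[OF f(1)], of b s]
  have "?c * weighted_norm b s (\<lambda>\<xi>. fourier f \<xi> - G \<xi>) < e"
    using f(2) unfolding pos_less_divide_eq[OF c] by (simp only: mult.commute)
  then have "H_norm b s (tempered_diff (tempered_of_fun f) u) < ennreal e"
    unfolding tempered_of_fun_eq_of_transform[OF f(1)] G(2) tempered_diff_of_transform[OF W G(1)]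
      H_norm_of_transform(2)[OF weighted_diff[OF W G(1)]] using e by (simp add: ennreal_less_iff weighted_norm_nonneg)
  with f(1) that show ?thesis by blast
qed

section \<open>Products in \<open>\<H>\<^sup>s\<close>\<close>

text \<open>The part of \<open>is_H_product\<close> that survives when the arguments or the result
  are multiplied by Schwartz functions; such modified maps no longer restrict to the pointwise
  product.\<close>

definition H_continuous :: "('n::finite \<Rightarrow> 'j::finite) \<Rightarrow> real^'j \<Rightarrow> real^'j \<Rightarrow> real^'j \<Rightarrow>
   ('n functional \<Rightarrow> 'n functional \<Rightarrow> 'n functional) \<Rightarrow> bool" where
  "H_continuous b s t \<sigma> P \<longleftrightarrow>
    (\<forall>u\<in>H_space b s. \<forall>v\<in>H_space b t. P u v \<in> H_space b \<sigma>) \<and>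
    (\<forall>u\<in>H_space b s. \<forall>v\<in>H_space b t. \<forall>e>0::real. \<exists>d>0::real.
      \<forall>u'\<in>H_space b s. \<forall>v'\<in>H_space b t.
        H_norm b s (tempered_diff u' u) < ennreal d \<and> H_norm b t (tempered_diff v' v) < ennreal d \<longrightarrow>
        H_norm b \<sigma> (tempered_diff (P u' v') (P u v)) < ennreal e)"

lemma H_continuousE:
  assumes P: "H_continuous b s t \<sigma> P" and u: "u \<in> H_space b s" and v: "v \<in> H_space b t" and e: "0 < e"
  obtains d where "d > 0" "\<And>u' v'. u' \<in> H_space b s \<Longrightarrow> v' \<in> H_space b t \<Longrightarrow>
    H_norm b s (tempered_diff u' u) < ennreal d \<Longrightarrow> H_norm b t (tempered_diff v' v) < ennreal d \<Longrightarrow>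
    H_norm b \<sigma> (tempered_diff (P u' v') (P u v)) < ennreal e"
proof -
  note * = conjunct2[OF P[unfolded H_continuous_def], THEN bspec, OF u, THEN bspec, OF v, THEN spec, THEN mp, OF e]
  then obtain d where d: "d > 0" and **: "\<forall>u'\<in>H_space b s. \<forall>v'\<in>H_space b t.
        H_norm b s (tempered_diff u' u) < ennreal d \<and> H_norm b t (tempered_diff v' v) < ennreal d \<longrightarrow>
        H_norm b \<sigma> (tempered_diff (P u' v') (P u v)) < ennreal e"
    by (elim exE conjE)
  show ?thesis by (rule that[OF d]) (use ** in simp)
qed

lemma is_H_product_iff: "is_H_product b s t \<sigma> P \<longleftrightarrow> H_continuous b s t \<sigma> P \<and>
  (\<forall>f\<in>schwartz_functions. \<forall>g\<in>schwartz_functions.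
      P (tempered_of_fun f) (tempered_of_fun g) = tempered_of_fun (\<lambda>x. f x * g x))"
  by (auto simp: is_H_product_def H_continuous_def)

text \<open>Two elements with a common approximation to every precision have transforms at weighted
  distance 0, which agree almost everywhere and hence define the same functional.\<close>

lemma H_eqI:
  fixes b :: "'n::finite \<Rightarrow> 'j::finite"
  assumes u: "u \<in> H_space b s" and v: "v \<in> H_space b s"
    and close: "\<And>e. 0 < e \<Longrightarrow> \<exists>w\<in>H_space b s. H_norm b s (tempered_diff w u) < ennreal e \<and> H_norm b s (tempered_diff w v) < ennreal e"
  shows "u = v"
proof -
  let ?c = "1 / sqrt ((2 * pi) ^ CARD('n))"
  have c: "?c > 0" by simp
  obtain F G where F: "F \<in> weighted_L2 b s" "u = of_transform F" and G: "G \<in> weighted_L2 b s" "v = of_transform G"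
    using u v by (metis H_space_of_transform)
  let ?n = "weighted_norm b s (\<lambda>\<xi>. F \<xi> - G \<xi>)"
  have "?c * ?n \<le> 0 + e" if e: "0 < e" for e
  proof -
    have "e / 2 > 0" using e by simp
    then obtain w where w: "w \<in> H_space b s" "H_norm b s (tempered_diff w u) < ennreal (e/2)" "H_norm b s (tempered_diff w v) < ennreal (e/2)"
      using close by blast
    obtain E where E: "E \<in> weighted_L2 b s" "w = of_transform E" using w(1) by (metis H_space_of_transform)
    have 1: "?c * weighted_norm b s (\<lambda>\<xi>. E \<xi> - F \<xi>) < e/2"
      using w(2) e unfolding E(2) F(2) tempered_diff_of_transform[OF E(1) F(1)] H_norm_of_transform(2)[OF weighted_diff[OF E(1) F(1)]]
      by (subst (asm) ennreal_less_iff) (simp_all add: weighted_norm_nonneg)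
    have 2: "?c * weighted_norm b s (\<lambda>\<xi>. E \<xi> - G \<xi>) < e/2"
      using w(3) e unfolding E(2) G(2) tempered_diff_of_transform[OF E(1) G(1)] H_norm_of_transform(2)[OF weighted_diff[OF E(1) G(1)]]
      by (subst (asm) ennreal_less_iff) (simp_all add: weighted_norm_nonneg)
    have "weighted_norm b s (\<lambda>\<xi>. (E \<xi> - G \<xi>) + - (E \<xi> - F \<xi>)) \<le> weighted_norm b s (\<lambda>\<xi>. E \<xi> - G \<xi>) + weighted_norm b s (\<lambda>\<xi>. - (E \<xi> - F \<xi>))"
      by (intro weighted_add weighted_diff weighted_uminus E F G)
    then have "?n \<le> weighted_norm b s (\<lambda>\<xi>. E \<xi> - G \<xi>) + weighted_norm b s (\<lambda>\<xi>. E \<xi> - F \<xi>)"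
      using weighted_uminus(2)[OF weighted_diff[OF E(1) F(1)]] by simp
    then have "?c * ?n \<le> ?c * (weighted_norm b s (\<lambda>\<xi>. E \<xi> - G \<xi>) + weighted_norm b s (\<lambda>\<xi>. E \<xi> - F \<xi>))"
      by (rule mult_left_mono) simp
    also have "\<dots> = ?c * weighted_norm b s (\<lambda>\<xi>. E \<xi> - G \<xi>) + ?c * weighted_norm b s (\<lambda>\<xi>. E \<xi> - F \<xi>)"
      by (rule distrib_left)
    also have "\<dots> \<le> e / 2 + e / 2" using 1 2 by (intro add_mono less_imp_le)
    finally show ?thesis by simp
  qed
  then have "?c * ?n \<le> 0" by (rule field_le_epsilon)
  then have "?n \<le> 0" using mult_le_cancel_left_pos[OF c, of ?n 0] by (simp only: mult_zero_right)
  then have "?n = 0" using weighted_norm_nonneg[of b s "\<lambda>\<xi>. F \<xi> - G \<xi>"] by linarith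
  then have "AE \<xi> in lborel. complex_of_real (bracket b s \<xi>) * (F \<xi> - G \<xi>) = 0"
    using weighted_diff[OF F(1) G(1)] unfolding weighted_norm_def weighted_L2_def by (intro L2_norm_zero_AE) auto
  then have "AE \<xi> in lborel. F \<xi> = G \<xi>" using bracket_pos[of b s] by (simp add: less_imp_neq[symmetric])
  then show ?thesis unfolding F(2) G(2)
    by (intro of_transform_cong_AE weighted_measurable[OF F(1)] weighted_measurable[OF G(1)])
qed

text \<open>One pair of Schwartz functions is taken so close to (u, v) that the continuity of both
  maps applies; their common value on it approximates both sides.\<close>

lemma H_continuous_unique:
  assumes P: "H_continuous b s t \<sigma> P" and Q: "H_continuous b s t \<sigma> Q"
    and eq: "\<And>f g. f \<in> schwartz_functions \<Longrightarrow> g \<in> schwartz_functions \<Longrightarrow> P (tempered_of_fun f) (tempered_of_fun g) = Q (tempered_of_fun f) (tempered_of_fun g)"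
    and u: "u \<in> H_space b s" and v: "v \<in> H_space b t"
  shows "P u v = Q u v"
proof (rule H_eqI)
  show "P u v \<in> H_space b \<sigma>" "Q u v \<in> H_space b \<sigma>" using P Q u v by (auto simp: H_continuous_def)
  fix e :: real assume e: "0 < e"
  obtain d where d: "d > 0" "\<And>u' v'. u' \<in> H_space b s \<Longrightarrow> v' \<in> H_space b t \<Longrightarrow>
    H_norm b s (tempered_diff u' u) < ennreal d \<Longrightarrow> H_norm b t (tempered_diff v' v) < ennreal d \<Longrightarrow>
        H_norm b \<sigma> (tempered_diff (P u' v') (P u v)) < ennreal e"
    by (rule H_continuousE[OF P u v e], blast)
  obtain d' where d': "d' > 0" "\<And>u' v'. u' \<in> H_space b s \<Longrightarrow> v' \<in> H_space b t \<Longrightarrow>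
    H_norm b s (tempered_diff u' u) < ennreal d' \<Longrightarrow> H_norm b t (tempered_diff v' v) < ennreal d' \<Longrightarrow>
        H_norm b \<sigma> (tempered_diff (Q u' v') (Q u v)) < ennreal e"
    by (rule H_continuousE[OF Q u v e], blast)
  have m: "min d d' > 0" using d d' by simp
  obtain f where f: "f \<in> schwartz_functions" "H_norm b s (tempered_diff (tempered_of_fun f) u) < ennreal (min d d')"
    using H_dense[OF u m] by blast
  obtain g where g: "g \<in> schwartz_functions" "H_norm b t (tempered_diff (tempered_of_fun g) v) < ennreal (min d d')"
    using H_dense[OF v m] by blast
  have le: "ennreal (min d d') \<le> ennreal d" "ennreal (min d d') \<le> ennreal d'" by (auto intro: ennreal_leI)
  show "\<exists>w\<in>H_space b \<sigma>. H_norm b \<sigma> (tempered_diff w (P u v)) < ennreal e \<and> H_norm b \<sigma> (tempered_diff w (Q u v)) < ennreal e"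
  proof (intro bexI[of _ "P (tempered_of_fun f) (tempered_of_fun g)"] conjI)
    show "H_norm b \<sigma> (tempered_diff (P (tempered_of_fun f) (tempered_of_fun g)) (P u v)) < ennreal e"
      using f g le by (intro d(2) schwartz_H_space) (auto intro: less_le_trans)
    show "H_norm b \<sigma> (tempered_diff (P (tempered_of_fun f) (tempered_of_fun g)) (Q u v)) < ennreal e"
      unfolding eq[OF f(1) g(1)] using f g le by (intro d'(2) schwartz_H_space) (auto intro: less_le_trans)
    show "P (tempered_of_fun f) (tempered_of_fun g) \<in> H_space b \<sigma>"
      by (rule bspec[OF bspec[OF conjunct1[OF P[unfolded H_continuous_def]]]]) (intro schwartz_H_space f(1) g(1))+
  qed
qed

lemma is_H_product_unique:
  "is_H_product b s t \<sigma> P \<Longrightarrow> is_H_product b s t \<sigma> Q \<Longrightarrow> u \<in> H_space b s \<Longrightarrow> v \<in> H_space b t \<Longrightarrow> P u v = Q u v"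
  unfolding is_H_product_iff by (elim conjE, erule H_continuous_unique, assumption) simp_all

text \<open>Here \<open>\<sigma>\<close> need not be the minimum, so that the condition also covers the products with a smooth
  factor, where \<open>s\<close> is large and \<open>t = \<sigma>\<close>.\<close>

definition admissible :: "('n::finite \<Rightarrow> 'j::finite) \<Rightarrow> real^'j \<Rightarrow> real^'j \<Rightarrow> real^'j \<Rightarrow> bool" where
  "admissible b s t \<sigma> \<longleftrightarrow> surj b \<and> (\<forall>l. \<sigma> $ l \<le> s $ l \<and> \<sigma> $ l \<le> t $ l \<and> 0 \<le> s $ l + t $ l \<and>
    real (block_dim b l) / 2 < s $ l + t $ l - \<sigma> $ l)"

text \<open>The Fourier transform of a product of functions with transforms F and G. The factor (2
  pi)^(-n) belongs to the convention that places the whole constant in the inverse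
  transform.\<close>

definition product_transform :: "(real^'n::finite \<Rightarrow> complex) \<Rightarrow> (real^'n \<Rightarrow> complex) \<Rightarrow> (real^'n \<Rightarrow> complex)" where
  "product_transform F G = (\<lambda>\<xi>. (1 / complex_of_real ((2 * pi) ^ CARD('n))) * conv F G \<xi>)"

lemma product_transform_bound:
  fixes b :: "'n::finite \<Rightarrow> 'j::finite"
  assumes adm: "admissible b s t \<sigma>"
  obtains C where "0 \<le> C" "\<And>F G. F \<in> weighted_L2 b s \<Longrightarrow> G \<in> weighted_L2 b t \<Longrightarrow> product_transform F G \<in> weighted_L2 b \<sigma>"
    "\<And>F G. F \<in> weighted_L2 b s \<Longrightarrow> G \<in> weighted_L2 b t \<Longrightarrow> weighted_norm b \<sigma> (product_transform F G) \<le> C * weighted_norm b s F * weighted_norm b t G"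
    "\<And>F G. F \<in> weighted_L2 b s \<Longrightarrow> G \<in> weighted_L2 b t \<Longrightarrow> (AE \<xi> in lborel. abs_conv F G \<xi> < \<infinity>)"
proof -
  let ?k = "1 / complex_of_real ((2 * pi) ^ CARD('n))"
  obtain C where C: "0 \<le> C" "\<And>F G. F \<in> weighted_L2 b s \<Longrightarrow> G \<in> weighted_L2 b t \<Longrightarrow>
    (\<integral>\<^sup>+\<xi>. (ennreal (bracket b \<sigma> \<xi>) * abs_conv F G \<xi>)\<^sup>2 \<partial>lborel) \<le> ennreal ((C * weighted_norm b s F * weighted_norm b t G)\<^sup>2)"
    by (rule abs_conv_bound[of b \<sigma> s t]) (use adm in \<open>auto simp: admissible_def\<close>)
  have *: "conv F G \<in> weighted_L2 b \<sigma>" "weighted_norm b \<sigma> (conv F G) \<le> C * weighted_norm b s F * weighted_norm b t G" "AE \<xi> in lborel. abs_conv F G \<xi> < \<infinity>"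
    if F: "F \<in> weighted_L2 b s" and G: "G \<in> weighted_L2 b t" for F G
    using conv_bound[OF weighted_measurable[OF F] weighted_measurable[OF G] _ C(2)[OF F G]] C(1)
    by (simp_all add: weighted_norm_nonneg)
  show ?thesis
  proof (rule that[of "norm ?k * C"])
    show "0 \<le> norm ?k * C" using C(1) by simp
    fix F G assume FG: "F \<in> weighted_L2 b s" "G \<in> weighted_L2 b t"
    show "product_transform F G \<in> weighted_L2 b \<sigma>" unfolding product_transform_def by (rule weighted_cmult[OF *(1)[OF FG]])
    have "weighted_norm b \<sigma> (product_transform F G) = norm ?k * weighted_norm b \<sigma> (conv F G)"
      unfolding product_transform_def by (rule weighted_cmult[OF *(1)[OF FG]])
    also have "\<dots> \<le> norm ?k * (C * weighted_norm b s F * weighted_norm b t G)" by (intro mult_left_mono *(2) FG) simp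
    finally show "weighted_norm b \<sigma> (product_transform F G) \<le> (norm ?k * C) * weighted_norm b s F * weighted_norm b t G"
      by (simp only: mult.assoc)
    show "AE \<xi> in lborel. abs_conv F G \<xi> < \<infinity>" by (rule *(3)[OF FG])
  qed
qed

text \<open>The usual splitting F'G' - FG = (F' - F)G' + F(G' - G). For the convolutions it is an
  identity only where the integrals for (F', G'), (F, G') and (F, G) converge absolutely, which is
  almost everywhere and suffices for the norm.\<close>

lemma product_transform_diff_bound:
  fixes b :: "'n::finite \<Rightarrow> 'j::finite"
  assumes adm: "admissible b s t \<sigma>"
  obtains C where "0 \<le> C" "\<And>F G F' G'. F \<in> weighted_L2 b s \<Longrightarrow> G \<in> weighted_L2 b t \<Longrightarrow> F' \<in> weighted_L2 b s \<Longrightarrow> G' \<in> weighted_L2 b t \<Longrightarrow>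
    weighted_norm b \<sigma> (\<lambda>\<xi>. product_transform F' G' \<xi> - product_transform F G \<xi>) \<le>
      C * (weighted_norm b s (\<lambda>\<xi>. F' \<xi> - F \<xi>) * weighted_norm b t G' + weighted_norm b s F * weighted_norm b t (\<lambda>\<xi>. G' \<xi> - G \<xi>))"
proof -
  obtain C where C: "0 \<le> C" "\<And>F G. F \<in> weighted_L2 b s \<Longrightarrow> G \<in> weighted_L2 b t \<Longrightarrow> product_transform F G \<in> weighted_L2 b \<sigma>"
    "\<And>F G. F \<in> weighted_L2 b s \<Longrightarrow> G \<in> weighted_L2 b t \<Longrightarrow> weighted_norm b \<sigma> (product_transform F G) \<le> C * weighted_norm b s F * weighted_norm b t G"
    "\<And>F G. F \<in> weighted_L2 b s \<Longrightarrow> G \<in> weighted_L2 b t \<Longrightarrow> (AE \<xi> in lborel. abs_conv F G \<xi> < \<infinity>)"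
    by (rule product_transform_bound[OF adm], blast)
  have "weighted_norm b \<sigma> (\<lambda>\<xi>. product_transform F' G' \<xi> - product_transform F G \<xi>) \<le>
      C * (weighted_norm b s (\<lambda>\<xi>. F' \<xi> - F \<xi>) * weighted_norm b t G' + weighted_norm b s F * weighted_norm b t (\<lambda>\<xi>. G' \<xi> - G \<xi>))"
    if F: "F \<in> weighted_L2 b s" and G: "G \<in> weighted_L2 b t" and F': "F' \<in> weighted_L2 b s" and G': "G' \<in> weighted_L2 b t" for F G F' G'
  proof -
    let ?A = "product_transform (\<lambda>\<xi>. F' \<xi> - F \<xi>) G'" and ?B = "product_transform F (\<lambda>\<xi>. G' \<xi> - G \<xi>)"
    note m = weighted_measurable[OF F] weighted_measurable[OF G] weighted_measurable[OF F'] weighted_measurable[OF G']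
    note W = C(2)[OF F' G'] C(2)[OF F G] C(2)[OF weighted_diff[OF F' F] G'] C(2)[OF F weighted_diff[OF G' G]]
    have "AE \<xi> in lborel. product_transform F' G' \<xi> - product_transform F G \<xi> = ?A \<xi> + ?B \<xi>"
      using C(4)[OF F' G'] C(4)[OF F G'] C(4)[OF F G]
    proof eventually_elim
      fix \<xi> assume "abs_conv F' G' \<xi> < \<infinity>" "abs_conv F G' \<xi> < \<infinity>" "abs_conv F G \<xi> < \<infinity>"
      then have i: "integrable lborel (\<lambda>\<eta>. F' (\<xi> - \<eta>) * G' \<eta>)" "integrable lborel (\<lambda>\<eta>. F (\<xi> - \<eta>) * G' \<eta>)" "integrable lborel (\<lambda>\<eta>. F (\<xi> - \<eta>) * G \<eta>)"
        using m by (auto intro: abs_conv_finite_integrable)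
      have "conv (\<lambda>\<xi>. F' \<xi> - F \<xi>) G' \<xi> = conv F' G' \<xi> - conv F G' \<xi>" "conv F (\<lambda>\<xi>. G' \<xi> - G \<xi>) \<xi> = conv F G' \<xi> - conv F G \<xi>"
        unfolding conv_def left_diff_distrib right_diff_distrib using i by (simp_all add: Bochner_Integration.integral_diff)
      then have "conv F' G' \<xi> - conv F G \<xi> = conv (\<lambda>\<xi>. F' \<xi> - F \<xi>) G' \<xi> + conv F (\<lambda>\<xi>. G' \<xi> - G \<xi>) \<xi>" by simp
      then show "product_transform F' G' \<xi> - product_transform F G \<xi> = ?A \<xi> + ?B \<xi>"
        unfolding product_transform_def by (simp only: right_diff_distrib[symmetric] distrib_left[symmetric])
    qed
    then have "weighted_norm b \<sigma> (\<lambda>\<xi>. product_transform F' G' \<xi> - product_transform F G \<xi>) = weighted_norm b \<sigma> (\<lambda>\<xi>. ?A \<xi> + ?B \<xi>)"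
      using W[THEN weighted_measurable] unfolding weighted_norm_def L2_norm_def
      by (intro arg_cong[where f=sqrt] integral_cong_AE) auto
    also have "\<dots> \<le> weighted_norm b \<sigma> ?A + weighted_norm b \<sigma> ?B" by (intro weighted_add W)
    also have "\<dots> \<le> C * weighted_norm b s (\<lambda>\<xi>. F' \<xi> - F \<xi>) * weighted_norm b t G' + C * weighted_norm b s F * weighted_norm b t (\<lambda>\<xi>. G' \<xi> - G \<xi>)"
      by (intro add_mono C(3) weighted_diff F G F' G')
    finally show ?thesis by (simp only: distrib_left mult.assoc)
  qed
  with C(1) that show ?thesis by blast
qed

text \<open>Transforms are determined only up to null sets, so representatives are selected; the
  choice is shown below not to affect the result.\<close>

definition H_product :: "('n::finite \<Rightarrow> 'j::finite) \<Rightarrow> real^'j \<Rightarrow> real^'j \<Rightarrow> 'n functional \<Rightarrow> 'n functional \<Rightarrow> 'n functional" where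
  "H_product b s t u v = of_transform (product_transform (SOME F. F \<in> weighted_L2 b s \<and> u = of_transform F)
     (SOME G. G \<in> weighted_L2 b t \<and> v = of_transform G))"

lemma weighted_norm_AE_zero:
  assumes "F \<in> weighted_L2 b s" "G \<in> weighted_L2 b s" "AE \<xi> in lborel. F \<xi> = G \<xi>"
  shows "weighted_norm b s (\<lambda>\<xi>. F \<xi> - G \<xi>) = 0"
proof -
  have "weighted_norm b s (\<lambda>\<xi>. F \<xi> - G \<xi>) = weighted_norm b s (\<lambda>\<xi>. 0)"
    using assms(3) weighted_measurable[OF assms(1)] weighted_measurable[OF assms(2)] unfolding weighted_norm_def L2_norm_def
    by (intro arg_cong[where f=sqrt] integral_cong_AE) auto
  then show ?thesis by (simp add: weighted_norm_def L2_norm_def)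
qed

lemma weighted_norm_zero_of_transform:
  assumes F: "F \<in> weighted_L2 b s" and G: "G \<in> weighted_L2 b s" and "weighted_norm b s (\<lambda>\<xi>. F \<xi> - G \<xi>) = 0"
  shows "of_transform F = of_transform G"
proof -
  have "AE \<xi> in lborel. complex_of_real (bracket b s \<xi>) * (F \<xi> - G \<xi>) = 0"
    using weighted_diff[OF F G] assms(3) unfolding weighted_norm_def weighted_L2_def by (intro L2_norm_zero_AE) auto
  then have "AE \<xi> in lborel. F \<xi> = G \<xi>" using bracket_pos[of b s] by (simp add: less_imp_neq[symmetric])
  then show ?thesis by (intro of_transform_cong_AE weighted_measurable[OF F] weighted_measurable[OF G])
qed

text \<open>The selected representatives are at weighted distance 0 from F and G, and the difference
  bound then gives distance 0 for the product transforms.\<close>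

lemma H_product_of_transform:
  assumes adm: "admissible b s t \<sigma>" and F: "F \<in> weighted_L2 b s" and G: "G \<in> weighted_L2 b t"
  shows "H_product b s t (of_transform F) (of_transform G) = of_transform (product_transform F G)"
proof -
  let ?F = "SOME F'. F' \<in> weighted_L2 b s \<and> of_transform F = of_transform F'"
  let ?G = "SOME G'. G' \<in> weighted_L2 b t \<and> of_transform G = of_transform G'"
  have F': "?F \<in> weighted_L2 b s \<and> of_transform F = of_transform ?F" by (rule someI[of _ F]) (use F in simp)
  have G': "?G \<in> weighted_L2 b t \<and> of_transform G = of_transform ?G" by (rule someI[of _ G]) (use G in simp)
  have zF: "weighted_norm b s (\<lambda>\<xi>. ?F \<xi> - F \<xi>) = 0"
    using F' F of_transform_inject[of ?F b s F] by (intro weighted_norm_AE_zero) auto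
  have zG: "weighted_norm b t (\<lambda>\<xi>. ?G \<xi> - G \<xi>) = 0"
    using G' G of_transform_inject[of ?G b t G] by (intro weighted_norm_AE_zero) auto
  obtain C where "0 \<le> C" and C0: "\<And>F G F' G'. F \<in> weighted_L2 b s \<Longrightarrow> G \<in> weighted_L2 b t \<Longrightarrow> F' \<in> weighted_L2 b s \<Longrightarrow> G' \<in> weighted_L2 b t \<Longrightarrow>
    weighted_norm b \<sigma> (\<lambda>\<xi>. product_transform F' G' \<xi> - product_transform F G \<xi>) \<le>
      C * (weighted_norm b s (\<lambda>\<xi>. F' \<xi> - F \<xi>) * weighted_norm b t G' + weighted_norm b s F * weighted_norm b t (\<lambda>\<xi>. G' \<xi> - G \<xi>))"
    by (rule product_transform_diff_bound[OF adm], blast)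
  note C = C0[OF F G conjunct1[OF F'] conjunct1[OF G']]
  have W: "product_transform F G \<in> weighted_L2 b \<sigma>" if "F \<in> weighted_L2 b s" "G \<in> weighted_L2 b t" for F G
    using product_transform_bound[OF adm] that by metis
  have "weighted_norm b \<sigma> (\<lambda>\<xi>. product_transform ?F ?G \<xi> - product_transform F G \<xi>) = 0"
    using C weighted_norm_nonneg[of b \<sigma> "\<lambda>\<xi>. product_transform ?F ?G \<xi> - product_transform F G \<xi>"] unfolding zF zG by simp
  then show ?thesis unfolding H_product_def
    using F' G' F G by (intro weighted_norm_zero_of_transform[of _ b \<sigma>] W) auto
qed

text \<open>The formula for the inverse transform of a product, evaluated at -\<xi>, turns the
  correlation into a convolution. One factor (2 pi)^n cancels, the other is the one in
  \<open>product_transform\<close>.\<close>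

lemma product_transform_schwartz:
  fixes f g :: "real^'n::finite \<Rightarrow> complex"
  assumes f: "f \<in> schwartz_functions" and g: "g \<in> schwartz_functions"
  shows "product_transform (fourier f) (fourier g) = fourier (\<lambda>x. f x * g x)"
proof
  fix \<xi> :: "real^'n"
  let ?c = "complex_of_real ((2 * pi) ^ CARD('n))"
  have "inv_fourier (\<lambda>x. g x * f x) (- \<xi>) = (LINT \<eta>|lborel. fourier g \<eta> * inv_fourier f (- \<xi> + \<eta>)) / ?c"
    by (rule inv_fourier_mult[OF g f])
  also have "(LINT \<eta>|lborel. fourier g \<eta> * inv_fourier f (- \<xi> + \<eta>)) = conv (fourier f) (fourier g) \<xi> / ?c"
    unfolding conv_def inv_fourier_eq by (simp add: mult.commute)
  finally have "inv_fourier (\<lambda>x. f x * g x) (- \<xi>) = conv (fourier f) (fourier g) \<xi> / ?c / ?c" by (simp only: mult.commute)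
  moreover have "inv_fourier (\<lambda>x. f x * g x) (- \<xi>) = fourier (\<lambda>x. f x * g x) \<xi> / ?c" by (simp add: inv_fourier_eq)
  ultimately have "fourier (\<lambda>x. f x * g x) \<xi> / ?c = conv (fourier f) (fourier g) \<xi> / ?c / ?c" by simp
  then have "fourier (\<lambda>x. f x * g x) \<xi> = conv (fourier f) (fourier g) \<xi> / ?c"
    by (subst (asm) divide_cancel_right) simp
  then show "product_transform (fourier f) (fourier g) \<xi> = fourier (\<lambda>x. f x * g x) \<xi>" by (simp add: product_transform_def)
qed

lemma H_product_bound:
  fixes b :: "'n::finite \<Rightarrow> 'j::finite"
  assumes adm: "admissible b s t \<sigma>"
  obtains C where "0 \<le> C" "\<And>u v. u \<in> H_space b s \<Longrightarrow> v \<in> H_space b t \<Longrightarrow> H_product b s t u v \<in> H_space b \<sigma>"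
    "\<And>u v. u \<in> H_space b s \<Longrightarrow> v \<in> H_space b t \<Longrightarrow> Hn b \<sigma> (H_product b s t u v) \<le> C * Hn b s u * Hn b t v"
    "\<And>u v u' v'. u \<in> H_space b s \<Longrightarrow> v \<in> H_space b t \<Longrightarrow> u' \<in> H_space b s \<Longrightarrow> v' \<in> H_space b t \<Longrightarrow>
      Hn b \<sigma> (tempered_diff (H_product b s t u' v') (H_product b s t u v)) \<le> C * (Hn b s (tempered_diff u' u) * Hn b t v' + Hn b s u * Hn b t (tempered_diff v' v))"
proof -
  let ?c = "1 / sqrt ((2 * pi) ^ CARD('n))"
  have c: "0 < ?c" by simp
  obtain C where C: "0 \<le> C" "\<And>F G. F \<in> weighted_L2 b s \<Longrightarrow> G \<in> weighted_L2 b t \<Longrightarrow> product_transform F G \<in> weighted_L2 b \<sigma>"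
    "\<And>F G. F \<in> weighted_L2 b s \<Longrightarrow> G \<in> weighted_L2 b t \<Longrightarrow> weighted_norm b \<sigma> (product_transform F G) \<le> C * weighted_norm b s F * weighted_norm b t G"
    by (rule product_transform_bound[OF adm], blast)
  obtain D where D: "0 \<le> D" "\<And>F G F' G'. F \<in> weighted_L2 b s \<Longrightarrow> G \<in> weighted_L2 b t \<Longrightarrow> F' \<in> weighted_L2 b s \<Longrightarrow> G' \<in> weighted_L2 b t \<Longrightarrow>
    weighted_norm b \<sigma> (\<lambda>\<xi>. product_transform F' G' \<xi> - product_transform F G \<xi>) \<le>
      D * (weighted_norm b s (\<lambda>\<xi>. F' \<xi> - F \<xi>) * weighted_norm b t G' + weighted_norm b s F * weighted_norm b t (\<lambda>\<xi>. G' \<xi> - G \<xi>))"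
    by (rule product_transform_diff_bound[OF adm], blast)
  note prod = H_product_of_transform[OF adm]
  \<comment> \<open>Each norm in \<open>H_space\<close> is \<open>?c\<close> times a weighted norm.
    The left side contains one such factor and each product on the right two, hence the division by
    \<open>?c\<close>.\<close>
  let ?M = "max C D / ?c"
  have M: "C / ?c \<le> ?M" "D / ?c \<le> ?M" using c by (intro divide_right_mono; simp)+
  show ?thesis
  proof (rule that[of ?M])
    show "0 \<le> ?M" using C(1) c by simp
    fix u v assume u: "u \<in> H_space b s" and v: "v \<in> H_space b t"
    obtain F where F: "F \<in> weighted_L2 b s" "u = of_transform F" using u by (metis H_space_of_transform)
    obtain G where G: "G \<in> weighted_L2 b t" "v = of_transform G" using v by (metis H_space_of_transform)
    show "H_product b s t u v \<in> H_space b \<sigma>"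
      unfolding F(2) G(2) prod[OF F(1) G(1)] by (rule H_norm_of_transform[OF C(2)[OF F(1) G(1)]])
    have "Hn b \<sigma> (H_product b s t u v) = ?c * weighted_norm b \<sigma> (product_transform F G)"
      unfolding F(2) G(2) prod[OF F(1) G(1)] by (rule Hn_of_transform[OF C(2)[OF F(1) G(1)]])
    also have "\<dots> \<le> ?c * (C * weighted_norm b s F * weighted_norm b t G)" using c by (intro mult_left_mono C(3) F G) simp
    also have "\<dots> = (C / ?c) * (?c * weighted_norm b s F) * (?c * weighted_norm b t G)" using c by (simp add: field_simps)
    also have "\<dots> \<le> ?M * (?c * weighted_norm b s F) * (?c * weighted_norm b t G)"
      using c by (intro mult_right_mono M mult_nonneg_nonneg weighted_norm_nonneg) auto
    finally show "Hn b \<sigma> (H_product b s t u v) \<le> ?M * Hn b s u * Hn b t v"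
      unfolding F(2) G(2) Hn_of_transform[OF F(1)] Hn_of_transform[OF G(1)] .
    fix u' v' assume u': "u' \<in> H_space b s" and v': "v' \<in> H_space b t"
    obtain F' where F': "F' \<in> weighted_L2 b s" "u' = of_transform F'" using u' by (metis H_space_of_transform)
    obtain G' where G': "G' \<in> weighted_L2 b t" "v' = of_transform G'" using v' by (metis H_space_of_transform)
    let ?X = "weighted_norm b s (\<lambda>\<xi>. F' \<xi> - F \<xi>)" and ?Y = "weighted_norm b t (\<lambda>\<xi>. G' \<xi> - G \<xi>)"
    have "Hn b \<sigma> (tempered_diff (H_product b s t u' v') (H_product b s t u v)) = ?c * weighted_norm b \<sigma> (\<lambda>\<xi>. product_transform F' G' \<xi> - product_transform F G \<xi>)"
      unfolding F(2) G(2) F'(2) G'(2) prod[OF F(1) G(1)] prod[OF F'(1) G'(1)] tempered_diff_of_transform[OF C(2)[OF F'(1) G'(1)] C(2)[OF F(1) G(1)]]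
      by (rule Hn_of_transform[OF weighted_diff[OF C(2)[OF F'(1) G'(1)] C(2)[OF F(1) G(1)]]])
    also have "\<dots> \<le> ?c * (D * (?X * weighted_norm b t G' + weighted_norm b s F * ?Y))" using c by (intro mult_left_mono D F G F' G') simp
    also have "\<dots> = (D / ?c) * ((?c * ?X) * (?c * weighted_norm b t G') + (?c * weighted_norm b s F) * (?c * ?Y))" using c by (simp add: field_simps)
    also have "\<dots> \<le> ?M * ((?c * ?X) * (?c * weighted_norm b t G') + (?c * weighted_norm b s F) * (?c * ?Y))"
      using c by (intro mult_right_mono M add_nonneg_nonneg mult_nonneg_nonneg weighted_norm_nonneg) auto
    finally show "Hn b \<sigma> (tempered_diff (H_product b s t u' v') (H_product b s t u v)) \<le> ?M * (Hn b s (tempered_diff u' u) * Hn b t v' + Hn b s u * Hn b t (tempered_diff v' v))"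
      unfolding F(2) G(2) F'(2) G'(2) tempered_diff_of_transform[OF F'(1) F(1)] tempered_diff_of_transform[OF G'(1) G(1)]
        Hn_of_transform[OF F(1)] Hn_of_transform[OF G'(1)] Hn_of_transform[OF weighted_diff[OF F'(1) F(1)]] Hn_of_transform[OF weighted_diff[OF G'(1) G(1)]] .
  qed
qed

lemma is_H_product_H_product:
  assumes adm: "admissible b s t \<sigma>"
  shows "is_H_product b s t \<sigma> (H_product b s t)"
proof -
  obtain C where C: "0 \<le> C" "\<And>u v. u \<in> H_space b s \<Longrightarrow> v \<in> H_space b t \<Longrightarrow> H_product b s t u v \<in> H_space b \<sigma>"
    "\<And>u v u' v'. u \<in> H_space b s \<Longrightarrow> v \<in> H_space b t \<Longrightarrow> u' \<in> H_space b s \<Longrightarrow> v' \<in> H_space b t \<Longrightarrow>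
      Hn b \<sigma> (tempered_diff (H_product b s t u' v') (H_product b s t u v)) \<le> C * (Hn b s (tempered_diff u' u) * Hn b t v' + Hn b s u * Hn b t (tempered_diff v' v))"
    by (rule H_product_bound[OF adm], blast)
  have cont: "\<exists>d>0::real. \<forall>u'\<in>H_space b s. \<forall>v'\<in>H_space b t.
        H_norm b s (tempered_diff u' u) < ennreal d \<and> H_norm b t (tempered_diff v' v) < ennreal d \<longrightarrow>
        H_norm b \<sigma> (tempered_diff (H_product b s t u' v') (H_product b s t u v)) < ennreal e"
    if u: "u \<in> H_space b s" and v: "v \<in> H_space b t" and e: "e > 0" for u v and e :: real
  proof -
    \<comment> \<open>The radius is at most 1, so the norm of v' is at most that of v plus 1. The
      final + 1 makes \<open>?K\<close> positive and the last comparison strict.\<close>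
    let ?K = "C * (Hn b t v + 1 + Hn b s u) + 1"
    have K: "?K > 0" using C(1) by (intro add_nonneg_pos mult_nonneg_nonneg add_nonneg_nonneg Hn_nonneg) auto
    let ?d = "min 1 (e / ?K)"
    show ?thesis
    proof (intro exI[of _ ?d] conjI ballI impI)
      show "?d > 0" using e K by simp
      fix u' v' assume u': "u' \<in> H_space b s" and v': "v' \<in> H_space b t"
        and close: "H_norm b s (tempered_diff u' u) < ennreal ?d \<and> H_norm b t (tempered_diff v' v) < ennreal ?d"
      have 1: "Hn b s (tempered_diff u' u) < ?d" using close H_norm_less_iff[OF H_tempered_diff[OF u' u], of ?d] by blast
      have 2: "Hn b t (tempered_diff v' v) < ?d" using close H_norm_less_iff[OF H_tempered_diff[OF v' v], of ?d] by blast
      have 3: "Hn b t v' \<le> Hn b t v + 1" using Hn_diff_bound[OF v' v] 2 by linarith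
      have "Hn b \<sigma> (tempered_diff (H_product b s t u' v') (H_product b s t u v)) \<le> C * (Hn b s (tempered_diff u' u) * Hn b t v' + Hn b s u * Hn b t (tempered_diff v' v))"
        by (rule C(3)[OF u v u' v'])
      also have "\<dots> \<le> C * (?d * (Hn b t v + 1) + Hn b s u * ?d)"
        using e K by (intro mult_left_mono add_mono mult_mono C(1) less_imp_le[OF 1] less_imp_le[OF 2] 3 Hn_nonneg add_nonneg_nonneg) auto
      also have "\<dots> = C * (Hn b t v + 1 + Hn b s u) * ?d" by (simp only: algebra_simps)
      also have "\<dots> < ?K * ?d" using \<open>?d > 0\<close> by (intro mult_strict_right_mono) auto
      also have "\<dots> \<le> ?K * (e / ?K)" using K by (intro mult_left_mono) auto
      also have "\<dots> = e" using K by (simp only: times_divide_eq_right nonzero_mult_div_cancel_left less_imp_neq[OF K, symmetric] not_False_eq_True)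
      finally show "H_norm b \<sigma> (tempered_diff (H_product b s t u' v') (H_product b s t u v)) < ennreal e"
        using H_norm_less_iff[OF H_tempered_diff[OF C(2)[OF u' v'] C(2)[OF u v]]] by blast
    qed
  qed
  have "H_product b s t (tempered_of_fun f) (tempered_of_fun g) = tempered_of_fun (\<lambda>x. f x * g x)"
    if f: "f \<in> schwartz_functions" and g: "g \<in> schwartz_functions" for f g
    unfolding tempered_of_fun_eq_of_transform[OF f] tempered_of_fun_eq_of_transform[OF g] tempered_of_fun_eq_of_transform[OF schwartz_mult[OF f g]]
    by (subst H_product_of_transform[OF adm]) (simp_all add: schwartz_weighted_L2 fourier_schwartz f g product_transform_schwartz)
  with cont C(2) show ?thesis unfolding is_H_product_def by blast
qed

section \<open>Multiplication by Schwartz functions\<close>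

text \<open>Links the definition of multiplication by testing with the convolution of transforms.
  The substitution \<zeta> = \<xi> + \<eta> and Fubini are needed; G is only in a weighted space, so
  absolute convergence of the double integral rests on the convolution estimate with t = \<sigma> =
  s.\<close>

lemma tempered_mult_of_transform:
  fixes b :: "'n::finite \<Rightarrow> 'j::finite"
  assumes adm: "admissible b r s s" and \<theta>: "\<theta> \<in> schwartz_functions" and G: "G \<in> weighted_L2 b s"
  shows "tempered_mult \<theta> (of_transform G) = of_transform (product_transform (fourier \<theta>) G)"
proof
  fix \<phi> :: "real^'n \<Rightarrow> complex"
  show "tempered_mult \<theta> (of_transform G) \<phi> = of_transform (product_transform (fourier \<theta>) G) \<phi>"
  proof (cases "\<phi> \<in> schwartz_functions")
    case True
    let ?c = "complex_of_real ((2 * pi) ^ CARD('n))"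
    let ?p = "inv_fourier \<phi>" and ?t = "fourier \<theta>"
    note pS = inv_fourier_schwartz[OF True] and tS = fourier_schwartz[OF \<theta>]
    note W = schwartz_weighted_L2[OF tS, of b r] and P = schwartz_weighted_L2[OF pS, of b "- s"]
    note [measurable] = weighted_measurable[OF G] schwartz_measurable[OF pS] schwartz_measurable[OF tS]
    obtain C where C: "0 \<le> C" "\<And>F G. F \<in> weighted_L2 b r \<Longrightarrow> G \<in> weighted_L2 b s \<Longrightarrow>
      (\<integral>\<^sup>+\<xi>. (ennreal (bracket b s \<xi>) * abs_conv F G \<xi>)\<^sup>2 \<partial>lborel) \<le> ennreal ((C * weighted_norm b r F * weighted_norm b s G)\<^sup>2)"
      by (rule abs_conv_bound[of b s r s]) (use adm in \<open>auto simp: admissible_def\<close>)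
    \<comment> \<open>Inserting the product of the weights of order s and -s allows Cauchy-Schwarz:
      one factor is the weighted norm of the convolution, the other a weighted norm of a Schwartz
      function.\<close>
    have mb: "ennreal (bracket b s \<zeta>) * ennreal (bracket b (- s) \<zeta>) = 1" for \<zeta>
      using bracket_pos[of b s \<zeta>] by (simp add: bracket_uminus flip: ennreal_mult)
    have "(\<integral>\<^sup>+\<zeta>. abs_conv ?t G \<zeta> * ennreal (norm (?p \<zeta>)) \<partial>lborel) < \<infinity>"
    proof -
      have "(\<integral>\<^sup>+\<zeta>. abs_conv ?t G \<zeta> * ennreal (norm (?p \<zeta>)) \<partial>lborel) =
        (\<integral>\<^sup>+\<zeta>. (ennreal (bracket b s \<zeta>) * abs_conv ?t G \<zeta>) * (ennreal (bracket b (- s) \<zeta>) * ennreal (norm (?p \<zeta>))) \<partial>lborel)"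
      proof (rule nn_integral_cong)
        fix \<zeta>
        have "(ennreal (bracket b s \<zeta>) * abs_conv ?t G \<zeta>) * (ennreal (bracket b (- s) \<zeta>) * ennreal (norm (?p \<zeta>))) =
          (ennreal (bracket b s \<zeta>) * ennreal (bracket b (- s) \<zeta>)) * (abs_conv ?t G \<zeta> * ennreal (norm (?p \<zeta>)))"
          by (simp only: mult_ac)
        then show "abs_conv ?t G \<zeta> * ennreal (norm (?p \<zeta>)) = (ennreal (bracket b s \<zeta>) * abs_conv ?t G \<zeta>) * (ennreal (bracket b (- s) \<zeta>) * ennreal (norm (?p \<zeta>)))"
          by (simp only: mb mult_1)
      qed
      also have "\<dots>\<^sup>2 \<le> (\<integral>\<^sup>+\<zeta>. (ennreal (bracket b s \<zeta>) * abs_conv ?t G \<zeta>)\<^sup>2 \<partial>lborel) * (\<integral>\<^sup>+\<zeta>. (ennreal (bracket b (- s) \<zeta>) * ennreal (norm (?p \<zeta>)))\<^sup>2 \<partial>lborel)"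
        by (rule Cauchy_Schwarz_nn_integral) measurable
      also have "\<dots> < \<infinity>"
        unfolding weighted_nn_integral[OF P] using C(2)[OF W G] by (auto simp: ennreal_mult_less_top intro: le_less_trans)
      finally show ?thesis by (simp add: power_less_top_ennreal)
    qed
    moreover have "(\<integral>\<^sup>+z. ennreal (norm (case z of (\<zeta>, \<xi>) \<Rightarrow> ?t (\<zeta> - \<xi>) * G \<xi> * ?p \<zeta>)) \<partial>(lborel \<Otimes>\<^sub>M lborel)) =
      (\<integral>\<^sup>+\<zeta>. abs_conv ?t G \<zeta> * ennreal (norm (?p \<zeta>)) \<partial>lborel)"
      unfolding abs_conv_def by (subst lborel.nn_integral_fst[symmetric]) (simp_all add: norm_mult ennreal_mult nn_integral_multc)
    ultimately have i: "integrable (lborel \<Otimes>\<^sub>M lborel) (\<lambda>(\<zeta>, \<xi>). ?t (\<zeta> - \<xi>) * G \<xi> * ?p \<zeta>)"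
      by (intro integrableI_bounded) simp_all
    have "of_transform G (\<lambda>x. \<theta> x * \<phi> x) = (LINT \<xi>|lborel. G \<xi> * ((LINT \<eta>|lborel. ?t \<eta> * ?p (\<xi> + \<eta>)) / ?c))"
      using schwartz_mult[OF \<theta> True] by (simp add: of_transform_def inv_fourier_mult[OF \<theta> True])
    also have "\<dots> = (LINT \<xi>|lborel. LINT \<zeta>|lborel. (1 / ?c) * (?t (\<zeta> - \<xi>) * G \<xi> * ?p \<zeta>))"
    proof (rule Bochner_Integration.integral_cong[OF refl])
      fix \<xi>
      have "(LINT \<eta>|lborel. ?t \<eta> * ?p (\<xi> + \<eta>)) = (LINT \<eta>|lborel. (\<lambda>\<zeta>. ?t (\<zeta> - \<xi>) * ?p \<zeta>) (\<xi> + \<eta>))" by simp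
      also have "\<dots> = (LINT \<zeta>|lborel. ?t (\<zeta> - \<xi>) * ?p \<zeta>)" by (rule lborel_integral_translate) measurable
      finally have eq: "(LINT \<eta>|lborel. ?t \<eta> * ?p (\<xi> + \<eta>)) = (LINT \<zeta>|lborel. ?t (\<zeta> - \<xi>) * ?p \<zeta>)" .
      have "(LINT \<zeta>|lborel. (1 / ?c) * (?t (\<zeta> - \<xi>) * G \<xi> * ?p \<zeta>)) = (LINT \<zeta>|lborel. (G \<xi> / ?c) * (?t (\<zeta> - \<xi>) * ?p \<zeta>))"
        by (simp add: mult_ac)
      also have "\<dots> = (G \<xi> / ?c) * (LINT \<zeta>|lborel. ?t (\<zeta> - \<xi>) * ?p \<zeta>)" by (rule integral_mult_right_zero)
      finally show "G \<xi> * ((LINT \<eta>|lborel. ?t \<eta> * ?p (\<xi> + \<eta>)) / ?c) = (LINT \<zeta>|lborel. (1 / ?c) * (?t (\<zeta> - \<xi>) * G \<xi> * ?p \<zeta>))"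
        by (simp add: eq)
    qed
    also have "\<dots> = (1 / ?c) * (LINT \<xi>|lborel. LINT \<zeta>|lborel. ?t (\<zeta> - \<xi>) * G \<xi> * ?p \<zeta>)" by (simp only: integral_mult_right_zero)
    also have "(LINT \<xi>|lborel. LINT \<zeta>|lborel. ?t (\<zeta> - \<xi>) * G \<xi> * ?p \<zeta>) = (LINT \<zeta>|lborel. LINT \<xi>|lborel. ?t (\<zeta> - \<xi>) * G \<xi> * ?p \<zeta>)"
      by (rule lborel_pair.Fubini_integral[OF i])
    also have "\<dots> = (LINT \<zeta>|lborel. conv ?t G \<zeta> * ?p \<zeta>)" by (simp add: conv_def)
    also have "(1 / ?c) * \<dots> = (LINT \<zeta>|lborel. product_transform ?t G \<zeta> * ?p \<zeta>)"
      unfolding product_transform_def mult.assoc by (rule integral_mult_right_zero[symmetric])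
    finally show ?thesis using True by (simp add: tempered_mult_def of_transform_def)
  qed (simp add: tempered_mult_def of_transform_def)
qed

text \<open>Large enough for a factor of this order to act on the space of order s: it is at least
  s_l and -s_l in every block, and it exceeds n_l / 2, which is the remaining order when t =
  \<sigma> = s.\<close>

definition mult_exponent :: "('n::finite \<Rightarrow> 'j::finite) \<Rightarrow> real^'j \<Rightarrow> real^'j" where
  "mult_exponent b s = vec_lambda (\<lambda>l. \<bar>s $ l\<bar> + real (block_dim b l))"

lemma admissible_mult_exponent:
  assumes "surj b" shows "admissible b (mult_exponent b s) s s"
proof -
  have "block_dim b l > 0" for l
  proof -
    obtain i where "b i = l" using assms by (metis surjD)
    then show ?thesis by (auto simp: block_dim_def card_gt_0_iff)
  qed
  then show ?thesis using assms unfolding admissible_def mult_exponent_def by (auto simp: add_pos_nonneg)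
qed

lemma H_product_schwartz_left:
  assumes b: "surj b" and \<theta>: "\<theta> \<in> schwartz_functions" and u: "u \<in> H_space b s"
  shows "H_product b (mult_exponent b s) s (tempered_of_fun \<theta>) u = tempered_mult \<theta> u"
proof -
  note adm = admissible_mult_exponent[OF b, of s]
  obtain G where G: "G \<in> weighted_L2 b s" "u = of_transform G" using u by (metis H_space_of_transform)
  show ?thesis unfolding G(2) tempered_of_fun_eq_of_transform[OF \<theta>] tempered_mult_of_transform[OF adm \<theta> G(1)]
    by (rule H_product_of_transform[OF adm schwartz_weighted_L2[OF fourier_schwartz[OF \<theta>]] G(1)])
qed

lemma tempered_mult_H_bound:
  assumes b: "surj b"
  obtains C where "0 \<le> C" "\<And>\<theta> u. \<theta> \<in> schwartz_functions \<Longrightarrow> u \<in> H_space b s \<Longrightarrow> tempered_mult \<theta> u \<in> H_space b s"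
    "\<And>\<theta> u. \<theta> \<in> schwartz_functions \<Longrightarrow> u \<in> H_space b s \<Longrightarrow>
      Hn b s (tempered_mult \<theta> u) \<le> C * Hn b (mult_exponent b s) (tempered_of_fun \<theta>) * Hn b s u"
proof -
  note adm = admissible_mult_exponent[OF b, of s]
  obtain C where C: "0 \<le> C" "\<And>u v. u \<in> H_space b (mult_exponent b s) \<Longrightarrow> v \<in> H_space b s \<Longrightarrow> H_product b (mult_exponent b s) s u v \<in> H_space b s"
    "\<And>u v. u \<in> H_space b (mult_exponent b s) \<Longrightarrow> v \<in> H_space b s \<Longrightarrow> Hn b s (H_product b (mult_exponent b s) s u v) \<le> C * Hn b (mult_exponent b s) u * Hn b s v"
    by (rule H_product_bound[OF adm], blast)
  show ?thesis
    by (rule that[OF C(1)]; subst H_product_schwartz_left[OF b, symmetric]; (assumption | rule C(2,3) schwartz_H_space)+)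
qed

lemma tempered_mult_in_H:
  "surj b \<Longrightarrow> \<theta> \<in> schwartz_functions \<Longrightarrow> u \<in> H_space b s \<Longrightarrow> tempered_mult \<theta> u \<in> H_space b s"
  by (rule tempered_mult_H_bound, assumption, blast)

lemma tempered_mult_tempered_of_fun:
  "\<theta> \<in> schwartz_functions \<Longrightarrow> tempered_mult \<theta> (tempered_of_fun f) = tempered_of_fun (\<lambda>x. \<theta> x * f x)"
  by (auto simp: tempered_mult_def tempered_of_fun_def schwartz_mult mult_ac intro!: restrict_ext)

lemma tempered_diff_mult:
  "\<theta> \<in> schwartz_functions \<Longrightarrow> tempered_diff (tempered_mult \<theta> u) (tempered_mult \<theta> v) = tempered_mult \<theta> (tempered_diff u v)"
  by (auto simp: tempered_mult_def tempered_diff_def schwartz_mult intro!: restrict_ext)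

lemma H_space_tempered: "u \<in> H_space b s \<Longrightarrow> u \<in> tempered_distributions"
  by (simp add: H_space_def)

lemma tempered_linear:
  assumes "u \<in> tempered_distributions" "f \<in> schwartz_functions" "g \<in> schwartz_functions"
  shows "u (\<lambda>x. a * f x + c * g x) = a * u f + c * u g"
  using assms by (auto simp: tempered_distributions_def linear_functional_on_def)

lemma tempered_mult_diff:
  assumes u: "u \<in> tempered_distributions" and \<theta>: "\<theta> \<in> schwartz_functions" "\<theta>' \<in> schwartz_functions"
  shows "tempered_diff (tempered_mult \<theta> u) (tempered_mult \<theta>' u) = tempered_mult (\<lambda>x. \<theta> x - \<theta>' x) u"
proof -
  have "u (\<lambda>x. \<theta> x * \<phi> x) - u (\<lambda>x. \<theta>' x * \<phi> x) = u (\<lambda>x. (\<theta> x - \<theta>' x) * \<phi> x)" if "\<phi> \<in> schwartz_functions" for \<phi>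
    using tempered_linear[OF u schwartz_mult[OF \<theta>(1) that] schwartz_mult[OF \<theta>(2) that], of 1 "-1"] by (simp add: left_diff_distrib)
  then show ?thesis by (auto simp: tempered_mult_def tempered_diff_def intro!: restrict_ext)
qed

lemma H_continuous_mult_args:
  assumes b: "surj b" and P: "H_continuous b s t \<sigma> P" and \<theta>: "\<theta> \<in> schwartz_functions" "\<theta>' \<in> schwartz_functions"
  shows "H_continuous b s t \<sigma> (\<lambda>u v. P (tempered_mult \<theta> u) (tempered_mult \<theta>' v))"
  unfolding H_continuous_def
proof (intro conjI ballI allI impI)
  fix u v assume u: "u \<in> H_space b s" and v: "v \<in> H_space b t"
  note mu = tempered_mult_in_H[OF b \<theta>(1)] and mv = tempered_mult_in_H[OF b \<theta>(2)]
  show "P (tempered_mult \<theta> u) (tempered_mult \<theta>' v) \<in> H_space b \<sigma>"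
    using P mu[OF u] mv[OF v] unfolding H_continuous_def by blast
  fix e :: real assume e: "0 < e"
  obtain d where d: "d > 0" "\<And>u' v'. u' \<in> H_space b s \<Longrightarrow> v' \<in> H_space b t \<Longrightarrow>
    H_norm b s (tempered_diff u' (tempered_mult \<theta> u)) < ennreal d \<Longrightarrow> H_norm b t (tempered_diff v' (tempered_mult \<theta>' v)) < ennreal d \<Longrightarrow>
    H_norm b \<sigma> (tempered_diff (P u' v') (P (tempered_mult \<theta> u) (tempered_mult \<theta>' v))) < ennreal e"
    by (rule H_continuousE[OF P mu[OF u] mv[OF v] e], blast)
  obtain C where C: "0 \<le> C" "\<And>\<theta> u. \<theta> \<in> schwartz_functions \<Longrightarrow> u \<in> H_space b s \<Longrightarrow> Hn b s (tempered_mult \<theta> u) \<le> C * Hn b (mult_exponent b s) (tempered_of_fun \<theta>) * Hn b s u"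
    by (rule tempered_mult_H_bound[OF b, of s], blast)
  obtain D where D: "0 \<le> D" "\<And>\<theta> u. \<theta> \<in> schwartz_functions \<Longrightarrow> u \<in> H_space b t \<Longrightarrow> Hn b t (tempered_mult \<theta> u) \<le> D * Hn b (mult_exponent b t) (tempered_of_fun \<theta>) * Hn b t u"
    by (rule tempered_mult_H_bound[OF b, of t], blast)
  \<comment> \<open>A common bound for the operator norms of the two multiplications; the summand 1
    makes it positive, so that one can divide by it.\<close>
  define k where "k = max (C * Hn b (mult_exponent b s) (tempered_of_fun \<theta>)) (D * Hn b (mult_exponent b t) (tempered_of_fun \<theta>')) + 1"
  have k: "C * Hn b (mult_exponent b s) (tempered_of_fun \<theta>) \<le> k" "D * Hn b (mult_exponent b t) (tempered_of_fun \<theta>') \<le> k" "0 < k"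
    using mult_nonneg_nonneg[OF C(1) Hn_nonneg[of b "mult_exponent b s" "tempered_of_fun \<theta>"]]
      max.cobounded1[of "C * Hn b (mult_exponent b s) (tempered_of_fun \<theta>)" "D * Hn b (mult_exponent b t) (tempered_of_fun \<theta>')"]
      max.cobounded2[of "D * Hn b (mult_exponent b t) (tempered_of_fun \<theta>')" "C * Hn b (mult_exponent b s) (tempered_of_fun \<theta>)"]
    unfolding k_def by linarith+
  show "\<exists>d>0. \<forall>u'\<in>H_space b s. \<forall>v'\<in>H_space b t.
      H_norm b s (tempered_diff u' u) < ennreal d \<and> H_norm b t (tempered_diff v' v) < ennreal d \<longrightarrow>
      H_norm b \<sigma> (tempered_diff (P (tempered_mult \<theta> u') (tempered_mult \<theta>' v')) (P (tempered_mult \<theta> u) (tempered_mult \<theta>' v))) < ennreal e"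
  proof (intro exI[of _ "d / k"] conjI ballI impI)
    show "0 < d / k" using d(1) k(3) by simp
    fix u' v' assume u': "u' \<in> H_space b s" and v': "v' \<in> H_space b t"
      and close: "H_norm b s (tempered_diff u' u) < ennreal (d / k) \<and> H_norm b t (tempered_diff v' v) < ennreal (d / k)"
    have 1: "Hn b s (tempered_diff u' u) < d / k" using close H_norm_less_iff[OF H_tempered_diff[OF u' u]] by blast
    have 2: "Hn b t (tempered_diff v' v) < d / k" using close H_norm_less_iff[OF H_tempered_diff[OF v' v]] by blast
    have "Hn b s (tempered_mult \<theta> (tempered_diff u' u)) \<le> k * Hn b s (tempered_diff u' u)"
      by (rule order_trans[OF C(2)[OF \<theta>(1) H_tempered_diff[OF u' u]]]) (intro mult_right_mono k Hn_nonneg)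
    also have "\<dots> < d" using 1 k(3) by (simp add: pos_less_divide_eq mult.commute)
    finally have 3: "H_norm b s (tempered_diff (tempered_mult \<theta> u') (tempered_mult \<theta> u)) < ennreal d"
      unfolding tempered_diff_mult[OF \<theta>(1)] H_norm_less_iff[OF mu[OF H_tempered_diff[OF u' u]]] .
    have "Hn b t (tempered_mult \<theta>' (tempered_diff v' v)) \<le> k * Hn b t (tempered_diff v' v)"
      by (rule order_trans[OF D(2)[OF \<theta>(2) H_tempered_diff[OF v' v]]]) (intro mult_right_mono k Hn_nonneg)
    also have "\<dots> < d" using 2 k(3) by (simp add: pos_less_divide_eq mult.commute)
    finally have 4: "H_norm b t (tempered_diff (tempered_mult \<theta>' v') (tempered_mult \<theta>' v)) < ennreal d"
      unfolding tempered_diff_mult[OF \<theta>(2)] H_norm_less_iff[OF mv[OF H_tempered_diff[OF v' v]]] .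
    show "H_norm b \<sigma> (tempered_diff (P (tempered_mult \<theta> u') (tempered_mult \<theta>' v')) (P (tempered_mult \<theta> u) (tempered_mult \<theta>' v))) < ennreal e"
      by (rule d(2)[OF mu[OF u'] mv[OF v'] 3 4])
  qed
qed

lemma H_continuous_mult_result:
  assumes b: "surj b" and P: "H_continuous b s t \<sigma> P" and \<theta>: "\<theta> \<in> schwartz_functions"
  shows "H_continuous b s t \<sigma> (\<lambda>u v. tempered_mult \<theta> (P u v))"
  unfolding H_continuous_def
proof (intro conjI ballI allI impI)
  fix u v assume u: "u \<in> H_space b s" and v: "v \<in> H_space b t"
  note m = tempered_mult_in_H[OF b \<theta>]
  have PH: "P u v \<in> H_space b \<sigma>" if "u \<in> H_space b s" "v \<in> H_space b t" for u v
    using P that unfolding H_continuous_def by blast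
  show "tempered_mult \<theta> (P u v) \<in> H_space b \<sigma>" by (rule m[OF PH[OF u v]])
  fix e :: real assume e: "0 < e"
  obtain C where C: "0 \<le> C" "\<And>\<theta> u. \<theta> \<in> schwartz_functions \<Longrightarrow> u \<in> H_space b \<sigma> \<Longrightarrow> Hn b \<sigma> (tempered_mult \<theta> u) \<le> C * Hn b (mult_exponent b \<sigma>) (tempered_of_fun \<theta>) * Hn b \<sigma> u"
    by (rule tempered_mult_H_bound[OF b, of \<sigma>], blast)
  define k where "k = C * Hn b (mult_exponent b \<sigma>) (tempered_of_fun \<theta>) + 1"
  have k: "C * Hn b (mult_exponent b \<sigma>) (tempered_of_fun \<theta>) \<le> k" "0 < k"
    using mult_nonneg_nonneg[OF C(1) Hn_nonneg[of b "mult_exponent b \<sigma>" "tempered_of_fun \<theta>"]] unfolding k_def by auto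
  have ek: "0 < e / k" using e k(2) by simp
  obtain d where d: "d > 0" "\<And>u' v'. u' \<in> H_space b s \<Longrightarrow> v' \<in> H_space b t \<Longrightarrow>
    H_norm b s (tempered_diff u' u) < ennreal d \<Longrightarrow> H_norm b t (tempered_diff v' v) < ennreal d \<Longrightarrow>
    H_norm b \<sigma> (tempered_diff (P u' v') (P u v)) < ennreal (e / k)"
    by (rule H_continuousE[OF P u v ek], blast)
  show "\<exists>d>0. \<forall>u'\<in>H_space b s. \<forall>v'\<in>H_space b t.
      H_norm b s (tempered_diff u' u) < ennreal d \<and> H_norm b t (tempered_diff v' v) < ennreal d \<longrightarrow>
      H_norm b \<sigma> (tempered_diff (tempered_mult \<theta> (P u' v')) (tempered_mult \<theta> (P u v))) < ennreal e"
  proof (intro exI[of _ d] conjI ballI impI d(1))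
    fix u' v' assume u': "u' \<in> H_space b s" and v': "v' \<in> H_space b t"
      and close: "H_norm b s (tempered_diff u' u) < ennreal d \<and> H_norm b t (tempered_diff v' v) < ennreal d"
    note D = H_tempered_diff[OF PH[OF u' v'] PH[OF u v]]
    have 1: "Hn b \<sigma> (tempered_diff (P u' v') (P u v)) < e / k"
      using d(2)[OF u' v'] close H_norm_less_iff[OF D] by blast
    have "Hn b \<sigma> (tempered_mult \<theta> (tempered_diff (P u' v') (P u v))) \<le> k * Hn b \<sigma> (tempered_diff (P u' v') (P u v))"
      by (rule order_trans[OF C(2)[OF \<theta> D]]) (intro mult_right_mono k Hn_nonneg)
    also have "\<dots> < e" using 1 k(2) by (simp add: pos_less_divide_eq mult.commute)
    finally show "H_norm b \<sigma> (tempered_diff (tempered_mult \<theta> (P u' v')) (tempered_mult \<theta> (P u v))) < ennreal e"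
      unfolding tempered_diff_mult[OF \<theta>] H_norm_less_iff[OF m[OF D]] .
  qed
qed

text \<open>On Schwartz functions both sides are the pointwise product of four functions. The
  statement is about any P with the defining property of the product, since
  \<open>is_product\<close> quantifies P existentially.\<close>

lemma H_product_mult:
  fixes b :: "'n::finite \<Rightarrow> 'j::finite"
  assumes b: "surj b" and P: "is_H_product b s t \<sigma> P" and \<theta>: "\<theta> \<in> schwartz_functions" "\<theta>' \<in> schwartz_functions"
    and u: "u \<in> H_space b s" and v: "v \<in> H_space b t"
  shows "P (tempered_mult \<theta> u) (tempered_mult \<theta>' v) = tempered_mult (\<lambda>x. \<theta> x * \<theta>' x) (P u v)"
proof -
  have Pc: "H_continuous b s t \<sigma> P" and PS: "\<And>f g. f \<in> schwartz_functions \<Longrightarrow> g \<in> schwartz_functions \<Longrightarrow>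
      P (tempered_of_fun f) (tempered_of_fun g) = tempered_of_fun (\<lambda>x. f x * g x)"
    using P by (auto simp: is_H_product_iff)
  show ?thesis
  proof (rule H_continuous_unique[OF H_continuous_mult_args[OF b Pc \<theta>] H_continuous_mult_result[OF b Pc schwartz_mult[OF \<theta>]] _ u v])
    fix f g :: "real^'n \<Rightarrow> complex" assume f: "f \<in> schwartz_functions" and g: "g \<in> schwartz_functions"
    show "P (tempered_mult \<theta> (tempered_of_fun f)) (tempered_mult \<theta>' (tempered_of_fun g)) = tempered_mult (\<lambda>x. \<theta> x * \<theta>' x) (P (tempered_of_fun f) (tempered_of_fun g))"
      unfolding tempered_mult_tempered_of_fun[OF \<theta>(1)] tempered_mult_tempered_of_fun[OF \<theta>(2)] PS[OF f g]
        PS[OF schwartz_mult[OF \<theta>(1) f] schwartz_mult[OF \<theta>(2) g]] tempered_mult_tempered_of_fun[OF schwartz_mult[OF \<theta>]]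
      by (simp only: mult_ac)
  qed
qed

section \<open>Translation of multipliers\<close>

lemma Hn_translate:
  fixes b :: "'n::finite \<Rightarrow> 'j::finite"
  assumes h: "h \<in> test_functions"
  shows "Hn b s (tempered_of_fun (translate y h)) = Hn b s (tempered_of_fun h)"
proof -
  note S = test_imp_schwartz[OF h] and S' = test_imp_schwartz[OF test_translate[OF h, of y]]
  have "weighted_norm b s (fourier (translate y h)) = weighted_norm b s (fourier h)"
    unfolding weighted_norm_def L2_norm_def by (simp add: fourier_translate[OF schwartz_measurable[OF S]] norm_mult)
  then show ?thesis
    unfolding tempered_of_fun_eq_of_transform[OF S] tempered_of_fun_eq_of_transform[OF S']
      Hn_of_transform[OF schwartz_weighted_L2[OF fourier_schwartz[OF S]]] Hn_of_transform[OF schwartz_weighted_L2[OF fourier_schwartz[OF S']]]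
    by simp
qed

text \<open>On the Fourier side a translation is a factor of modulus 1 that converges pointwise.
  Dominated convergence applies, the constant 4 being the square of the bound 2 for the difference
  of two such factors.\<close>

lemma Hn_translate_continuous:
  fixes b :: "'n::finite \<Rightarrow> 'j::finite" and Y :: "nat \<Rightarrow> real^'n"
  assumes h: "h \<in> test_functions" and Y: "Y \<longlonglongrightarrow> y"
  shows "(\<lambda>k. Hn b s (tempered_of_fun (\<lambda>x. translate (Y k) h x - translate y h x))) \<longlonglongrightarrow> 0"
proof -
  note S = test_imp_schwartz[OF h] and S' = test_imp_schwartz[OF test_translate[OF h]]
  note D = schwartz_diff[OF S' S']
  have [measurable]: "fourier h \<in> borel_measurable borel" by (rule schwartz_measurable[OF fourier_schwartz[OF S]])
  have L: "(\<lambda>\<xi>. complex_of_real (bracket b s \<xi>) * fourier h \<xi>) \<in> L2_functions"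
    using schwartz_weighted_L2[OF fourier_schwartz[OF S]] by (simp add: weighted_L2_def)
  have F: "complex_of_real (bracket b s \<xi>) * fourier (\<lambda>x. translate (Y k) h x - translate y h x) \<xi> =
    (cis (- (Y k \<bullet> \<xi>)) - cis (- (y \<bullet> \<xi>))) * (complex_of_real (bracket b s \<xi>) * fourier h \<xi>)" for k \<xi>
    by (simp add: fourier_diff[OF S' S'] fourier_translate[OF schwartz_measurable[OF S]] algebra_simps)
  have "(\<lambda>k. LINT \<xi>|lborel. (norm ((cis (- (Y k \<bullet> \<xi>)) - cis (- (y \<bullet> \<xi>))) * (complex_of_real (bracket b s \<xi>) * fourier h \<xi>)))\<^sup>2)
    \<longlonglongrightarrow> (LINT \<xi>|(lborel :: (real^'n) measure). 0)"
  proof (rule integral_dominated_convergence)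
    show "integrable lborel (\<lambda>\<xi>. 4 * (norm (complex_of_real (bracket b s \<xi>) * fourier h \<xi>))\<^sup>2)"
      by (intro integrable_mult_right L2_integrable L)
    show "AE \<xi> in lborel. norm ((norm ((cis (- (Y k \<bullet> \<xi>)) - cis (- (y \<bullet> \<xi>))) * (complex_of_real (bracket b s \<xi>) * fourier h \<xi>)))\<^sup>2)
      \<le> 4 * (norm (complex_of_real (bracket b s \<xi>) * fourier h \<xi>))\<^sup>2" for k
    proof (rule AE_I2)
      fix \<xi>
      have "norm (cis (- (Y k \<bullet> \<xi>)) - cis (- (y \<bullet> \<xi>))) \<le> 2"
        using norm_triangle_ineq4[of "cis (- (Y k \<bullet> \<xi>))" "cis (- (y \<bullet> \<xi>))"] by simp
      then have "(norm (cis (- (Y k \<bullet> \<xi>)) - cis (- (y \<bullet> \<xi>))))\<^sup>2 \<le> 2\<^sup>2" by (intro power_mono) auto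
      then have "(norm (cis (- (Y k \<bullet> \<xi>)) - cis (- (y \<bullet> \<xi>))))\<^sup>2 * (norm (complex_of_real (bracket b s \<xi>) * fourier h \<xi>))\<^sup>2 \<le> 2\<^sup>2 * (norm (complex_of_real (bracket b s \<xi>) * fourier h \<xi>))\<^sup>2"
        by (rule mult_right_mono) simp
      then show "norm ((norm ((cis (- (Y k \<bullet> \<xi>)) - cis (- (y \<bullet> \<xi>))) * (complex_of_real (bracket b s \<xi>) * fourier h \<xi>)))\<^sup>2)
        \<le> 4 * (norm (complex_of_real (bracket b s \<xi>) * fourier h \<xi>))\<^sup>2"
        unfolding norm_mult[of "cis _ - cis _"] power_mult_distrib[of _ _ 2] by (simp del: norm_mult)
    qed
    show "AE \<xi> in lborel. (\<lambda>k. (norm ((cis (- (Y k \<bullet> \<xi>)) - cis (- (y \<bullet> \<xi>))) * (complex_of_real (bracket b s \<xi>) * fourier h \<xi>)))\<^sup>2) \<longlonglongrightarrow> 0"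
    proof (rule AE_I2)
      fix \<xi>
      have "(\<lambda>k. cis (- (Y k \<bullet> \<xi>))) \<longlonglongrightarrow> cis (- (y \<bullet> \<xi>))"
        by (intro tendsto_cis tendsto_minus tendsto_inner Y tendsto_const)
      from tendsto_power[OF tendsto_norm[OF tendsto_mult[OF tendsto_diff[OF this tendsto_const] tendsto_const]], of "cis (- (y \<bullet> \<xi>))" "complex_of_real (bracket b s \<xi>) * fourier h \<xi>" 2]
      show "(\<lambda>k. (norm ((cis (- (Y k \<bullet> \<xi>)) - cis (- (y \<bullet> \<xi>))) * (complex_of_real (bracket b s \<xi>) * fourier h \<xi>)))\<^sup>2) \<longlonglongrightarrow> 0"
        by simp
    qed
  qed simp_all
  from tendsto_mult[OF tendsto_const[of "1 / sqrt ((2 * pi) ^ CARD('n))"] tendsto_real_sqrt[OF this]]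
  have "(\<lambda>k. (1 / sqrt ((2 * pi) ^ CARD('n))) * weighted_norm b s (fourier (\<lambda>x. translate (Y k) h x - translate y h x))) \<longlonglongrightarrow> 0"
    unfolding weighted_norm_def L2_norm_def F by simp
  then show ?thesis
    unfolding tempered_of_fun_eq_of_transform[OF D] Hn_of_transform[OF schwartz_weighted_L2[OF fourier_schwartz[OF D]]] .
qed

section \<open>Local products of distributions\<close>

lemma test_sum: "(\<And>i. i \<in> I \<Longrightarrow> f i \<in> test_functions) \<Longrightarrow> (\<lambda>x. \<Sum>i\<in>I. f i x) \<in> test_functions"
  by (induction I rule: infinite_finite_induct) (auto intro: test_add test_zero)

lemma distribution_linear:
  assumes "w \<in> distributions" "f \<in> test_functions" "g \<in> test_functions"
  shows "w (\<lambda>x. a * f x + c * g x) = a * w f + c * w g"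
  using assms by (auto simp: distributions_def linear_functional_on_def)

lemma distribution_sum:
  assumes w: "w \<in> distributions" and "finite I" "\<And>i. i \<in> I \<Longrightarrow> f i \<in> test_functions"
  shows "w (\<lambda>x. \<Sum>i\<in>I. f i x) = (\<Sum>i\<in>I. w (f i))"
  using assms(2,3)
proof (induction I)
  case empty
  show ?case using distribution_linear[OF w test_zero test_zero, of 0 0] by simp
next
  case (insert i I)
  then show ?case using distribution_linear[OF w, of "f i" "\<lambda>x. \<Sum>i\<in>I. f i x" 1 1] test_sum[of I f] by simp
qed

lemma test_schwartz_mult: "g \<in> test_functions \<Longrightarrow> \<phi> \<in> schwartz_functions \<Longrightarrow> (\<lambda>x. g x * \<phi> x) \<in> test_functions"
  by (rule test_mult) (auto intro: schwartz_smooth)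

lemma cutoff_mult:
  assumes "\<theta> \<in> schwartz_functions"
  shows "cutoff (\<lambda>x. \<theta> x * g x) w = tempered_mult \<theta> (cutoff g w)"
  using assms by (auto simp: cutoff_def tempered_mult_def schwartz_mult mult_ac intro!: restrict_ext)

lemma cutoff_sum:
  assumes w: "w \<in> distributions" and I: "finite I" and h: "\<And>i. i \<in> I \<Longrightarrow> h i \<in> test_functions"
    and \<theta>: "\<And>i. i \<in> I \<Longrightarrow> \<theta> i \<in> test_functions" and g: "\<And>x. g x = (\<Sum>i\<in>I. \<theta> i x * h i x)"
  shows "cutoff g w = (\<lambda>\<phi>\<in>schwartz_functions. \<Sum>i\<in>I. tempered_mult (\<theta> i) (cutoff (h i) w) \<phi>)"
  unfolding cutoff_def[of g]
proof (rule restrict_ext)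
  fix \<phi> :: "real^'a \<Rightarrow> complex" assume \<phi>: "\<phi> \<in> schwartz_functions"
  have "(\<lambda>x. g x * \<phi> x) = (\<lambda>x. \<Sum>i\<in>I. h i x * (\<theta> i x * \<phi> x))"
    by (simp add: g sum_distrib_left mult_ac)
  then have "w (\<lambda>x. g x * \<phi> x) = (\<Sum>i\<in>I. w (\<lambda>x. h i x * (\<theta> i x * \<phi> x)))"
    using distribution_sum[OF w I, of "\<lambda>i x. h i x * (\<theta> i x * \<phi> x)"] test_schwartz_mult[OF h schwartz_mult[OF test_imp_schwartz[OF \<theta>] \<phi>]] by simp
  also have "\<dots> = (\<Sum>i\<in>I. tempered_mult (\<theta> i) (cutoff (h i) w) \<phi>)"
    using \<phi> \<theta> by (intro sum.cong) (auto simp: tempered_mult_def cutoff_def schwartz_mult test_imp_schwartz)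
  finally show "w (\<lambda>x. g x * \<phi> x) = (\<Sum>i\<in>I. tempered_mult (\<theta> i) (cutoff (h i) w) \<phi>)" .
qed

definition locally_H :: "('n::finite \<Rightarrow> 'j::finite) \<Rightarrow> real^'j \<Rightarrow> 'n functional set" where
  "locally_H b s = {w \<in> distributions. \<forall>g\<in>test_functions. cutoff g w \<in> H_space b s}"

lemma locally_HD: "w \<in> locally_H b s \<Longrightarrow> g \<in> test_functions \<Longrightarrow> cutoff g w \<in> H_space b s"
  by (simp add: locally_H_def)

text \<open>For fixed x the set of y with g(x - y) \<noteq> 0 is open, and it contains x - x_0 if
  g(x_0) \<noteq> 0; hence it meets the dense set Y. Compactness selects finitely many
  translates.\<close>

lemma translates_cover:
  fixes g :: "real^'n::finite \<Rightarrow> complex"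
  assumes g: "g \<in> test_functions" "g \<noteq> (\<lambda>x. 0)" and K: "compact K"
    and dense: "\<And>U. open U \<Longrightarrow> U \<noteq> {} \<Longrightarrow> \<exists>y\<in>Y. y \<in> U"
  obtains I where "finite I" "I \<subseteq> Y" "\<And>x. x \<in> K \<Longrightarrow> \<exists>y\<in>I. translate y g x \<noteq> 0"
proof -
  have cont: "continuous_on UNIV g" by (rule smooth_continuous[OF test_smooth[OF g(1)]])
  obtain x0 where x0: "g x0 \<noteq> 0" using g(2) by auto
  have "\<exists>y\<in>Y. translate y g x \<noteq> 0" for x
  proof -
    let ?U = "(\<lambda>y. g (x - y)) -` (- {0})"
    have "open ?U"
      by (rule open_vimage) (auto intro!: continuous_on_compose2[OF cont] continuous_intros)
    moreover have "x - x0 \<in> ?U" using x0 by simp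
    then have "?U \<noteq> {}" by blast
    ultimately obtain y where "y \<in> Y" "y \<in> ?U" using dense by blast
    then show ?thesis by (auto simp: translate_def)
  qed
  then have cover: "K \<subseteq> (\<Union>y\<in>Y. translate y g -` (- {0}))" by auto
  have op: "open (translate y g -` (- {0}))" for y
    by (rule open_vimage) (auto intro!: smooth_continuous test_smooth test_translate g)
  obtain I where I: "I \<subseteq> Y" "finite I" "K \<subseteq> (\<Union>y\<in>I. translate y g -` (- {0}))"
    by (rule compactE_image[OF K op cover], blast)
  show ?thesis by (rule that[OF I(2,1)]) (use I(3) in auto)
qed

lemma AE_dense:
  assumes ae: "AE y in lebesgue. y \<in> Y" and U: "open U" "U \<noteq> {}"
  shows "\<exists>y\<in>Y. y \<in> (U :: (real^'n::finite) set)"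
proof (rule ccontr)
  assume "\<not> ?thesis"
  then have "y \<notin> U" if "y \<in> Y" for y using that by blast
  with ae have "AE y in lebesgue. y \<notin> U" by (rule eventually_mono)
  then have "U \<in> null_sets lebesgue" using AE_iff_null_sets[of U lebesgue] U(1) by simp
  then have "negligible U" by (simp add: negligible_iff_null_sets)
  then show False using open_not_negligible[OF U] by blast
qed

lemma locally_H_of_AE:
  fixes b :: "'n::finite \<Rightarrow> 'j::finite"
  assumes b: "surj b" and w: "w \<in> distributions" and g: "g \<in> test_functions" "g \<noteq> (\<lambda>x. 0)"
    and ae: "AE y in lebesgue. cutoff (translate y g) w \<in> H_space b s"
  shows "w \<in> locally_H b s"
  unfolding locally_H_def
proof (intro CollectI conjI w ballI)
  fix h :: "real^'n \<Rightarrow> complex" assume h: "h \<in> test_functions"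
  let ?Y = "{y. cutoff (translate y g) w \<in> H_space b s}"
  have K: "compact (closure {x. h x \<noteq> 0})" using h by (simp add: test_functions_def)
  have ae': "AE y in lebesgue. y \<in> ?Y" using ae by simp
  obtain I where I: "finite I" "I \<subseteq> ?Y" "\<And>x. x \<in> closure {x. h x \<noteq> 0} \<Longrightarrow> \<exists>y\<in>I. translate y g x \<noteq> 0"
    by (rule translates_cover[OF g K AE_dense[OF ae']], assumption, assumption, blast)
  obtain \<theta> where \<theta>: "\<And>i. i \<in> I \<Longrightarrow> \<theta> i \<in> test_functions" "\<And>x. h x = (\<Sum>i\<in>I. \<theta> i x * translate i g x)"
    by (rule test_partition[OF h I(1) test_smooth[OF test_translate[OF g(1)]] I(3)], assumption, blast)
  have eq: "cutoff h w = (\<lambda>\<phi>\<in>schwartz_functions. \<Sum>i\<in>I. tempered_mult (\<theta> i) (cutoff (translate i g) w) \<phi>)"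
    by (rule cutoff_sum[OF w I(1) test_translate[OF g(1)] \<theta>])
  show "cutoff h w \<in> H_space b s" unfolding eq
    using I(2) by (intro H_sum I(1) tempered_mult_in_H[OF b] test_imp_schwartz \<theta>(1)) auto
qed

text \<open>A single decomposition of h into multiples of translates of g is moved along with y. The
  multipliers are then translates of fixed functions and keep their norms, so C and I do not depend
  on y. This is the independence of the local space from the window.\<close>

lemma locally_H_norm_change:
  fixes b :: "'n::finite \<Rightarrow> 'j::finite"
  assumes b: "surj b" and w: "w \<in> locally_H b s" and g: "g \<in> test_functions" "g \<noteq> (\<lambda>x. 0)" and h: "h \<in> test_functions"
  obtains C I where "0 \<le> C" "finite I"
    "\<And>y. Hn b s (cutoff (translate y h) w) \<le> C * (\<Sum>z\<in>I. Hn b s (cutoff (translate (z + y) g) w))"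
proof -
  have wd: "w \<in> distributions" using w by (simp add: locally_H_def)
  have K: "compact (closure {x. h x \<noteq> 0})" using h by (simp add: test_functions_def)
  obtain I where I: "finite I" "\<And>x. x \<in> closure {x. h x \<noteq> 0} \<Longrightarrow> \<exists>y\<in>I. translate y g x \<noteq> 0"
    by (rule translates_cover[OF g K, of UNIV]) blast+
  obtain \<theta> where \<theta>: "\<And>i. i \<in> I \<Longrightarrow> \<theta> i \<in> test_functions" "\<And>x. h x = (\<Sum>i\<in>I. \<theta> i x * translate i g x)"
    by (rule test_partition[OF h I(1) test_smooth[OF test_translate[OF g(1)]] I(2)], assumption, blast)
  obtain C where C: "0 \<le> C" "\<And>\<theta> u. \<theta> \<in> schwartz_functions \<Longrightarrow> u \<in> H_space b s \<Longrightarrow> Hn b s (tempered_mult \<theta> u) \<le> C * Hn b (mult_exponent b s) (tempered_of_fun \<theta>) * Hn b s u"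
    by (rule tempered_mult_H_bound[OF b, of s], blast)
  define D where "D = (\<Sum>i\<in>I. Hn b (mult_exponent b s) (tempered_of_fun (\<theta> i)))"
  have D: "0 \<le> D" "\<And>i. i \<in> I \<Longrightarrow> Hn b (mult_exponent b s) (tempered_of_fun (\<theta> i)) \<le> D"
    unfolding D_def by (auto intro!: sum_nonneg member_le_sum I(1) Hn_nonneg)
  have "Hn b s (cutoff (translate y h) w) \<le> (C * D) * (\<Sum>z\<in>I. Hn b s (cutoff (translate (z + y) g) w))" for y
  proof -
    have T: "translate y (\<theta> i) \<in> test_functions" if "i \<in> I" for i by (rule test_translate[OF \<theta>(1)[OF that]])
    have G: "translate (i + y) g \<in> test_functions" for i by (rule test_translate[OF g(1)])
    have "translate y h x = (\<Sum>i\<in>I. translate y (\<theta> i) x * translate (i + y) g x)" for x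
      by (simp add: translate_def \<theta>(2) diff_diff_eq add.commute)
    then have eq: "cutoff (translate y h) w = (\<lambda>\<phi>\<in>schwartz_functions. \<Sum>i\<in>I. tempered_mult (translate y (\<theta> i)) (cutoff (translate (i + y) g) w) \<phi>)"
      by (intro cutoff_sum[OF wd I(1)] T G)
    have "Hn b s (cutoff (translate y h) w) \<le> (\<Sum>i\<in>I. Hn b s (tempered_mult (translate y (\<theta> i)) (cutoff (translate (i + y) g) w)))"
      unfolding eq by (intro H_sum I(1) tempered_mult_in_H[OF b] test_imp_schwartz T locally_HD[OF w] G)
    also have "\<dots> \<le> (\<Sum>i\<in>I. (C * D) * Hn b s (cutoff (translate (i + y) g) w))"
    proof (rule sum_mono)
      fix i assume i: "i \<in> I"
      have "Hn b s (tempered_mult (translate y (\<theta> i)) (cutoff (translate (i + y) g) w)) \<le> C * Hn b (mult_exponent b s) (tempered_of_fun (translate y (\<theta> i))) * Hn b s (cutoff (translate (i + y) g) w)"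
        by (intro C(2) test_imp_schwartz T i locally_HD[OF w] G)
      also have "\<dots> \<le> (C * D) * Hn b s (cutoff (translate (i + y) g) w)"
        unfolding Hn_translate[OF \<theta>(1)[OF i]] by (intro mult_right_mono mult_left_mono D i C Hn_nonneg)
      finally show "Hn b s (tempered_mult (translate y (\<theta> i)) (cutoff (translate (i + y) g) w)) \<le> (C * D) * Hn b s (cutoff (translate (i + y) g) w)" .
    qed
    finally show ?thesis by (simp only: sum_distrib_left)
  qed
  moreover have "0 \<le> C * D" using C(1) D(1) by simp
  ultimately show ?thesis using that I(1) by blast
qed

section \<open>Continuity in the translation parameter and locality\<close>

lemma exists_cutoff:
  fixes K :: "(real^'n::finite) set"
  assumes "compact K" obtains G where "G \<in> test_functions" "\<And>x. x \<in> K \<Longrightarrow> G x = 1"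
  using exists_bump[OF assms open_UNIV subset_UNIV] by (metis of_real_1)

lemma exists_cutoff_support:
  assumes "f \<in> test_functions" "g \<in> test_functions"
  obtains G where "G \<in> test_functions" "\<And>x. f x \<noteq> 0 \<Longrightarrow> G x = 1" "\<And>x. g x \<noteq> 0 \<Longrightarrow> G x = 1"
proof -
  obtain K where K: "compact K" "\<And>x. f x \<noteq> 0 \<Longrightarrow> x \<in> K" using test_functionsE[OF assms(1)] by metis
  obtain L where L: "compact L" "\<And>x. g x \<noteq> 0 \<Longrightarrow> x \<in> L" using test_functionsE[OF assms(2)] by metis
  obtain G where "G \<in> test_functions" "\<And>x. x \<in> K \<union> L \<Longrightarrow> G x = 1" by (rule exists_cutoff[OF compact_Un[OF K(1) L(1)]], blast)
  with K L that show ?thesis by blast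
qed

lemma cutoff_factor:
  assumes "f \<in> test_functions" "\<And>x. f x \<noteq> 0 \<Longrightarrow> G x = 1"
  shows "cutoff f w = tempered_mult f (cutoff G w)"
proof -
  have "(\<lambda>x. f x * G x) = f" using assms(2) by (auto simp: fun_eq_iff)
  then show ?thesis using cutoff_mult[OF test_imp_schwartz[OF assms(1)], of G w] by simp
qed

text \<open>For centres within distance 1 of y all cutoffs are multiples of one distribution
  \<open>cutoff G w\<close>, where G is 1 on the union of the supports. The difference of two of
  them is a multiplication by a difference of translates, which is small in the multiplier
  norm.\<close>

lemma locally_H_continuous:
  fixes b :: "'n::finite \<Rightarrow> 'j::finite"
  assumes b: "surj b" and w: "w \<in> locally_H b s" and h: "h \<in> test_functions"
  shows "continuous_on UNIV (\<lambda>y. Hn b s (cutoff (translate y h) w))"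
proof (rule continuous_at_imp_continuous_on, rule ballI)
  fix y :: "real^'n"
  obtain K where K: "compact K" "\<And>x. h x \<noteq> 0 \<Longrightarrow> x \<in> K" using test_functionsE[OF h] by metis
  have "compact {a + z | a z. a \<in> cball y 1 \<and> z \<in> K}" by (rule compact_sums) (auto intro: K)
  then obtain G where G: "G \<in> test_functions" "\<And>x. x \<in> {a + z | a z. a \<in> cball y 1 \<and> z \<in> K} \<Longrightarrow> G x = 1"
    by (rule exists_cutoff, blast)
  have G1: "G x = 1" if "dist z y < 1" "translate z h x \<noteq> 0" for x z
  proof (rule G(2), rule CollectI, intro exI conjI)
    show "x = z + (x - z)" by simp
    show "z \<in> cball y 1" using that(1) by (simp add: dist_commute)
    show "x - z \<in> K" using that(2) by (intro K(2)) (simp add: translate_def)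
  qed
  obtain C where C: "0 \<le> C" "\<And>\<theta> u. \<theta> \<in> schwartz_functions \<Longrightarrow> u \<in> H_space b s \<Longrightarrow> Hn b s (tempered_mult \<theta> u) \<le> C * Hn b (mult_exponent b s) (tempered_of_fun \<theta>) * Hn b s u"
    by (rule tempered_mult_H_bound[OF b, of s], blast)
  let ?U = "cutoff G w"
  note U = locally_HD[OF w G(1)]
  show "isCont (\<lambda>y. Hn b s (cutoff (translate y h) w)) y"
    unfolding continuous_at_sequentially o_def
  proof (intro allI impI)
    fix Y :: "nat \<Rightarrow> real^'n" assume Y: "Y \<longlonglongrightarrow> y"
    have "(\<lambda>k. Hn b s (cutoff (translate (Y k) h) w) - Hn b s (cutoff (translate y h) w)) \<longlonglongrightarrow> 0"
    proof (rule Lim_null_comparison)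
      have "\<forall>\<^sub>F k in sequentially. dist (Y k) y < 1" by (rule tendstoD[OF Y]) simp
      then show "\<forall>\<^sub>F k in sequentially. norm (Hn b s (cutoff (translate (Y k) h) w) - Hn b s (cutoff (translate y h) w))
        \<le> C * Hn b (mult_exponent b s) (tempered_of_fun (\<lambda>x. translate (Y k) h x - translate y h x)) * Hn b s ?U"
      proof eventually_elim
        fix k assume k: "dist (Y k) y < 1"
        note T = test_translate[OF h]
        note S = test_imp_schwartz[OF T]
        have e1: "cutoff (translate (Y k) h) w = tempered_mult (translate (Y k) h) ?U" by (rule cutoff_factor[OF T G1[OF k]])
        have e2: "cutoff (translate y h) w = tempered_mult (translate y h) ?U" by (rule cutoff_factor[OF T G1]) simp_all
        have "\<bar>Hn b s (cutoff (translate (Y k) h) w) - Hn b s (cutoff (translate y h) w)\<bar> \<le> Hn b s (tempered_diff (cutoff (translate (Y k) h) w) (cutoff (translate y h) w))"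
          by (intro Hn_diff_bound locally_HD[OF w] T)
        also have "\<dots> = Hn b s (tempered_mult (\<lambda>x. translate (Y k) h x - translate y h x) ?U)"
          unfolding e1 e2 by (subst tempered_mult_diff[OF H_space_tempered[OF U] S S]) simp
        also have "\<dots> \<le> C * Hn b (mult_exponent b s) (tempered_of_fun (\<lambda>x. translate (Y k) h x - translate y h x)) * Hn b s ?U"
          by (intro C(2) schwartz_diff S U)
        finally show "norm (Hn b s (cutoff (translate (Y k) h) w) - Hn b s (cutoff (translate y h) w))
          \<le> C * Hn b (mult_exponent b s) (tempered_of_fun (\<lambda>x. translate (Y k) h x - translate y h x)) * Hn b s ?U" by simp
      qed
      show "(\<lambda>k. C * Hn b (mult_exponent b s) (tempered_of_fun (\<lambda>x. translate (Y k) h x - translate y h x)) * Hn b s ?U) \<longlonglongrightarrow> 0"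
        using tendsto_mult[OF tendsto_mult[OF tendsto_const[of C] Hn_translate_continuous[OF h Y, of b "mult_exponent b s"]] tendsto_const[of "Hn b s ?U"]] by simp
    qed
    then show "(\<lambda>k. Hn b s (cutoff (translate (Y k) h) w)) \<longlonglongrightarrow> Hn b s (cutoff (translate y h) w)"
      by (rule LIM_zero_cancel)
  qed
qed

text \<open>Cutting both arguments with g multiplies the product by g twice, relative to a cutoff G
  that is 1 on the support of g.\<close>

lemma H_product_cutoffs_agree:
  assumes b: "surj b" and P: "is_H_product b s t \<sigma> P" and u: "u \<in> locally_H b s" and v: "v \<in> locally_H b t"
    and G: "G \<in> test_functions" and g: "g \<in> test_functions" "\<And>x. g x \<noteq> 0 \<Longrightarrow> G x = 1"
  shows "P (cutoff g u) (cutoff g v) = tempered_mult (\<lambda>x. g x * g x) (P (cutoff G u) (cutoff G v))"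
proof -
  have "cutoff g w = tempered_mult g (cutoff G w)" for w
    by (rule cutoff_factor[OF g(1)]) (rule g(2))
  moreover have "P (tempered_mult g (cutoff G u)) (tempered_mult g (cutoff G v)) = tempered_mult (\<lambda>x. g x * g x) (P (cutoff G u) (cutoff G v))"
    by (rule H_product_mult[OF b P]) (intro test_imp_schwartz g(1) locally_HD[OF u G] locally_HD[OF v G])+
  ultimately show ?thesis by simp
qed

text \<open>Both cutoffs are compared with a third one, E, which is 1 wherever one of them is
  nonzero. Where f is nonzero they equal 1, so the squares that appear do not change f.\<close>

lemma H_product_local:
  assumes b: "surj b" and P: "is_H_product b s t \<sigma> P" and u: "u \<in> locally_H b s" and v: "v \<in> locally_H b t"
    and f: "f \<in> test_functions" and G: "G \<in> test_functions" "\<And>x. f x \<noteq> 0 \<Longrightarrow> G x = 1"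
    and G': "G' \<in> test_functions" "\<And>x. f x \<noteq> 0 \<Longrightarrow> G' x = 1"
  shows "P (cutoff G u) (cutoff G v) f = P (cutoff G' u) (cutoff G' v) f"
proof -
  obtain E where E: "E \<in> test_functions" "\<And>x. G x \<noteq> 0 \<Longrightarrow> E x = 1" "\<And>x. G' x \<noteq> 0 \<Longrightarrow> E x = 1"
    by (rule exists_cutoff_support[OF G(1) G'(1)], blast)
  have *: "P (cutoff g u) (cutoff g v) f = P (cutoff E u) (cutoff E v) f"
    if g: "g \<in> test_functions" "\<And>x. g x \<noteq> 0 \<Longrightarrow> E x = 1" "\<And>x. f x \<noteq> 0 \<Longrightarrow> g x = 1" for g
  proof -
    have "(\<lambda>x. g x * g x * f x) = f"
    proof
      fix x show "g x * g x * f x = f x" using g(3)[of x] by (cases "f x = 0") auto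
    qed
    moreover have "P (cutoff g u) (cutoff g v) = tempered_mult (\<lambda>x. g x * g x) (P (cutoff E u) (cutoff E v))"
      by (rule H_product_cutoffs_agree[OF b P u v E(1) g(1)]) (rule g(2))
    ultimately show ?thesis using test_imp_schwartz[OF f] by (simp add: tempered_mult_def)
  qed
  have "P (cutoff G u) (cutoff G v) f = P (cutoff E u) (cutoff E v) f" by (rule *) (use G E in auto)
  moreover have "P (cutoff G' u) (cutoff G' v) f = P (cutoff E u) (cutoff E v) f" by (rule *) (use G' E in auto)
  ultimately show ?thesis by simp
qed

text \<open>The choice of \<open>G\<close> is immaterial by the preceding lemma.\<close>

definition local_product :: "('n functional \<Rightarrow> 'n functional \<Rightarrow> 'n functional) \<Rightarrow> 'n::finite functional \<Rightarrow> 'n functional \<Rightarrow> 'n functional" where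
  "local_product P u v = (\<lambda>f\<in>test_functions.
     let G = SOME G. G \<in> test_functions \<and> (\<forall>x. f x \<noteq> 0 \<longrightarrow> G x = 1) in P (cutoff G u) (cutoff G v) f)"

lemma local_product_eq:
  assumes b: "surj b" and P: "is_H_product b s t \<sigma> P" and u: "u \<in> locally_H b s" and v: "v \<in> locally_H b t"
    and f: "f \<in> test_functions" and G: "G \<in> test_functions" "\<And>x. f x \<noteq> 0 \<Longrightarrow> G x = 1"
  shows "local_product P u v f = P (cutoff G u) (cutoff G v) f"
proof -
  let ?G = "SOME G. G \<in> test_functions \<and> (\<forall>x. f x \<noteq> 0 \<longrightarrow> G x = 1)"
  have "?G \<in> test_functions \<and> (\<forall>x. f x \<noteq> 0 \<longrightarrow> ?G x = 1)" by (rule someI[of _ G]) (use G in blast)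
  then have "P (cutoff ?G u) (cutoff ?G v) f = P (cutoff G u) (cutoff G v) f"
    using G by (intro H_product_local[OF b P u v f]) auto
  then show ?thesis using f by (simp add: local_product_def Let_def)
qed

section \<open>Existence and uniqueness of the product of distributions\<close>

lemma is_H_product_mem: "is_H_product b s t \<sigma> P \<Longrightarrow> u \<in> H_space b s \<Longrightarrow> v \<in> H_space b t \<Longrightarrow> P u v \<in> H_space b \<sigma>"
  by (simp add: is_H_product_def)

lemma schwartz_bdd_above:
  "f \<in> schwartz_functions \<Longrightarrow> bdd_above (range (\<lambda>x. (1 + norm x) ^ k * norm (partial_derivs is f x)))"
  by (simp add: schwartz_functions_def)

text \<open>On K the polynomial weight in the seminorms is at most (1 + R)^N, and outside K all
  derivatives of f vanish.\<close>

lemma tempered_bound_on_compact: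
  fixes w :: "'n::finite functional"
  assumes w: "w \<in> tempered_distributions" and K: "compact K"
  shows "\<exists>C N. \<forall>f\<in>test_functions. {x. f x \<noteq> 0} \<subseteq> K \<longrightarrow> norm (w f) \<le> C * (\<Sum>is | length is \<le> N. SUP x. norm (partial_derivs is f x))"
proof -
  obtain C N where C: "\<And>f. f \<in> schwartz_functions \<Longrightarrow> norm (w f) \<le> C * (\<Sum>is | length is \<le> N. SUP x. (1 + norm x) ^ N * norm (partial_derivs is f x))"
    using w unfolding tempered_distributions_def by blast
  obtain R where R: "\<And>x. x \<in> K \<Longrightarrow> norm x \<le> R" "0 < R" using compact_imp_bounded[OF K] bounded_pos by metis
  have "norm (w f) \<le> (\<bar>C\<bar> * (1 + R) ^ N) * (\<Sum>is | length is \<le> N. SUP x. norm (partial_derivs is f x))"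
    if f: "f \<in> test_functions" and fK: "{x. f x \<noteq> 0} \<subseteq> K" for f
  proof -
    note S = test_imp_schwartz[OF f]
    have bdd: "bdd_above (range (\<lambda>x. norm (partial_derivs is f x)))" for "is"
    proof -
      show ?thesis using schwartz_bdd_above[OF S, of 0 "is"] by simp
    qed
    have le: "(SUP x. (1 + norm x) ^ N * norm (partial_derivs is f x)) \<le> (1 + R) ^ N * (SUP x. norm (partial_derivs is f x))" for "is"
    proof (rule cSUP_least)
      fix x :: "real^'n"
      have up: "norm (partial_derivs is f x) \<le> (SUP x. norm (partial_derivs is f x))" by (rule cSUP_upper[OF _ bdd]) simp
      show "(1 + norm x) ^ N * norm (partial_derivs is f x) \<le> (1 + R) ^ N * (SUP x. norm (partial_derivs is f x))"
      proof (cases "x \<in> K")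
        case True
        then show ?thesis using R(1)[OF True] R(2) up by (intro mult_mono power_mono) auto
      next
        case False
        have "partial_derivs is f x = 0"
          by (rule partial_derivs_outside[OF compact_imp_closed[OF K] _ False]) (use fK in auto)
        then show ?thesis using R(2) order_trans[OF norm_ge_zero up] by simp
      qed
    qed simp
    have nn: "0 \<le> (SUP x. (1 + norm x) ^ N * norm (partial_derivs is f x))" for "is"
    proof -
      from cSUP_upper[OF UNIV_I schwartz_bdd_above[OF S, of N "is"], of 0] show ?thesis by (rule order_trans[rotated]) simp
    qed
    have "norm (w f) \<le> C * (\<Sum>is | length is \<le> N. SUP x. (1 + norm x) ^ N * norm (partial_derivs is f x))" by (rule C[OF S])
    \<comment> \<open>The definition of tempered distributions imposes no sign on C; the absolute
      value is needed before the suprema, which are nonnegative, can be enlarged.\<close>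
    also have "\<dots> \<le> \<bar>C\<bar> * (\<Sum>is | length is \<le> N. SUP x. (1 + norm x) ^ N * norm (partial_derivs is f x))"
      by (intro mult_right_mono sum_nonneg nn) simp
    also have "\<dots> \<le> \<bar>C\<bar> * (\<Sum>is | length is \<le> N. (1 + R) ^ N * (SUP x. norm (partial_derivs is f x)))"
      by (intro mult_left_mono sum_mono le) simp
    finally show ?thesis by (simp add: sum_distrib_left mult.assoc)
  qed
  then show ?thesis by blast
qed

text \<open>By locality any admissible cutoff may be used, so one G is chosen for two functions and
  their combination, which gives linearity, and one G for a whole compact set, which gives
  continuity with the constants of a single tempered distribution.\<close>

lemma local_product_is_product:
  fixes b :: "'n::finite \<Rightarrow> 'j::finite"
  assumes b: "surj b" and P: "is_H_product b s t \<sigma> P" and u: "u \<in> locally_H b s" and v: "v \<in> locally_H b t"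
  shows "is_product b s t \<sigma> u v (local_product P u v)"
proof -
  let ?w = "local_product P u v"
  have PT: "P (cutoff G u) (cutoff G v) \<in> tempered_distributions" if "G \<in> test_functions" for G
    by (rule H_space_tempered[OF is_H_product_mem[OF P locally_HD[OF u that] locally_HD[OF v that]]])
  have "?w \<in> distributions"
    unfolding distributions_def linear_functional_on_def
  proof (intro CollectI conjI ballI allI impI)
    show "?w \<in> extensional test_functions" by (simp add: local_product_def)
    fix f g :: "real^'n \<Rightarrow> complex" and a c assume f: "f \<in> test_functions" and g: "g \<in> test_functions"
    obtain G where G: "G \<in> test_functions" "\<And>x. f x \<noteq> 0 \<Longrightarrow> G x = 1" "\<And>x. g x \<noteq> 0 \<Longrightarrow> G x = 1"
      by (rule exists_cutoff_support[OF f g], blast)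
    have 1: "?w (\<lambda>x. a * f x + c * g x) = P (cutoff G u) (cutoff G v) (\<lambda>x. a * f x + c * g x)"
    proof (rule local_product_eq[OF b P u v _ G(1)])
      show "(\<lambda>x. a * f x + c * g x) \<in> test_functions" by (intro test_add test_cmult f g)
      fix x assume "a * f x + c * g x \<noteq> 0"
      then have "f x \<noteq> 0 \<or> g x \<noteq> 0" by auto
      then show "G x = 1" using G by blast
    qed
    have 2: "?w f = P (cutoff G u) (cutoff G v) f" by (rule local_product_eq[OF b P u v f G(1)]) (rule G(2))
    have 3: "?w g = P (cutoff G u) (cutoff G v) g" by (rule local_product_eq[OF b P u v g G(1)]) (rule G(3))
    show "?w (\<lambda>x. a * f x + c * g x) = a * ?w f + c * ?w g"
      unfolding 1 2 3
      by (rule tempered_linear[OF PT[OF G(1)] test_imp_schwartz[OF f] test_imp_schwartz[OF g]])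
  next
    fix K :: "(real^'n) set" assume K: "compact K"
    obtain G where G: "G \<in> test_functions" "\<And>x. x \<in> K \<Longrightarrow> G x = 1" by (rule exists_cutoff[OF K], blast)
    have "?w f = P (cutoff G u) (cutoff G v) f" if "f \<in> test_functions" "{x. f x \<noteq> 0} \<subseteq> K" for f
      by (rule local_product_eq[OF b P u v that(1) G(1)]) (use that(2) G(2) in blast)
    moreover obtain C N where "\<forall>f\<in>test_functions. {x. f x \<noteq> 0} \<subseteq> K \<longrightarrow>
        norm (P (cutoff G u) (cutoff G v) f) \<le> C * (\<Sum>is | length is \<le> N. SUP x. norm (partial_derivs is f x))"
      using tempered_bound_on_compact[OF PT[OF G(1)] K] by (elim exE)
    ultimately show "\<exists>C N. \<forall>f\<in>test_functions. {x. f x \<noteq> 0} \<subseteq> K \<longrightarrow> norm (?w f) \<le> C * (\<Sum>is | length is \<le> N. SUP x. norm (partial_derivs is f x))"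
      by (intro exI[of _ C] exI[of _ N] ballI impI) simp
  qed
  moreover have "cutoff (translate y (\<lambda>x. (g x)\<^sup>2)) ?w = P (cutoff (translate y g) u) (cutoff (translate y g) v)"
    if g: "g \<in> test_functions" for g y
  proof -
    note T = test_translate[OF g, of y]
    obtain G where G: "G \<in> test_functions" "\<And>x. translate y g x \<noteq> 0 \<Longrightarrow> G x = 1"
      by (rule exists_cutoff_support[OF T T], blast)
    have "?w (\<lambda>x. translate y (\<lambda>x. (g x)\<^sup>2) x * \<phi> x) = P (cutoff G u) (cutoff G v) (\<lambda>x. (translate y g x * translate y g x) * \<phi> x)"
      if \<phi>: "\<phi> \<in> schwartz_functions" for \<phi>
    proof -
      have eq: "(\<lambda>x. translate y (\<lambda>x. (g x)\<^sup>2) x * \<phi> x) = (\<lambda>x. translate y g x * (translate y g x * \<phi> x))"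
        by (simp add: translate_def power2_eq_square mult.assoc)
      have "?w (\<lambda>x. translate y g x * (translate y g x * \<phi> x)) = P (cutoff G u) (cutoff G v) (\<lambda>x. translate y g x * (translate y g x * \<phi> x))"
        by (rule local_product_eq[OF b P u v _ G(1)]) (auto intro!: test_mult T smooth_mult test_smooth schwartz_smooth[OF \<phi>] G(2))
      then show ?thesis unfolding eq by (simp only: mult.assoc)
    qed
    then have "cutoff (translate y (\<lambda>x. (g x)\<^sup>2)) ?w = tempered_mult (\<lambda>x. translate y g x * translate y g x) (P (cutoff G u) (cutoff G v))"
      unfolding cutoff_def[of "translate y (\<lambda>x. (g x)\<^sup>2)"] tempered_mult_def by (rule restrict_ext)
    moreover have "P (cutoff (translate y g) u) (cutoff (translate y g) v) = tempered_mult (\<lambda>x. translate y g x * translate y g x) (P (cutoff G u) (cutoff G v))"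
      by (rule H_product_cutoffs_agree[OF b P u v G(1) T]) (rule G(2))
    ultimately show ?thesis by simp
  qed
  ultimately show ?thesis
    unfolding is_product_def using P locally_HD[OF u test_translate] locally_HD[OF v test_translate] by blast
qed

text \<open>For a test function f take G equal to 1 on its support. Then G^2 f = f, so w f is read
  off from the cutoff by G^2, which is a product in \<open>H_space\<close>. The two products may
  come with different maps P and Q, but these agree on the spaces in question.\<close>

lemma is_product_unique:
  fixes b :: "'n::finite \<Rightarrow> 'j::finite"
  assumes w: "is_product b s t \<sigma> u v w" and w': "is_product b s t \<sigma> u v w'"
  shows "w = w'"
proof
  fix f
  have wd: "w \<in> distributions" "w' \<in> distributions" using w w' by (auto simp: is_product_def)
  show "w f = w' f"
  proof (cases "f \<in> test_functions")
    case True
    obtain G where G: "G \<in> test_functions" "\<And>x. f x \<noteq> 0 \<Longrightarrow> G x = 1"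
      by (rule exists_cutoff_support[OF True True], blast)
    obtain P where P: "is_H_product b s t \<sigma> P" "cutoff (translate 0 G) u \<in> H_space b s" "cutoff (translate 0 G) v \<in> H_space b t"
      "cutoff (translate 0 (\<lambda>x. (G x)\<^sup>2)) w = P (cutoff (translate 0 G) u) (cutoff (translate 0 G) v)"
      using w G(1) unfolding is_product_def by blast
    obtain Q where Q: "is_H_product b s t \<sigma> Q"
      "cutoff (translate 0 (\<lambda>x. (G x)\<^sup>2)) w' = Q (cutoff (translate 0 G) u) (cutoff (translate 0 G) v)"
      using w' G(1) unfolding is_product_def by blast
    have eq: "cutoff (translate 0 (\<lambda>x. (G x)\<^sup>2)) w f = cutoff (translate 0 (\<lambda>x. (G x)\<^sup>2)) w' f"
      unfolding P(4) Q(2) is_H_product_unique[OF P(1) Q(1) P(2,3)] ..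
    have "(\<lambda>x. translate 0 (\<lambda>x. (G x)\<^sup>2) x * f x) = f"
    proof
      fix x show "translate 0 (\<lambda>x. (G x)\<^sup>2) x * f x = f x"
        using G(2)[of x] by (cases "f x = 0") (auto simp: translate_def)
    qed
    then show ?thesis using eq test_imp_schwartz[OF True] by (simp add: cutoff_def)
  next
    case False
    then show ?thesis using wd by (simp add: distributions_def extensional_def)
  qed
qed

lemma is_product_locally_H:
  fixes b :: "'n::finite \<Rightarrow> 'j::finite"
  assumes b: "surj b" and w: "is_product b s t \<sigma> u v w"
  shows "w \<in> locally_H b \<sigma>"
  unfolding locally_H_def
proof (intro CollectI conjI ballI)
  show "w \<in> distributions" using w by (simp add: is_product_def)
  fix g :: "real^'n \<Rightarrow> complex" assume g: "g \<in> test_functions"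
  obtain G where G: "G \<in> test_functions" "\<And>x. g x \<noteq> 0 \<Longrightarrow> G x = 1"
    by (rule exists_cutoff_support[OF g g], blast)
  obtain P where P: "is_H_product b s t \<sigma> P" "cutoff (translate 0 G) u \<in> H_space b s" "cutoff (translate 0 G) v \<in> H_space b t"
      "cutoff (translate 0 (\<lambda>x. (G x)\<^sup>2)) w = P (cutoff (translate 0 G) u) (cutoff (translate 0 G) v)"
      using w G(1) unfolding is_product_def by blast
  have "cutoff g w = tempered_mult g (cutoff (translate 0 (\<lambda>x. (G x)\<^sup>2)) w)"
    by (rule cutoff_factor[OF g]) (simp add: G(2) translate_def)
  then show "cutoff g w \<in> H_space b \<sigma>"
    unfolding P(4) using tempered_mult_in_H[OF b test_imp_schwartz[OF g] is_H_product_mem[OF P(1-3)]] by simp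
qed

section \<open>The spaces \<open>\<K>\<^sub>p\<^sup>s\<close>\<close>

text \<open>The form that \<open>in_Lp\<close> takes for nonnegative continuous functions: a bound
  at every point in place of almost every point, and an integral over Borel measure.\<close>

definition Lp_bounded :: "ennreal \<Rightarrow> (real^'n::finite \<Rightarrow> real) \<Rightarrow> bool" where
  "Lp_bounded p a \<longleftrightarrow> (if p = \<infinity> then \<exists>C. \<forall>y. a y \<le> C
     else (\<integral>\<^sup>+y. ennreal (a y powr enn2real p) \<partial>lborel) < \<infinity>)"

text \<open>For p = \<infinity> the set where a exceeds the bound is open; if it were nonempty it
  would have positive measure. For finite p the completion of the measure does not change the
  integral.\<close>

lemma in_Lp_continuous_iff:
  fixes a :: "real^'n::finite \<Rightarrow> real"
  assumes a: "continuous_on UNIV a" "\<And>y. 0 \<le> a y"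
  shows "in_Lp p (\<lambda>y. ennreal (a y)) \<longleftrightarrow> Lp_bounded p a"
proof -
  have [measurable]: "a \<in> borel_measurable borel" by (rule borel_measurable_continuous_onI[OF a(1)])
  have m: "(\<lambda>y. ennreal (a y)) \<in> borel_measurable lebesgue" by (rule measurable_completion) measurable
  show ?thesis
  proof (cases "p = \<infinity>")
    case True
    \<comment> \<open>The bound is max C 0 because a negative C is read as 0 by
      \<open>ennreal\<close>.\<close>
    have "\<forall>y. a y \<le> max C 0" if ae: "AE y in lebesgue. ennreal (a y) \<le> ennreal C" for C
    proof (rule ccontr)
      assume "\<not> ?thesis"
      then obtain z where "max C 0 < a z" by (auto simp: not_le)
      then have ne: "a -` {max C 0<..} \<noteq> {}" by blast
      have "open (a -` {max C 0<..})" by (rule open_vimage[OF open_greaterThan a(1)])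
      moreover from ae have "AE y in lebesgue. y \<in> {y. ennreal (a y) \<le> ennreal C}" by simp
      ultimately obtain y where "ennreal (a y) \<le> ennreal C" "max C 0 < a y" using AE_dense[of "{y. ennreal (a y) \<le> ennreal C}"] ne by blast
      then show False by (cases "0 \<le> C") (auto simp: ennreal_le_iff2)
    qed
    moreover have "AE y in lebesgue. ennreal (a y) \<le> ennreal C" if "\<forall>y. a y \<le> C" for C
      using that by (intro AE_I2 ennreal_leI) auto
    ultimately show ?thesis using True m unfolding in_Lp_def Lp_bounded_def by auto
  next
    case False
    have "(\<integral>\<^sup>+y. ennreal (a y powr enn2real p) \<partial>lebesgue) = (\<integral>\<^sup>+y. ennreal (a y powr enn2real p) \<partial>lborel)"
      by (rule nn_integral_completion)
    then show ?thesis using False m a(2) by (simp add: in_Lp_def Lp_bounded_def)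
  qed
qed

text \<open>The sum is at most the number of terms times the largest term. This crude bound replaces
  the triangle inequality in L^p, as constants do not matter.\<close>

lemma sum_powr_le:
  fixes a :: "'i \<Rightarrow> real"
  assumes I: "finite I" and a: "\<And>i. i \<in> I \<Longrightarrow> 0 \<le> a i" and p: "0 \<le> p"
  shows "(\<Sum>i\<in>I. a i) powr p \<le> real (card I) powr p * (\<Sum>i\<in>I. a i powr p)"
proof (cases "I = {}")
  case False
  have "Max (a ` I) \<in> a ` I" using I False by (intro Max_in) auto
  then obtain i where i: "i \<in> I" "Max (a ` I) = a i" by auto
  have le: "a j \<le> a i" if "j \<in> I" for j unfolding i(2)[symmetric] using I that by (intro Max_ge) auto
  have "(\<Sum>i\<in>I. a i) \<le> real (card I) * a i" using sum_bounded_above[of I a "a i"] le by simp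
  then have "(\<Sum>i\<in>I. a i) powr p \<le> (real (card I) * a i) powr p" using p a by (intro powr_mono2 sum_nonneg) auto
  also have "\<dots> = real (card I) powr p * a i powr p" using a[OF i(1)] by (simp add: powr_mult)
  also have "\<dots> \<le> real (card I) powr p * (\<Sum>i\<in>I. a i powr p)"
    using I i by (intro mult_left_mono member_le_sum) auto
  finally show ?thesis .
qed simp

lemma Lp_bounded_translates:
  fixes a h :: "real^'n::finite \<Rightarrow> real"
  assumes p: "1 \<le> p" and a: "Lp_bounded p a" "\<And>y. 0 \<le> a y" "a \<in> borel_measurable borel" and C: "0 \<le> C" and I: "finite I"
    and h: "\<And>y. 0 \<le> h y" "\<And>y. h y \<le> C * (\<Sum>z\<in>I. a (z + y))"
  shows "Lp_bounded p h"
proof (cases "p = \<infinity>")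
  case True
  then obtain B where B: "\<And>y. a y \<le> B" using a(1) by (auto simp: Lp_bounded_def)
  have "h y \<le> C * (\<Sum>z\<in>I. B)" for y
    by (rule order_trans[OF h(2)]) (intro mult_left_mono sum_mono B C)
  then show ?thesis using True unfolding Lp_bounded_def by auto
next
  case False
  let ?P = "enn2real p"
  note [measurable] = a(3)
  have P: "0 \<le> ?P" by simp
  have "(\<integral>\<^sup>+y. ennreal (h y powr ?P) \<partial>lborel) \<le> (\<integral>\<^sup>+y. ennreal (C powr ?P * real (card I) powr ?P) * (\<Sum>z\<in>I. ennreal (a (z + y) powr ?P)) \<partial>lborel)"
  proof (rule nn_integral_mono)
    fix y
    have "h y powr ?P \<le> (C * (\<Sum>z\<in>I. a (z + y))) powr ?P" by (intro powr_mono2 h P)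
    also have "\<dots> = C powr ?P * (\<Sum>z\<in>I. a (z + y)) powr ?P" using C by (simp add: powr_mult sum_nonneg a)
    also have "\<dots> \<le> C powr ?P * (real (card I) powr ?P * (\<Sum>z\<in>I. a (z + y) powr ?P))"
      by (intro mult_left_mono sum_powr_le I a P) auto
    finally have "ennreal (h y powr ?P) \<le> ennreal ((C powr ?P * real (card I) powr ?P) * (\<Sum>z\<in>I. a (z + y) powr ?P))"
      by (simp add: mult.assoc ennreal_leI)
    then show "ennreal (h y powr ?P) \<le> ennreal (C powr ?P * real (card I) powr ?P) * (\<Sum>z\<in>I. ennreal (a (z + y) powr ?P))"
      by (simp add: ennreal_mult sum_nonneg)
  qed
  also have "\<dots> = ennreal (C powr ?P * real (card I) powr ?P) * (\<Sum>z\<in>I. \<integral>\<^sup>+y. ennreal (a (z + y) powr ?P) \<partial>lborel)"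
  proof -
    have m: "(\<lambda>y. ennreal (a (z + y) powr ?P)) \<in> borel_measurable lborel" for z by measurable
    show ?thesis by (simp only: nn_integral_cmult[OF borel_measurable_sum[OF m]] nn_integral_sum[OF m])
  qed
  also have "\<dots> = ennreal (C powr ?P * real (card I) powr ?P) * (\<Sum>z\<in>I. \<integral>\<^sup>+y. ennreal (a y powr ?P) \<partial>lborel)"
    using nn_integral_lborel_affine[of "\<lambda>y. ennreal (a y powr ?P)" 1] by simp
  also have "\<dots> < \<infinity>"
    using a(1) False by (simp add: Lp_bounded_def ennreal_mult_less_top of_nat_less_top)
  finally show ?thesis using False by (simp add: Lp_bounded_def)
qed

text \<open>The first conclusion removes the exceptional null set; after it, continuity of the local
  norm turns the hypothesis into \<open>Lp_bounded\<close>, and the change of window extends it from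
  the given test function to all others.\<close>

lemma K_space_local:
  fixes b :: "'n::finite \<Rightarrow> 'j::finite"
  assumes b: "surj b" and p: "1 \<le> p" and u: "u \<in> K_space b p s"
  shows "u \<in> locally_H b s" "h \<in> test_functions \<Longrightarrow> Lp_bounded p (\<lambda>y. Hn b s (cutoff (translate y h) u))"
proof -
  obtain g where ud: "u \<in> distributions" and g: "g \<in> test_functions" "g \<noteq> (\<lambda>x. 0)" and Lp: "in_Lp p (\<lambda>y. H_norm b s (cutoff (translate y g) u))"
    using u by (auto simp: K_space_def)
  have "AE y in lebesgue. H_norm b s (cutoff (translate y g) u) < \<infinity>"
  proof (cases "p = \<infinity>")
    case True
    then obtain C where "AE y in lebesgue. H_norm b s (cutoff (translate y g) u) \<le> ennreal C" using Lp by (auto simp: in_Lp_def)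
    then show ?thesis by (rule eventually_mono) (auto intro: le_less_trans)
  qed (use Lp in \<open>simp add: in_Lp_def\<close>)
  then have "AE y in lebesgue. cutoff (translate y g) u \<in> H_space b s" by (simp only: H_norm_finite_iff)
  then show uL: "u \<in> locally_H b s" by (rule locally_H_of_AE[OF b ud g])
  have cont: "continuous_on UNIV (\<lambda>y. Hn b s (cutoff (translate y g) u))" by (rule locally_H_continuous[OF b uL g(1)])
  have "H_norm b s (cutoff (translate y g) u) = ennreal (Hn b s (cutoff (translate y g) u))" for y
    by (rule H_norm_eq_Hn[OF locally_HD[OF uL test_translate[OF g(1)]]])
  then have Lg: "Lp_bounded p (\<lambda>y. Hn b s (cutoff (translate y g) u))"
    using Lp in_Lp_continuous_iff[OF cont Hn_nonneg, of p] by simp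
  assume h: "h \<in> test_functions"
  obtain C I where C: "0 \<le> C" "finite I"
    "\<And>y. Hn b s (cutoff (translate y h) u) \<le> C * (\<Sum>z\<in>I. Hn b s (cutoff (translate (z + y) g) u))"
    by (rule locally_H_norm_change[OF b uL g h], blast)
  show "Lp_bounded p (\<lambda>y. Hn b s (cutoff (translate y h) u))"
    by (rule Lp_bounded_translates[OF p Lg Hn_nonneg borel_measurable_continuous_onI[OF cont] C(1,2) Hn_nonneg C(3)])
qed

lemma Lp_bounded_cmult:
  assumes a: "Lp_bounded p a" "\<And>y. 0 \<le> a y" "a \<in> borel_measurable borel" and C: "0 \<le> C"
    and h: "\<And>y. 0 \<le> h y" "\<And>y. h y \<le> C * a y" and p: "1 \<le> p"
  shows "Lp_bounded p h"
  by (rule Lp_bounded_translates[OF p a C, of "{0}"]) (use h in auto)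

text \<open>Membership in \<open>L\<^sup>r\<close> needs Young's inequality only up to a constant: if \<open>y\<^sup>Q \<le> x\<^sup>P\<close> then
  \<open>x y \<le> x\<^bsup>1 + P/Q\<^esup> = x\<^bsup>P/R\<^esup>\<close>.\<close>

lemma Young_powr:
  fixes x y P Q R :: real
  assumes "0 \<le> x" "0 \<le> y" "1 \<le> P" "1 \<le> Q" "1 \<le> R" "1 / P + 1 / Q = 1 / R"
  shows "(x * y) powr R \<le> x powr P + y powr Q"
proof -
  have *: "(x * y) powr R \<le> x powr P"
    if "0 \<le> x" "0 \<le> y" "y powr Q \<le> x powr P" "1 \<le> P" "1 \<le> Q" "1 / P + 1 / Q = 1 / R" for x y P Q :: real
  proof (cases "x = 0")
    case True
    then show ?thesis by simp
  next
    case False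
    then have x: "0 < x" using that by simp
    have "y = (y powr Q) powr (1 / Q)" using that by (simp add: powr_powr)
    also have "\<dots> \<le> (x powr P) powr (1 / Q)" using that by (intro powr_mono2) auto
    also have "\<dots> = x powr (P / Q)" by (simp add: powr_powr)
    finally have "x * y \<le> x powr 1 * x powr (P / Q)" using x by (simp add: mult_left_mono)
    also have "\<dots> = x powr (1 + P / Q)" by (simp only: powr_add)
    finally have "(x * y) powr R \<le> (x powr (1 + P / Q)) powr R" using that assms by (intro powr_mono2) auto
    also have "\<dots> = x powr ((1 + P / Q) * R)" by (simp add: powr_powr)
    also have "(1 + P / Q) * R = P"
    proof -
      have "(1 + P / Q) * R = P * (1 / P + 1 / Q) * R" using that by (simp add: field_simps)
      also have "\<dots> = P" unfolding that(6) using assms by simp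
      finally show ?thesis .
    qed
    finally show ?thesis .
  qed
  show ?thesis
  proof (cases "y powr Q \<le> x powr P")
    case True
    have "(x * y) powr R \<le> x powr P" by (rule *) (use True assms in auto)
    then show ?thesis by (simp add: add_increasing2)
  next
    case False
    have "(y * x) powr R \<le> y powr Q" by (rule *) (use False assms in \<open>auto simp: add.commute\<close>)
    then show ?thesis by (simp add: add_increasing mult.commute)
  qed
qed

text \<open>Reciprocals in \<open>ennreal\<close> are injective, also at 0 and \<infinity>, so an
  infinite p or q forces the other exponent to equal r. When both are finite, 1/p is positive and
  hence r is finite too, and the relation can be written in the reals.\<close>

lemma Hoelder_exponents_cases:
  fixes p q r :: ennreal
  assumes "1 \<le> p" "1 \<le> q" "1 \<le> r" and eq: "1 / p + 1 / q = 1 / r"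
  obtains "p = \<infinity>" "q = r" | "q = \<infinity>" "p = r" |
    P Q R where "p = ennreal P" "q = ennreal Q" "r = ennreal R" "1 \<le> P" "1 \<le> Q" "1 \<le> R" "1 / P + 1 / Q = 1 / R"
proof -
  have inj: "x = y" if "1 / x = 1 / y" for x y :: ennreal
  proof -
    have "inverse x = inverse y" using that by (simp add: divide_ennreal_def)
    then show ?thesis
    proof (cases "x = 0 \<or> x = top")
      case True
      then show ?thesis using \<open>inverse x = inverse y\<close> ennreal_inverse_eq_0_iff[of y] ennreal_inverse_eq_top_iff[of y] by (metis ennreal_inverse_top ennreal_inverse_zero)
    next
      case False
      then have "y \<noteq> 0" "y \<noteq> top" using \<open>inverse x = inverse y\<close> ennreal_inverse_eq_0_iff[of x] ennreal_inverse_eq_top_iff[of x] by auto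
      then obtain X Y where "x = ennreal X" "y = ennreal Y" "0 < X" "0 < Y"
        using False by (cases x; cases y) (auto simp: le_less)
      then show ?thesis using \<open>inverse x = inverse y\<close> by (simp add: inverse_ennreal)
    qed
  qed
  show ?thesis
  proof (cases "p = \<infinity>")
    case True
    then show ?thesis using eq inj[of q r] that(1) by (simp add: ennreal_divide_top)
  next
    case p: False
    show ?thesis
    proof (cases "q = \<infinity>")
      case True
      then show ?thesis using eq inj[of p r] that(2) by (simp add: ennreal_divide_top)
    next
      case q: False
      obtain P where P: "p = ennreal P" "0 \<le> P" using p by (cases p) auto
      obtain Q where Q: "q = ennreal Q" "0 \<le> Q" using q by (cases q) auto
      have P1: "1 \<le> P" using assms(1) P by (simp add: ennreal_1[symmetric] del: ennreal_1)
      have Q1: "1 \<le> Q" using assms(2) Q by (simp add: ennreal_1[symmetric] del: ennreal_1)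
      have e: "1 / p = ennreal (1 / P)" "1 / q = ennreal (1 / Q)"
        using P Q P1 Q1 divide_ennreal[of 1 P] divide_ennreal[of 1 Q] by auto
      have "r \<noteq> \<infinity>"
      proof
        assume "r = \<infinity>"
        then have "ennreal (1 / P) + ennreal (1 / Q) = 0" using eq e by (simp add: ennreal_divide_top)
        then show False using P1 by simp
      qed
      then obtain R where R: "r = ennreal R" "0 \<le> R" by (cases r) auto
      have R1: "1 \<le> R" using assms(3) R by (simp add: ennreal_1[symmetric] del: ennreal_1)
      have "1 / r = ennreal (1 / R)" using R R1 divide_ennreal[of 1 R] by auto
      then have "ennreal (1 / P + 1 / Q) = ennreal (1 / R)" using eq e P1 Q1 by simp
      then have "1 / P + 1 / Q = 1 / R" using P1 Q1 R1 by (subst (asm) ennreal_inj) auto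
      then show ?thesis using that(3) P Q R P1 Q1 R1 by blast
    qed
  qed
qed

text \<open>If one exponent is infinite, that factor is bounded and goes into the constant.
  Otherwise the pointwise inequality \<open>Young_powr\<close> bounds the integrand by a sum of two
  integrable functions; only finiteness matters here.\<close>

lemma Lp_bounded_product:
  fixes a c h :: "real^'n::finite \<Rightarrow> real"
  assumes pqr: "1 \<le> p" "1 \<le> q" "1 \<le> r" "1 / p + 1 / q = 1 / r"
    and a: "Lp_bounded p a" "\<And>y. 0 \<le> a y" "a \<in> borel_measurable borel"
    and c: "Lp_bounded q c" "\<And>y. 0 \<le> c y" "c \<in> borel_measurable borel"
    and h: "\<And>y. 0 \<le> h y" "\<And>y. h y \<le> C * a y * c y" and C: "0 \<le> C"
  shows "Lp_bounded r h"
  using Hoelder_exponents_cases[OF pqr]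
proof cases
  case 1
  then obtain B where B: "\<And>y. a y \<le> B" using a(1) by (auto simp: Lp_bounded_def)
  have B0: "0 \<le> B" using order_trans[OF a(2) B] .
  have "h y \<le> (C * B) * c y" for y
    by (rule order_trans[OF h(2)]) (intro mult_right_mono mult_left_mono B C c)
  moreover have "Lp_bounded r c" using c(1) 1 by simp
  moreover have "0 \<le> C * B" using C B0 by simp
  ultimately show ?thesis by (intro Lp_bounded_cmult[where a = c and C = "C * B" and h = h, OF _ c(2,3) _ h(1) _ pqr(3)])
next
  case 2
  then obtain B where B: "\<And>y. c y \<le> B" using c(1) by (auto simp: Lp_bounded_def)
  have B0: "0 \<le> B" using order_trans[OF c(2) B] .
  have "h y \<le> (C * B) * a y" for y
  proof -
    have "h y \<le> C * a y * B" by (rule order_trans[OF h(2)]) (intro mult_left_mono mult_nonneg_nonneg B C a)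
    then show ?thesis by (simp only: mult_ac)
  qed
  moreover have "Lp_bounded r a" using a(1) 2 by simp
  moreover have "0 \<le> C * B" using C B0 by simp
  ultimately show ?thesis by (intro Lp_bounded_cmult[where a = a and C = "C * B" and h = h, OF _ a(2,3) _ h(1) _ pqr(3)])
next
  case (3 P Q R)
  note [measurable] = a(3) c(3)
  have pr: "enn2real p = P" "enn2real q = Q" "enn2real r = R" "p \<noteq> \<infinity>" "q \<noteq> \<infinity>" "r \<noteq> \<infinity>" using 3 by auto
  have fin: "(\<integral>\<^sup>+y. ennreal (a y powr P) \<partial>lborel) < \<infinity>" "(\<integral>\<^sup>+y. ennreal (c y powr Q) \<partial>lborel) < \<infinity>"
    using a(1) c(1) pr by (simp_all add: Lp_bounded_def)
  have "(\<integral>\<^sup>+y. ennreal (h y powr R) \<partial>lborel) \<le> (\<integral>\<^sup>+y. ennreal (C powr R) * (ennreal (a y powr P) + ennreal (c y powr Q)) \<partial>lborel)"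
  proof (rule nn_integral_mono)
    fix y
    have "h y powr R \<le> (C * (a y * c y)) powr R" using h[of y] 3 by (intro powr_mono2) (auto simp: mult.assoc)
    also have "\<dots> = C powr R * (a y * c y) powr R" using C a(2) c(2) by (simp add: powr_mult)
    also have "\<dots> \<le> C powr R * (a y powr P + c y powr Q)" using a(2) c(2) 3 by (intro mult_left_mono Young_powr) auto
    finally have "ennreal (h y powr R) \<le> ennreal (C powr R * (a y powr P + c y powr Q))" by (rule ennreal_leI)
    then show "ennreal (h y powr R) \<le> ennreal (C powr R) * (ennreal (a y powr P) + ennreal (c y powr Q))"
      by (simp add: ennreal_mult)
  qed
  also have "\<dots> = ennreal (C powr R) * ((\<integral>\<^sup>+y. ennreal (a y powr P) \<partial>lborel) + (\<integral>\<^sup>+y. ennreal (c y powr Q) \<partial>lborel))"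
    by (simp add: nn_integral_cmult nn_integral_add)
  also have "\<dots> < \<infinity>" using fin by (simp add: ennreal_mult_less_top)
  finally show ?thesis using pr by (simp add: Lp_bounded_def)
qed

lemma product_in_K_space:
  fixes b :: "'n::finite \<Rightarrow> 'j::finite"
  assumes adm: "admissible b s t \<sigma>" and pqr: "1 \<le> p" "1 \<le> q" "1 \<le> r" "1 / p + 1 / q = 1 / r"
    and u: "u \<in> K_space b p s" and v: "v \<in> K_space b q t" and w: "is_product b s t \<sigma> u v w"
  shows "w \<in> K_space b r \<sigma>"
proof -
  have b: "surj b" using adm by (simp add: admissible_def)
  note uL = K_space_local[OF b pqr(1) u] and vL = K_space_local[OF b pqr(2) v]
  have wL: "w \<in> locally_H b \<sigma>" by (rule is_product_locally_H[OF b w])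
  obtain g :: "real^'n \<Rightarrow> complex" where g: "g \<in> test_functions" "\<And>x. x \<in> {0} \<Longrightarrow> g x = 1"
    by (rule exists_cutoff[of "{0}"]) auto
  \<comment> \<open>The square is the window for the product, since the defining relation of
    \<open>is_product\<close> describes cutoffs of w by squares only.\<close>
  let ?g2 = "\<lambda>x. (g x)\<^sup>2"
  have g2: "?g2 \<in> test_functions" using test_mult[OF g(1) test_smooth[OF g(1)]] by (simp add: power2_eq_square)
  have nz: "?g2 \<noteq> (\<lambda>x. 0)"
  proof
    assume eq: "?g2 = (\<lambda>x. 0)"
    from fun_cong[OF this, of 0] g(2)[of 0] show False by simp
  qed
  note cont = locally_H_continuous[OF b wL g2]
  obtain P where P: "is_H_product b s t \<sigma> P" "\<And>y. cutoff (translate y ?g2) w = P (cutoff (translate y g) u) (cutoff (translate y g) v)"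
    using w g(1) unfolding is_product_def by blast
  obtain C where C: "0 \<le> C" "\<And>u v. u \<in> H_space b s \<Longrightarrow> v \<in> H_space b t \<Longrightarrow> Hn b \<sigma> (H_product b s t u v) \<le> C * Hn b s u * Hn b t v"
    by (rule H_product_bound[OF adm], blast)
  have le: "Hn b \<sigma> (cutoff (translate y ?g2) w) \<le> C * Hn b s (cutoff (translate y g) u) * Hn b t (cutoff (translate y g) v)" for y
  proof -
    note U = locally_HD[OF uL(1) test_translate[OF g(1), of y]] and V = locally_HD[OF vL(1) test_translate[OF g(1), of y]]
    show ?thesis unfolding P(2) is_H_product_unique[OF P(1) is_H_product_H_product[OF adm] U V] by (rule C(2)[OF U V])
  qed
  have "Lp_bounded r (\<lambda>y. Hn b \<sigma> (cutoff (translate y ?g2) w))"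
    by (rule Lp_bounded_product[OF pqr uL(2)[OF g(1)] Hn_nonneg _ vL(2)[OF g(1)] Hn_nonneg _ Hn_nonneg le C(1)])
      (intro borel_measurable_continuous_onI locally_H_continuous b uL(1) vL(1) g(1))+
  then have "in_Lp r (\<lambda>y. ennreal (Hn b \<sigma> (cutoff (translate y ?g2) w)))"
    using in_Lp_continuous_iff[OF cont Hn_nonneg] by blast
  moreover have "H_norm b \<sigma> (cutoff (translate y ?g2) w) = ennreal (Hn b \<sigma> (cutoff (translate y ?g2) w))" for y
    by (rule H_norm_eq_Hn[OF locally_HD[OF wL test_translate[OF g2]]])
  ultimately have "in_Lp r (\<lambda>y. H_norm b \<sigma> (cutoff (translate y ?g2) w))" by simp
  then show ?thesis using w g2 nz unfolding K_space_def is_product_def by blast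
qed

text \<open>Existence and uniqueness of the product are part of the conclusion because
  \<open>dist_product\<close> is a definite description, about which the inclusion alone would say
  nothing definite.\<close>

theorem proposition3p8:
  fixes b :: "'n::finite \<Rightarrow> 'j::finite"
    and s t \<epsilon> \<sigma> :: "real^'j"
    and p q r :: ennreal
  assumes "surj b"
    and "\<And>l. s $ l + t $ l > real (block_dim b l) / 2"
    and "\<And>l. 0 < \<epsilon> $ l \<and> \<epsilon> $ l < s $ l + t $ l - real (block_dim b l) / 2"
    and "\<And>l. \<sigma> $ l = Min {s $ l, t $ l, s $ l + t $ l - real (block_dim b l) / 2 - \<epsilon> $ l}"
    and "1 \<le> p" and "1 \<le> q" and "1 \<le> r"
    and "1 / p + 1 / q = 1 / r"
  shows "(\<forall>u\<in>K_space b p s. \<forall>v\<in>K_space b q t. \<exists>!w. is_product b s t \<sigma> u v w) \<and>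
    {dist_product b s t \<sigma> u v | u v. u \<in> K_space b p s \<and> v \<in> K_space b q t} \<subseteq> K_space b r \<sigma>"
proof -
  have adm: "admissible b s t \<sigma>"
    unfolding admissible_def
  proof (intro conjI allI assms(1))
    fix l
    have m: "\<sigma> $ l \<le> s $ l" "\<sigma> $ l \<le> t $ l" "\<sigma> $ l \<le> s $ l + t $ l - real (block_dim b l) / 2 - \<epsilon> $ l"
      unfolding assms(4) by (rule Min_le; simp)+
    then show "\<sigma> $ l \<le> s $ l" "\<sigma> $ l \<le> t $ l" by auto
    have "0 \<le> real (block_dim b l)" by simp
    with assms(2)[of l] show "0 \<le> s $ l + t $ l" by linarith
    \<comment> \<open>The third entry of the minimum gives s_l + t_l - \<sigma>_l \<ge> n_l / 2 +
      \<epsilon>_l, and \<epsilon>_l > 0 makes the inequality strict.\<close>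
    show "real (block_dim b l) / 2 < s $ l + t $ l - \<sigma> $ l" using m(3) assms(3)[of l] by linarith
  qed
  have ex1: "\<exists>!w. is_product b s t \<sigma> u v w" if "u \<in> K_space b p s" "v \<in> K_space b q t" for u v
    using local_product_is_product[OF assms(1) is_H_product_H_product[OF adm] K_space_local(1)[OF assms(1,5) that(1)] K_space_local(1)[OF assms(1,6) that(2)]]
      is_product_unique by blast
  moreover have "dist_product b s t \<sigma> u v \<in> K_space b r \<sigma>" if uv: "u \<in> K_space b p s" "v \<in> K_space b q t" for u v
  proof -
    have "is_product b s t \<sigma> u v (dist_product b s t \<sigma> u v)"
      unfolding dist_product_def by (rule theI'[OF ex1[OF uv]])
    then show ?thesis by (rule product_in_K_space[OF adm assms(5-8) uv])
  qed
  ultimately show ?thesis by blast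
qed

end
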